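(* Let $\mathcal{K}$ be a finite connected simplicial complex of size $n$ whose edges carry non-negative real weights, and let $g=\dim \mathsf{H}_1(\mathcal{K})$ (homology with $\mathbb{Z}_2$ coefficients). Then in $$O\bigl(n^{\omega}+4^g g+2^g n^2(g+\log n)\bigr)=O(n^{\omega})+2^{O(g)}n^2\log n$$ time one can compute, for all homology classes $h\in\mathsf{H}_1(\mathcal{K})$, a shortest cycle in the class $h$, i.e. a $1$-cycle of minimum weight among all $1$-cycles $z$ with $[z]=h$.
   Context: All homology is simplicial with $\mathbb{Z}_2$ coefficients. The size of $\mathcal{K}$ is its number of simplices. A $1$-cycle is identified with the set of edges having coefficient $1$ in it; $[z]$ denotes the homology class of a cycle $z$. Given non-negative real edge weights $w(e)$, the weight (length) of a cycle is $w(z)=\sum_{e\in z}w(e)$. $\omega>2$ denotes a real number such that two $n\times n$ matrices (over $\mathbb{Z}_2$) can be multiplied in $O(n^{\omega})$ time. Time is counted in unit-cost elementary operations, including additions and comparisons of weights. *)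

theory Defs
  imports Complex_Main "HOL-Library.Z2" "HOL-Algebra.AbelCoset" "Jordan_Normal_Form.VS_Connect"
begin

section \<open>Simplicial homology with coefficients in the field with two elements\<close>

definition simplicial_complex :: "'v set set \<Rightarrow> bool" where
  "simplicial_complex K \<longleftrightarrow>
     (\<forall>\<sigma>\<in>K. finite \<sigma> \<and> \<sigma> \<noteq> {}) \<and> (\<forall>\<sigma>\<in>K. \<forall>\<tau>. \<tau> \<noteq> {} \<and> \<tau> \<subseteq> \<sigma> \<longrightarrow> \<tau> \<in> K)"

definition simplices :: "'v set set \<Rightarrow> nat \<Rightarrow> 'v set set" where
  "simplices K p = {\<sigma> \<in> K. card \<sigma> = p + 1}"

abbreviation edges :: "'v set set \<Rightarrow> 'v set set" where
  "edges K \<equiv> simplices K 1"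

definition connected_complex :: "'v set set \<Rightarrow> bool" where
  "connected_complex K \<longleftrightarrow> K \<noteq> {} \<and>
     (\<forall>u v. {u} \<in> K \<and> {v} \<in> K \<longrightarrow> (u, v) \<in> {(x, y). {x, y} \<in> K}\<^sup>*)"

text \<open>A \<open>p\<close>-chain is identified with the set of \<open>p\<close>-simplices having coefficient \<open>1\<close> in it,
  so that addition of chains is symmetric difference.  The fields \<open>mult\<close> and \<open>one\<close> belong to
  the record type of modules but play no role.\<close>

definition chains :: "'v set set \<Rightarrow> nat \<Rightarrow> (bit, 'v set set) module" where
  "chains K p = \<lparr>carrier = Pow (simplices K p), mult = undefined, one = undefined,
     zero = {}, add = sym_diff, smult = (\<lambda>a c. if a = 1 then c else {})\<rparr>"

text \<open>A \<open>(p-1)\<close>-simplex has \<open>p\<close> vertices; excluding \<open>\<tau> = {}\<close> makes the boundary of a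
  \<open>0\<close>-chain zero.\<close>

definition boundary :: "nat \<Rightarrow> 'v set set \<Rightarrow> 'v set set" where
  "boundary p c = {\<tau>. \<tau> \<noteq> {} \<and> card \<tau> = p \<and> odd (card {\<sigma> \<in> c. \<tau> \<subseteq> \<sigma>})}"

definition cycles :: "'v set set \<Rightarrow> nat \<Rightarrow> 'v set set set" where
  "cycles K p = {z \<in> carrier (chains K p). boundary p z = {}}"

definition boundaries :: "'v set set \<Rightarrow> nat \<Rightarrow> 'v set set set" where
  "boundaries K p = boundary (p + 1) ` carrier (chains K (p + 1))"

abbreviation cycle_space :: "'v set set \<Rightarrow> nat \<Rightarrow> (bit, 'v set set) module" where
  "cycle_space K p \<equiv> chains K p\<lparr>carrier := cycles K p\<rparr>"

definition homology_class :: "'v set set \<Rightarrow> nat \<Rightarrow> 'v set set \<Rightarrow> 'v set set set" where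
  "homology_class K p z = boundaries K p +>\<^bsub>cycle_space K p\<^esub> z"

definition homology :: "'v set set \<Rightarrow> nat \<Rightarrow> (bit, 'v set set set) module" where
  "homology K p = \<lparr>carrier = a_rcosets\<^bsub>cycle_space K p\<^esub> (boundaries K p),
     mult = undefined, one = undefined, zero = boundaries K p,
     add = set_add (cycle_space K p),
     smult = (\<lambda>a h. if a = 1 then h else boundaries K p)\<rparr>"

definition homology_dim :: "'v set set \<Rightarrow> nat \<Rightarrow> nat" where
  "homology_dim K p = vectorspace.dim class_ring (homology K p)"

definition weight :: "('v set \<Rightarrow> real) \<Rightarrow> 'v set set \<Rightarrow> real" where
  "weight w z = (\<Sum>e\<in>z. w e)"

definition shortest_cycle_in ::
  "'v set set \<Rightarrow> ('v set \<Rightarrow> real) \<Rightarrow> 'v set set set \<Rightarrow> 'v set set \<Rightarrow> bool" where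
  "shortest_cycle_in K w h z \<longleftrightarrow> z \<in> cycles K 1 \<and> homology_class K 1 z = h \<and>
     (\<forall>z'\<in>cycles K 1. homology_class K 1 z' = h \<longrightarrow> weight w z \<le> weight w z')"

section \<open>The machine model\<close>

text \<open>Unit-cost random access machine.  It has words (natural numbers) and
  weights (exact real numbers), each held in scalar variables and in arrays; all of these
  are named by natural numbers, and a program mentions only finitely many names.
  Weights can only be copied, added and compared, the only weight constant is \<open>0\<close>, and
  execution is relative to a bound \<open>W\<close> on words: it is stuck as soon as an operation involves a
  word exceeding \<open>W\<close>.  These restrictions matter: with unbounded integers, say, a unit-cost
  machine could pack a whole row of a matrix into one register and multiply matrices over the
  field with two elements in nearly quadratic time.\<close>

record machine_state =
  wvar :: "nat \<Rightarrow> nat"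
  warr :: "nat \<Rightarrow> nat \<Rightarrow> nat"
  rvar :: "nat \<Rightarrow> real"
  rarr :: "nat \<Rightarrow> nat \<Rightarrow> real"

datatype word_exp =
    Const nat
  | Var nat
  | Load nat word_exp
  | WAdd word_exp word_exp
  | WSub word_exp word_exp
  | WMul word_exp word_exp
  | WDiv word_exp word_exp
  | WMod word_exp word_exp

datatype real_exp =
    RZero
  | RVar nat
  | RLoad nat word_exp
  | RAdd real_exp real_exp

datatype test =
    Leq word_exp word_exp
  | RLeq real_exp real_exp
  | Neg test
  | Conj test test

datatype com =
    Skip
  | Assign nat word_exp
  | Store nat word_exp word_exp
  | RAssign nat real_exp
  | RStore nat word_exp real_exp
  | Seq com com
  | Cond test com com
  | While test com

text \<open>\<open>WSub\<close> is truncated subtraction; \<open>x div 0 = 0\<close> and \<open>x mod 0 = x\<close>.\<close>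

fun word_val :: "word_exp \<Rightarrow> machine_state \<Rightarrow> nat" where
  "word_val (Const c) s = c"
| "word_val (Var x) s = wvar s x"
| "word_val (Load a e) s = warr s a (word_val e s)"
| "word_val (WAdd e f) s = word_val e s + word_val f s"
| "word_val (WSub e f) s = word_val e s - word_val f s"
| "word_val (WMul e f) s = word_val e s * word_val f s"
| "word_val (WDiv e f) s = word_val e s div word_val f s"
| "word_val (WMod e f) s = word_val e s mod word_val f s"

fun real_val :: "real_exp \<Rightarrow> machine_state \<Rightarrow> real" where
  "real_val RZero s = 0"
| "real_val (RVar x) s = rvar s x"
| "real_val (RLoad a e) s = rarr s a (word_val e s)"
| "real_val (RAdd e f) s = real_val e s + real_val f s"

fun test_val :: "test \<Rightarrow> machine_state \<Rightarrow> bool" where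
  "test_val (Leq e f) s \<longleftrightarrow> word_val e s \<le> word_val f s"
| "test_val (RLeq e f) s \<longleftrightarrow> real_val e s \<le> real_val f s"
| "test_val (Neg b) s \<longleftrightarrow> \<not> test_val b s"
| "test_val (Conj b c) s \<longleftrightarrow> test_val b s \<and> test_val c s"

text \<open>All words (values and addresses) that arise during an evaluation.\<close>

fun word_words :: "word_exp \<Rightarrow> machine_state \<Rightarrow> nat set" where
  "word_words (Const c) s = {c}"
| "word_words (Var x) s = {wvar s x}"
| "word_words (Load a e) s = insert (word_val (Load a e) s) (word_words e s)"
| "word_words (WAdd e f) s = insert (word_val (WAdd e f) s) (word_words e s \<union> word_words f s)"
| "word_words (WSub e f) s = insert (word_val (WSub e f) s) (word_words e s \<union> word_words f s)"
| "word_words (WMul e f) s = insert (word_val (WMul e f) s) (word_words e s \<union> word_words f s)"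
| "word_words (WDiv e f) s = insert (word_val (WDiv e f) s) (word_words e s \<union> word_words f s)"
| "word_words (WMod e f) s = insert (word_val (WMod e f) s) (word_words e s \<union> word_words f s)"

fun real_words :: "real_exp \<Rightarrow> machine_state \<Rightarrow> nat set" where
  "real_words RZero s = {}"
| "real_words (RVar x) s = {}"
| "real_words (RLoad a e) s = word_words e s"
| "real_words (RAdd e f) s = real_words e s \<union> real_words f s"

fun test_words :: "test \<Rightarrow> machine_state \<Rightarrow> nat set" where
  "test_words (Leq e f) s = word_words e s \<union> word_words f s"
| "test_words (RLeq e f) s = real_words e s \<union> real_words f s"
| "test_words (Neg b) s = test_words b s"
| "test_words (Conj b c) s = test_words b s \<union> test_words c s"

text \<open>Every constant, variable access, array access, arithmetic operation, comparison and Boolean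
  connective costs one unit.\<close>

fun word_cost :: "word_exp \<Rightarrow> nat" where
  "word_cost (Const c) = 1"
| "word_cost (Var x) = 1"
| "word_cost (Load a e) = 1 + word_cost e"
| "word_cost (WAdd e f) = 1 + word_cost e + word_cost f"
| "word_cost (WSub e f) = 1 + word_cost e + word_cost f"
| "word_cost (WMul e f) = 1 + word_cost e + word_cost f"
| "word_cost (WDiv e f) = 1 + word_cost e + word_cost f"
| "word_cost (WMod e f) = 1 + word_cost e + word_cost f"

fun real_cost :: "real_exp \<Rightarrow> nat" where
  "real_cost RZero = 1"
| "real_cost (RVar x) = 1"
| "real_cost (RLoad a e) = 1 + word_cost e"
| "real_cost (RAdd e f) = 1 + real_cost e + real_cost f"

fun test_cost :: "test \<Rightarrow> nat" where
  "test_cost (Leq e f) = 1 + word_cost e + word_cost f"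
| "test_cost (RLeq e f) = 1 + real_cost e + real_cost f"
| "test_cost (Neg b) = 1 + test_cost b"
| "test_cost (Conj b c) = 1 + test_cost b + test_cost c"

text \<open>\<open>exec W P s t s'\<close>: with word bound \<open>W\<close>, program \<open>P\<close> started in \<open>s\<close> halts in \<open>s'\<close> after
  \<open>t\<close> elementary operations.\<close>

inductive exec :: "nat \<Rightarrow> com \<Rightarrow> machine_state \<Rightarrow> nat \<Rightarrow> machine_state \<Rightarrow> bool" for W :: nat where
  Skip: "exec W Skip s 1 s"
| Assign: "word_words e s \<subseteq> {..W} \<Longrightarrow>
    exec W (Assign x e) s (1 + word_cost e) (s\<lparr>wvar := (wvar s)(x := word_val e s)\<rparr>)"
| Store: "word_words i s \<union> word_words e s \<subseteq> {..W} \<Longrightarrow>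
    exec W (Store a i e) s (1 + word_cost i + word_cost e)
      (s\<lparr>warr := (warr s)(a := (warr s a)(word_val i s := word_val e s))\<rparr>)"
| RAssign: "real_words r s \<subseteq> {..W} \<Longrightarrow>
    exec W (RAssign x r) s (1 + real_cost r) (s\<lparr>rvar := (rvar s)(x := real_val r s)\<rparr>)"
| RStore: "word_words i s \<union> real_words r s \<subseteq> {..W} \<Longrightarrow>
    exec W (RStore a i r) s (1 + word_cost i + real_cost r)
      (s\<lparr>rarr := (rarr s)(a := (rarr s a)(word_val i s := real_val r s))\<rparr>)"
| Seq: "exec W P s t s' \<Longrightarrow> exec W Q s' u s'' \<Longrightarrow> exec W (Seq P Q) s (t + u) s''"
| CondTrue: "test_words b s \<subseteq> {..W} \<Longrightarrow> test_val b s \<Longrightarrow> exec W P s t s' \<Longrightarrow>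
    exec W (Cond b P Q) s (1 + test_cost b + t) s'"
| CondFalse: "test_words b s \<subseteq> {..W} \<Longrightarrow> \<not> test_val b s \<Longrightarrow> exec W Q s t s' \<Longrightarrow>
    exec W (Cond b P Q) s (1 + test_cost b + t) s'"
| WhileFalse: "test_words b s \<subseteq> {..W} \<Longrightarrow> \<not> test_val b s \<Longrightarrow>
    exec W (While b P) s (1 + test_cost b) s"
| WhileTrue: "test_words b s \<subseteq> {..W} \<Longrightarrow> test_val b s \<Longrightarrow> exec W P s t s' \<Longrightarrow>
    exec W (While b P) s' u s'' \<Longrightarrow> exec W (While b P) s (1 + test_cost b + t + u) s''"

definition word_state :: "nat \<Rightarrow> machine_state \<Rightarrow> bool" where
  "word_state W s \<longleftrightarrow> (\<forall>x. wvar s x \<le> W) \<and> (\<forall>a i. warr s a i \<le> W)"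

section \<open>Matrix multiplication\<close>

text \<open>Row-major storage of an \<open>n \<times> n\<close> matrix in array \<open>a\<close>.\<close>

definition stores_matrix :: "nat \<Rightarrow> nat \<Rightarrow> bit mat \<Rightarrow> machine_state \<Rightarrow> bool" where
  "stores_matrix n a A s \<longleftrightarrow>
     (\<forall>i<n. \<forall>j<n. warr s a (i * n + j) = (if A $$ (i, j) = 1 then 1 else 0))"

text \<open>Two \<open>n \<times> n\<close> matrices can be multiplied in \<open>O(n\<^sup>\<omega>)\<close> time on machines with
  \<open>O(log n)\<close>-bit words.  Memory outside the input is not assumed to be initialised:
  it holds arbitrary words and arbitrary weights.\<close>

definition matrix_mult_time :: "real \<Rightarrow> bool" where
  "matrix_mult_time \<omega> \<longleftrightarrow> (\<exists>P (k::nat) (C::real). \<forall>n\<ge>1. \<forall>W \<ge> k * n ^ k.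
     \<forall>A\<in>carrier_mat n n. \<forall>B\<in>carrier_mat n n. \<forall>s.
       word_state W s \<and> wvar s 0 = n \<and> stores_matrix n 0 A s \<and> stores_matrix n 1 B s \<longrightarrow>
       (\<exists>t s'. exec W P s t s' \<and> real t \<le> C * real n powr \<omega> \<and> stores_matrix n 2 (A * B) s'))"

section \<open>Input and output of the algorithm\<close>

text \<open>The simplices are numbered in an arbitrary way as \<open>\<sigma> 0, \<dots>, \<sigma> (n - 1)\<close>, where \<open>n\<close> is given
  in variable \<open>0\<close>.  Entries \<open>warr s 0 i, \<dots>, warr s 0 (i + 1) - 1\<close> of array \<open>1\<close> list, once each,
  the numbers of the vertices of \<open>\<sigma> i\<close>; array \<open>0\<close> of weights holds the weights of the edges.\<close>

definition encodes_complex ::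
  "'v set set \<Rightarrow> ('v set \<Rightarrow> real) \<Rightarrow> (nat \<Rightarrow> 'v set) \<Rightarrow> machine_state \<Rightarrow> bool" where
  "encodes_complex K w \<sigma> s \<longleftrightarrow>
     bij_betw \<sigma> {..<card K} K \<and> wvar s 0 = card K \<and> warr s 0 0 = 0 \<and>
     (\<forall>i<card K. warr s 0 (i + 1) = warr s 0 i + card (\<sigma> i) \<and>
        (\<lambda>j. \<sigma> (warr s 1 j)) ` {warr s 0 i..<warr s 0 (i + 1)} = (\<lambda>v. {v}) ` \<sigma> i \<and>
        warr s 1 ` {warr s 0 i..<warr s 0 (i + 1)} \<subseteq> {..<card K}) \<and>
     (\<forall>i<card K. \<sigma> i \<in> edges K \<longrightarrow> rarr s 0 i = w (\<sigma> i))"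

text \<open>Chains are returned as the rows, of length \<open>n\<close>, of a zero-one matrix in array \<open>2\<close>.\<close>

definition output_chain ::
  "'v set set \<Rightarrow> (nat \<Rightarrow> 'v set) \<Rightarrow> machine_state \<Rightarrow> nat \<Rightarrow> 'v set set" where
  "output_chain K \<sigma> s i = {\<sigma> j | j. j < card K \<and> warr s 2 (i * card K + j) = 1}"

text \<open>The number of rows is returned in variable \<open>0\<close>; as it equals the number of classes,
  each class has exactly one row.\<close>

definition outputs_shortest_cycles ::
  "'v set set \<Rightarrow> ('v set \<Rightarrow> real) \<Rightarrow> (nat \<Rightarrow> 'v set) \<Rightarrow> machine_state \<Rightarrow> bool" where
  "outputs_shortest_cycles K w \<sigma> s \<longleftrightarrow>
     wvar s 0 = card (carrier (homology K 1)) \<and>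
     (\<forall>i < wvar s 0 * card K. warr s 2 i \<in> {0, 1}) \<and>
     (\<forall>h\<in>carrier (homology K 1). \<exists>i < wvar s 0. shortest_cycle_in K w h (output_chain K \<sigma> s i))"

end

(*
  Gauss-Jordan elimination over the field with two elements, organised recursively so that the row
  operations of a block of columns are applied to the next block by one matrix product, runs in time
  O(n^\<omega>).  Applied to the boundary matrix of the edges it yields a spanning forest; applied to the
  boundary matrix of the triangles joined by the unit columns of the forest, it yields g non-pivot
  edges and a linear map from chains to g-bit annotations that separates the homology classes.

  A cycle is a union of closed walks.  Consider walks in the graph whose nodes record the start vertex
  of the current closed walk, the current vertex and the annotation collected so far; between two closed
  walks there is a hub for each annotation.  A shortest path from the hub of 0 to the hub of h has the
  length of a shortest cycle with annotation h, and the sum modulo 2 of its edges is such a cycle.  This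
  graph has O(2^g n^2) nodes and arcs, and one run of Dijkstra's algorithm finds all these paths.  Ties
  are broken by the number of arcs, so that a path has O(n) arcs and can be written out in that time.
*)
theory Submission
  imports Defs
begin

text \<open>The pivot of a column can be chosen only when the column is fully reduced, whereas row
  operations should be applied in bulk. The elimination therefore runs like a binary counter:
  finished blocks ending at the current column are merged while they are right halves, and the
  merged block is then applied to its right neighbour only. A block of length b costs N / b square
  products and there are N / b such blocks; \<omega> > 2 makes the sum over b geometric.

  A path may use an edge twice, and then the chain collected along it may weigh less than the path
  is long. It never weighs more, as weights are non-negative, and every cycle is the edge set of
  some path; the two inequalities meet at the minimum. The bound on the arcs comes from the same
  comparison: the path found is lexicographically at most the one built from its own chain, which
  has at most 3n + 2 arcs.

  The machine has no bit operations and bounded words, so the sums of classes and edge annotations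
  are tabulated. The dimension of homology enters only through the number 2^g of classes.\<close>

section \<open>Reasoning about programs\<close>

text \<open>A weakest precondition for total correctness. The elapsed time is an argument of
  \<open>Q\<close>, so that bounds on time need no calculus of their own.\<close>

definition run :: "nat => com => machine_state => (nat => machine_state => bool) => bool" where
  "run W P s Q \<longleftrightarrow> (\<exists>t s'. exec W P s t s' \<and> Q t s')"

abbreviation set_wvar :: "nat => nat => machine_state => machine_state" where
  "set_wvar x v s \<equiv> s\<lparr>wvar := (wvar s)(x := v)\<rparr>"

abbreviation set_warr :: "nat => nat => nat => machine_state => machine_state" where
  "set_warr a i v s \<equiv> s\<lparr>warr := (warr s)(a := (warr s a)(i := v))\<rparr>"

abbreviation set_rvar :: "nat => real => machine_state => machine_state" where
  "set_rvar x v s \<equiv> s\<lparr>rvar := (rvar s)(x := v)\<rparr>"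

abbreviation set_rarr :: "nat => nat => real => machine_state => machine_state" where
  "set_rarr a i v s \<equiv> s\<lparr>rarr := (rarr s)(a := (rarr s a)(i := v))\<rparr>"

lemma run_Skip: "run W Skip s Q \<longleftrightarrow> Q 1 s"
proof -
  have "exec W Skip s t s' \<longleftrightarrow> t = 1 \<and> s' = s" for t s'
    using exec.Skip[of W s] by (auto elim: exec.cases)
  then show ?thesis unfolding run_def by auto
qed

lemma run_Assign: "run W (Assign x e) s Q \<longleftrightarrow>
    word_words e s \<subseteq> {..W} \<and> Q (Suc (word_cost e)) (set_wvar x (word_val e s) s)"
  unfolding run_def by (auto elim!: exec.cases dest: exec.Assign) (metis exec.Assign plus_1_eq_Suc subsetI)

lemma run_Store: "run W (Store a i e) s Q \<longleftrightarrow> word_words i s \<union> word_words e s \<subseteq> {..W} \<and>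
    Q (Suc (word_cost i + word_cost e)) (set_warr a (word_val i s) (word_val e s) s)"
  unfolding run_def
  by (rule iffI, auto elim!: exec.cases)
    (metis (no_types, lifting) add.assoc exec.Store le_sup_iff plus_1_eq_Suc)

lemma run_RAssign: "run W (RAssign x e) s Q \<longleftrightarrow>
    real_words e s \<subseteq> {..W} \<and> Q (Suc (real_cost e)) (set_rvar x (real_val e s) s)"
  unfolding run_def
  by (rule iffI, auto elim!: exec.cases) (metis exec.RAssign plus_1_eq_Suc)

lemma run_RStore: "run W (RStore a i e) s Q \<longleftrightarrow> word_words i s \<union> real_words e s \<subseteq> {..W} \<and>
    Q (Suc (word_cost i + real_cost e)) (set_rarr a (word_val i s) (real_val e s) s)"
  unfolding run_def
  by (rule iffI, auto elim!: exec.cases)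
    (metis (no_types, lifting) add.assoc exec.RStore le_sup_iff plus_1_eq_Suc)

inductive_cases exec_SeqE: "exec W (Seq P Q) s t s'"
inductive_cases exec_CondE: "exec W (Cond b P Q) s t s'"
inductive_cases exec_WhileE: "exec W (While b P) s t s'"

lemma run_Seq: "run W (Seq A B) s Q \<longleftrightarrow> run W A s (\<lambda>t s'. run W B s' (\<lambda>u s''. Q (t + u) s''))"
  unfolding run_def by (blast intro: exec.Seq elim!: exec_SeqE)

lemma run_Cond: "run W (Cond b A B) s Q \<longleftrightarrow> test_words b s \<subseteq> {..W} \<and>
    (if test_val b s then run W A s (\<lambda>t. Q (Suc (test_cost b + t)))
     else run W B s (\<lambda>t. Q (Suc (test_cost b + t))))"
proof -
  have "exec W (Cond b A B) s u s' \<longleftrightarrow> test_words b s \<subseteq> {..W} \<and> (\<exists>t. u = 1 + test_cost b + t \<and>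
      (if test_val b s then exec W A s t s' else exec W B s t s'))" for u s'
    using exec.CondTrue[of b s W A _ s' B] exec.CondFalse[of b s W B _ s' A] by (auto elim!: exec_CondE)
  then show ?thesis unfolding run_def by auto
qed

lemma run_While_True: "test_words b s \<subseteq> {..W} ==> test_val b s ==>
    run W P s (\<lambda>t s'. run W (While b P) s' (\<lambda>u. Q (1 + test_cost b + t + u))) ==>
    run W (While b P) s Q"
  unfolding run_def by (blast intro: exec.WhileTrue)

lemma run_While_False: "test_words b s \<subseteq> {..W} ==> \<not> test_val b s ==>
    Q (1 + test_cost b) s ==> run W (While b P) s Q"
  unfolding run_def by (blast intro: exec.WhileFalse)

lemmas run_simps = run_Skip run_Assign run_Store run_RAssign run_RStore run_Seq run_Cond

lemma run_mono: "run W P s Q ==> (\<And>t s'. Q t s' ==> R t s') ==> run W P s R"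
  unfolding run_def by blast

subsection \<open>Frame conditions\<close>

fun wvars_of :: "com => nat set" where
  "wvars_of (Assign x e) = {x}"
| "wvars_of (Seq A B) = wvars_of A \<union> wvars_of B"
| "wvars_of (Cond b A B) = wvars_of A \<union> wvars_of B"
| "wvars_of (While b A) = wvars_of A"
| "wvars_of _ = {}"

fun warrs_of :: "com => nat set" where
  "warrs_of (Store a i e) = {a}"
| "warrs_of (Seq A B) = warrs_of A \<union> warrs_of B"
| "warrs_of (Cond b A B) = warrs_of A \<union> warrs_of B"
| "warrs_of (While b A) = warrs_of A"
| "warrs_of _ = {}"

fun rvars_of :: "com => nat set" where
  "rvars_of (RAssign x e) = {x}"
| "rvars_of (Seq A B) = rvars_of A \<union> rvars_of B"
| "rvars_of (Cond b A B) = rvars_of A \<union> rvars_of B"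
| "rvars_of (While b A) = rvars_of A"
| "rvars_of _ = {}"

fun rarrs_of :: "com => nat set" where
  "rarrs_of (RStore a i e) = {a}"
| "rarrs_of (Seq A B) = rarrs_of A \<union> rarrs_of B"
| "rarrs_of (Cond b A B) = rarrs_of A \<union> rarrs_of B"
| "rarrs_of (While b A) = rarrs_of A"
| "rarrs_of _ = {}"

definition frame :: "com => machine_state => machine_state => bool" where
  "frame P s s' \<longleftrightarrow> (\<forall>x. x \<notin> wvars_of P --> wvar s' x = wvar s x) \<and>
     (\<forall>a. a \<notin> warrs_of P --> warr s' a = warr s a) \<and>
     (\<forall>x. x \<notin> rvars_of P --> rvar s' x = rvar s x) \<and>
     (\<forall>a. a \<notin> rarrs_of P --> rarr s' a = rarr s a)"

lemma frameD:
  assumes "frame P s s'"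
  shows "x \<notin> wvars_of P ==> wvar s' x = wvar s x" "x \<notin> warrs_of P ==> warr s' x = warr s x"
    "x \<notin> rvars_of P ==> rvar s' x = rvar s x" "x \<notin> rarrs_of P ==> rarr s' x = rarr s x"
  using assms unfolding frame_def by auto

lemma frame_refl: "frame P s s"
  by (simp add: frame_def)

lemma frame_trans: "frame P s s' ==> frame P s' s'' ==> frame P s s''"
  unfolding frame_def by simp

lemma exec_frame: "exec W P s t s' ==> frame P s s'"
  by (induction rule: exec.induct) (auto simp: frame_def)

lemma word_val_in_words: "word_val e s \<in> word_words e s"
  by (cases e) auto

lemma word_stateD: "word_state W s ==> wvar s x \<le> W" "word_state W s ==> warr s a i \<le> W"
  by (auto simp: word_state_def)

text \<open>An assigned word is the value of an expression, and a value is among the words that its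
  evaluation compares with \<open>W\<close>.\<close>

lemma exec_word_state: "exec W P s t s' ==> word_state W s ==> word_state W s'"
proof (induction rule: exec.induct)
  case (Assign e s x)
  then show ?case using word_val_in_words[of e s] by (auto simp: word_state_def)
next
  case (Store i s e a)
  then show ?case using word_val_in_words[of e s] by (auto simp: word_state_def)
qed (auto simp: word_state_def)

text \<open>Frame and word bound hold of every execution, so they can be added to any postcondition
  afterwards; the specifications of the programs need not mention them.\<close>

lemma run_strengthen:
  assumes "run W P s Q" "word_state W s"
  shows "run W P s (\<lambda>t s'. Q t s' \<and> word_state W s' \<and> frame P s s')"
  using assms exec_frame exec_word_state unfolding run_def by blast

lemma run_strengthenE:
  assumes "run W P s Q" "word_state W s"
    and "\<And>t s'. Q t s' ==> word_state W s' ==> frame P s s' ==> R t s'"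
  shows "run W P s R"
  using run_mono[OF run_strengthen[OF assms(1,2)]] assms(3) by blast

lemma run_SeqI:
  assumes "run W A s Q" "word_state W s"
    and "\<And>t s'. Q t s' ==> word_state W s' ==> frame A s s' ==> run W B s' (\<lambda>u. R (t + u))"
  shows "run W (Seq A B) s R"
  unfolding run_Seq by (rule run_strengthenE[OF assms])

lemma run_Assign_Seq:
  assumes "word_words e s \<subseteq> {..W}" "word_val e s = v"
    and "run W B (set_wvar x v s) (\<lambda>t. Q (1 + word_cost e + t))"
  shows "run W (Seq (Assign x e) B) s Q"
  using assms by (simp add: run_Seq run_Assign)

lemma run_RAssign_Seq:
  assumes "real_words e s \<subseteq> {..W}" "real_val e s = v"
    and "run W B (set_rvar x v s) (\<lambda>t. Q (1 + real_cost e + t))"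
  shows "run W (Seq (RAssign x e) B) s Q"
  using assms by (simp add: run_Seq run_RAssign)

subsection \<open>Loops\<close>

text \<open>The potential \<open>\<Phi>\<close> pays for the remaining iterations.\<close>

lemma run_While:
  assumes ws: "word_state W s" and inv: "I s"
    and words: "\<And>s'. word_state W s' ==> frame P s s' ==> I s' ==> test_words b s' \<subseteq> {..W}"
    and step: "\<And>s'. word_state W s' ==> frame P s s' ==> I s' ==> test_val b s' ==>
      run W P s' (\<lambda>t s''. I s'' \<and> \<Phi> s'' + t + 1 + test_cost b \<le> \<Phi> s')"
    and fin: "\<And>t s'. word_state W s' ==> frame P s s' ==> I s' ==> \<not> test_val b s' ==>
      t + \<Phi> s' \<le> \<Phi> s + 1 + test_cost b ==> Q t s'"
  shows "run W (While b P) s Q"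
proof -
  have main: "run W (While b P) s' (\<lambda>t s''. word_state W s'' \<and> frame P s s'' \<and> I s'' \<and> \<not> test_val b s'' \<and>
      t + \<Phi> s'' \<le> \<Phi> s' + 1 + test_cost b)"
    if "word_state W s'" "frame P s s'" "I s'" for s'
    using that
  proof (induction "\<Phi> s'" arbitrary: s' rule: less_induct)
    \<comment> \<open>Every iteration is charged at least \<open>1 + test_cost b\<close>, so the
      potential strictly decreases and the time bound proves termination as well.\<close>
    case less
    show ?case
    proof (cases "test_val b s'")
      case True
      show ?thesis
      proof (rule run_While_True[OF words[OF less(2-4)] True], rule run_strengthenE[OF step[OF less(2-4) True] less(2)])
        fix t s2
        assume a: "I s2 \<and> \<Phi> s2 + t + 1 + test_cost b \<le> \<Phi> s'" "word_state W s2" "frame P s' s2"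
        show "run W (While b P) s2 (\<lambda>u s''. word_state W s'' \<and> frame P s s'' \<and> I s'' \<and> \<not> test_val b s'' \<and>
            1 + test_cost b + t + u + \<Phi> s'' \<le> \<Phi> s' + 1 + test_cost b)"
        proof (rule run_mono[OF less(1)])
          show "\<Phi> s2 < \<Phi> s'" "word_state W s2" "I s2" using a by auto
          show "frame P s s2" using a less(3) frame_trans by blast
        qed (use a in auto)
      qed
    next
      case False
      show ?thesis by (rule run_While_False[OF words[OF less(2-4)] False]) (use less False in auto)
    qed
  qed
  show ?thesis by (rule run_mono[OF main[OF ws frame_refl inv]]) (use fin in auto)
qed

definition For :: "nat => nat => com => com" where
  "For x y P = Seq (Assign x (Const 0))
     (While (Neg (Leq (Var y) (Var x))) (Seq P (Assign x (WAdd (Var x) (Const 1)))))"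

lemma For_of [simp]:
  "wvars_of (For x y P) = insert x (wvars_of P)" "warrs_of (For x y P) = warrs_of P"
  "rvars_of (For x y P) = rvars_of P" "rarrs_of (For x y P) = rarrs_of P"
  by (auto simp: For_def)

text \<open>An iteration costs 9 besides its body: 5 for the test and 4 for the increment. The
  constant 7 is the initial assignment, 2, and the failing test, 5. The invariant after the body is
  stated for the incremented counter because the increment is not part of \<open>P\<close>.\<close>

lemma run_For:
  assumes ws: "word_state W s" and x: "x \<notin> wvars_of P" and y: "y \<notin> wvars_of P" "y \<noteq> x"
    and W: "1 \<le> W"
    and init: "I 0 (set_wvar x 0 s)"
    and step: "\<And>i s'. i < wvar s y ==> word_state W s' ==> frame (For x y P) s s' ==> wvar s' x = i ==>
      I i s' ==> run W P s' (\<lambda>t s''. I (Suc i) (set_wvar x (Suc i) s'') \<and> t \<le> T i)"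
    and fin: "\<And>t s'. word_state W s' ==> frame (For x y P) s s' ==> wvar s' x = wvar s y ==>
      I (wvar s y) s' ==> t \<le> 7 + (\<Sum>i<wvar s y. T i + 9) ==> Q t s'"
  shows "run W (For x y P) s Q"
proof -
  let ?m = "wvar s y" and ?B = "Seq P (Assign x (WAdd (Var x) (Const 1)))"
  let ?s0 = "set_wvar x 0 s"
  define \<Phi> where "\<Phi> s' = (\<Sum>i\<in>{wvar s' x..<?m}. T i + 9)" for s' :: machine_state
  have fr0: "frame (For x y P) s s'" if "frame ?B ?s0 s'" for s'
    using that unfolding frame_def For_def by auto
  have "run W (While (Neg (Leq (Var y) (Var x))) ?B) ?s0 (\<lambda>t. Q (2 + t))"
  proof (rule run_While[where I = "\<lambda>s'. I (wvar s' x) s' \<and> wvar s' x \<le> ?m" and \<Phi> = \<Phi>], goal_cases)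
    case 1 then show ?case using ws by (auto simp: word_state_def)
  next
    case 2 then show ?case using init by auto
  next
    case 3 then show ?case by (auto simp: word_state_def)
  next
    case (4 s')
    have ym: "wvar s' y = ?m" using y fr0[OF 4(2)] unfolding frame_def by auto
    have lt: "wvar s' x < ?m" using 4 ym by auto
    have le: "wvar s y \<le> W" using ws by (auto simp: word_state_def)
    show ?case
    proof (rule run_SeqI[OF step[OF lt 4(1) fr0[OF 4(2)] refl] 4(1)])
      show "I (wvar s' x) s'" using 4 by auto
    next
      fix t s2 assume a: "I (Suc (wvar s' x)) (set_wvar x (Suc (wvar s' x)) s2) \<and> t \<le> T (wvar s' x)"
        "word_state W s2" "frame P s' s2"
      have x2: "wvar s2 x = wvar s' x" using a x unfolding frame_def by auto
      have "\<Phi> s' = T (wvar s' x) + 9 + (\<Sum>i\<in>{Suc (wvar s' x)..<?m}. T i + 9)"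
        unfolding \<Phi>_def using lt by (simp add: sum.atLeast_Suc_lessThan)
      then show "run W (Assign x (WAdd (Var x) (Const 1))) s2
         (\<lambda>u s''. (I (wvar s'' x) s'' \<and> wvar s'' x \<le> ?m) \<and>
              \<Phi> s'' + (t + u) + 1 + test_cost (Neg (Leq (Var y) (Var x))) \<le> \<Phi> s')"
        using a lt W le by (simp add: run_simps x2 \<Phi>_def)
    qed
  next
    case (5 t s')
    have ym: "wvar s' y = ?m" using y fr0[OF 5(2)] unfolding frame_def by auto
    have e: "wvar s' x = ?m" using 5 ym by auto
    show ?case
      by (rule fin[OF 5(1) fr0[OF 5(2)] e]) (use 5 e in \<open>auto simp: \<Phi>_def atLeast0LessThan\<close>)
  qed
  then show ?thesis
    unfolding For_def run_Seq run_Assign by simp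
qed

subsection \<open>Relocation of programs\<close>

fun shift_word :: "nat => word_exp => word_exp" where
  "shift_word d (Const c) = Const c"
| "shift_word d (Var x) = Var (d + x)"
| "shift_word d (Load a e) = Load (d + a) (shift_word d e)"
| "shift_word d (WAdd e f) = WAdd (shift_word d e) (shift_word d f)"
| "shift_word d (WSub e f) = WSub (shift_word d e) (shift_word d f)"
| "shift_word d (WMul e f) = WMul (shift_word d e) (shift_word d f)"
| "shift_word d (WDiv e f) = WDiv (shift_word d e) (shift_word d f)"
| "shift_word d (WMod e f) = WMod (shift_word d e) (shift_word d f)"

fun shift_real :: "nat => real_exp => real_exp" where
  "shift_real d RZero = RZero"
| "shift_real d (RVar x) = RVar (d + x)"
| "shift_real d (RLoad a e) = RLoad (d + a) (shift_word d e)"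
| "shift_real d (RAdd e f) = RAdd (shift_real d e) (shift_real d f)"

fun shift_test :: "nat => test => test" where
  "shift_test d (Leq e f) = Leq (shift_word d e) (shift_word d f)"
| "shift_test d (RLeq e f) = RLeq (shift_real d e) (shift_real d f)"
| "shift_test d (Neg b) = Neg (shift_test d b)"
| "shift_test d (Conj b c) = Conj (shift_test d b) (shift_test d c)"

fun shift :: "nat => com => com" where
  "shift d Skip = Skip"
| "shift d (Assign x e) = Assign (d + x) (shift_word d e)"
| "shift d (Store a i e) = Store (d + a) (shift_word d i) (shift_word d e)"
| "shift d (RAssign x r) = RAssign (d + x) (shift_real d r)"
| "shift d (RStore a i r) = RStore (d + a) (shift_word d i) (shift_real d r)"
| "shift d (Seq A B) = Seq (shift d A) (shift d B)"
| "shift d (Cond b A B) = Cond (shift_test d b) (shift d A) (shift d B)"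
| "shift d (While b A) = While (shift_test d b) (shift d A)"

definition view :: "nat => machine_state => machine_state" where
  "view d s = \<lparr>wvar = (\<lambda>x. wvar s (d + x)), warr = (\<lambda>x. warr s (d + x)),
     rvar = (\<lambda>x. rvar s (d + x)), rarr = (\<lambda>x. rarr s (d + x))\<rparr>"

lemma view_sel [simp]:
  "wvar (view d s) x = wvar s (d + x)" "warr (view d s) x = warr s (d + x)"
  "rvar (view d s) x = rvar s (d + x)" "rarr (view d s) x = rarr s (d + x)"
  by (simp_all add: view_def)

lemma shift_word_sem [simp]:
  "word_val (shift_word d e) s = word_val e (view d s)"
  "word_words (shift_word d e) s = word_words e (view d s)"
  "word_cost (shift_word d e) = word_cost e"
  by (induction e) auto

lemma shift_real_sem [simp]:
  "real_val (shift_real d e) s = real_val e (view d s)"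
  "real_words (shift_real d e) s = real_words e (view d s)"
  "real_cost (shift_real d e) = real_cost e"
  by (induction e) auto

lemma shift_test_sem [simp]:
  "test_val (shift_test d e) s = test_val e (view d s)"
  "test_words (shift_test d e) s = test_words e (view d s)"
  "test_cost (shift_test d e) = test_cost e"
  by (induction e) auto

lemma view_update:
  "view d (set_wvar (d + x) v s) = set_wvar x v (view d s)"
  "view d (set_warr (d + x) i v s) = set_warr x i v (view d s)"
  "view d (set_rvar (d + x) r s) = set_rvar x r (view d s)"
  "view d (set_rarr (d + x) i r s) = set_rarr x i r (view d s)"
  by (auto simp: view_def)

text \<open>\<open>view d\<close> is a simulation: reads, writes and evaluated words correspond
  under the shift, and costs are the same. It keeps the given multiplication program, whose names
  are unknown, apart from the programs around it.\<close>

lemma exec_shift: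
  "exec W P s\<^sub>0 t s\<^sub>1 ==> view d s = s\<^sub>0 ==> \<exists>s'. exec W (shift d P) s t s' \<and> view d s' = s\<^sub>1"
proof (induction arbitrary: s rule: exec.induct)
  case (Skip s)
  then show ?case using exec.Skip[of W s] by (auto intro!: exI[of _ s])
next
  case (Assign e s0 x)
  show ?case
    by (rule exI[of _ "set_wvar (d + x) (word_val e s0) s"])
      (use Assign exec.Assign[of "shift_word d e" s W "d + x"] in \<open>simp add: view_update\<close>)
next
  case (Store i s0 e a)
  show ?case
    by (rule exI[of _ "set_warr (d + a) (word_val i s0) (word_val e s0) s"])
      (use Store exec.Store[of "shift_word d i" s "shift_word d e" W "d + a"] in \<open>simp add: view_update\<close>)
next
  case (RAssign e s0 x)
  show ?case
    by (rule exI[of _ "set_rvar (d + x) (real_val e s0) s"])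
      (use RAssign exec.RAssign[of "shift_real d e" s W "d + x"] in \<open>simp add: view_update\<close>)
next
  case (RStore i s0 e a)
  show ?case
    by (rule exI[of _ "set_rarr (d + a) (word_val i s0) (real_val e s0) s"])
      (use RStore exec.RStore[of "shift_word d i" s "shift_real d e" W "d + a"] in \<open>simp add: view_update\<close>)
next
  case (Seq P s0 t s1 Q u s2)
  then show ?case by (metis exec.Seq shift.simps(6))
next
  case (CondTrue b s0 P t s1 Q)
  obtain s' where "exec W (shift d P) s t s'" "view d s' = s1" using CondTrue by blast
  then show ?case using CondTrue exec.CondTrue[of "shift_test d b" s W "shift d P" t s' "shift d Q"]
    by (auto intro!: exI[of _ s'])
next
  case (CondFalse b s0 Q t s1 P)
  obtain s' where "exec W (shift d Q) s t s'" "view d s' = s1" using CondFalse by blast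
  then show ?case using CondFalse exec.CondFalse[of "shift_test d b" s W "shift d Q" t s' "shift d P"]
    by (auto intro!: exI[of _ s'])
next
  case (WhileFalse b s0 P)
  then show ?case using exec.WhileFalse[of "shift_test d b" s W "shift d P"] by (auto intro!: exI[of _ s])
next
  case (WhileTrue b s0 P t s1 u s2)
  obtain s' where 1: "exec W (shift d P) s t s'" "view d s' = s1" using WhileTrue by blast
  obtain s'' where 2: "exec W (shift d (While b P)) s' u s''" "view d s'' = s2" using WhileTrue(6)[OF 1(2)] by blast
  show ?case using 1 2 WhileTrue exec.WhileTrue[of "shift_test d b" s W "shift d P" t s' u s'']
    by (auto intro!: exI[of _ s''])
qed

lemma shift_of:
  "wvars_of (shift d P) \<subseteq> {d..}" "warrs_of (shift d P) \<subseteq> {d..}"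
  "rvars_of (shift d P) \<subseteq> {d..}" "rarrs_of (shift d P) \<subseteq> {d..}"
  by (induction P) auto

section \<open>Lazy Gauss-Jordan elimination over the field with two elements\<close>

declare add_bit_eq_xor [simp del] mult_bit_eq_and [simp del] One_nat_def [simp del]

lemma bit_add_self [simp]: "x + x = (0 :: bit)"
  by (cases x) auto

lemma bit_add_left_self [simp]: "x + (x + y) = (y :: bit)"
  by (cases x; cases y) auto

definition unit_col :: "nat => nat => bit" where
  "unit_col p i = (if i = p then 1 else 0)"

lemma unit_col_simps [simp]: "unit_col p p = 1" "i \<noteq> p ==> unit_col p i = 0"
  by (auto simp: unit_col_def)

text \<open>A matrix is given by its columns \<open>M j\<close>.  The value \<open>piv j = Suc p\<close> says that row \<open>p\<close> is the
  pivot row of column \<open>j\<close>, and \<open>piv j = 0\<close> that column \<open>j\<close> has no pivot.  \<open>gj piv M j\<close> is the product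
  of the row operations of the first \<open>j\<close> elimination steps.\<close>

primrec gj :: "(nat => nat) => (nat => nat => bit) => nat => (nat => bit) => nat => bit" where
  "gj piv M 0 = (\<lambda>x. x)"
| "gj piv M (Suc j) = (\<lambda>x. if piv j = 0 then gj piv M j x else
     (\<lambda>i. gj piv M j x i + (gj piv M j (M j) i + unit_col (piv j - 1) i) * gj piv M j x (piv j - 1)))"

text \<open>The current column has entry 1 in its pivot row, so adding the unit vector makes the
  entry there zero. The step thus clears the column in all other rows, above as well as below, and
  leaves the pivot row alone.\<close>

definition gj_col :: "(nat => nat) => (nat => nat => bit) => nat => nat => bit" where
  "gj_col piv M j i = gj piv M j (M j) i + unit_col (piv j - 1) i"

definition gj_step :: "(nat => nat) => (nat => nat => bit) => nat => (nat => bit) => nat => bit" where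
  "gj_step piv M j x i = x i + (if piv j = 0 then 0 else gj_col piv M j i * x (piv j - 1))"

lemma gj_Suc: "gj piv M (Suc j) x = gj_step piv M j (gj piv M j x)"
  by (auto simp: gj_step_def gj_col_def)

declare gj.simps(2) [simp del]

primrec gj_from :: "(nat => nat) => (nat => nat => bit) => nat => nat => (nat => bit) => nat => bit" where
  "gj_from piv M a 0 x = x"
| "gj_from piv M a (Suc d) x = gj_step piv M (a + d) (gj_from piv M a d x)"

lemma gj_from_add: "gj_from piv M a (d + e) x = gj_from piv M (a + d) e (gj_from piv M a d x)"
  by (induction e) (auto simp: add.assoc)

lemma gj_add: "gj piv M (a + d) x = gj_from piv M a d (gj piv M a x)"
  by (induction d) (auto simp: gj_Suc)

text \<open>The columns in which the product of the steps \<open>a, \<dots>, a + d - 1\<close>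
  differs from the identity. They are indexed by the matrix column \<open>y\<close> whose pivot row
  they belong to, so they can be stored in the place of that column.\<close>

definition block_col :: "(nat => nat) => (nat => nat => bit) => nat => nat => nat => nat => bit" where
  "block_col piv M a d y i = gj_from piv M a d (unit_col (piv y - 1)) i + unit_col (piv y - 1) i"

definition used_rows :: "(nat => nat) => nat => nat set" where
  "used_rows piv j = {p. \<exists>i<j. piv i = Suc p}"

definition pivoting :: "(nat => nat) => (nat => nat => bit) => nat => nat => bool" where
  "pivoting piv M N j \<longleftrightarrow> (\<forall>i<j. if piv i = 0 then \<forall>p<N. p \<notin> used_rows piv i --> gj piv M i (M i) p = 0
     else piv i - 1 < N \<and> piv i - 1 \<notin> used_rows piv i \<and> gj piv M i (M i) (piv i - 1) = 1)"

lemma pivoting_mono: "pivoting piv M N j ==> i \<le> j ==> pivoting piv M N i"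
  unfolding pivoting_def by (meson less_le_trans)

lemma pivoting_distinct:
  assumes "pivoting piv M N j" "i < j" "i' < j" "i \<noteq> i'" "piv i \<noteq> 0"
  shows "piv i \<noteq> piv i'"
proof -
  have *: "piv l \<noteq> piv l'" if "l < l'" "l' < j" "piv l' \<noteq> 0" for l l'
  proof
    assume "piv l = piv l'"
    then have "piv l' - 1 \<in> used_rows piv l'" using that by (auto simp: used_rows_def intro!: exI[of _ l])
    then show False using assms(1) that by (auto simp: pivoting_def)
  qed
  show ?thesis
    using *[of i i'] *[of i' i] assms by (cases "i < i'") auto
qed

lemma gj_cong:
  assumes "\<And>i. i < j ==> piv i = piv' i"
  shows "gj piv M j = gj piv' M j"
  using assms by (induction j) (auto simp: gj.simps(2) fun_eq_iff)

lemma gj_step_cong: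
  assumes "\<And>i. i \<le> j ==> piv i = piv' i"
  shows "gj_step piv M j = gj_step piv' M j"
proof -
  have "gj piv M j = gj piv' M j" by (rule gj_cong) (use assms in auto)
  then show ?thesis using assms[of j] unfolding gj_step_def gj_col_def fun_eq_iff by simp
qed

lemma gj_from_cong:
  assumes "\<And>i. i < a + d ==> piv i = piv' i"
  shows "gj_from piv M a d = gj_from piv' M a d"
  using assms
proof (induction d)
  case (Suc d)
  then have "gj_step piv M (a + d) = gj_step piv' M (a + d)" by (intro gj_step_cong) auto
  moreover have "gj_from piv M a d = gj_from piv' M a d" by (rule Suc.IH) (use Suc.prems in auto)
  ultimately show ?case by (intro ext) simp
qed (auto simp: fun_eq_iff)

lemma block_col_cong:
  assumes "\<And>i. i < a + d ==> piv i = piv' i" "y < a + d"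
  shows "block_col piv M a d y = block_col piv' M a d y"
  using gj_from_cong[OF assms(1)] assms by (simp add: block_col_def fun_eq_iff)

lemma pivoting_cong:
  assumes "\<And>i. i < j ==> piv i = piv' i"
  shows "pivoting piv M N j \<longleftrightarrow> pivoting piv' M N j"
proof -
  have "used_rows piv i = used_rows piv' i" "gj piv M i = gj piv' M i" if "i < j" for i
    using assms that by (auto simp: used_rows_def intro!: gj_cong)
  then show ?thesis using assms by (simp add: pivoting_def)
qed

subsection \<open>Linearity\<close>

lemma gj_step_add: "gj_step piv M j (\<lambda>i. x i + y i) = (\<lambda>i. gj_step piv M j x i + gj_step piv M j y i)"
  by (auto simp: gj_step_def algebra_simps)

lemma gj_from_linear: "gj_from piv M a d (\<lambda>i. x i + y i) = (\<lambda>i. gj_from piv M a d x i + gj_from piv M a d y i)"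
  by (induction d) (auto simp: gj_step_add)

lemma gj_linear: "gj piv M j (\<lambda>i. x i + y i) = (\<lambda>i. gj piv M j x i + gj piv M j y i)"
  by (induction j) (auto simp: gj_Suc gj_step_add)

lemma gj_zero: "gj piv M j (\<lambda>i. 0) = (\<lambda>i. 0)"
  by (induction j) (auto simp: gj_Suc gj_step_def)

lemma gj_sum:
  assumes "finite S"
  shows "gj piv M j (\<lambda>i. \<Sum>c\<in>S. f c i) = (\<lambda>i. \<Sum>c\<in>S. gj piv M j (f c) i)"
  using assms by (induction S) (auto simp: gj_zero gj_linear)

subsection \<open>Blocks\<close>

text \<open>The steps of a block multiply to the identity plus a matrix whose nonzero columns stand
  at the pivot rows of the block. A block thus acts by one matrix product, and \<open>d\<close>
  columns suffice to store it.\<close>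

lemma gj_from_expand:
  assumes "\<And>y y'. a \<le> y ==> y < y' ==> y' < a + d ==> piv y \<noteq> 0 ==> piv y \<noteq> piv y'"
  shows "gj_from piv M a d x i =
    x i + (\<Sum>y\<in>{a..<a + d}. if piv y = 0 then 0 else block_col piv M a d y i * x (piv y - 1))"
  using assms
proof (induction d arbitrary: x i)
  case (Suc d)
  let ?s = "\<lambda>d x i. \<Sum>y\<in>{a..<a + d}. if piv y = 0 then 0 else block_col piv M a d y i * x (piv y - 1)"
  have IH: "gj_from piv M a d x i = x i + ?s d x i" for x i
    by (rule Suc.IH, rule Suc.prems) auto
  show ?case
  proof (cases "piv (a + d) = 0")
    case True
    then have *: "block_col piv M a (Suc d) y = block_col piv M a d y" for y
      by (simp add: block_col_def gj_step_def fun_eq_iff)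
    have "gj_from piv M a (Suc d) x i = gj_from piv M a d x i"
      using True by (simp add: gj_step_def)
    then show ?thesis using True by (simp only: * IH) simp
  next
    case False
    let ?p = "piv (a + d) - 1" and ?u = "gj_col piv M (a + d)"
    have ne: "piv y - 1 \<noteq> ?p" if "a \<le> y" "y < a + d" "piv y \<noteq> 0" for y
      using Suc.prems[of y "a + d"] that False by (metis Suc_pred' add_Suc_right gr0I lessI)
    have old: "block_col piv M a (Suc d) y i = block_col piv M a d y i + ?u i * block_col piv M a d y ?p"
      if "a \<le> y" "y < a + d" "piv y \<noteq> 0" for y i
      using ne[OF that] False by (simp add: block_col_def gj_step_def algebra_simps)
    \<comment> \<open>The new pivot row differs from all earlier ones, so its unit vector passes
      through the earlier steps unchanged.\<close>
    have "gj_from piv M a d (unit_col ?p) j = unit_col ?p j" for j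
      unfolding IH using ne by (auto intro!: sum.neutral simp: unit_col_def)
    then have new: "block_col piv M a (Suc d) (a + d) i = ?u i" for i
      using False by (simp add: block_col_def gj_step_def)
    have "?s (Suc d) x i = (\<Sum>y\<in>{a..<a + d}. if piv y = 0 then 0 else block_col piv M a (Suc d) y i * x (piv y - 1))
        + ?u i * x ?p"
      using False new by simp
    also have "(\<Sum>y\<in>{a..<a + d}. if piv y = 0 then 0 else block_col piv M a (Suc d) y i * x (piv y - 1)) =
        (\<Sum>y\<in>{a..<a + d}. (if piv y = 0 then 0 else block_col piv M a d y i * x (piv y - 1)) +
           ?u i * (if piv y = 0 then 0 else block_col piv M a d y ?p * x (piv y - 1)))"
      by (rule sum.cong) (auto simp: old algebra_simps)
    also have "\<dots> = ?s d x i + ?u i * ?s d x ?p"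
      by (simp add: sum.distrib sum_distrib_left)
    finally show ?thesis
      using False by (simp add: gj_step_def IH algebra_simps)
  qed
qed auto

lemma gj_from_fixed:
  assumes "\<And>y. a \<le> y ==> y < a + d ==> piv y \<noteq> 0 ==> x (piv y - 1) = 0"
  shows "gj_from piv M a d x = x"
  using assms by (induction d) (auto simp: gj_step_def fun_eq_iff)

text \<open>The unit vector of a pivot row of the left block is fixed by the right block, so the
  stored column is brought up to date by applying the right block to it like to any other
  column.\<close>

lemma block_col_left:
  assumes "pivoting piv M N (a + b + c)" "a \<le> y" "y < a + b" "piv y \<noteq> 0"
  shows "block_col piv M a (b + c) y = gj_from piv M (a + b) c (block_col piv M a b y)"
proof -
  let ?e = "unit_col (piv y - 1)"
  have fixed: "gj_from piv M (a + b) c ?e = ?e"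
  proof (rule gj_from_fixed)
    fix y' assume y': "a + b \<le> y'" "y' < a + b + c" "piv y' \<noteq> 0"
    have "piv y \<noteq> piv y'"
      by (rule pivoting_distinct[OF assms(1)]) (use y' assms in auto)
    then show "?e (piv y' - 1) = 0" using y' assms by (auto simp: unit_col_def)
  qed
  have "gj_from piv M (a + b) c (block_col piv M a b y) =
      (\<lambda>i. gj_from piv M (a + b) c (gj_from piv M a b ?e) i + ?e i)"
    using gj_from_linear[of piv M "a + b" c "gj_from piv M a b ?e" ?e] fixed
    by (simp add: block_col_def [abs_def])
  then show ?thesis by (simp add: block_col_def fun_eq_iff gj_from_add)
qed

text \<open>The left block fixes the unit vectors of later pivot rows, so the columns stored for the
  right block stay valid for the union.\<close>

lemma block_col_right:
  assumes "pivoting piv M N (a + b + c)" "a + b \<le> y" "y < a + b + c" "piv y \<noteq> 0"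
  shows "block_col piv M a (b + c) y = block_col piv M (a + b) c y"
proof -
  let ?e = "unit_col (piv y - 1)"
  have fixed: "gj_from piv M a b ?e = ?e"
  proof (rule gj_from_fixed)
    fix y' assume y': "a \<le> y'" "y' < a + b" "piv y' \<noteq> 0"
    have "piv y \<noteq> piv y'"
      by (rule pivoting_distinct[OF assms(1)]) (use y' assms in auto)
    then show "?e (piv y' - 1) = 0" using y' assms by (auto simp: unit_col_def)
  qed
  then show ?thesis by (intro ext) (simp add: block_col_def gj_from_add)
qed

lemma block_col_single: "piv j \<noteq> 0 ==> block_col piv M j 1 j = gj_col piv M j"
  by (auto simp: block_col_def gj_step_def fun_eq_iff One_nat_def)

subsection \<open>The result of the elimination\<close>

text \<open>A pivot entry is 1, hence pivot rows lie in \<open>E\<close>, and row operations between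
  rows of \<open>E\<close> cannot leave \<open>E\<close>.\<close>

lemma gj_support:
  assumes "pivoting piv M N j" "\<And>c i. c < j ==> i \<notin> E ==> M c i = 0"
  shows "(\<And>i. i \<notin> E ==> x i = 0) ==> i \<notin> E ==> gj piv M j x i = 0"
  using assms
proof (induction j arbitrary: x i)
  case (Suc j)
  have p: "pivoting piv M N j" by (rule pivoting_mono[OF Suc.prems(3)]) auto
  have IH: "gj piv M j x i = 0" if "\<And>i. i \<notin> E ==> x i = 0" "i \<notin> E" for x i
    by (rule Suc.IH[OF that p]) (auto intro: Suc.prems(4))
  show ?case
  proof (cases "piv j = 0")
    case False
    then have "gj piv M j (M j) (piv j - 1) = 1" using Suc.prems(3) by (auto simp: pivoting_def)
    then have "piv j - 1 \<in> E" using IH[of "M j" "piv j - 1"] Suc.prems(4) by fastforce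
    then have "gj_col piv M j i = 0"
      using Suc.prems IH[of "M j" i] by (auto simp: gj_col_def unit_col_def)
    then show ?thesis using IH[OF Suc.prems(1,2)] by (simp add: gj_Suc gj_step_def)
  qed (use IH[OF Suc.prems(1,2)] in \<open>simp add: gj_Suc gj_step_def\<close>)
qed auto

lemma gj_unused:
  assumes "\<And>p. p \<in> used_rows piv j ==> x p = 0"
  shows "gj piv M j x = x"
proof -
  have "gj_from piv M 0 j x = x"
    by (rule gj_from_fixed) (use assms in \<open>force simp: used_rows_def\<close>)
  then show ?thesis using gj_add[of piv M 0 j x] by simp
qed

text \<open>The column becomes a unit vector in its own step, and later steps read only other pivot
  rows, where this vector is zero.\<close>

lemma gj_pivot_col:
  assumes "pivoting piv M N q" "c < q" "piv c \<noteq> 0"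
  shows "gj piv M q (M c) = unit_col (piv c - 1)"
proof -
  have 1: "gj piv M (Suc c) (M c) = unit_col (piv c - 1)"
  proof
    fix i
    have "gj piv M c (M c) (piv c - 1) = 1" using assms by (auto simp: pivoting_def)
    then show "gj piv M (Suc c) (M c) i = unit_col (piv c - 1) i"
      using assms(3) by (simp add: gj_Suc gj_step_def gj_col_def)
  qed
  have "gj_from piv M (Suc c) (q - Suc c) (unit_col (piv c - 1)) = unit_col (piv c - 1)"
  proof (rule gj_from_fixed)
    fix y assume y: "Suc c \<le> y" "y < Suc c + (q - Suc c)" "piv y \<noteq> 0"
    have "piv c \<noteq> piv y"
      by (rule pivoting_distinct[OF assms(1)]) (use y assms in auto)
    then show "unit_col (piv c - 1) (piv y - 1) = 0" using assms y by (auto simp: unit_col_def)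
  qed
  then show ?thesis using gj_add[of piv M "Suc c" "q - Suc c" "M c"] assms 1 by simp
qed

lemma gj_col_used:
  assumes "pivoting piv M N q" "\<And>c i. c < q ==> i \<ge> N ==> M c i = 0" "c < q" "i \<notin> used_rows piv q"
  shows "gj piv M q (M c) i = 0"
proof (cases "piv c = 0")
  case False
  then have "i \<noteq> piv c - 1" using assms by (auto simp: used_rows_def)
  then show ?thesis using gj_pivot_col[OF assms(1,3) False] by simp
next
  case True
  let ?x = "gj piv M c (M c)"
  have x0: "?x p = 0" if "p \<notin> used_rows piv c" for p
  proof (cases "p < N")
    case True
    then show ?thesis using assms(1,3) \<open>piv c = 0\<close> that by (auto simp: pivoting_def)
  next
    case False
    then show ?thesis
      using gj_support[OF pivoting_mono[OF assms(1)], of c "{..<N}" "M c" p] assms(2,3) by auto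
  qed
  have "gj_from piv M c (q - c) ?x = ?x"
  proof (rule gj_from_fixed)
    fix y assume y: "c \<le> y" "y < c + (q - c)" "piv y \<noteq> 0"
    have "piv y - 1 \<notin> used_rows piv c"
    proof
      assume "piv y - 1 \<in> used_rows piv c"
      then obtain i where i: "i < c" "piv i = Suc (piv y - 1)" by (auto simp: used_rows_def)
      then have "piv i = piv y" using y by simp
      then show False using pivoting_distinct[OF assms(1), of y i] y i assms(3) by auto
    qed
    then show "?x (piv y - 1) = 0" by (rule x0)
  qed
  moreover have "i \<notin> used_rows piv c" using assms by (auto simp: used_rows_def)
  ultimately show ?thesis using gj_add[of piv M c "q - c" "M c"] assms(3) x0 by simp
qed

text \<open>A step adds the pivot row to other rows and leaves the pivot row alone, so modulo 2 it
  undoes itself. This is the source of the injectivity of the elimination.\<close>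

lemma gj_step_invol:
  assumes "piv j \<noteq> 0 ==> gj piv M j (M j) (piv j - 1) = 1"
  shows "gj_step piv M j (gj_step piv M j x) = x"
proof (cases "piv j = 0")
  case False
  then have "gj_col piv M j (piv j - 1) = 0" using assms by (simp add: gj_col_def)
  then have "gj_step piv M j x (piv j - 1) = x (piv j - 1)" by (simp add: gj_step_def)
  then have "gj_step piv M j (gj_step piv M j x) i = gj_step piv M j x i + gj_col piv M j i * x (piv j - 1)" for i
    using False by (simp add: gj_step_def[of piv M j "gj_step piv M j x"])
  then show ?thesis using False by (intro ext) (simp add: gj_step_def add.assoc)
qed (simp add: gj_step_def fun_eq_iff)

lemma gj_inj:
  assumes "pivoting piv M N j" "gj piv M j x = gj piv M j y"
  shows "x = y"
  using assms
proof (induction j)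
  case (Suc j)
  have "gj_step piv M j (gj_step piv M j z) = z" for z
    by (rule gj_step_invol) (use Suc.prems in \<open>auto simp: pivoting_def\<close>)
  moreover have "gj_step piv M j (gj piv M j x) = gj_step piv M j (gj piv M j y)"
    using Suc.prems by (simp add: gj_Suc)
  ultimately have "gj piv M j x = gj piv M j y" by metis
  moreover have "pivoting piv M N j" by (rule pivoting_mono[OF Suc.prems(1)]) simp
  ultimately show ?case using Suc.IH by blast
qed auto

definition pivot_cols :: "(nat => nat) => nat => nat set" where
  "pivot_cols piv q = {c. c < q \<and> piv c \<noteq> 0}"

lemma finite_pivot_cols [simp]: "finite (pivot_cols piv q)"
  by (simp add: pivot_cols_def)

lemma gj_pivot_sum:
  assumes "pivoting piv M N q" "S \<subseteq> pivot_cols piv q"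
  shows "gj piv M q (\<lambda>i. \<Sum>c\<in>S. M c i) i = (if \<exists>c\<in>S. i = piv c - 1 then 1 else 0)"
proof -
  have fin: "finite S" using assms finite_subset finite_pivot_cols by blast
  have inj: "piv c - 1 \<noteq> piv c' - 1" if "c \<in> S" "c' \<in> S" "c \<noteq> c'" for c c'
  proof -
    have "c < q" "c' < q" "piv c \<noteq> 0" "piv c' \<noteq> 0" using that assms(2) by (auto simp: pivot_cols_def)
    then show ?thesis using pivoting_distinct[OF assms(1), of c c'] that by auto
  qed
  have "gj piv M q (\<lambda>i. \<Sum>c\<in>S. M c i) i = (\<Sum>c\<in>S. unit_col (piv c - 1) i)"
    unfolding gj_sum[OF fin] using gj_pivot_col[OF assms(1)] assms(2)
    by (intro sum.cong) (auto simp: pivot_cols_def)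
  also have "\<dots> = (if \<exists>c\<in>S. i = piv c - 1 then 1 else 0)"
  proof (cases "\<exists>c\<in>S. i = piv c - 1")
    case True
    then obtain c where c: "c \<in> S" "i = piv c - 1" by blast
    have "(\<Sum>c\<in>S. unit_col (piv c - 1) i) = unit_col (piv c - 1) i + (\<Sum>c\<in>S - {c}. unit_col (piv c - 1) i)"
      using fin c by (simp add: sum.remove)
    also have "(\<Sum>c\<in>S - {c}. unit_col (piv c - 1) i) = 0"
      using inj c by (intro sum.neutral) (auto simp: unit_col_def)
    finally show ?thesis using True c by simp
  qed (auto intro!: sum.neutral simp: unit_col_def)
  finally show ?thesis .
qed

text \<open>Reduced pivot columns are distinct unit vectors, so a vector reduced to the used rows
  has the same image as a sum of pivot columns; injectivity carries the equality back.\<close>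

lemma gj_span:
  assumes "pivoting piv M N q" "\<And>i. i \<notin> used_rows piv q ==> gj piv M q x i = 0"
  obtains S where "S \<subseteq> pivot_cols piv q" "x = (\<lambda>i. \<Sum>c\<in>S. M c i)"
proof
  \<comment> \<open>The coefficient of a pivot column is the reduced entry in its pivot row.\<close>
  let ?S = "{c \<in> pivot_cols piv q. gj piv M q x (piv c - 1) = 1}"
  show S: "?S \<subseteq> pivot_cols piv q" by auto
  have "gj piv M q x i = gj piv M q (\<lambda>i. \<Sum>c\<in>?S. M c i) i" for i
  proof (cases "i \<in> used_rows piv q")
    case True
    then obtain c where c: "c < q" "piv c = Suc i" by (auto simp: used_rows_def)
    have "(\<exists>c'\<in>?S. i = piv c' - 1) \<longleftrightarrow> gj piv M q x i = 1"
      using c by (auto simp: pivot_cols_def intro!: bexI[of _ c])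
    then show ?thesis unfolding gj_pivot_sum[OF assms(1) S] by auto
  next
    case False
    then have "\<not> (\<exists>c\<in>?S. i = piv c - 1)" by (auto simp: used_rows_def pivot_cols_def)
    then show ?thesis unfolding gj_pivot_sum[OF assms(1) S] using assms(2)[OF False] by auto
  qed
  then have "gj piv M q x = gj piv M q (\<lambda>i. \<Sum>c\<in>?S. M c i)" by (rule ext)
  then show "x = (\<lambda>i. \<Sum>c\<in>?S. M c i)" by (rule gj_inj[OF assms(1)])
qed

lemma pivot_cols_independent:
  assumes "pivoting piv M N q" "S \<subseteq> pivot_cols piv q" "\<And>i. (\<Sum>c\<in>S. M c i) = 0"
  shows "S = {}"
proof (rule ccontr)
  assume "S \<noteq> {}"
  then obtain c where "c \<in> S" by auto
  then have "gj piv M q (\<lambda>i. \<Sum>c\<in>S. M c i) (piv c - 1) = 1"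
    unfolding gj_pivot_sum[OF assms(1,2)] by auto
  then show False using assms(3) by (simp add: gj_zero)
qed

lemma gj_expand:
  assumes "pivoting piv M N q"
  shows "gj piv M q x i = x i + (\<Sum>y<q. if piv y = 0 then 0 else block_col piv M 0 q y i * x (piv y - 1))"
proof -
  have "gj_from piv M 0 q x i = x i + (\<Sum>y\<in>{0..<0 + q}. if piv y = 0 then 0 else block_col piv M 0 q y i * x (piv y - 1))"
    by (rule gj_from_expand, rule pivoting_distinct[OF assms]) auto
  then show ?thesis using gj_add[of piv M 0 q x] by (simp add: atLeast0LessThan)
qed

section \<open>Loops that fill arrays\<close>

notation Seq (infixr \<open>;;\<close> 58)
notation Assign (infix \<open>::=\<close> 60)
notation WAdd (infixl \<open>+.\<close> 65)
notation WSub (infixl \<open>-.\<close> 65)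
notation WMul (infixl \<open>*.\<close> 70)
notation WDiv (infixl \<open>div.\<close> 70)
notation WMod (infixl \<open>mod.\<close> 70)

abbreviation (input) cell_exp :: "nat => nat => nat => word_exp" where
  "cell_exp x m y \<equiv> Var x *. Var m +. Var y"

lemma run_Store_word_val:
  assumes "word_words i s \<union> word_words e s \<subseteq> {..W}" "Q (1 + word_cost i + word_cost e) (set_warr a (word_val i s) (word_val e s) s)"
  shows "run W (Store a i e) s Q"
  using assms by (simp add: run_Store One_nat_def)

lemma run_fill1:
  assumes ws: "word_state W s" and W: "1 \<le> W" and xy: "x \<noteq> y"
    and sem: "\<And>i s'. i < wvar s y ==> word_state W s' ==> frame (For x y (Store a ie e)) s s' ==> wvar s' x = i ==>
      (\<And>k. k \<notin> idx ` {..<i} ==> warr s' a k = warr s a k) ==>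
      word_val ie s' = idx i \<and> word_val e s' = f i \<and> word_words ie s' \<union> word_words e s' \<subseteq> {..W}"
    and inj: "inj_on idx {..<wvar s y}"
  shows "run W (For x y (Store a ie e)) s (\<lambda>t s'. (\<forall>i<wvar s y. warr s' a (idx i) = f i) \<and>
    (\<forall>k. k \<notin> idx ` {..<wvar s y} --> warr s' a k = warr s a k) \<and>
    t \<le> 7 + wvar s y * (word_cost ie + word_cost e + 10))"
proof (rule run_For[where I = "\<lambda>i s'. (\<forall>i'<i. warr s' a (idx i') = f i') \<and> (\<forall>k. k \<notin> idx ` {..<i} --> warr s' a k = warr s a k)"
      and T = "\<lambda>_. 1 + word_cost ie + word_cost e"], goal_cases)
  case (7 i s')
  have *: "word_val ie s' = idx i" "word_val e s' = f i" "word_words ie s' \<union> word_words e s' \<subseteq> {..W}"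
    using sem[of i s'] 7 by blast+
  have ne: "idx i' \<noteq> idx i" if "i' < i" for i'
    using inj that 7(1) unfolding inj_on_def by fastforce
  show ?case
    by (rule run_Store_word_val[OF *(3)]) (use 7 ne in \<open>auto simp: * less_Suc_eq lessThan_Suc\<close>)
next
  case (8 t s')
  then show ?case by (simp add: ac_simps)
qed (use ws W xy in auto)

text \<open>Since \<open>idx\<close> is injective on the range, a cell still has its initial value
  when its turn comes. The value expression may therefore read the cell that it replaces, which
  permits updates in place.\<close>

lemma run_fill2:
  assumes ws: "word_state W s" and W: "1 \<le> W"
    and xy: "x1 \<noteq> y1" "x1 \<noteq> y2" "x1 \<noteq> x2" "x2 \<noteq> y1" "x2 \<noteq> y2"
    and m: "wvar s y1 = m\<^sub>1" "wvar s y2 = m\<^sub>2"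
    and sem: "\<And>i l s'. i < m\<^sub>1 ==> l < m\<^sub>2 ==> word_state W s' ==>
      frame (For x1 y1 (For x2 y2 (Store a ie e))) s s' ==> wvar s' x1 = i ==> wvar s' x2 = l ==>
      warr s' a (idx i l) = warr s a (idx i l) ==>
      (\<And>k. k \<notin> case_prod idx ` ({..<m\<^sub>1} \<times> {..<m\<^sub>2}) ==> warr s' a k = warr s a k) ==>
      word_val ie s' = idx i l \<and> word_val e s' = f i l \<and> word_words ie s' \<union> word_words e s' \<subseteq> {..W}"
    and inj: "\<And>i l i' l'. i < m\<^sub>1 ==> i' < m\<^sub>1 ==> l < m\<^sub>2 ==> l' < m\<^sub>2 ==> idx i l = idx i' l' ==> i = i' \<and> l = l'"
  shows "run W (For x1 y1 (For x2 y2 (Store a ie e))) s (\<lambda>t s'. (\<forall>i<m\<^sub>1. \<forall>l<m\<^sub>2. warr s' a (idx i l) = f i l) \<and>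
    (\<forall>k. k \<notin> case_prod idx ` ({..<m\<^sub>1} \<times> {..<m\<^sub>2}) --> warr s' a k = warr s a k) \<and>
    t \<le> 7 + m\<^sub>1 * (16 + m\<^sub>2 * (word_cost ie + word_cost e + 10)))"
proof -
  let ?I = "\<lambda>i s'. (\<forall>i'<i. \<forall>l<m\<^sub>2. warr s' a (idx i' l) = f i' l) \<and>
     (\<forall>k. k \<notin> case_prod idx ` ({..<i} \<times> {..<m\<^sub>2}) --> warr s' a k = warr s a k)"
  show ?thesis
  proof (rule run_For[where I = ?I and T = "\<lambda>_. 7 + m\<^sub>2 * (word_cost ie + word_cost e + 10)"], goal_cases)
    case (7 i s')
    have i: "i < m\<^sub>1" using 7(1) m by simp
    have m2: "wvar s' y2 = m\<^sub>2" using 7(3) xy m by (auto simp: frame_def)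
    have "run W (For x2 y2 (Store a ie e)) s' (\<lambda>t s''. (\<forall>l<wvar s' y2. warr s'' a (idx i l) = f i l) \<and>
       (\<forall>k. k \<notin> idx i ` {..<wvar s' y2} --> warr s'' a k = warr s' a k) \<and>
       t \<le> 7 + wvar s' y2 * (word_cost ie + word_cost e + 10))"
    proof (rule run_fill1)
      show "word_state W s'" "1 \<le> W" "x2 \<noteq> y2" using 7 W xy by auto
      show "inj_on (idx i) {..<wvar s' y2}" using inj i m2 by (auto simp: inj_on_def)
    next
      fix l s2 assume a: "l < wvar s' y2" "word_state W s2" "frame (For x2 y2 (Store a ie e)) s' s2" "wvar s2 x2 = l"
        "\<And>k. k \<notin> idx i ` {..<l} ==> warr s2 a k = warr s' a k"
      have l: "l < m\<^sub>2" using a m2 by simp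
      show "word_val ie s2 = idx i l \<and> word_val e s2 = f i l \<and> word_words ie s2 \<union> word_words e s2 \<subseteq> {..W}"
      proof (rule sem[OF i l a(2)])
        show "frame (For x1 y1 (For x2 y2 (Store a ie e))) s s2" using 7(3) a(3) by (simp add: frame_def)
        show "wvar s2 x1 = i" using 7(4) a(3) xy by (simp add: frame_def)
        show "wvar s2 x2 = l" by fact
        have "idx i l \<notin> idx i ` {..<l}"
        proof
          assume "idx i l \<in> idx i ` {..<l}"
          then obtain l' where "l' < l" "idx i l = idx i l'" by auto
          then show False using inj[of i i l l'] i l by simp
        qed
        moreover have "idx i l \<notin> case_prod idx ` ({..<i} \<times> {..<m\<^sub>2})"
        proof
          assume "idx i l \<in> case_prod idx ` ({..<i} \<times> {..<m\<^sub>2})"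
          then obtain i' l' where "i' < i" "l' < m\<^sub>2" "idx i l = idx i' l'" by auto
          then show False using inj[of i i' l l'] i l by simp
        qed
        ultimately show "warr s2 a (idx i l) = warr s a (idx i l)" using a(5) 7(5) by simp
      next
        fix k assume k: "k \<notin> case_prod idx ` ({..<m\<^sub>1} \<times> {..<m\<^sub>2})"
        have "k \<notin> idx i ` {..<l}" using k i l by force
        moreover have "k \<notin> case_prod idx ` ({..<i} \<times> {..<m\<^sub>2})" using k i by force
        ultimately show "warr s2 a k = warr s a k" using a(5) 7(5) by simp
      qed
    qed
    then show ?case
    proof (rule run_mono, goal_cases)
      case (1 t s'')
      have A: "warr s'' a (idx i' l) = f i' l" if "i' < i" "l < m\<^sub>2" for i' l
      proof -
        have "idx i' l \<notin> idx i ` {..<m\<^sub>2}" using inj[of i' i l] that i by fastforce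
        then show ?thesis using 1 7(5) that m2 by simp
      qed
      have B: "warr s'' a k = warr s a k" if "k \<notin> case_prod idx ` ({..<Suc i} \<times> {..<m\<^sub>2})" for k
      proof -
        have "k \<notin> idx i ` {..<m\<^sub>2}" using that by force
        moreover have "k \<notin> case_prod idx ` ({..<i} \<times> {..<m\<^sub>2})" using that by force
        ultimately show ?thesis using 1 7(5) m2 by simp
      qed
      show ?case using 1 A B m2 by (simp add: less_Suc_eq)
    qed
  next
    case (8 t s')
    then show ?case using m by (simp add: algebra_simps)
  qed (use ws W xy m in auto)
qed

lemma mat_idx_less: "i < (n::nat) ==> j < m ==> i * m + j < n * m"
proof -
  assume "i < n" "j < m"
  then have "i * m + j < i * m + m" by simp
  also have "\<dots> = Suc i * m" by simp
  also have "\<dots> \<le> n * m" using \<open>i < n\<close> by (intro mult_le_mono1) simp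
  finally show ?thesis .
qed

lemma mat_idx_inj: "j < (m::nat) ==> j' < m ==> i * m + j = i' * m + j' \<longleftrightarrow> i = i' \<and> j = j'"
  by (metis add.commute add_right_cancel div_mult_self3 div_less add_0 less_nat_zero_code)

definition nat_of_bit :: "bit => nat" where
  "nat_of_bit x = (if x = 1 then 1 else 0)"

lemma nat_of_bit_simps [simp]:
  "nat_of_bit 0 = 0" "nat_of_bit 1 = 1" "nat_of_bit x = 0 \<longleftrightarrow> x = 0" "nat_of_bit x = 1 \<longleftrightarrow> x = 1"
  "nat_of_bit x \<le> 1" "0 < nat_of_bit x \<longleftrightarrow> x = 1"
  by (auto simp: nat_of_bit_def)

lemma nat_of_bit_add: "(nat_of_bit x + nat_of_bit y) mod 2 = nat_of_bit (x + y)"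
  by (cases x; cases y) auto

section \<open>Multiplication by the given program\<close>

text \<open>The given program is relocated to the names from \<open>100\<close> on; all other programs use smaller names.\<close>

locale mult_machine =
  fixes MM :: com and TM :: "nat => nat" and k\<^sub>M :: nat
  assumes MM_names: "wvars_of MM \<subseteq> {100..}" "warrs_of MM \<subseteq> {100..}" "rvars_of MM \<subseteq> {100..}" "rarrs_of MM \<subseteq> {100..}"
    and MM_run: "\<And>b W A B s. 1 \<le> b ==> k\<^sub>M * b ^ k\<^sub>M \<le> W ==> word_state W s ==> wvar s 100 = b ==>
      (\<And>i j. i < b ==> j < b ==> warr s 100 (i * b + j) = nat_of_bit (A i j)) ==>
      (\<And>i j. i < b ==> j < b ==> warr s 101 (i * b + j) = nat_of_bit (B i j)) ==>
      run W MM s (\<lambda>t s'. t \<le> TM b \<and> (\<forall>i<b. \<forall>j<b. warr s' 102 (i * b + j) = nat_of_bit (\<Sum>l<b. A i l * B l j)))"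

lemma matrix_mult_time_machine:
  assumes "matrix_mult_time \<omega>"
  obtains MM TM k C where "mult_machine MM TM k" "\<And>b. 1 \<le> b ==> real (TM b) \<le> C * real b powr \<omega>" "C \<ge> 0"
proof -
  obtain P k C where P: "\<And>n W A B s. 1 \<le> n ==> k * n ^ k \<le> W ==> A \<in> carrier_mat n n ==> B \<in> carrier_mat n n ==>
      word_state W s ==> wvar s 0 = n ==> stores_matrix n 0 A s ==> stores_matrix n 1 B s ==>
      \<exists>t s'. exec W P s t s' \<and> real t \<le> C * real n powr \<omega> \<and> stores_matrix n 2 (A * B) s'"
    using assms unfolding matrix_mult_time_def by metis
  \<comment> \<open>Times are natural numbers, so the real bound is rounded down;
    \<open>max 0 C\<close> covers a negative constant.\<close>
  define TM where "TM b = nat \<lfloor>max 0 C * real b powr \<omega>\<rfloor>" for b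
  have "mult_machine (shift 100 P) TM k"
  proof
    fix b W A B s
    assume a: "1 \<le> b" "k * b ^ k \<le> W" "word_state W s" "wvar s 100 = b"
      "\<And>i j. i < b ==> j < b ==> warr s 100 (i * b + j) = nat_of_bit (A i j)"
      "\<And>i j. i < b ==> j < b ==> warr s 101 (i * b + j) = nat_of_bit (B i j)"
    let ?A = "mat b b (\<lambda>(i, j). A i j)" and ?B = "mat b b (\<lambda>(i, j). B i j)"
    have "\<exists>t s'. exec W P (view 100 s) t s' \<and> real t \<le> C * real b powr \<omega> \<and> stores_matrix b 2 (?A * ?B) s'"
    proof (rule P)
      show "word_state W (view 100 s)" using a by (auto simp: word_state_def)
      show "stores_matrix b 0 ?A (view 100 s)" "stores_matrix b 1 ?B (view 100 s)"
        using a by (auto simp: stores_matrix_def nat_of_bit_def)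
    qed (use a in auto)
    then obtain t s' where *: "exec W P (view 100 s) t s'" "real t \<le> C * real b powr \<omega>" "stores_matrix b 2 (?A * ?B) s'"
      by blast
    obtain s'' where s'': "exec W (shift 100 P) s t s''" "view 100 s'' = s'"
      using exec_shift[OF *(1) refl] by blast
    have "C * real b powr \<omega> \<le> max 0 C * real b powr \<omega>" by (intro mult_right_mono) auto
    then have "t \<le> TM b" using *(2) unfolding TM_def by linarith
    moreover have "warr s'' 102 (i * b + j) = nat_of_bit (\<Sum>l<b. A i l * B l j)" if "i < b" "j < b" for i j
    proof -
      have "warr s' 2 (i * b + j) = nat_of_bit ((?A * ?B) $$ (i, j))"
        using *(3) that by (simp add: stores_matrix_def nat_of_bit_def)
      also have "(?A * ?B) $$ (i, j) = (\<Sum>l<b. A i l * B l j)"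
        using that by (simp add: scalar_prod_def atLeast0LessThan)
      finally show ?thesis using s''(2) by auto
    qed
    ultimately show "run W (shift 100 P) s (\<lambda>t s'. t \<le> TM b \<and>
        (\<forall>i<b. \<forall>j<b. warr s' 102 (i * b + j) = nat_of_bit (\<Sum>l<b. A i l * B l j)))"
      using s''(1) unfolding run_def by blast
  qed (rule shift_of)+
  moreover have "real (TM b) \<le> max 0 C * real b powr \<omega>" for b
    unfolding TM_def by (simp add: of_nat_floor)
  ultimately show ?thesis using that[of "shift 100 P" TM k "max 0 C"] by auto
qed

section \<open>The elimination program\<close>

abbreviation (input) "vN \<equiv> 2 :: nat"
abbreviation (input) "vb \<equiv> 4 :: nat"
abbreviation (input) "vj \<equiv> 5 :: nat"
abbreviation (input) "vsrc \<equiv> 6 :: nat"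
abbreviation (input) "vtgt \<equiv> 7 :: nat"
abbreviation (input) "vi \<equiv> 8 :: nat"
abbreviation (input) "vl \<equiv> 9 :: nat"
abbreviation (input) "vr \<equiv> 10 :: nat"
abbreviation (input) "vp \<equiv> 12 :: nat"
abbreviation (input) "vchunks \<equiv> 13 :: nat"
abbreviation (input) "aX \<equiv> 3 :: nat"
abbreviation (input) "aPiv \<equiv> 4 :: nat"
abbreviation (input) "aUsed \<equiv> 5 :: nat"
abbreviation (input) "aY \<equiv> 9 :: nat"

definition stores_cols :: "nat => nat => (nat => nat => bit) => machine_state => bool" where
  "stores_cols N a x s \<longleftrightarrow> (\<forall>i<N. \<forall>y<N. warr s a (i * N + y) = nat_of_bit (x y i))"

definition pivot_entry :: "(nat => nat) => nat => (nat => bit) => bit" where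
  "pivot_entry piv y x = (if piv y = 0 then 0 else x (piv y - 1))"

text \<open>Applies the row operations stored in the columns \<open>src, \<dots>, src + b - 1\<close> to the columns
  \<open>tgt, \<dots>, tgt + b - 1\<close>.\<close>

definition apply_cols :: "(nat => nat) => nat => nat => nat => (nat => nat => bit) => nat => nat => bit" where
  "apply_cols piv b src tgt x y i = (if tgt \<le> y \<and> y < tgt + b
     then x y i + (\<Sum>l<b. x (src + l) i * pivot_entry piv (src + l) (x y)) else x y i)"

text \<open>The product of an N x b with a b x b matrix is cut into N / b square products;
  \<open>vr\<close> numbers these chunks of b rows.\<close>

definition load_chunk :: com where
  "load_chunk = For vi vb (For vl vb (Store 100 (cell_exp vi vb vl)
     (Load aX ((cell_exp vr vb vi) *. Var vN +. (Var vsrc +. Var vl)))))"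

text \<open>The pivot rows of the target columns are saved before any chunk is changed, because they
  lie in the very rows that are being updated. The first factor is the sign of the pivot value and
  turns a missing pivot into a zero row.\<close>

definition load_pivot_rows :: com where
  "load_pivot_rows = For vi vb (For vl vb (Store aY (cell_exp vi vb vl)
     ((Const 1 -. (Const 1 -. Load aPiv (Var vsrc +. Var vi))) *.
      Load aX ((Load aPiv (Var vsrc +. Var vi) -. Const 1) *. Var vN +. (Var vtgt +. Var vl)))))"

text \<open>The multiplication program may destroy its operands, so the second one is supplied
  afresh for every chunk.\<close>

definition copy_pivot_rows :: com where
  "copy_pivot_rows = For vi vb (For vl vb (Store 101 (cell_exp vi vb vl)
     (Load aY (cell_exp vi vb vl))))"

definition add_chunk :: com where
  "add_chunk = For vi vb (For vl vb (Store aX ((cell_exp vr vb vi) *. Var vN +. (Var vtgt +. Var vl))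
     ((Load aX ((cell_exp vr vb vi) *. Var vN +. (Var vtgt +. Var vl)) +.
       Load 102 (cell_exp vi vb vl)) mod. Const 2)))"

definition apply_chunk :: "com => com" where
  "apply_chunk MM = (100 ::= Var vb) ;; load_chunk ;; copy_pivot_rows ;; MM ;; add_chunk"

definition apply_block :: "com => com" where
  "apply_block MM = (vchunks ::= Var vN div. Var vb) ;; load_pivot_rows ;; For vr vchunks (apply_chunk MM)"

lemma mat_words:
  fixes N :: nat
  assumes "i < N" "y < N" "N * N + 10 \<le> W"
  shows "i * N + y < N * N" "i * N + y \<le> W" "i * N \<le> W" "i \<le> W" "y \<le> W" "N \<le> W" "1 \<le> W" "2 \<le> W"
proof -
  show 1: "i * N + y < N * N" by (rule mat_idx_less[OF assms(1,2)])
  have "N \<le> N * N" by simp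
  then show "i \<le> W" "y \<le> W" "N \<le> W" using assms by linarith+
  show "i * N + y \<le> W" "i * N \<le> W" "1 \<le> W" "2 \<le> W" using 1 assms by linarith+
qed

context mult_machine
begin

lemma MM_notin [simp]:
  "x < 100 ==> x \<notin> wvars_of MM" "x < 100 ==> x \<notin> warrs_of MM"
  "x < 100 ==> x \<notin> rvars_of MM" "x < 100 ==> x \<notin> rarrs_of MM"
  using MM_names by (auto dest: subsetD)

end

lemma apply_names [simp]:
  "wvars_of load_chunk = {vi, vl}" "warrs_of load_chunk = {100}" "rvars_of load_chunk = {}" "rarrs_of load_chunk = {}"
  "wvars_of load_pivot_rows = {vi, vl}" "warrs_of load_pivot_rows = {aY}" "rvars_of load_pivot_rows = {}" "rarrs_of load_pivot_rows = {}"
  "wvars_of copy_pivot_rows = {vi, vl}" "warrs_of copy_pivot_rows = {101}" "rvars_of copy_pivot_rows = {}" "rarrs_of copy_pivot_rows = {}"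
  "wvars_of add_chunk = {vi, vl}" "warrs_of add_chunk = {aX}" "rvars_of add_chunk = {}" "rarrs_of add_chunk = {}"
  "wvars_of (apply_chunk MM) = {100, vi, vl} \<union> wvars_of MM" "warrs_of (apply_chunk MM) = {100, 101, aX} \<union> warrs_of MM"
  "rvars_of (apply_chunk MM) = rvars_of MM" "rarrs_of (apply_chunk MM) = rarrs_of MM"
  "wvars_of (apply_block MM) = {100, vi, vl, vr, vchunks} \<union> wvars_of MM"
  "warrs_of (apply_block MM) = {100, 101, aX, aY} \<union> warrs_of MM"
  "rvars_of (apply_block MM) = rvars_of MM" "rarrs_of (apply_block MM) = rarrs_of MM"
  by (auto simp: load_chunk_def load_pivot_rows_def copy_pivot_rows_def add_chunk_def apply_chunk_def apply_block_def)

text \<open>The constant is 7 + 16 + 77, using that 1 and \<open>b\<close> are at most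
  \<open>b * b\<close>.\<close>

lemma square_bound:
  fixes b :: nat
  assumes "t \<le> 7 + b * (16 + b * c)" "1 \<le> b" "c \<le> 77"
  shows "t \<le> 100 * (b * b)"
proof -
  have "t \<le> 7 + 16 * b + (b * b) * c" using assms(1) by (simp add: algebra_simps)
  moreover have "(b * b) * c \<le> (b * b) * 77" using assms(3) by (intro mult_le_mono2)
  moreover have "b \<le> b * b" by simp
  ultimately show ?thesis using assms(2) by linarith
qed

lemma block_idx:
  fixes N :: nat
  assumes "i < b" "l < b" "b \<le> N" "N * N + 10 \<le> W"
  shows "i * b + l < N * N" "i * b + l \<le> W" "i * b \<le> W" "b \<le> W" "i \<le> W" "l \<le> W" "i < N" "l < N"
proof -
  have 1: "i * b + l < b * b" using mat_idx_less assms by blast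
  also have 2: "\<dots> \<le> N * N" using assms by (intro mult_le_mono) auto
  finally show "i * b + l < N * N" .
  then show "i * b + l \<le> W" "i * b \<le> W" using assms by linarith+
  have "N \<le> N * N" by simp
  then show "b \<le> W" "i \<le> W" "l \<le> W" "i < N" "l < N" using assms by linarith+
qed

lemma nat_of_bit_le: "1 \<le> W ==> nat_of_bit x \<le> W"
  using nat_of_bit_simps(5) order_trans by blast

section \<open>One block product on the machine\<close>

lemma run_load_pivot_rows:
  assumes ws: "word_state W s" and NW: "N * N + 10 \<le> W" and b: "1 \<le> b"
    and v: "wvar s vN = N" "wvar s vb = b" "wvar s vsrc = src" "wvar s vtgt = tgt"
    and bd: "src + b \<le> N" "tgt + b \<le> N" and piv: "\<And>l. l < b ==> warr s aPiv (src + l) \<le> N"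
    and x: "stores_cols N aX x s"
  shows "run W load_pivot_rows s (\<lambda>t s'.
    (\<forall>i<b. \<forall>l<b. warr s' aY (i * b + l) = nat_of_bit (pivot_entry (warr s aPiv) (src + i) (x (tgt + l)))) \<and>
    t \<le> 100 * (b * b))"
  unfolding load_pivot_rows_def
proof (rule run_mono, rule run_fill2[where idx = "\<lambda>i l. i * b + l" and m\<^sub>1 = b and m\<^sub>2 = b and
     f = "\<lambda>i l. nat_of_bit (pivot_entry (warr s aPiv) (src + i) (x (tgt + l)))"], goal_cases)
  case (10 i l s')
  note fr = frameD[OF 10(4)]
  let ?p = "warr s aPiv (src + i) - 1"
  have bN: "b \<le> N" using bd by simp
  note ib = block_idx[OF 10(1,2) bN NW]
  have il: "src + i < N" "tgt + l < N" using 10 bd by linarith+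
  have p: "?p < N" using piv[OF 10(1)] il by linarith
  note w = mat_words[OF p il(2) NW]
  have "warr s aX (?p * N + (tgt + l)) = nat_of_bit (x (tgt + l) ?p)"
    using x p il by (simp add: stores_cols_def)
  moreover have "warr s aPiv (src + i) \<le> W" using ws by (rule word_stateD)
  ultimately show ?case
    using w 10(5,6) ib il NW by (simp add: fr v pivot_entry_def nat_of_bit_le)
next
  case (11 i l i' l')
  then show ?case using mat_idx_inj by auto
next
  case (12 t s')
  then show ?case by (auto intro: square_bound[OF _ b])
qed (use ws NW v in auto)

lemma run_load_chunk:
  assumes ws: "word_state W s" and NW: "N * N + 10 \<le> W" and b: "1 \<le> b"
    and v: "wvar s vN = N" "wvar s vb = b" "wvar s vsrc = src" "wvar s vr = r"
    and bd: "src + b \<le> N" "r * b + b \<le> N"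
    and x: "\<And>i y. i < b ==> y < b ==> warr s aX ((r * b + i) * N + (src + y)) = nat_of_bit (f i y)"
  shows "run W load_chunk s (\<lambda>t s'.
    (\<forall>i<b. \<forall>l<b. warr s' 100 (i * b + l) = nat_of_bit (f i l)) \<and> t \<le> 100 * (b * b))"
  unfolding load_chunk_def
proof (rule run_mono, rule run_fill2[where idx = "\<lambda>i l. i * b + l" and m\<^sub>1 = b and m\<^sub>2 = b and
     f = "\<lambda>i l. nat_of_bit (f i l)"], goal_cases)
  case (10 i l s')
  note fr = frameD[OF 10(4)]
  have bN: "b \<le> N" using bd by simp
  note ib = block_idx[OF 10(1,2) bN NW]
  have il: "src + l < N" "r * b + i < N" using 10 bd by linarith+
  note w = mat_words[OF il(2,1) NW]
  have "r * b \<le> W" "r \<le> W" "src \<le> W" using w il word_stateD(1)[OF ws, of vr] v by auto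
  then show ?case
    using w 10(5,6) ib il NW x[OF 10(1,2)] by (simp add: fr v nat_of_bit_le)
next
  case (11 i l i' l')
  then show ?case using mat_idx_inj by auto
next
  case (12 t s')
  then show ?case by (auto intro: square_bound[OF _ b])
qed (use ws NW v in auto)

lemma run_copy_pivot_rows:
  assumes ws: "word_state W s" and NW: "N * N + 10 \<le> W" and b: "1 \<le> b"
    and v: "wvar s vb = b" and bd: "b \<le> N"
  shows "run W copy_pivot_rows s (\<lambda>t s'.
    (\<forall>i<b. \<forall>l<b. warr s' 101 (i * b + l) = warr s aY (i * b + l)) \<and> t \<le> 100 * (b * b))"
  unfolding copy_pivot_rows_def
proof (rule run_mono, rule run_fill2[where idx = "\<lambda>i l. i * b + l" and m\<^sub>1 = b and m\<^sub>2 = b and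
     f = "\<lambda>i l. warr s aY (i * b + l)"], goal_cases)
  case (10 i l s')
  note fr = frameD[OF 10(4)]
  note ib = block_idx[OF 10(1,2) bd NW]
  show ?case
    using 10(5,6) ib NW word_stateD(2)[OF ws] by (simp add: fr v)
next
  case (11 i l i' l')
  then show ?case using mat_idx_inj by auto
next
  case (12 t s')
  then show ?case by (auto intro: square_bound[OF _ b])
qed (use ws NW v in auto)

lemma run_add_chunk:
  assumes ws: "word_state W s" and NW: "N * N + 10 \<le> W" and b: "1 \<le> b"
    and v: "wvar s vN = N" "wvar s vb = b" "wvar s vtgt = tgt" "wvar s vr = r"
    and bd: "tgt + b \<le> N" "r * b + b \<le> N"
    and x: "stores_cols N aX x s"
    and z: "\<And>i y. i < b ==> y < b ==> warr s 102 (i * b + y) = nat_of_bit (f i y)"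
  shows "run W add_chunk s (\<lambda>t s'. stores_cols N aX (\<lambda>y i. if r * b \<le> i \<and> i < r * b + b \<and> tgt \<le> y \<and> y < tgt + b
     then x y i + f (i - r * b) (y - tgt) else x y i) s' \<and> t \<le> 100 * (b * b))"
  unfolding add_chunk_def
proof (rule run_mono, rule run_fill2[where idx = "\<lambda>i l. (r * b + i) * N + (tgt + l)" and m\<^sub>1 = b and m\<^sub>2 = b and
     f = "\<lambda>i l. nat_of_bit (x (tgt + l) (r * b + i) + f i l)"], goal_cases)
  case (10 i l s')
  note fr = frameD[OF 10(4)]
  have bN: "b \<le> N" using bd by simp
  note ib = block_idx[OF 10(1,2) bN NW]
  have il: "tgt + l < N" "r * b + i < N" using 10 bd by linarith+
  note w = mat_words[OF il(2,1) NW]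
  have "r * b \<le> W" "r \<le> W" "tgt \<le> W" using w il word_stateD(1)[OF ws, of vr] v by auto
  moreover have "warr s aX ((r * b + i) * N + (tgt + l)) = nat_of_bit (x (tgt + l) (r * b + i))"
    using x il by (simp add: stores_cols_def)
  moreover have "nat_of_bit (x (tgt + l) (r * b + i)) + nat_of_bit (f i l) \<le> W"
    using nat_of_bit_simps(5)[of "x (tgt + l) (r * b + i)"] nat_of_bit_simps(5)[of "f i l"] w(8) by linarith
  ultimately show ?case
    using w 10(5,6,7) ib il NW z[OF 10(1,2)] by (simp add: fr v nat_of_bit_le nat_of_bit_add)
next
  case (11 i l i' l')
  then have "tgt + l < N" "tgt + l' < N" using bd by linarith+
  then show ?case using mat_idx_inj[of "tgt + l" N "tgt + l'" "r * b + i" "r * b + i'"] 11 by auto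
next
  case (12 t s')
  have "warr s' aX (i * N + y) = nat_of_bit (if r * b \<le> i \<and> i < r * b + b \<and> tgt \<le> y \<and> y < tgt + b
     then x y i + f (i - r * b) (y - tgt) else x y i)" if "i < N" "y < N" for i y
  proof (cases "r * b \<le> i \<and> i < r * b + b \<and> tgt \<le> y \<and> y < tgt + b")
    case True
    then have "i - r * b < b" "y - tgt < b" by auto
    then have "warr s' aX ((r * b + (i - r * b)) * N + (tgt + (y - tgt))) =
      nat_of_bit (x (tgt + (y - tgt)) (r * b + (i - r * b)) + f (i - r * b) (y - tgt))" using 12 by blast
    then show ?thesis using True by simp
  next
    case False
    have "i * N + y \<notin> (\<lambda>(i, l). (r * b + i) * N + (tgt + l)) ` ({..<b} \<times> {..<b})"
    proof
      assume "i * N + y \<in> (\<lambda>(i, l). (r * b + i) * N + (tgt + l)) ` ({..<b} \<times> {..<b})"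
      then obtain i' l where "i' < b" "l < b" "i * N + y = (r * b + i') * N + (tgt + l)" by auto
      moreover have "tgt + l < N" using \<open>l < b\<close> bd by linarith
      ultimately have "i = r * b + i'" "y = tgt + l" using mat_idx_inj[of y N "tgt + l" i "r * b + i'"] that by auto
      then show False using False \<open>i' < b\<close> \<open>l < b\<close> by auto
    qed
    then have "warr s' aX (i * N + y) = warr s aX (i * N + y)" using 12 by blast
    then show ?thesis unfolding if_not_P[OF False] using x that by (simp add: stores_cols_def)
  qed
  then show ?case using 12 by (auto simp: stores_cols_def intro: square_bound[OF _ b])
qed (use ws NW v in auto)

context mult_machine
begin

lemma run_apply_chunk:
  assumes ws: "word_state W s" and NW: "N * N + 10 \<le> W" and b: "1 \<le> b" and kM: "k\<^sub>M * b ^ k\<^sub>M \<le> W"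
    and v: "wvar s vN = N" "wvar s vb = b" "wvar s vsrc = src" "wvar s vtgt = tgt" "wvar s vr = r"
    and bd: "src + b \<le> N" "tgt + b \<le> N" "r * b + b \<le> N"
    and x: "stores_cols N aX x s"
    and y: "\<And>i l. i < b ==> l < b ==> warr s aY (i * b + l) = nat_of_bit (y i l)"
  shows "run W (apply_chunk MM) s (\<lambda>t s'. stores_cols N aX (\<lambda>c i. if r * b \<le> i \<and> i < r * b + b \<and> tgt \<le> c \<and> c < tgt + b
     then x c i + (\<Sum>l<b. x (src + l) i * y l (c - tgt)) else x c i) s' \<and> t \<le> TM b + 400 * (b * b))"
proof -
  let ?f = "\<lambda>i c. \<Sum>l<b. x (src + l) (r * b + i) * y l c"
  let ?s1 = "set_wvar 100 b s"
  have bW: "b \<le> W" using word_stateD(1)[OF ws, of vb] v by simp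
  have ws1: "word_state W ?s1" using ws bW by (auto simp: word_state_def)
  have bN: "b \<le> N" using bd by simp
  have x1: "stores_cols N aX x ?s1" using x by (simp add: stores_cols_def)
  have v1: "wvar ?s1 vN = N" "wvar ?s1 vb = b" "wvar ?s1 vsrc = src" "wvar ?s1 vr = r"
    by (simp_all add: v)
  have xs: "warr ?s1 aX ((r * b + i) * N + (src + c)) = nat_of_bit (x (src + c) (r * b + i))" if "i < b" "c < b" for i c
  proof -
    have "src + c < N" "r * b + i < N" using that bd by linarith+
    then show ?thesis using x by (simp add: stores_cols_def)
  qed
  have main: "run W (load_chunk ;; copy_pivot_rows ;; MM ;; add_chunk) ?s1
     (\<lambda>t s'. stores_cols N aX (\<lambda>c i. if r * b \<le> i \<and> i < r * b + b \<and> tgt \<le> c \<and> c < tgt + b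
        then x c i + ?f (i - r * b) (c - tgt) else x c i) s' \<and> t \<le> TM b + 300 * (b * b))"
  proof (rule run_SeqI[OF run_load_chunk[OF ws1 NW b v1 bd(1,3) xs] ws1], assumption, assumption, goal_cases)
    case (1 t1 s2)
    note fr2 = frameD[OF 1(3)]
    have vb2: "wvar s2 vb = b" by (simp add: fr2 v)
    show ?case
    proof (rule run_SeqI[OF run_copy_pivot_rows[OF 1(2) NW b vb2 bN] 1(2)], goal_cases)
      case A: (1 t2 s3)
      note fr3 = frameD[OF A(3)]
      have v3: "wvar s3 100 = b" by (simp add: fr2 fr3)
      have a3: "warr s3 100 (i * b + j) = nat_of_bit (x (src + j) (r * b + i))" if "i < b" "j < b" for i j
        using 1(1) that by (simp add: fr3)
      have b3: "warr s3 101 (i * b + j) = nat_of_bit (y i j)" if "i < b" "j < b" for i j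
        using A(1) y that by (simp add: fr2)
      show ?case
      proof (rule run_SeqI[OF MM_run[OF b kM A(2) v3 a3 b3] A(2)], assumption, assumption, assumption, assumption, goal_cases)
        case B: (1 t3 s4)
        note fr4 = frameD[OF B(3)]
        have v4: "wvar s4 vN = N" "wvar s4 vb = b" "wvar s4 vtgt = tgt" "wvar s4 vr = r"
          by (simp_all add: fr2 fr3 fr4 v)
        have x4: "stores_cols N aX x s4" using x by (simp add: stores_cols_def fr2 fr3 fr4)
        have z4: "warr s4 102 (i * b + j) = nat_of_bit (?f i j)" if "i < b" "j < b" for i j
          using B(1) that by simp
        show ?case
        proof (rule run_mono[OF run_add_chunk[where f = ?f, OF B(2) NW b v4 bd(2,3) x4 z4]], assumption, assumption, goal_cases)
          case C: (1 t4 s5)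
          then show ?case using 1(1) A(1) B(1) by auto
        qed
      qed
    qed
  qed
  have fin: "2 + (t::nat) \<le> TM b + 400 * (b * b)" if "t \<le> TM b + 300 * (b * b)" for t
  proof -
    have "1 \<le> b * b" using b mult_le_mono[of 1 b 1 b] by simp
    then show ?thesis using that by linarith
  qed
  have "run W (apply_chunk MM) s (\<lambda>t s'. stores_cols N aX (\<lambda>c i. if r * b \<le> i \<and> i < r * b + b \<and> tgt \<le> c \<and> c < tgt + b
        then x c i + ?f (i - r * b) (c - tgt) else x c i) s' \<and> t \<le> TM b + 400 * (b * b))"
    unfolding apply_chunk_def run_Seq[of W "_ ::= _"] run_Assign
    using run_mono[OF main] fin by (simp add: v bW)
  moreover have "(\<lambda>c i. if r * b \<le> i \<and> i < r * b + b \<and> tgt \<le> c \<and> c < tgt + b then x c i + ?f (i - r * b) (c - tgt) else x c i) =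
    (\<lambda>c i. if r * b \<le> i \<and> i < r * b + b \<and> tgt \<le> c \<and> c < tgt + b
     then x c i + (\<Sum>l<b. x (src + l) i * y l (c - tgt)) else x c i)"
    by (auto simp: fun_eq_iff)
  ultimately show ?thesis by simp
qed

lemma run_apply_block:
  assumes ws: "word_state W s" and NW: "N * N + 10 \<le> W" and b: "1 \<le> b" and kM: "k\<^sub>M * b ^ k\<^sub>M \<le> W"
    and v: "wvar s vN = N" "wvar s vb = b" "wvar s vsrc = src" "wvar s vtgt = tgt"
    and bd: "src + b \<le> N" "tgt + b \<le> N" "src + b \<le> tgt \<or> tgt + b \<le> src" "b dvd N"
    and piv: "\<And>l. l < b ==> warr s aPiv (src + l) \<le> N"
    and x: "stores_cols N aX x s"
  shows "run W (apply_block MM) s (\<lambda>t s'. stores_cols N aX (apply_cols (warr s aPiv) b src tgt x) s' \<and>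
    t \<le> (N div b) * (TM b + 600 * (b * b)))"
proof -
  define q where "q = N div b"
  let ?y = "\<lambda>l c. pivot_entry (warr s aPiv) (src + l) (x (tgt + c))"
  let ?x' = "apply_cols (warr s aPiv) b src tgt x"
  have N: "N = q * b" using bd(4) unfolding q_def by simp
  have q1: "1 \<le> q" using bd(1) b N by (cases q) auto
  have NN: "N \<le> N * N" by simp
  have "b \<le> N" using bd by simp
  moreover have "q \<le> N" using N b mult_le_mono2[of 1 b q] by simp
  ultimately have qW: "q \<le> W" "b \<le> W" "N \<le> W" using NW NN by linarith+
  let ?s1 = "set_wvar vchunks q s"
  have ws1: "word_state W ?s1" using ws qW by (auto simp: word_state_def)
  have x1: "stores_cols N aX x ?s1" using x by (simp add: stores_cols_def)
  have v1: "wvar ?s1 vN = N" "wvar ?s1 vb = b" "wvar ?s1 vsrc = src" "wvar ?s1 vtgt = tgt"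
    by (simp_all add: v)
  have piv1: "warr ?s1 aPiv (src + l) \<le> N" if "l < b" for l
    using piv that by simp
  have main: "run W (load_pivot_rows ;; For vr vchunks (apply_chunk MM)) ?s1
      (\<lambda>t s'. stores_cols N aX ?x' s' \<and> t \<le> 7 + 100 * (b * b) + q * (TM b + 400 * (b * b) + 9))"
  proof (rule run_SeqI[OF run_load_pivot_rows[OF ws1 NW b v1 bd(1,2) piv1 x1] ws1], assumption, goal_cases)
    case S: (1 t1 s2)
    note fr2 = frameD[OF S(3)]
    have q2: "wvar s2 vchunks = q" by (simp add: fr2)
    have step: "run W (apply_chunk MM) s3 (\<lambda>t s4.
        stores_cols N aX (\<lambda>c i. if i < Suc r * b then ?x' c i else x c i) (set_wvar vr (Suc r) s4) \<and> t \<le> TM b + 400 * (b * b))"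
      if r: "r < q" and ws3: "word_state W s3" and fr: "frame (For vr vchunks (apply_chunk MM)) s2 s3" and vr: "wvar s3 vr = r"
        and I: "stores_cols N aX (\<lambda>c i. if i < r * b then ?x' c i else x c i) s3" for r s3
    proof -
      note fr3 = frameD[OF fr]
      have "Suc r * b \<le> q * b" using r by (intro mult_le_mono1) simp
      then have rb: "r * b + b \<le> N" using N by simp
      have v3: "wvar s3 vN = N" "wvar s3 vb = b" "wvar s3 vsrc = src" "wvar s3 vtgt = tgt" "wvar s3 vr = r"
        by (simp_all add: fr2 fr3 v vr)
      have y3: "warr s3 aY (i * b + l) = nat_of_bit (?y i l)" if "i < b" "l < b" for i l
        using S(1) that by (simp add: fr3)
      show ?thesis
      proof (rule run_mono[OF run_apply_chunk[OF ws3 NW b kM v3 bd(1,2) rb I y3]], assumption, assumption, goal_cases)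
        case (1 t s4)
        \<comment> \<open>A chunk reads its own rows, which are still the old ones, and the pivot
          rows saved at the beginning.\<close>
        have "(if r * b \<le> i \<and> i < r * b + b \<and> tgt \<le> c \<and> c < tgt + b
            then (if i < r * b then ?x' c i else x c i) +
               (\<Sum>l<b. (if i < r * b then ?x' (src + l) i else x (src + l) i) * ?y l (c - tgt))
            else if i < r * b then ?x' c i else x c i) = (if i < Suc r * b then ?x' c i else x c i)" for c i
          by (auto simp: apply_cols_def)
        then show ?case using 1 by (simp add: stores_cols_def)
      qed
    qed
    show ?case
    proof (rule run_For[where I = "\<lambda>r s'. stores_cols N aX (\<lambda>c i. if i < r * b then ?x' c i else x c i) s'"
          and T = "\<lambda>_. TM b + 400 * (b * b)"])
      show "word_state W s2" by fact
      show "1 \<le> W" using qW b by linarith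
      show "stores_cols N aX (\<lambda>c i. if i < 0 * b then ?x' c i else x c i) (set_wvar vr 0 s2)"
        using x by (simp add: fr2 stores_cols_def)
    next
      fix t s3 assume "stores_cols N aX (\<lambda>c i. if i < wvar s2 vchunks * b then ?x' c i else x c i) s3"
        and t: "t \<le> 7 + (\<Sum>i<wvar s2 vchunks. TM b + 400 * (b * b) + 9)"
      then have "stores_cols N aX ?x' s3" using N unfolding q2 stores_cols_def by simp
      then show "stores_cols N aX ?x' s3 \<and> t1 + t \<le> 7 + 100 * (b * b) + q * (TM b + 400 * (b * b) + 9)"
        using t S(1) unfolding q2 by (auto simp: algebra_simps)
    qed (use q2 step in simp_all)
  qed
  have fin: "4 + (t::nat) \<le> q * (TM b + 600 * (b * b))"
    if "t \<le> 7 + 100 * (b * b) + q * (TM b + 400 * (b * b) + 9)" for t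
  proof -
    have b2: "1 \<le> b * b" using b mult_le_mono[of 1 b 1 b] by simp
    then have "11 + 100 * (b * b) \<le> 1 * (120 * (b * b))" by linarith
    also have "\<dots> \<le> q * (120 * (b * b))" using q1 by (intro mult_le_mono1)
    finally have "4 + t \<le> q * (120 * (b * b)) + q * (TM b + 400 * (b * b) + 9)" using that by linarith
    also have "\<dots> = q * (TM b + 520 * (b * b) + 9)" by (simp add: algebra_simps)
    also have "\<dots> \<le> q * (TM b + 600 * (b * b))" using b2 by (intro mult_le_mono2) linarith
    finally show ?thesis .
  qed
  show ?thesis
    unfolding apply_block_def run_Seq[of W "_ ::= _"] run_Assign
    using run_mono[OF main] fin by (simp add: v qW q_def[symmetric])
qed

end

subsection \<open>The invariant of lazy elimination\<close>

text \<open>Columns of a finished block no longer hold the matrix: they are overwritten by the row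
  operations to which their elimination gave rise.\<close>

definition block_ok :: "(nat => nat) => (nat => nat => bit) => nat => nat => nat => (nat => nat => bit) => bool" where
  "block_ok piv M N a d x \<longleftrightarrow> (\<forall>y\<in>{a..<a + d}. piv y \<noteq> 0 --> (\<forall>i<N. x y i = block_col piv M a d y i))"

text \<open>State of the sibling, at level \<open>k\<close> of the binary recursion on columns, of the block that
  contains the current column \<open>c\<close>.\<close>

definition sibling_ok :: "(nat => nat) => (nat => nat => bit) => nat => nat => (nat => nat => bit) => nat => bool" where
  "sibling_ok piv M N c x k \<longleftrightarrow> (let a = 2 * 2 ^ k * (c div (2 * 2 ^ k)) in
     if odd (c div 2 ^ k) then block_ok piv M N a (2 ^ k) x
     else \<forall>y\<in>{a + 2 ^ k..<a + 2 * 2 ^ k}. \<forall>i<N. x y i = gj piv M a (M y) i)"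

lemma sum_shift_lessThan: "(\<Sum>l<d. f (a + l)) = sum f {a..<a + (d :: nat)}"
  by (induction d) auto

text \<open>The stored columns are the matrix of \<open>gj_from_expand\<close>, and the pivot
  entries of the target column are the coefficients.\<close>

lemma apply_cols_gj_from:
  assumes piv: "pivoting piv M N (a + d)" and ok: "block_ok piv M N a d x"
    and z: "\<And>i. i < N ==> x t i = z i" and t: "tgt \<le> t" "t < tgt + d" and i: "i < N"
  shows "apply_cols piv d a tgt x t i = gj_from piv M a d z i"
proof -
  have "(\<Sum>l<d. x (a + l) i * pivot_entry piv (a + l) (x t)) =
      (\<Sum>y\<in>{a..<a + d}. x y i * pivot_entry piv y (x t))"
    by (rule sum_shift_lessThan)
  also have "\<dots> = (\<Sum>y\<in>{a..<a + d}. if piv y = 0 then 0 else block_col piv M a d y i * z (piv y - 1))"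
  proof (rule sum.cong)
    fix y assume y: "y \<in> {a..<a + d}"
    have "piv y \<noteq> 0 ==> piv y - 1 < N" using piv y by (auto simp: pivoting_def)
    then show "x y i * pivot_entry piv y (x t) = (if piv y = 0 then 0 else block_col piv M a d y i * z (piv y - 1))"
      using ok y i z by (simp add: pivot_entry_def block_ok_def)
  qed simp
  moreover have "gj_from piv M a d z i =
    z i + (\<Sum>y\<in>{a..<a + d}. if piv y = 0 then 0 else block_col piv M a d y i * z (piv y - 1))"
    by (rule gj_from_expand, rule pivoting_distinct[OF piv]) auto
  ultimately show ?thesis using t z[OF i] by (simp add: apply_cols_def)
qed

lemma apply_cols_outside: "\<not> (tgt \<le> y \<and> y < tgt + d) ==> apply_cols piv d src tgt x y = x y"
  by (auto simp: apply_cols_def)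

text \<open>Two neighbouring blocks are merged by applying the right one to the columns of the left
  one, see \<open>block_col_left\<close>; by \<open>block_col_right\<close> nothing else has to
  change.\<close>

lemma block_ok_combine:
  assumes piv: "pivoting piv M N (a + d + d)" and ok: "block_ok piv M N a d x" "block_ok piv M N (a + d) d x"
  shows "block_ok piv M N a (d + d) (apply_cols piv d (a + d) a x)"
  unfolding block_ok_def
proof (intro ballI impI allI)
  fix y i assume y: "y \<in> {a..<a + (d + d)}" "piv y \<noteq> 0" and i: "i < N"
  show "apply_cols piv d (a + d) a x y i = block_col piv M a (d + d) y i"
  proof (cases "y < a + d")
    case True
    have "apply_cols piv d (a + d) a x y i = gj_from piv M (a + d) d (block_col piv M a d y) i"
      by (rule apply_cols_gj_from[OF piv ok(2)]) (use ok(1) y True i in \<open>auto simp: block_ok_def\<close>)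
    then show ?thesis using block_col_left[OF piv, of y] y True by simp
  next
    case False
    then have "apply_cols piv d (a + d) a x y = x y" by (intro apply_cols_outside) auto
    then show ?thesis using block_col_right[OF piv, of y] ok(2) y False i by (simp add: block_ok_def)
  qed
qed

text \<open>A multiple of \<open>B\<close> never lies strictly inside the aligned block of length
  \<open>B\<close> that contains \<open>j\<close>.\<close>

lemma multiple_le_iff:
  fixes B :: nat
  assumes "B dvd m" "0 < B"
  shows "m \<le> j \<longleftrightarrow> m \<le> B * (j div B)" "j < m \<longleftrightarrow> B * (j div B) + B \<le> m"
proof -
  obtain q where q: "m = B * q" using assms by blast
  have "m \<le> j \<longleftrightarrow> q \<le> j div B" using q assms by (simp add: less_eq_div_iff_mult_less_eq mult.commute)
  then show 1: "m \<le> j \<longleftrightarrow> m \<le> B * (j div B)" using q assms by simp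
  have "j < m \<longleftrightarrow> j div B < q" using q assms by (simp add: div_less_iff_less_mult mult.commute)
  also have "\<dots> \<longleftrightarrow> j div B + 1 \<le> q" by linarith
  also have "\<dots> \<longleftrightarrow> B * (j div B + 1) \<le> m" unfolding q using assms by simp
  finally show "j < m \<longleftrightarrow> B * (j div B) + B \<le> m" by (simp add: algebra_simps)
qed

lemma div_mult_bounds: "b * (c div b) \<le> c" "0 < b ==> c < b * (c div b) + (b :: nat)"
  using mult_div_mod_eq[of b c] mod_less_divisor[of b c] by linarith+

text \<open>Here \<open>a\<close> is the start of the aligned block of length
  \<open>2 * 2 ^ k\<close> that contains \<open>c\<close>, and the parity of
  \<open>c div 2 ^ k\<close> tells in which half of it \<open>c\<close> lies.\<close>

lemma half_multiple:
  fixes k c :: nat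
  defines "a \<equiv> 2 * 2 ^ k * (c div (2 * 2 ^ k))"
  shows "odd (c div 2 ^ k) ==> a + 2 ^ k \<le> c" "even (c div 2 ^ k) ==> c < a + 2 ^ k" "a \<le> c" "c < a + 2 * 2 ^ k"
    "2 ^ k dvd a"
proof -
  let ?p = "2 ^ k :: nat"
  define q where "q = c div ?p"
  have q2: "c div (2 * ?p) = q div 2" unfolding q_def by (metis div_mult2_eq mult.commute)
  have c: "?p * q \<le> c" "c < ?p * q + ?p" unfolding q_def
    by (intro div_mult_bounds; simp)+
  have a: "a = ?p * (2 * (q div 2))" unfolding a_def q2 by simp
  show "a + ?p \<le> c" if "odd (c div ?p)"
  proof -
    have "2 * (q div 2) + 1 = q" using that odd_two_times_div_two_succ unfolding q_def by blast
    then have "a + ?p = ?p * q" unfolding a by (metis Suc_eq_plus1 add.commute mult_Suc_right)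
    then show ?thesis using c by simp
  qed
  show "c < a + ?p" if "even (c div ?p)" using that c unfolding a q_def by simp
  show "a \<le> c" unfolding a_def by simp
  show "c < a + 2 * ?p" unfolding a_def by (intro div_mult_bounds) simp
  show "?p dvd a" unfolding a by simp
qed

text \<open>The sibling at level \<open>k\<close> is disjoint from the smaller aligned block around
  \<open>j\<close>, so work inside that block and pivots from \<open>j\<close> on do not affect
  it.\<close>

lemma sibling_ok_cong:
  assumes ok: "sibling_ok piv M N j x k" and B: "B dvd 2 ^ k"
    and x: "\<And>y. \<not> (B * (j div B) \<le> y \<and> y < B * (j div B) + B) ==> x' y = x y"
    and piv: "\<And>i. i < j ==> piv' i = piv i"
  shows "sibling_ok piv' M N j x' k"
proof -
  define a where "a = 2 * 2 ^ k * (j div (2 * 2 ^ k))"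
  have B0: "0 < B" using B by (auto intro: Nat.gr0I)
  note h = half_multiple[where c = j and k = k, folded a_def]
  have dv: "B dvd a" "B dvd a + 2 ^ k" using B h(5) dvd_trans by (auto intro!: dvd_add)
  show ?thesis
  proof (cases "odd (j div 2 ^ k)")
    case True
    have le: "a + 2 ^ k \<le> j" "a + 2 ^ k \<le> B * (j div B)"
      using h(1)[OF True] multiple_le_iff(1)[OF dv(2) B0] by auto
    have "block_col piv' M a (2 ^ k) y = block_col piv M a (2 ^ k) y" if "y \<in> {a..<a + 2 ^ k}" for y
      by (rule block_col_cong) (use piv le that in auto)
    moreover have "x' y = x y" if "y \<in> {a..<a + 2 ^ k}" for y using x le that by auto
    moreover have "piv' y = piv y" if "y \<in> {a..<a + 2 ^ k}" for y using piv le that by auto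
    ultimately have "block_ok piv' M N a (2 ^ k) x' = block_ok piv M N a (2 ^ k) x"
      unfolding block_ok_def by auto
    then show ?thesis using ok True unfolding sibling_ok_def Let_def a_def by simp
  next
    case False
    have le: "B * (j div B) + B \<le> a + 2 ^ k"
      using h(2) False multiple_le_iff(2)[OF dv(2) B0] by auto
    have g: "gj piv' M a = gj piv M a" by (rule gj_cong) (use piv h(3) in auto)
    have xx: "x' y = x y" if "y \<in> {a + 2 ^ k..<a + 2 * 2 ^ k}" for y using x le that by auto
    have "\<forall>y\<in>{a + 2 ^ k..<a + 2 * 2 ^ k}. \<forall>i<N. x y i = gj piv M a (M y) i"
      using ok False unfolding sibling_ok_def Let_def a_def by simp
    then have "\<forall>y\<in>{a + 2 ^ k..<a + 2 * 2 ^ k}. \<forall>i<N. x' y i = gj piv' M a (M y) i" using g xx by simp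
    then show ?thesis using False unfolding sibling_ok_def Let_def a_def by simp
  qed
qed

lemma sibling_ok_0: "(\<And>y i. y < N ==> i < N ==> x y i = M y i) ==> 2 ^ k < (N::nat) ==> 2 * 2 ^ k \<le> N ==> sibling_ok piv M N 0 x k"
  by (auto simp: sibling_ok_def)

text \<open>The state between two columns: column \<open>j\<close> is finished and the block of
  length \<open>2 ^ k\<close> ending with it has been merged, while the levels from \<open>k\<close>
  on are as they were.\<close>

definition level_ok :: "(nat => nat) => (nat => nat => bit) => nat => nat => nat => (nat => nat => bit) => nat => bool" where
  "level_ok piv M N L j x k \<longleftrightarrow> k \<le> L \<and> 2 ^ k dvd j + 1 \<and> block_ok piv M N (j + 1 - 2 ^ k) (2 ^ k) x \<and>
     (\<forall>k'. k \<le> k' \<and> k' < L --> sibling_ok piv M N j x k')"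

text \<open>The state at the start of column \<open>c\<close>. Only this column is guaranteed to be
  fully reduced; the right siblings lag behind by the operations of the left half in
  progress.\<close>

definition lazy_ok :: "(nat => nat) => (nat => nat => bit) => nat => nat => nat => (nat => nat => bit) => bool" where
  "lazy_ok piv M N L c x \<longleftrightarrow> (if c < N then (\<forall>i<N. x c i = gj piv M c (M c) i) \<and> (\<forall>k<L. sibling_ok piv M N c x k)
     else block_ok piv M N 0 N x)"

lemma lazy_ok_0:
  assumes "\<And>y i. y < N ==> i < N ==> x y i = M y i" "N = 2 ^ L"
  shows "lazy_ok piv M N L 0 x"
proof -
  have "sibling_ok piv M N 0 x k" if "k < L" for k
  proof (rule sibling_ok_0[OF assms(1)])
    have "2 ^ Suc k \<le> (2::nat) ^ L" using that by (intro power_increasing) auto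
    then show "2 * 2 ^ k \<le> N" using assms(2) by simp
    show "2 ^ k < N" using that assms(2) by simp
  qed
  then show ?thesis using assms by (simp add: lazy_ok_def)
qed

lemma dvd_Suc_witness: "p dvd j + (1::nat) ==> \<exists>q. j + 1 = p * (q + 1)"
proof -
  assume "p dvd j + 1"
  then obtain q where "j + 1 = p * q" by blast
  then show ?thesis by (intro exI[of _ "q - 1"]) (cases q; simp add: algebra_simps)
qed

text \<open>The block of length \<open>2 ^ k\<close> that ends with \<open>j\<close> is a right
  half, so the block of twice the length ends with \<open>j\<close> too.\<close>

lemma level_odd:
  assumes "2 ^ k dvd j + (1::nat)" "odd (j div 2 ^ k)"
  shows "2 * 2 ^ k dvd j + 1" "2 * 2 ^ k * (j div (2 * 2 ^ k)) = j + 1 - 2 * 2 ^ k" "2 * 2 ^ k \<le> j + 1"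
proof -
  let ?p = "2 ^ k :: nat"
  obtain q where q: "j + 1 = ?p * (q + 1)" using assms(1) dvd_Suc_witness by blast
  have jq: "q * ?p + ?p = j + 1" "0 < ?p" using q by (simp_all add: algebra_simps)
  then have "j div ?p = q" by (intro div_nat_eqI) (unfold mult_Suc_right mult.commute[of ?p], linarith+)
  then obtain m where m: "q = 2 * m + 1" using assms(2) by (auto elim!: oddE)
  have j1: "j + 1 = 2 * ?p * (m + 1)" using q m by (simp add: algebra_simps)
  then show "2 * ?p dvd j + 1" by simp
  have "j div (2 * ?p) = q div 2" using \<open>j div ?p = q\<close> by (metis div_mult2_eq mult.commute)
  then have "j div (2 * ?p) = m" using m by simp
  then show "2 * ?p * (j div (2 * ?p)) = j + 1 - 2 * ?p" using j1 by (simp add: algebra_simps)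
  show "2 * ?p \<le> j + 1" using j1 by simp
qed

lemma even_div_pow: "2 * 2 ^ k dvd m ==> even (m div (2 ^ k :: nat))"
  by (auto simp: dvd_def mult.assoc)

text \<open>The block that ends with \<open>j\<close> is a left half, and \<open>j + 1\<close> is
  the first column of the right half belonging to it.\<close>

lemma level_even:
  assumes "2 ^ k dvd j + (1::nat)" "even (j div 2 ^ k)"
  shows "2 * 2 ^ k * (j div (2 * 2 ^ k)) + 2 ^ k = j + 1" "(j + 1) div (2 * 2 ^ k) = j div (2 * 2 ^ k)" "odd ((j + 1) div 2 ^ k)"
proof -
  let ?p = "2 ^ k :: nat"
  obtain q where q: "j + 1 = ?p * (q + 1)" using assms(1) dvd_Suc_witness by blast
  have jq: "q * ?p + ?p = j + 1" "0 < ?p" using q by (simp_all add: algebra_simps)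
  then have qq: "j div ?p = q" by (intro div_nat_eqI) (unfold mult_Suc_right mult.commute[of ?p], linarith+)
  then obtain m where m: "q = 2 * m" using assms(2) by auto
  have "j div (2 * ?p) = q div 2" using qq by (metis div_mult2_eq mult.commute)
  then have d: "j div (2 * ?p) = m" using m by simp
  show 1: "2 * ?p * (j div (2 * ?p)) + ?p = j + 1" unfolding d using q m by (simp add: algebra_simps)
  have q1: "(j + 1) div ?p = q + 1" unfolding q by simp
  then show "odd ((j + 1) div ?p)" using m by simp
  have "(j + 1) div (2 * ?p) = (q + 1) div 2" using q1 by (metis div_mult2_eq mult.commute)
  then show "(j + 1) div (2 * ?p) = j div (2 * ?p)" using d m by simp
qed

text \<open>A carry of the binary counter: the finished right half is applied to its left sibling,
  whose operations have been kept since its own completion.\<close>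

lemma level_combine:
  assumes lv: "level_ok piv M N L j x k" and odd: "odd (j div 2 ^ k)" and j: "j < N" "N = 2 ^ L"
    and piv: "pivoting piv M N (j + 1)"
  shows "k < L" "level_ok piv M N L j (apply_cols piv (2 ^ k) (j + 1 - 2 ^ k) (j + 1 - 2 * 2 ^ k) x) (Suc k)"
proof -
  let ?p = "2 ^ k :: nat"
  note l = lv[unfolded level_ok_def]
  have dvd: "?p dvd j + 1" using l by blast
  note o = level_odd[OF dvd odd]
  have "2 * ?p \<le> 2 ^ L" using o(3) j by simp
  then have "(2::nat) ^ Suc k \<le> 2 ^ L" by simp
  then show k: "k < L" using power_le_imp_le_exp[of 2 "Suc k" L] by (simp add: Suc_le_eq)
  define a where "a = j + 1 - 2 * ?p"
  have aj: "j + 1 = a + ?p + ?p" "j + 1 - ?p = a + ?p" unfolding a_def using o(3) by auto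
  have sib: "sibling_ok piv M N j x k" using l k by blast
  have ok1: "block_ok piv M N a ?p x" using sib odd o(2) unfolding sibling_ok_def Let_def a_def by simp
  have ok2: "block_ok piv M N (a + ?p) ?p x" using l aj by simp
  have "block_ok piv M N a (?p + ?p) (apply_cols piv ?p (a + ?p) a x)"
    by (rule block_ok_combine[OF _ ok1 ok2]) (use piv aj in simp)
  moreover have "sibling_ok piv M N j (apply_cols piv ?p (a + ?p) a x) k'" if "Suc k \<le> k'" "k' < L" for k'
  proof (rule sibling_ok_cong[where B = "2 * ?p"])
    show "sibling_ok piv M N j x k'" using l that by simp
    show "2 * ?p dvd 2 ^ k'" using that(1) by (metis le_imp_power_dvd power_Suc)
    fix y assume "\<not> (2 * ?p * (j div (2 * ?p)) \<le> y \<and> y < 2 * ?p * (j div (2 * ?p)) + 2 * ?p)"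
    then show "apply_cols piv ?p (a + ?p) a x y = x y"
      by (intro apply_cols_outside) (use o(2) a_def in auto)
  qed simp
  ultimately show "level_ok piv M N L j (apply_cols piv ?p (j + 1 - ?p) (j + 1 - 2 * ?p) x) (Suc k)"
    using k o(1) unfolding level_ok_def aj(2) a_def[symmetric] power_Suc by (auto simp: mult_2)
qed

text \<open>Once the finished block is a left half, it is applied to the whole right half. This
  makes \<open>j + 1\<close> current and prepares all levels inside that half.\<close>

lemma level_update:
  assumes lv: "level_ok piv M N L j x k" and even: "even (j div 2 ^ k)" and j: "j + 1 < N" "N = 2 ^ L"
    and piv: "pivoting piv M N (j + 1)"
  shows "k < L" "j + 1 + 2 ^ k \<le> N" "lazy_ok piv M N L (j + 1) (apply_cols piv (2 ^ k) (j + 1 - 2 ^ k) (j + 1) x)"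
proof -
  let ?p = "2 ^ k :: nat"
  note l = lv[unfolded level_ok_def]
  have dvd: "?p dvd j + 1" using l by blast
  note e = level_even[OF dvd even]
  define a where "a = 2 * ?p * (j div (2 * ?p))"
  have aj: "a + ?p = j + 1" "j + 1 - ?p = a" using e(1) unfolding a_def by auto
  show k: "k < L"
  proof (rule ccontr)
    assume "\<not> k < L"
    then have "k = L" using l by simp
    then show False using dvd j dvd_imp_le[of ?p "j + 1"] by simp
  qed
  have dN: "2 * ?p dvd N" using k j(2) by (metis Suc_leI le_imp_power_dvd power_Suc)
  have "a + 2 * ?p \<le> N"
    using multiple_le_iff(2)[OF dN, of j] j(1) unfolding a_def by simp
  then show le: "j + 1 + ?p \<le> N" using aj by simp
  have sib: "sibling_ok piv M N j x k" using l k by blast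
  then have xs: "x y i = gj piv M a (M y) i" if "y \<in> {a + ?p..<a + 2 * ?p}" "i < N" for y i
    using even that unfolding sibling_ok_def Let_def a_def by simp
  have ok: "block_ok piv M N a ?p x" using l aj by simp
  let ?x = "apply_cols piv ?p a (j + 1) x"
  \<comment> \<open>The right half had received the operations before \<open>a\<close>; those of
    \<open>a, \<dots>, j\<close> are now added.\<close>
  have new: "?x y i = gj piv M (j + 1) (M y) i" if "j + 1 \<le> y" "y < j + 1 + ?p" "i < N" for y i
  proof -
    have "?x y i = gj_from piv M a ?p (gj piv M a (M y)) i"
      by (rule apply_cols_gj_from[OF _ ok]) (use piv aj xs that in auto)
    then show ?thesis using gj_add[of piv M a ?p "M y"] aj by simp
  qed
  have "sibling_ok piv M N (j + 1) ?x k'" if k': "k' < L" for k'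
  proof -
    consider "k' < k" | "k' = k" | "k < k'" by linarith
    then show ?thesis
    proof cases
      case 1
      \<comment> \<open>Below level \<open>k\<close>, the column \<open>j + 1\<close> begins an
        aligned block, and its right siblings lie among the columns just updated.\<close>
      have d2: "2 * 2 ^ k' dvd j + 1" using 1 dvd by (metis Suc_leI dvd_trans le_imp_power_dvd power_Suc)
      have le2: "2 * 2 ^ k' \<le> ?p" using 1 by (metis Suc_leI power_Suc power_increasing one_le_numeral)
      have a': "2 * 2 ^ k' * ((j + 1) div (2 * 2 ^ k')) = j + 1" using d2 by simp
      have "even ((j + 1) div 2 ^ k')" using d2 by (rule even_div_pow)
      moreover have "?x y i = gj piv M (j + 1) (M y) i" if "y \<in> {j + 1 + 2 ^ k'..<j + 1 + 2 * 2 ^ k'}" "i < N" for y i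
        by (rule new) (use that le2 in auto)
      ultimately show ?thesis unfolding sibling_ok_def Let_def a' by simp
    next
      case 2
      \<comment> \<open>At level \<open>k\<close>, the block just applied becomes the left sibling
        of \<open>j + 1\<close>.\<close>
      have "block_ok piv M N a ?p ?x"
        using ok aj apply_cols_outside[of "j + 1" _ ?p piv a x] unfolding block_ok_def by auto
      then show ?thesis using e unfolding sibling_ok_def Let_def 2 a_def by simp
    next
      case 3
      \<comment> \<open>Above level \<open>k\<close>, the columns \<open>j\<close> and
        \<open>j + 1\<close> lie in the same blocks, so the siblings do not change.\<close>
      have "sibling_ok piv M N j ?x k'"
      proof (rule sibling_ok_cong[where B = "2 * ?p"])
        show "sibling_ok piv M N j x k'" using l 3 k' by simp
        show "2 * ?p dvd 2 ^ k'" using 3 by (metis Suc_leI le_imp_power_dvd power_Suc)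
        fix y assume "\<not> (2 * ?p * (j div (2 * ?p)) \<le> y \<and> y < 2 * ?p * (j div (2 * ?p)) + 2 * ?p)"
        then show "?x y = x y"
          by (intro apply_cols_outside) (use aj a_def in auto)
      qed simp
      moreover have "(j + 1) div (2 ^ k'') = j div 2 ^ k''" if "k < k''" for k''
      proof -
        have "(2::nat) ^ k'' = 2 * ?p * 2 ^ (k'' - Suc k)"
          using that by (metis Suc_leI le_add_diff_inverse power_Suc power_add)
        then show ?thesis using e(2) by (metis div_mult2_eq)
      qed
      from this[of k'] this[of "Suc k'"] 3 have "(j + 1) div (2 ^ k') = j div 2 ^ k'" "(j + 1) div (2 * 2 ^ k') = j div (2 * 2 ^ k')"
        by auto
      ultimately show ?thesis unfolding sibling_ok_def by simp
    qed
  qed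
  then show "lazy_ok piv M N L (j + 1) (apply_cols piv ?p (j + 1 - ?p) (j + 1) x)"
    using new[of "j + 1"] j aj by (auto simp: lazy_ok_def)
qed

text \<open>A left half below the top level would have a right half still to come, which is
  impossible after the last column.\<close>

lemma level_final:
  assumes lv: "level_ok piv M N L j x k" and even: "even (j div 2 ^ k)" and j: "j + 1 = N" "N = 2 ^ L"
  shows "lazy_ok piv M N L (j + 1) x"
proof -
  note l = lv[unfolded level_ok_def]
  have "k = L"
  proof (rule ccontr)
    assume "k \<noteq> L"
    then have "2 * 2 ^ k dvd j + 1" using l j by (metis Suc_leI le_imp_power_dvd le_neq_implies_less power_Suc)
    moreover have "odd ((j + 1) div 2 ^ k)" using level_even(3)[OF _ even] l by blast
    ultimately show False using even_div_pow by blast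
  qed
  then have "block_ok piv M N 0 N x" using l j by simp
  then show ?thesis using j by (simp add: lazy_ok_def)
qed

subsection \<open>The program and its running time\<close>

text \<open>Every eligible row is as good as any other, so the scan simply keeps the last one it
  meets.\<close>

definition find_pivot :: com where
  "find_pivot = (vp ::= Const 0) ;;
     For vi vN (Cond (Conj (Leq (Load aUsed (Var vi)) (Const 0)) (Leq (Const 1) (Load aX (cell_exp vi vN vj))))
       (vp ::= Var vi +. Const 1) Skip)"

text \<open>Clearing the pivot entry turns the current column into \<open>gj_col\<close>, which is
  the stored form of a block of length one.\<close>

definition use_pivot :: com where
  "use_pivot = Cond (Leq (Const 1) (Var vp))
       (Store aUsed (Var vp -. Const 1) (Var vj +. Const 1) ;;
        Store aX ((Var vp -. Const 1) *. Var vN +. Var vj) (Const 0)) Skip ;;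
     Store aPiv (Var vj) (Var vp)"

text \<open>The loop is the carry propagation in the increment of a binary counter: it runs through
  the trailing ones of \<open>j\<close>.\<close>

definition combine_blocks :: "com => com" where
  "combine_blocks MM = (vb ::= Const 1) ;;
     While (Leq (Const 1) ((Var vj div. Var vb) mod. Const 2))
       ((vsrc ::= (Var vj +. Const 1) -. Var vb) ;;
        (vtgt ::= (Var vj +. Const 1) -. (Var vb +. Var vb)) ;;
        apply_block MM ;;
        (vb ::= Var vb +. Var vb))"

definition update_next :: "com => com" where
  "update_next MM = Cond (Leq (Var vj +. Const 2) (Var vN))
     ((vsrc ::= (Var vj +. Const 1) -. Var vb) ;;
      (vtgt ::= Var vj +. Const 1) ;;
      apply_block MM) Skip"

definition eliminate :: "com => com" where
  "eliminate MM = For vi vN (Store aUsed (Var vi) (Const 0)) ;;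
     For vj vN (find_pivot ;; use_pivot ;; combine_blocks MM ;; update_next MM)"

lemma eliminate_names [simp]:
  "wvars_of find_pivot = {vp, vi}" "warrs_of find_pivot = {}" "rvars_of find_pivot = {}" "rarrs_of find_pivot = {}"
  "wvars_of use_pivot = {}" "warrs_of use_pivot = {aUsed, aX, aPiv}" "rvars_of use_pivot = {}" "rarrs_of use_pivot = {}"
  "wvars_of (combine_blocks MM) = {vb, vsrc, vtgt, 100, vi, vl, vr, vchunks} \<union> wvars_of MM"
  "warrs_of (combine_blocks MM) = {100, 101, aX, aY} \<union> warrs_of MM"
  "rvars_of (combine_blocks MM) = rvars_of MM" "rarrs_of (combine_blocks MM) = rarrs_of MM"
  "wvars_of (update_next MM) = {vsrc, vtgt, 100, vi, vl, vr, vchunks} \<union> wvars_of MM"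
  "warrs_of (update_next MM) = {100, 101, aX, aY} \<union> warrs_of MM"
  "rvars_of (update_next MM) = rvars_of MM" "rarrs_of (update_next MM) = rarrs_of MM"
  "wvars_of (eliminate MM) = {vp, vj, vb, vsrc, vtgt, 100, vi, vl, vr, vchunks} \<union> wvars_of MM"
  "warrs_of (eliminate MM) = {aUsed, aPiv, 100, 101, aX, aY} \<union> warrs_of MM"
  "rvars_of (eliminate MM) = rvars_of MM" "rarrs_of (eliminate MM) = rarrs_of MM"
  by (auto simp: find_pivot_def use_pivot_def combine_blocks_def update_next_def eliminate_def)

section \<open>Elimination of a single column on the machine\<close>

lemma run_find_pivot:
  assumes ws: "word_state W s" and NW: "N * N + 10 \<le> W" and v: "wvar s vN = N" "wvar s vj = j" "j < N"
  shows "run W find_pivot s (\<lambda>t s'. t \<le> 40 * N + 20 \<and>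
    (if wvar s' vp = 0 then \<forall>i<N. warr s aUsed i = 0 --> warr s aX (i * N + j) = 0
     else wvar s' vp - 1 < N \<and> warr s aUsed (wvar s' vp - 1) = 0 \<and> warr s aX ((wvar s' vp - 1) * N + j) \<noteq> 0))"
proof -
  let ?I = "\<lambda>n s'. if wvar s' vp = 0 then \<forall>i<n. warr s aUsed i = 0 --> warr s aX (i * N + j) = 0
     else wvar s' vp - 1 < N \<and> warr s aUsed (wvar s' vp - 1) = 0 \<and> warr s aX ((wvar s' vp - 1) * N + j) \<noteq> 0"
  let ?s1 = "set_wvar vp 0 s"
  let ?B = "Cond (Conj (Leq (Load aUsed (Var vi)) (Const 0)) (Leq (Const 1) (Load aX (cell_exp vi vN vj))))
       (vp ::= Var vi +. Const 1) Skip"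
  have main: "run W (For vi vN ?B) ?s1 (\<lambda>t s'. t \<le> 40 * N + 10 \<and> ?I N s')"
  proof (rule run_For[where I = ?I and T = "\<lambda>_. 30"])
    show "word_state W ?s1" using ws by (auto simp: word_state_def)
    show "1 \<le> W" using NW by simp
  next
    fix i s' assume i: "i < wvar ?s1 vN" and ws': "word_state W s'" and fr: "frame (For vi vN ?B) ?s1 s'" and vi: "wvar s' vi = i" and I: "?I i s'"
    note fr' = frameD[OF fr]
    have iN: "i < N" using i v by simp
    note w = mat_words[OF iN v(3) NW]
    have iW: "i + 1 \<le> W" using iN w by linarith
    have aW: "warr s aUsed i \<le> W" "warr s aX (i * N + j) \<le> W" using word_stateD(2)[OF ws] by auto
    show "run W ?B s' (\<lambda>t s''. ?I (Suc i) (set_wvar vi (Suc i) s'') \<and> t \<le> 30)"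
      using iN w iW aW I by (simp add: run_simps fr' v vi less_Suc_eq)
  qed (use v in auto)
  show ?thesis unfolding find_pivot_def
    by (rule run_Assign_Seq[where v = 0]; (rule run_mono[OF main])?) auto
qed

lemma run_use_pivot:
  assumes ws: "word_state W s" and NW: "N * N + 10 \<le> W" and v: "wvar s vN = N" "wvar s vj = j" "j < N" "wvar s vp = p" "p \<le> N"
  shows "run W use_pivot s (\<lambda>t s'. t \<le> 40 \<and> warr s' aPiv = (warr s aPiv)(j := p) \<and>
    warr s' aUsed = (if p = 0 then warr s aUsed else (warr s aUsed)(p - 1 := j + 1)) \<and>
    warr s' aX = (if p = 0 then warr s aX else (warr s aX)((p - 1) * N + j := 0)))"
proof (cases "p = 0")
  case True
  have "j \<le> W" using mat_words[OF v(3) v(3) NW] by simp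
  then show ?thesis using v NW True by (simp add: use_pivot_def run_simps)
next
  case False
  then have "p - 1 < N" using v by simp
  note w = mat_words[OF this v(3) NW]
  have "p \<le> W" "j + 1 \<le> W" using w v by linarith+
  then show ?thesis using v NW False w by (simp add: use_pivot_def run_simps)
qed

context mult_machine
begin

definition apply_time :: "nat => nat => nat" where
  "apply_time N b = (N div b) * (TM b + 600 * (b * b))"

text \<open>A block of length \<open>2 ^ k\<close> can end with column \<open>j\<close> only if
  \<open>2 ^ k\<close> divides \<open>j + 1\<close>. Each such level is charged one block product,
  be it a merge or the final update.\<close>

definition column_time :: "nat => nat => nat => nat" where
  "column_time N L j = 40 * N + 200 + (\<Sum>k\<in>{k. k \<le> L \<and> 2 ^ k dvd j + 1}. apply_time N (2 ^ k) + 60)"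

text \<open>The level at which merging stops has not been paid out of the sum yet. Its share, on the
  left of the inequality, is left over for \<open>update_next\<close>.\<close>

lemma run_combine_blocks:
  assumes ws: "word_state W s" and NW: "N * N + 10 \<le> W" and kM: "k\<^sub>M * N ^ k\<^sub>M \<le> W"
    and v: "wvar s vN = N" "wvar s vj = j" "j < N" "N = 2 ^ L"
    and piv: "pivoting (warr s aPiv) M N (j + 1)"
    and x: "stores_cols N aX x s" "level_ok (warr s aPiv) M N L j x 0"
  shows "run W (combine_blocks MM) s (\<lambda>t s'. \<exists>k x. wvar s' vb = 2 ^ k \<and> stores_cols N aX x s' \<and>
      level_ok (warr s aPiv) M N L j x k \<and> even (j div 2 ^ k) \<and>
      t + apply_time N (2 ^ k) + 60 \<le> 20 + (\<Sum>k\<in>{k. k \<le> L \<and> 2 ^ k dvd j + 1}. apply_time N (2 ^ k) + 60))"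
proof -
  let ?piv = "warr s aPiv" and ?s1 = "set_wvar vb 1 s"
  let ?b = "Leq (Const 1) ((Var vj div. Var vb) mod. Const 2)"
  let ?B = "(vsrc ::= (Var vj +. Const 1) -. Var vb) ;;
        (vtgt ::= (Var vj +. Const 1) -. (Var vb +. Var vb)) ;;
        apply_block MM ;; (vb ::= Var vb +. Var vb)"
  let ?I = "\<lambda>s'. \<exists>k x. wvar s' vb = 2 ^ k \<and> stores_cols N aX x s' \<and> level_ok ?piv M N L j x k"
  define S where "S b = (\<Sum>k\<in>{k. k \<le> L \<and> 2 ^ k dvd j + 1 \<and> b \<le> 2 ^ k}. apply_time N (2 ^ k) + 60)" for b :: nat
  define \<Phi> where "\<Phi> s' = S (wvar s' vb)" for s' :: machine_state
  have NN: "N \<le> N * N" by simp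
  have N1: "1 \<le> N" using v by simp
  have W2: "N + N \<le> W"
  proof (cases "N = 1")
    case False
    then have "2 * N \<le> N * N" using N1 by (intro mult_le_mono1) simp
    then show ?thesis using NW by linarith
  qed (use NW in simp)
  have S1: "S 1 = (\<Sum>k\<in>{k. k \<le> L \<and> 2 ^ k dvd j + 1}. apply_time N (2 ^ k) + 60)"
    unfolding S_def by (intro sum.cong) auto
  have split: "S (2 ^ k) = apply_time N (2 ^ k) + 60 + S (2 * 2 ^ k)" if "k \<le> L" "2 ^ k dvd j + 1" for k
  proof -
    let ?A = "\<lambda>b::nat. {k. k \<le> L \<and> 2 ^ k dvd j + 1 \<and> b \<le> 2 ^ k}"
    have "2 * 2 ^ k \<le> (2::nat) ^ k' \<longleftrightarrow> 2 ^ k \<le> (2::nat) ^ k' \<and> k' \<noteq> k" for k'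
      using power_increasing_iff[of "2::nat" "Suc k" k'] power_increasing_iff[of "2::nat" k k']
      by (simp add: Suc_le_eq nat_less_le eq_commute)
    then have "?A (2 * 2 ^ k) = ?A (2 ^ k) - {k}" by auto
    moreover have "finite (?A (2 ^ k))" by (rule finite_subset[of _ "{..L}"]) auto
    moreover have "k \<in> ?A (2 ^ k)" using that by simp
    ultimately show ?thesis unfolding S_def by (simp only: sum.remove)
  qed
  have main: "run W (While ?b ?B) ?s1 (\<lambda>t s'. \<exists>k x. wvar s' vb = 2 ^ k \<and> stores_cols N aX x s' \<and>
      level_ok ?piv M N L j x k \<and> even (j div 2 ^ k) \<and>
      t + apply_time N (2 ^ k) + 60 \<le> 10 + S 1)"
  proof (rule run_While[where I = ?I and \<Phi> = \<Phi>])
    show "word_state W ?s1" using ws NW by (auto simp: word_state_def)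
    show "?I ?s1" using x by (intro exI[of _ 0] exI[of _ x]) (simp add: stores_cols_def)
  next
    fix s' assume ws': "word_state W s'" and fr: "frame ?B ?s1 s'" and "?I s'"
    note fr' = frameD[OF fr]
    have "wvar s' vj = j" by (simp add: fr' v)
    then have "j \<le> W" using word_stateD(1)[OF ws', of vj] by simp
    moreover from this have "j div wvar s' vb \<le> W" by (rule div_le_dividend[THEN order_trans])
    moreover from this have "j div wvar s' vb mod 2 \<le> W" by (rule mod_less_eq_dividend[THEN order_trans])
    moreover have "wvar s' vb \<le> W" using word_stateD(1)[OF ws'] .
    ultimately show "test_words ?b s' \<subseteq> {..W}" using NW by (simp add: fr' v)
  next
    fix s' assume ws': "word_state W s'" and fr: "frame ?B ?s1 s'" and "?I s'" and b: "test_val ?b s'"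
    then obtain k x where k: "wvar s' vb = 2 ^ k" and x: "stores_cols N aX x s'" and lv: "level_ok ?piv M N L j x k" by blast
    note fr' = frameD[OF fr]
    have vj: "wvar s' vj = j" "wvar s' vN = N" by (simp_all add: fr' v)
    have piv': "warr s' aPiv = ?piv" by (simp add: fr')
    have "1 \<le> j div 2 ^ k mod 2" using b by (simp add: vj k)
    then have odd: "odd (j div 2 ^ k)" by (simp add: odd_iff_mod_2_eq_one le_less_Suc_eq)
    note lc = level_combine[OF lv odd v(3,4) piv]
    have dv: "2 ^ k dvd j + 1" using lv by (simp add: level_ok_def)
    note lo = level_odd[OF dv odd]
    let ?p = "2 ^ k :: nat" and ?src = "j + 1 - 2 ^ k" and ?tgt = "j + 1 - 2 * 2 ^ k"
    let ?s2 = "set_wvar vtgt ?tgt (set_wvar vsrc ?src s')"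
    have pN: "?p \<le> N" "?p dvd N" using lc(1) v(4) by (simp_all add: le_imp_power_dvd)
    have jW: "j + 1 \<le> W" "2 * ?p \<le> W" "?p \<le> W" using W2 v pN by linarith+
    have "k\<^sub>M * ?p ^ k\<^sub>M \<le> k\<^sub>M * N ^ k\<^sub>M" using pN by (intro mult_le_mono2 power_mono) auto
    then have kM': "k\<^sub>M * ?p ^ k\<^sub>M \<le> W" using kM by linarith
    have ws2: "word_state W ?s2" using ws' jW by (auto simp: word_state_def)
    have v2: "wvar ?s2 vN = N" "wvar ?s2 vb = ?p" "wvar ?s2 vsrc = ?src" "wvar ?s2 vtgt = ?tgt"
      by (simp_all add: vj k)
    have x2: "stores_cols N aX x ?s2" using x by (simp add: stores_cols_def)
    have bd: "?src + ?p \<le> N" "?tgt + ?p \<le> N" "?src + ?p \<le> ?tgt \<or> ?tgt + ?p \<le> ?src"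
      using lo(3) v(3) by linarith+
    have pv: "warr ?s2 aPiv (?src + l) \<le> N" if "l < ?p" for l
    proof -
      have "?src + l < j + 1" using that lo(3) by linarith
      then have "?piv (?src + l) = 0 \<or> ?piv (?src + l) - 1 < N"
        using piv[unfolded pivoting_def, rule_format, of "?src + l"] by (auto split: if_splits)
      then show ?thesis by (auto simp: piv')
    qed
    have ap: "run W (apply_block MM ;; (vb ::= Var vb +. Var vb)) ?s2
        (\<lambda>t s''. ?I s'' \<and> \<Phi> s'' + t + 50 \<le> \<Phi> s')"
    proof (rule run_SeqI[OF run_apply_block[OF ws2 NW _ kM' v2 bd pN(2) pv x2] ws2])
      fix t s3
      assume a: "stores_cols N aX (apply_cols (warr ?s2 aPiv) ?p ?src ?tgt x) s3 \<and> t \<le> N div ?p * (TM ?p + 600 * (?p * ?p))"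
        and ws3: "word_state W s3" and fr3: "frame (apply_block MM) ?s2 s3"
      note fr3' = frameD[OF fr3]
      have b3: "wvar s3 vb = ?p" by (simp add: fr3' k)
      have "?I (set_wvar vb (2 * ?p) s3)"
        by (rule exI[of _ "Suc k"], rule exI[of _ "apply_cols ?piv ?p ?src ?tgt x"])
          (use a lc(2) in \<open>auto simp: piv' stores_cols_def\<close>)
      moreover have "\<Phi> (set_wvar vb (2 * ?p) s3) + (t + 4) + 50 \<le> \<Phi> s'"
        using split[of k] lv a unfolding \<Phi>_def by (auto simp: k level_ok_def apply_time_def)
      ultimately show "run W (vb ::= Var vb +. Var vb) s3 (\<lambda>u s''. ?I s'' \<and> \<Phi> s'' + (t + u) + 50 \<le> \<Phi> s')"
        using jW by (simp add: run_simps b3 mult_2)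
    qed simp_all
    have "run W ?B s' (\<lambda>t s''. ?I s'' \<and> \<Phi> s'' + t + 30 \<le> \<Phi> s')"
    proof (rule run_Assign_Seq[where v = ?src], goal_cases)
      case 3
      show ?case
      proof (rule run_Assign_Seq[where v = ?tgt], goal_cases)
        case 3
        show ?case by (rule run_mono[OF ap]) auto
      qed (use jW in \<open>simp_all add: vj k mult_2\<close>)
    qed (use jW NW in \<open>simp_all add: vj k\<close>)
    then show "run W ?B s' (\<lambda>t s''. ?I s'' \<and> \<Phi> s'' + t + 1 + test_cost ?b \<le> \<Phi> s')"
      by (rule run_mono) auto
  next
    fix t s' assume ws': "word_state W s'" and fr: "frame ?B ?s1 s'" and I: "?I s'" and b: "\<not> test_val ?b s'"
      and t: "t + \<Phi> s' \<le> \<Phi> ?s1 + 1 + test_cost ?b"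
    then obtain k x where k: "wvar s' vb = 2 ^ k" and x: "stores_cols N aX x s'" and lv: "level_ok ?piv M N L j x k" by blast
    note fr' = frameD[OF fr]
    have "\<not> 1 \<le> j div 2 ^ k mod 2" using b by (simp add: fr' v k)
    then have ev: "even (j div 2 ^ k)" by (simp add: even_iff_mod_2_eq_zero)
    have "apply_time N (2 ^ k) + 60 \<le> \<Phi> s'"
      using split[of k] lv unfolding \<Phi>_def by (simp add: k level_ok_def)
    moreover have "\<Phi> ?s1 = S 1" by (simp add: \<Phi>_def)
    ultimately have "t + apply_time N (2 ^ k) + 60 \<le> 10 + S 1"
      using t by simp
    then show "\<exists>k x. wvar s' vb = 2 ^ k \<and> stores_cols N aX x s' \<and> level_ok ?piv M N L j x k \<and> even (j div 2 ^ k) \<and>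
      t + apply_time N (2 ^ k) + 60 \<le> 10 + S 1"
      using k x lv ev by blast
  qed
  show ?thesis
    unfolding combine_blocks_def
    by (rule run_Assign_Seq[where v = 1]; (rule run_mono[OF main])?) (use NW in \<open>auto simp: S1\<close>)
qed

end

definition used_ok :: "(nat => nat) => nat => nat => (nat => nat) => bool" where
  "used_ok piv N c u \<longleftrightarrow> (\<forall>p<N. (u p = 0 \<longleftrightarrow> p \<notin> used_rows piv c) \<and> (\<forall>i<c. piv i = Suc p --> u p = Suc i))"

definition elim_inv :: "(nat => nat => bit) => nat => nat => nat => machine_state => bool" where
  "elim_inv M N L c s \<longleftrightarrow> pivoting (warr s aPiv) M N c \<and> used_ok (warr s aPiv) N c (warr s aUsed) \<and>
     (\<exists>x. stores_cols N aX x s \<and> lazy_ok (warr s aPiv) M N L c x)"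

lemma used_rows_Suc: "used_rows piv (Suc c) = used_rows piv c \<union> {p. piv c = Suc p}"
  by (auto simp: used_rows_def less_Suc_eq)

lemma used_rows_cong: "(\<And>i. i < c ==> piv i = piv' i) ==> used_rows piv c = used_rows piv' c"
  by (auto simp: used_rows_def)

text \<open>With its pivot entry cleared, the current column is a finished block of length one.
  Nothing else changes, which is \<open>sibling_ok_cong\<close> with \<open>B = 1\<close>.\<close>

lemma new_column_ok:
  fixes piv :: "nat => nat"
  assumes piv: "pivoting piv M N j" and used: "used_ok piv N j u" and lazy: "lazy_ok piv M N L j x" and j: "j < N"
    and p: "if p = 0 then \<forall>i<N. u i = 0 --> x j i = 0 else p - 1 < N \<and> u (p - 1) = 0 \<and> x j (p - 1) \<noteq> 0"
  defines "piv' \<equiv> piv(j := p)" and "x' \<equiv> if p = 0 then x else x(j := (x j)(p - 1 := 0))"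
    and "u' \<equiv> if p = 0 then u else u(p - 1 := j + 1)"
  shows "pivoting piv' M N (j + 1)" "level_ok piv' M N L j x' 0" "used_ok piv' N (j + 1) u'"
proof -
  have same: "piv' i = piv i" if "i < j" for i using that by (simp add: piv'_def)
  have pj: "piv' j = p" by (simp add: piv'_def)
  have gj: "gj piv' M j = gj piv M j" by (rule gj_cong) (simp add: same)
  have ur: "used_rows piv' j = used_rows piv j" by (rule used_rows_cong) (simp add: same)
  have xj: "x j i = gj piv M j (M j) i" if "i < N" for i using lazy j that by (simp add: lazy_ok_def)
  have "pivoting piv' M N j" using piv pivoting_cong[of j piv' piv M N] same by simp
  moreover have "if p = 0 then \<forall>r<N. r \<notin> used_rows piv' j --> gj piv' M j (M j) r = 0
     else p - 1 < N \<and> p - 1 \<notin> used_rows piv' j \<and> gj piv' M j (M j) (p - 1) = 1"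
    using p used xj unfolding gj ur used_ok_def by (auto split: if_splits)
  ultimately show "pivoting piv' M N (j + 1)"
    unfolding pivoting_def Suc_eq_plus1[symmetric] less_Suc_eq using pj by auto
  have "block_ok piv' M N j 1 x'"
  proof -
    have "x' j i = block_col piv' M j 1 j i" if "p \<noteq> 0" "i < N" for i
    proof -
      have "block_col piv' M j 1 j i = gj piv M j (M j) i + unit_col (p - 1) i"
        using block_col_single[of piv' j M] that pj by (simp add: gj_col_def gj)
      also have "\<dots> = x' j i"
        using p that xj[of i] by (auto simp: x'_def unit_col_def)
      finally show ?thesis by simp
    qed
    then show ?thesis unfolding block_ok_def Suc_eq_plus1[symmetric] atLeastLessThan_singleton using pj by auto
  qed
  moreover have "sibling_ok piv' M N j x' k" if "k < L" for k
    by (rule sibling_ok_cong[where B = 1 and x = x and piv = piv])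
      (use lazy j that same in \<open>auto simp: lazy_ok_def x'_def\<close>)
  ultimately show "level_ok piv' M N L j x' 0" by (simp add: level_ok_def)
  show "used_ok piv' N (j + 1) u'"
    unfolding used_ok_def
  proof (intro allI impI conjI)
    fix r assume r: "r < N"
    have ur1: "used_rows piv' (j + 1) = used_rows piv j \<union> {r. p = Suc r}"
      using used_rows_Suc[of piv' j] ur pj by (simp add: Suc_eq_plus1)
    show "u' r = 0 \<longleftrightarrow> r \<notin> used_rows piv' (j + 1)"
      using used r unfolding ur1 u'_def used_ok_def by auto
    fix i assume i: "i < j + 1" "piv' i = Suc r"
    show "u' r = Suc i"
    proof (cases "i = j")
      case True
      then show ?thesis using i pj by (auto simp: u'_def)
    next
      case False
      then have ij: "i < j" "piv i = Suc r" using i same by auto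
      then have "u r = Suc i" using used r by (auto simp: used_ok_def)
      moreover have "p = 0 \<or> p - 1 \<noteq> r" using p \<open>u r = Suc i\<close> by auto
      ultimately show ?thesis by (auto simp: u'_def)
    qed
  qed
qed

context mult_machine
begin

lemma run_update_next:
  assumes ws: "word_state W s" and NW: "N * N + 10 \<le> W" and kM: "k\<^sub>M * N ^ k\<^sub>M \<le> W"
    and v: "wvar s vN = N" "wvar s vj = j" "j < N" "N = 2 ^ L" "wvar s vb = 2 ^ k"
    and piv: "pivoting (warr s aPiv) M N (j + 1)"
    and x: "stores_cols N aX x s" "level_ok (warr s aPiv) M N L j x k" "even (j div 2 ^ k)"
  shows "run W (update_next MM) s (\<lambda>t s'. t \<le> apply_time N (2 ^ k) + 40 \<and>
    (\<exists>x. stores_cols N aX x s' \<and> lazy_ok (warr s aPiv) M N L (j + 1) x))"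
proof -
  let ?b = "Leq (Var vj +. Const 2) (Var vN)"
  let ?A = "(vsrc ::= (Var vj +. Const 1) -. Var vb) ;; (vtgt ::= Var vj +. Const 1) ;; apply_block MM"
  let ?p = "2 ^ k :: nat"
  have NN: "N \<le> N * N" by simp
  have "N \<le> W" "j + 2 \<le> W" "j \<le> W" "2 \<le> W" using v(3) NN NW by linarith+
  then have bw: "test_words ?b s \<subseteq> {..W}" using v(1-3) by simp
  show ?thesis
  proof (cases "j + 1 < N")
    case False
    then have j1: "j + 1 = N" using v(3) by simp
    have "lazy_ok (warr s aPiv) M N L (j + 1) x" by (rule level_final[OF x(2,3) j1 v(4)])
    then show ?thesis
      unfolding update_next_def run_Cond using bw x(1) v j1 False by (auto simp: run_simps)
  next
    case True
    note lu = level_update[OF x(2,3) True v(4) piv]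
    let ?src = "j + 1 - ?p" and ?tgt = "j + 1"
    let ?s2 = "set_wvar vtgt ?tgt (set_wvar vsrc ?src s)"
    have dv: "?p dvd j + 1" using x(2) by (simp add: level_ok_def)
    then have pj: "?p \<le> j + 1" by (rule dvd_imp_le) simp
    have pN: "?p \<le> N" "?p dvd N" using lu(1) v(4) by (simp_all add: le_imp_power_dvd)
    have jW: "j + 1 \<le> W" "?p \<le> W" using True pN NN NW by linarith+
    have "k\<^sub>M * ?p ^ k\<^sub>M \<le> k\<^sub>M * N ^ k\<^sub>M" using pN by (intro mult_le_mono2 power_mono) auto
    then have kM': "k\<^sub>M * ?p ^ k\<^sub>M \<le> W" using kM by linarith
    have ws2: "word_state W ?s2" using ws jW by (auto simp: word_state_def)
    have v2: "wvar ?s2 vN = N" "wvar ?s2 vb = ?p" "wvar ?s2 vsrc = ?src" "wvar ?s2 vtgt = ?tgt"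
      by (simp_all add: v)
    have x2: "stores_cols N aX x ?s2" using x by (simp add: stores_cols_def)
    have bd: "?src + ?p \<le> N" "?tgt + ?p \<le> N" "?src + ?p \<le> ?tgt \<or> ?tgt + ?p \<le> ?src"
      using lu(2) pj v(3) by linarith+
    have pv: "warr ?s2 aPiv (?src + l) \<le> N" if "l < ?p" for l
    proof -
      have "?src + l < j + 1" using that pj by linarith
      then have "warr s aPiv (?src + l) = 0 \<or> warr s aPiv (?src + l) - 1 < N"
        using piv[unfolded pivoting_def, rule_format, of "?src + l"] by (auto split: if_splits)
      then show ?thesis by auto
    qed
    have p1: "1 \<le> ?p" by simp
    have ap: "run W (apply_block MM) ?s2 (\<lambda>t s'. t \<le> apply_time N ?p \<and>
      (\<exists>x. stores_cols N aX x s' \<and> lazy_ok (warr s aPiv) M N L (j + 1) x))"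
      by (rule run_mono[OF run_apply_block[OF ws2 NW p1 kM' v2 bd pN(2) pv x2]])
        (use lu(3) in \<open>auto simp: apply_time_def\<close>)
    have A: "run W ?A s (\<lambda>t s'. t \<le> apply_time N ?p + 20 \<and>
      (\<exists>x. stores_cols N aX x s' \<and> lazy_ok (warr s aPiv) M N L (j + 1) x))"
    proof (rule run_Assign_Seq[where v = ?src], goal_cases)
      case 3
      show ?case
      proof (rule run_Assign_Seq[where v = ?tgt], goal_cases)
        case 3
        show ?case by (rule run_mono[OF ap]) auto
      qed (use jW NW in \<open>simp_all add: v\<close>)
    qed (use jW NW in \<open>simp_all add: v\<close>)
    have tv: "test_val ?b s" using True v by simp
    show ?thesis
      unfolding update_next_def run_Cond if_P[OF tv]
      by (rule conjI[OF bw], rule run_mono[OF A]) auto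
  qed
qed

lemma run_eliminate_column:
  assumes ws: "word_state W s" and NW: "N * N + 10 \<le> W" and kM: "k\<^sub>M * N ^ k\<^sub>M \<le> W"
    and v: "wvar s vN = N" "wvar s vj = j" "j < N" "N = 2 ^ L"
    and inv: "elim_inv M N L j s"
  shows "run W (find_pivot ;; use_pivot ;; combine_blocks MM ;; update_next MM) s
    (\<lambda>t s'. elim_inv M N L (Suc j) s' \<and> t \<le> column_time N L j)"
proof -
  obtain x where piv: "pivoting (warr s aPiv) M N j" and used: "used_ok (warr s aPiv) N j (warr s aUsed)"
    and x: "stores_cols N aX x s" and lazy: "lazy_ok (warr s aPiv) M N L j x"
    using inv by (auto simp: elim_inv_def)
  have xj: "warr s aX (i * N + j) = nat_of_bit (x j i)" if "i < N" for i
    using x that v(3) by (simp add: stores_cols_def)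
  show ?thesis
  proof (rule run_SeqI[OF run_find_pivot[OF ws NW v(1-3)] ws], goal_cases)
    case A: (1 t1 s1)
    note fr1 = frameD[OF A(3)]
    define p where "p = wvar s1 vp"
    have p: "if p = 0 then \<forall>i<N. warr s aUsed i = 0 --> x j i = 0
      else p - 1 < N \<and> warr s aUsed (p - 1) = 0 \<and> x j (p - 1) \<noteq> 0"
      using A(1) xj by (auto simp: p_def split: if_splits)
    then have pN: "p \<le> N" by (auto split: if_splits)
    note nc = new_column_ok[OF piv used lazy v(3) p]
    have v1: "wvar s1 vN = N" "wvar s1 vj = j" "wvar s1 vp = p" by (simp_all add: fr1 v p_def)
    show ?case
    proof (rule run_SeqI[OF run_use_pivot[OF A(2) NW v1(1,2) v(3) v1(3) pN] A(2)], goal_cases)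
      case B: (1 t2 s2)
      note fr2 = frameD[OF B(3)]
      let ?x = "if p = 0 then x else x(j := (x j)(p - 1 := 0))"
      have s2: "warr s2 aPiv = (warr s aPiv)(j := p)"
        "warr s2 aUsed = (if p = 0 then warr s aUsed else (warr s aUsed)(p - 1 := j + 1))"
        "warr s2 aX = (if p = 0 then warr s aX else (warr s aX)((p - 1) * N + j := 0))"
        using B(1) by (simp_all add: fr1)
      have x2: "stores_cols N aX ?x s2"
        unfolding stores_cols_def s2
      proof (intro allI impI)
        fix i y assume iy: "i < N" "y < N"
        have "i * N + y = (p - 1) * N + j \<longleftrightarrow> i = p - 1 \<and> y = j" by (rule mat_idx_inj[OF iy(2) v(3)])
        then show "(if p = 0 then warr s aX else (warr s aX)((p - 1) * N + j := 0)) (i * N + y) = nat_of_bit (?x y i)"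
          using x iy by (auto simp: stores_cols_def)
      qed
      have v2: "wvar s2 vN = N" "wvar s2 vj = j" by (simp_all add: fr2 v1)
      have piv2: "pivoting (warr s2 aPiv) M N (j + 1)" "level_ok (warr s2 aPiv) M N L j ?x 0"
        "used_ok (warr s2 aPiv) N (j + 1) (warr s2 aUsed)"
        using nc unfolding s2 by simp_all
      show ?case
      proof (rule run_SeqI[OF run_combine_blocks[OF B(2) NW kM v2 v(3,4) piv2(1) x2 piv2(2)] B(2)], goal_cases)
        case C: (1 t3 s3)
        note fr3 = frameD[OF C(3)]
        let ?S = "\<Sum>k\<in>{k. k \<le> L \<and> 2 ^ k dvd j + 1}. apply_time N (2 ^ k) + 60"
        obtain k x3 where k: "wvar s3 vb = 2 ^ k" and x3: "stores_cols N aX x3 s3" and l3: "level_ok (warr s2 aPiv) M N L j x3 k"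
          and ev: "even (j div 2 ^ k)" and t3: "t3 + apply_time N (2 ^ k) + 60 \<le> 20 + ?S"
          using C(1) by blast
        have v3: "wvar s3 vN = N" "wvar s3 vj = j" by (simp_all add: fr3 v2)
        have p3: "warr s3 aPiv = warr s2 aPiv" by (simp add: fr3)
        have u3: "warr s3 aUsed = warr s2 aUsed" by (simp add: fr3)
        have upd: "run W (update_next MM) s3 (\<lambda>t s'. t \<le> apply_time N (2 ^ k) + 40 \<and>
          (\<exists>x. stores_cols N aX x s' \<and> lazy_ok (warr s3 aPiv) M N L (j + 1) x))"
          by (rule run_update_next[OF C(2) NW kM v3 v(3,4) k _ x3 _ ev]) (use piv2 l3 p3 in auto)
        show ?case
        proof (rule run_strengthenE[OF upd C(2)], goal_cases)
          case D: (1 t4 s4)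
          note fr4 = frameD[OF D(3)]
          have "warr s4 aPiv = warr s2 aPiv" "warr s4 aUsed = warr s2 aUsed" by (simp_all add: fr4 p3 u3)
          then have "elim_inv M N L (Suc j) s4"
            using D(1) piv2 p3 unfolding elim_inv_def Suc_eq_plus1 by auto
          moreover have "t1 + (t2 + (t3 + t4)) \<le> column_time N L j"
            using A(1) B(1) t3 D(1) unfolding column_time_def by linarith
          ultimately show ?case by blast
        qed
      qed
    qed
  qed
qed

definition eliminate_time :: "nat => nat => nat" where
  "eliminate_time N L = 100 * N + 100 + (\<Sum>j<N. column_time N L j + 9)"

lemma run_eliminate:
  assumes ws: "word_state W s" and NW: "N * N + 10 \<le> W" and kM: "k\<^sub>M * N ^ k\<^sub>M \<le> W"
    and v: "wvar s vN = N" "N = 2 ^ L" and M: "stores_cols N aX M s"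
  shows "run W (eliminate MM) s (\<lambda>t s'. t \<le> eliminate_time N L \<and> pivoting (warr s' aPiv) M N N \<and>
    used_ok (warr s' aPiv) N N (warr s' aUsed) \<and>
    (\<forall>y<N. warr s' aPiv y \<noteq> 0 --> (\<forall>i<N. warr s' aX (i * N + y) = nat_of_bit (block_col (warr s' aPiv) M 0 N y i))))"
proof -
  have NN: "N \<le> N * N" by simp
  have N0: "0 < N" using v by simp
  have W1: "1 \<le> W" "N \<le> W" using NW NN by linarith+
  let ?F1 = "For vi vN (Store aUsed (Var vi) (Const 0))"
  have F1: "run W ?F1 s (\<lambda>t s'. (\<forall>i<wvar s vN. warr s' aUsed i = 0) \<and>
    (\<forall>k. k \<notin> (\<lambda>i. i) ` {..<wvar s vN} --> warr s' aUsed k = warr s aUsed k) \<and>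
    t \<le> 7 + wvar s vN * (word_cost (Var vi) + word_cost (Const 0) + 10))"
    by (rule run_fill1[OF ws W1(1)]) (use W1 v in auto)
  show ?thesis
    unfolding eliminate_def
  proof (rule run_SeqI[OF F1 ws], goal_cases)
    case A: (1 t1 s1)
    note fr1 = frameD[OF A(3)]
    let ?B = "find_pivot ;; use_pivot ;; combine_blocks MM ;; update_next MM"
    have N1: "wvar s1 vN = N" by (simp add: fr1 v)
    have "stores_cols N aX M s1" using M by (simp add: stores_cols_def fr1)
    moreover have "used_ok (warr s1 aPiv) N 0 (warr s1 aUsed)"
      using A(1) v by (simp add: used_ok_def used_rows_def)
    moreover have "lazy_ok (warr s1 aPiv) M N L 0 M" by (rule lazy_ok_0[OF refl v(2)])
    ultimately have inv0: "elim_inv M N L 0 s1"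
      by (auto simp: elim_inv_def pivoting_def)
    show ?case
    proof (rule run_For[where I = "elim_inv M N L" and T = "column_time N L"])
      show "word_state W s1" by fact
      show "1 \<le> W" by fact
      show "elim_inv M N L 0 (set_wvar vj 0 s1)" using inv0 by (simp add: elim_inv_def stores_cols_def)
    next
      fix j s' assume j: "j < wvar s1 vN" "word_state W s'" "frame (For vj vN ?B) s1 s'" "wvar s' vj = j" "elim_inv M N L j s'"
      note fr' = frameD[OF j(3)]
      have v': "wvar s' vN = N" "j < N" using j(1) by (simp_all add: fr' N1)
      show "run W ?B s' (\<lambda>t s''. elim_inv M N L (Suc j) (set_wvar vj (Suc j) s'') \<and> t \<le> column_time N L j)"
        by (rule run_mono[OF run_eliminate_column[OF j(2) NW kM v'(1) j(4) v'(2) v(2) j(5)]])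
          (auto simp: elim_inv_def stores_cols_def)
    next
      fix t s' assume fin: "elim_inv M N L (wvar s1 vN) s'" and t: "t \<le> 7 + (\<Sum>i<wvar s1 vN. column_time N L i + 9)"
      obtain x where "pivoting (warr s' aPiv) M N N" "used_ok (warr s' aPiv) N N (warr s' aUsed)"
        "stores_cols N aX x s'" "block_ok (warr s' aPiv) M N 0 N x"
        using fin unfolding N1 elim_inv_def lazy_ok_def by auto
      moreover have "t1 + t \<le> eliminate_time N L"
        using A(1) t unfolding N1 v eliminate_time_def by simp
      ultimately show "t1 + t \<le> eliminate_time N L \<and> pivoting (warr s' aPiv) M N N \<and>
        used_ok (warr s' aPiv) N N (warr s' aUsed) \<and>
        (\<forall>y<N. warr s' aPiv y \<noteq> 0 --> (\<forall>i<N. warr s' aX (i * N + y) = nat_of_bit (block_col (warr s' aPiv) M 0 N y i)))"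
        by (auto simp: block_ok_def stores_cols_def)
    qed simp_all
  qed
qed

end

section \<open>The cost of the elimination, summed over the levels of the recursion\<close>

lemma card_multiples_le:
  assumes "0 < d"
  shows "card {j. j < N \<and> d dvd j + 1} \<le> N div (d :: nat)"
proof -
  have "{j. j < N \<and> d dvd j + 1} \<subseteq> (\<lambda>q. d * q - 1) ` {1..N div d}"
  proof
    fix j assume "j \<in> {j. j < N \<and> d dvd j + 1}"
    then obtain q where q: "j < N" "j + 1 = d * q" by auto
    then have "q \<noteq> 0" by (intro notI) simp
    moreover have "q \<le> N div d"
      using q assms by (simp add: less_eq_div_iff_mult_less_eq mult.commute)
    ultimately show "j \<in> (\<lambda>q. d * q - 1) ` {1..N div d}"
      using q by (intro image_eqI[of _ _ q]) auto
  qed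
  then have "card {j. j < N \<and> d dvd j + 1} \<le> card ((\<lambda>q. d * q - 1) ` {1..N div d})"
    by (intro card_mono) auto
  also have "\<dots> \<le> N div d" using card_image_le[of "{1..N div d}"] by simp
  finally show ?thesis .
qed

context mult_machine
begin

text \<open>After an exchange of sums, level \<open>k\<close> is charged for
  \<open>N div 2 ^ k\<close> columns, each with \<open>N div 2 ^ k\<close> square products of size
  \<open>2 ^ k\<close>. The overhead of 60 per block raises 600 to 660.\<close>

lemma sum_column_time:
  fixes L :: nat
  defines "N \<equiv> 2 ^ L"
  shows "(\<Sum>j<N. column_time N L j) \<le> N * (40 * N + 200) +
    (\<Sum>k\<le>L. (N div 2 ^ k) * (N div 2 ^ k) * (TM (2 ^ k) + 660 * (2 ^ k * 2 ^ k)))"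
proof -
  let ?f = "\<lambda>k. apply_time N (2 ^ k) + 60"
  have "(\<Sum>j<N. \<Sum>k\<in>{k. k \<le> L \<and> 2 ^ k dvd j + 1}. ?f k) = (\<Sum>j<N. \<Sum>k\<le>L. if 2 ^ k dvd j + 1 then ?f k else 0)"
  proof (rule sum.cong[OF refl])
    fix j
    have "{k. k \<le> L \<and> 2 ^ k dvd j + 1} = {k \<in> {..L}. 2 ^ k dvd j + 1}" by auto
    then show "(\<Sum>k\<in>{k. k \<le> L \<and> 2 ^ k dvd j + 1}. ?f k) = (\<Sum>k\<le>L. if 2 ^ k dvd j + 1 then ?f k else 0)"
      by (simp only: sum.inter_filter[OF finite_atMost])
  qed
  also have "\<dots> = (\<Sum>k\<le>L. \<Sum>j<N. if 2 ^ k dvd j + 1 then ?f k else 0)"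
    by (rule sum.swap)
  also have "\<dots> = (\<Sum>k\<le>L. card {j. j < N \<and> 2 ^ k dvd j + 1} * ?f k)"
  proof (intro sum.cong refl)
    fix k
    have "(\<Sum>j<N. if 2 ^ k dvd j + 1 then ?f k else 0) = (\<Sum>j\<in>{j \<in> {..<N}. 2 ^ k dvd j + 1}. ?f k)"
      by (rule sum.inter_filter[symmetric]) simp
    also have "\<dots> = card {j. j < N \<and> 2 ^ k dvd j + 1} * ?f k" unfolding sum_constant by simp
    finally show "(\<Sum>j<N. if 2 ^ k dvd j + 1 then ?f k else 0) = card {j. j < N \<and> 2 ^ k dvd j + 1} * ?f k" .
  qed
  also have "\<dots> \<le> (\<Sum>k\<le>L. (N div 2 ^ k) * (N div 2 ^ k) * (TM (2 ^ k) + 660 * (2 ^ k * 2 ^ k)))"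
  proof (rule sum_mono)
    fix k assume "k \<in> {..L}"
    then have "2 ^ k dvd N" unfolding N_def by (simp add: le_imp_power_dvd)
    then have q: "1 \<le> N div 2 ^ k" using dvd_imp_le[of "2 ^ k" N] unfolding N_def
      by (simp add: Suc_le_eq div_greater_zero_iff One_nat_def)
    let ?q = "N div 2 ^ k" and ?p = "2 ^ k * 2 ^ k :: nat"
    have "1 * 1 \<le> ?p" by (intro mult_le_mono) auto
    then have "1 * 60 \<le> ?q * (60 * ?p)" using q by (intro mult_le_mono) auto
    then have "?f k \<le> ?q * (TM (2 ^ k) + 600 * ?p) + ?q * (60 * ?p)" unfolding apply_time_def by simp
    also have "\<dots> = ?q * (TM (2 ^ k) + 660 * ?p)" by (simp add: algebra_simps)
    finally have "card {j. j < N \<and> 2 ^ k dvd j + 1} * ?f k \<le> ?q * (?q * (TM (2 ^ k) + 660 * ?p))"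
      using card_multiples_le[of "2 ^ k" N] by (intro mult_le_mono) auto
    then show "card {j. j < N \<and> 2 ^ k dvd j + 1} * ?f k \<le> ?q * ?q * (TM (2 ^ k) + 660 * ?p)"
      by (simp add: mult.assoc)
  qed
  finally show ?thesis
    unfolding column_time_def sum.distrib[of "\<lambda>j. 40 * N + 200"] by simp
qed

text \<open>Since \<open>\<omega> > 2\<close>, the costs of the levels of the recursion form an increasing geometric sequence.\<close>

lemma eliminate_time_bound:
  assumes \<omega>: "\<omega> > 2" and C: "C \<ge> 0" and TM: "\<And>b. 1 \<le> b ==> real (TM b) \<le> C * real b powr \<omega>"
  shows "\<exists>D\<ge>0. \<forall>L. real (eliminate_time (2 ^ L) L) \<le> D * real (2 ^ L) powr \<omega>"
proof -
  define r :: real where "r = 2 powr (\<omega> - 2)"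
  have r1: "r > 1" unfolding r_def using \<omega> by simp
  \<comment> \<open>The scans of all columns take \<open>40 * N\<^sup>2 + 309 * N + 100\<close>, at
    most 449 times \<open>N\<^sup>2\<close>, which 500 covers. The factor \<open>r / (r - 1)\<close>
    bounds the geometric sum relative to its largest term.\<close>
  define D where "D = 500 + (C + 660) * (r / (r - 1))"
  have "real (eliminate_time (2 ^ L) L) \<le> D * real (2 ^ L) powr \<omega>" for L
  proof -
    let ?N = "2 ^ L :: nat"
    have r_pow: "r ^ k = (2 ^ k) powr (\<omega> - 2)" for k
      unfolding r_def by (simp add: powr_realpow[symmetric] powr_powr mult.commute)
    have powr2: "real (2 ^ k) powr \<omega> = (2 ^ k)\<^sup>2 * r ^ k" for k
    proof -
      have "real (2 ^ k) powr \<omega> = real (2 ^ k) powr (2 + (\<omega> - 2))" by simp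
      also have "\<dots> = real (2 ^ k) powr 2 * real (2 ^ k) powr (\<omega> - 2)" by (rule powr_add)
      also have "real (2 ^ k) powr 2 = (2 ^ k)\<^sup>2" by simp
      finally show ?thesis using r_pow by simp
    qed
    let ?t = "\<lambda>k. (?N div 2 ^ k) * (?N div 2 ^ k) * (TM (2 ^ k) + 660 * (2 ^ k * 2 ^ k))"
    have "real (?t k) \<le> (C + 660) * (2 ^ L)\<^sup>2 * r ^ k" if "k \<le> L" for k
    proof -
      have d: "real (?N div 2 ^ k) = 2 ^ L / 2 ^ k"
        using that by (simp add: real_of_nat_div le_imp_power_dvd)
      have "real (TM (2 ^ k)) \<le> C * ((2 ^ k)\<^sup>2 * r ^ k)" using TM[of "2 ^ k"] powr2[of k] by simp
      moreover have "(2 ^ k)\<^sup>2 * 1 \<le> (2 ^ k)\<^sup>2 * r ^ k"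
        using r1 by (intro mult_left_mono one_le_power) auto
      ultimately have *: "real (TM (2 ^ k) + 660 * (2 ^ k * 2 ^ k)) \<le> (C + 660) * ((2 ^ k)\<^sup>2 * r ^ k)"
      proof -
        assume a: "real (TM (2 ^ k)) \<le> C * ((2 ^ k)\<^sup>2 * r ^ k)" "(2 ^ k)\<^sup>2 * 1 \<le> (2 ^ k)\<^sup>2 * r ^ k"
        have "real (TM (2 ^ k) + 660 * (2 ^ k * 2 ^ k)) = real (TM (2 ^ k)) + 660 * (2 ^ k)\<^sup>2"
          by (simp add: power2_eq_square)
        also have "\<dots> \<le> C * ((2 ^ k)\<^sup>2 * r ^ k) + 660 * ((2 ^ k)\<^sup>2 * r ^ k)" using a by linarith
        finally show ?thesis by (simp only: distrib_right)
      qed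
      have "real (?t k) = (2 ^ L / 2 ^ k)\<^sup>2 * real (TM (2 ^ k) + 660 * (2 ^ k * 2 ^ k))"
        unfolding of_nat_mult d by (simp add: power2_eq_square)
      also have "\<dots> \<le> (2 ^ L / 2 ^ k)\<^sup>2 * ((C + 660) * ((2 ^ k)\<^sup>2 * r ^ k))"
        by (intro mult_left_mono *) simp
      also have "\<dots> = (C + 660) * (2 ^ L)\<^sup>2 * r ^ k" by (simp add: power_divide)
      finally show ?thesis .
    qed
    then have "real (\<Sum>k\<le>L. ?t k) \<le> (\<Sum>k\<le>L. (C + 660) * (2 ^ L)\<^sup>2 * r ^ k)"
      unfolding of_nat_sum by (intro sum_mono) auto
    also have "\<dots> = (C + 660) * (2 ^ L)\<^sup>2 * (\<Sum>k\<le>L. r ^ k)" by (simp add: sum_distrib_left)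
    also have "(\<Sum>k\<le>L. r ^ k) \<le> r ^ L * (r / (r - 1))"
    proof -
      have "(\<Sum>k\<le>L. r ^ k) = (r ^ Suc L - 1) / (r - 1)"
        using r1 geometric_sum[of r "Suc L"] by (simp add: lessThan_Suc_atMost)
      also have "\<dots> \<le> r ^ Suc L / (r - 1)" using r1 by (intro divide_right_mono) auto
      finally show ?thesis by (simp add: mult.commute)
    qed
    also have "(C + 660) * (2 ^ L)\<^sup>2 * (r ^ L * (r / (r - 1))) = (C + 660) * (r / (r - 1)) * real ?N powr \<omega>"
      unfolding powr2[of L] by (simp only: mult_ac)
    finally have main: "real (\<Sum>k\<le>L. ?t k) \<le> (C + 660) * (r / (r - 1)) * real ?N powr \<omega>"
      using C by (simp add: mult_left_mono)
    have "real (100 * ?N + 100 + ?N * (40 * ?N + 200) + ?N * 9) \<le> 500 * (2 ^ L)\<^sup>2"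
    proof -
      have "(1::real) \<le> 2 ^ L" by simp
      then have "(2::real) ^ L \<le> (2 ^ L)\<^sup>2" "1 \<le> (2 ^ L :: real)\<^sup>2"
        using mult_mono[of 1 "2 ^ L :: real" 1 "2 ^ L"] by (simp_all add: power2_eq_square)
      moreover have "real (100 * ?N + 100 + ?N * (40 * ?N + 200) + ?N * 9) = 40 * (2 ^ L)\<^sup>2 + 309 * 2 ^ L + 100"
        by (simp add: algebra_simps power2_eq_square)
      ultimately show ?thesis by linarith
    qed
    also have "\<dots> \<le> 500 * real ?N powr \<omega>"
    proof -
      have "(2 ^ L)\<^sup>2 * 1 \<le> (2 ^ L)\<^sup>2 * r ^ L" using r1 by (intro mult_left_mono one_le_power) auto
      then show ?thesis unfolding powr2 by simp
    qed
    finally have small: "real (100 * ?N + 100 + ?N * (40 * ?N + 200) + ?N * 9) \<le> 500 * real ?N powr \<omega>" .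
    have "eliminate_time ?N L \<le> (100 * ?N + 100 + ?N * (40 * ?N + 200) + ?N * 9) + (\<Sum>k\<le>L. ?t k)"
      using sum_column_time[of L] unfolding eliminate_time_def sum.distrib by simp
    then have "real (eliminate_time ?N L) \<le> real (100 * ?N + 100 + ?N * (40 * ?N + 200) + ?N * 9) + real (\<Sum>k\<le>L. ?t k)"
      unfolding of_nat_add[symmetric] by (simp only: of_nat_le_iff)
    also have "\<dots> \<le> 500 * real ?N powr \<omega> + (C + 660) * (r / (r - 1)) * real ?N powr \<omega>"
      by (intro add_mono small main)
    also have "\<dots> = D * real ?N powr \<omega>" unfolding D_def by (simp only: distrib_right)
    finally show ?thesis .
  qed
  moreover have "D \<ge> 0" unfolding D_def using C r1 by simp
  ultimately show ?thesis by blast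
qed

end

section \<open>Homology in degree one\<close>

lemma odd_card_sym_diff:
  assumes "finite A" "finite B"
  shows "odd (card (sym_diff A B)) \<longleftrightarrow> odd (card A) \<noteq> odd (card B)"
proof -
  have "card A = card (A - B) + card (A \<inter> B)" "card B = card (B - A) + card (A \<inter> B)"
    using assms by (metis card_Un_disjoint finite_Diff finite_Int Int_Diff_disjoint Un_Diff_Int add.commute Int_commute)+
  moreover have "card (sym_diff A B) = card (A - B) + card (B - A)"
    using assms by (intro card_Un_disjoint) auto
  ultimately show ?thesis by presburger
qed

lemma boundary_sym_diff:
  assumes "finite c" "finite d"
  shows "boundary p (sym_diff c d) = sym_diff (boundary p c) (boundary p d)"
proof -
  have "{\<sigma> \<in> sym_diff c d. \<tau> \<subseteq> \<sigma>} = sym_diff {\<sigma> \<in> c. \<tau> \<subseteq> \<sigma>} {\<sigma> \<in> d. \<tau> \<subseteq> \<sigma>}" for \<tau> by blast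
  then have "odd (card {\<sigma> \<in> sym_diff c d. \<tau> \<subseteq> \<sigma>}) \<longleftrightarrow>
      odd (card {\<sigma> \<in> c. \<tau> \<subseteq> \<sigma>}) \<noteq> odd (card {\<sigma> \<in> d. \<tau> \<subseteq> \<sigma>})" for \<tau>
    using odd_card_sym_diff[of "{\<sigma> \<in> c. \<tau> \<subseteq> \<sigma>}" "{\<sigma> \<in> d. \<tau> \<subseteq> \<sigma>}"] assms by simp
  then show ?thesis unfolding boundary_def by blast
qed

lemma boundary_empty [simp]: "boundary p {} = {}"
  by (simp add: boundary_def)

lemma boundary_single: "boundary p {\<sigma>} = {\<tau>. \<tau> \<noteq> {} \<and> card \<tau> = p \<and> \<tau> \<subseteq> \<sigma>}"
proof -
  have "{\<sigma>' \<in> {\<sigma>}. \<tau> \<subseteq> \<sigma>'} = (if \<tau> \<subseteq> \<sigma> then {\<sigma>} else {})" for \<tau> by auto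
  then show ?thesis by (auto simp: boundary_def)
qed

text \<open>A vertex of a triangle lies in exactly two of its edges, and any other vertex in
  none.\<close>

lemma boundary_boundary_triangle:
  assumes "card \<sigma> = 3"
  shows "boundary 1 (boundary 2 {\<sigma>}) = {}"
proof -
  have fin: "finite \<sigma>" using assms card.infinite by force
  have "even (card {e \<in> boundary 2 {\<sigma>}. \<tau> \<subseteq> e})" if t: "card \<tau> = 1" for \<tau>
  proof -
    obtain v where v: "\<tau> = {v}" using t by (rule card_1_singletonE)
    show ?thesis
    proof (cases "v \<in> \<sigma>")
      case True
      have "{e \<in> boundary 2 {\<sigma>}. \<tau> \<subseteq> e} = (\<lambda>x. {v, x}) ` (\<sigma> - {v})"
      proof (intro equalityI subsetI)
        fix e assume "e \<in> {e \<in> boundary 2 {\<sigma>}. \<tau> \<subseteq> e}"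
        then have e: "card e = 2" "e \<subseteq> \<sigma>" "v \<in> e" by (auto simp: boundary_single v)
        then obtain x where "e = {v, x}" "x \<noteq> v" by (auto simp: card_2_iff)
        then show "e \<in> (\<lambda>x. {v, x}) ` (\<sigma> - {v})" using e by auto
      qed (use True in \<open>auto simp: boundary_single v card_insert_if\<close>)
      moreover have "inj_on (\<lambda>x. {v, x}) (\<sigma> - {v})" by (auto simp: inj_on_def doubleton_eq_iff)
      moreover have "card (\<sigma> - {v}) = 2" using True assms fin by simp
      ultimately show ?thesis by (simp add: card_image)
    next
      case False
      then have "{e \<in> boundary 2 {\<sigma>}. \<tau> \<subseteq> e} = {}" by (auto simp: boundary_single v)
      then show ?thesis by (simp only: card.empty even_zero)
    qed
  qed
  then show ?thesis unfolding boundary_def[of 1] by blast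
qed

text \<open>Coordinates with respect to a finite basis give a bijection with functions from the
  basis to the field. This trades the dimension of homology for the number of classes.\<close>

lemma (in vectorspace) card_carrier_eq:
  assumes "finite (carrier V)"
  shows "card (carrier V) = card (carrier K) ^ dim"
proof -
  have "span (carrier V) = carrier V"
    using in_own_span[of "carrier V"] span_is_subset2[of "carrier V"] by auto
  then have "fin_dim" unfolding fin_dim_def using assms by blast
  then obtain A where A: "finite A" "basis A" using finite_basis_exists by blast
  then have AC: "A \<subseteq> carrier V" by (simp add: basis_def)
  have ex: "\<exists>!a. a \<in> A \<rightarrow>\<^sub>E carrier K \<and> lincomb a A = v" if "v \<in> carrier V" for v
    using basis_criterion[OF A(1) AC] A(2) that by blast
  have "bij_betw (\<lambda>a. lincomb a A) (A \<rightarrow>\<^sub>E carrier K) (carrier V)"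
    unfolding bij_betw_def
  proof
    have lc: "lincomb a A \<in> carrier V" if "a \<in> A \<rightarrow>\<^sub>E carrier K" for a
      using that AC A(1) by (intro lincomb_closed) auto
    show "inj_on (\<lambda>a. lincomb a A) (A \<rightarrow>\<^sub>E carrier K)"
      using ex lc by (intro inj_onI) metis
    show "(\<lambda>a. lincomb a A) ` (A \<rightarrow>\<^sub>E carrier K) = carrier V"
      using ex lc by blast
  qed
  then have "card (carrier V) = card (A \<rightarrow>\<^sub>E carrier K)" by (simp add: bij_betw_same_card)
  also have "\<dots> = card (carrier K) ^ card A" using A(1) by (simp add: card_PiE)
  finally show ?thesis using dim_basis[OF A] by simp
qed

lemma card_UNIV_bit: "card (UNIV :: bit set) = 2"
proof -
  have "(UNIV :: bit set) = {0, 1}" by (auto intro: bit_not_one_iff[THEN iffD1])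
  moreover have "card {0, 1 :: bit} = 2" by simp
  ultimately show ?thesis by (simp only:)
qed

section \<open>Cycles, boundaries and homology classes of a finite complex\<close>

locale finite_complex =
  fixes K :: "'v set set"
  assumes fin_K: "finite K" and complex: "simplicial_complex K"
begin

lemma finite_chain: "c \<subseteq> K ==> finite c"
  using fin_K finite_subset by blast

lemma simplices_subset: "simplices K p \<subseteq> K"
  by (auto simp: simplices_def)

lemma boundary_subset:
  assumes "c \<subseteq> K"
  shows "boundary (p + 1) c \<subseteq> simplices K p"
proof
  fix \<tau> assume t: "\<tau> \<in> boundary (p + 1) c"
  then have "{\<sigma> \<in> c. \<tau> \<subseteq> \<sigma>} \<noteq> {}" unfolding boundary_def by (metis (no_types, lifting) card.empty even_zero mem_Collect_eq)
  then obtain \<sigma> where "\<sigma> \<in> K" "\<tau> \<subseteq> \<sigma>" using assms by blast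
  moreover have "\<tau> \<noteq> {}" "card \<tau> = p + 1" using t by (simp_all add: boundary_def)
  moreover have "\<forall>\<sigma>\<in>K. \<forall>\<tau>. \<tau> \<noteq> {} \<and> \<tau> \<subseteq> \<sigma> --> \<tau> \<in> K" using complex unfolding simplicial_complex_def by (rule conjunct2)
  ultimately show "\<tau> \<in> simplices K p" unfolding simplices_def by blast
qed

lemma boundary_edges: "c \<subseteq> K ==> boundary 2 c \<subseteq> edges K"
  using boundary_subset[of c 1] by simp

lemma boundary_boundary:
  assumes "c \<subseteq> simplices K 2"
  shows "boundary 1 (boundary 2 c) = {}"
proof -
  have "finite c" using assms finite_chain simplices_subset by blast
  then show ?thesis using assms
  proof (induction c)
    case (insert \<sigma> c)
    have "c \<subseteq> K" "{\<sigma>} \<subseteq> K" using insert.prems simplices_subset[of 2] by auto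
    then have fc: "finite (boundary 2 c)" "finite (boundary 2 {\<sigma>})"
      using finite_subset[OF boundary_edges finite_subset[OF simplices_subset[of 1] fin_K]] by blast+
    have "insert \<sigma> c = sym_diff {\<sigma>} c" using insert by auto
    then have "boundary 2 (insert \<sigma> c) = sym_diff (boundary 2 {\<sigma>}) (boundary 2 c)"
      using boundary_sym_diff[of "{\<sigma>}" c 2] insert by simp
    moreover have "card \<sigma> = 3" using insert by (auto simp: simplices_def)
    ultimately show ?case
      using boundary_sym_diff[OF fc(2,1), of 1] boundary_boundary_triangle insert by simp
  qed simp
qed

abbreviation "Z\<^sub>1 \<equiv> cycles K 1"
abbreviation "B\<^sub>1 \<equiv> boundaries K 1"

lemma cycles_iff: "z \<in> Z\<^sub>1 \<longleftrightarrow> z \<subseteq> edges K \<and> boundary 1 z = {}"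
  by (auto simp: cycles_def chains_def)

lemma boundaries_iff: "z \<in> B\<^sub>1 \<longleftrightarrow> (\<exists>c\<subseteq>simplices K 2. z = boundary 2 c)"
  by (auto simp: boundaries_def chains_def)

lemma cycles_sym_diff: assumes "z \<in> Z\<^sub>1" "z' \<in> Z\<^sub>1" shows "sym_diff z z' \<in> Z\<^sub>1"
proof -
  have "finite z" "finite z'" using assms finite_chain simplices_subset[of 1] by (auto simp: cycles_iff)
  then have "boundary 1 (sym_diff z z') = sym_diff (boundary 1 z) (boundary 1 z')" by (rule boundary_sym_diff)
  then show ?thesis using assms by (auto simp: cycles_iff)
qed

lemma boundaries_sym_diff: assumes "z \<in> B\<^sub>1" "z' \<in> B\<^sub>1" shows "sym_diff z z' \<in> B\<^sub>1"
proof -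
  obtain c c' where c: "c \<subseteq> simplices K 2" "z = boundary 2 c" "c' \<subseteq> simplices K 2" "z' = boundary 2 c'"
    using assms by (auto simp: boundaries_iff)
  moreover have "finite c" "finite c'" using c finite_chain simplices_subset[of 2] by auto
  ultimately have "sym_diff z z' = boundary 2 (sym_diff c c')"
    using boundary_sym_diff[of c c' 2] by simp
  then show ?thesis using c unfolding boundaries_iff by (intro exI[of _ "sym_diff c c'"]) auto
qed

lemma boundaries_empty: "{} \<in> B\<^sub>1"
  unfolding boundaries_iff by (intro exI[of _ "{}"]) auto

lemma boundaries_cycles: "B\<^sub>1 \<subseteq> Z\<^sub>1"
proof
  fix z assume "z \<in> B\<^sub>1"
  then obtain c where c: "c \<subseteq> simplices K 2" "z = boundary 2 c" by (auto simp: boundaries_iff)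
  moreover have "boundary 2 c \<subseteq> edges K"
    using boundary_edges[of c] c simplices_subset[of 2] by auto
  ultimately show "z \<in> Z\<^sub>1" unfolding cycles_iff using boundary_boundary by simp
qed

definition cls :: "'v set set => 'v set set set" where
  "cls z = (\<lambda>b. sym_diff b z) ` B\<^sub>1"

lemma homology_class_eq: "homology_class K 1 z = cls z"
  by (auto simp: homology_class_def cls_def a_r_coset_def' chains_def)

lemma sym_diff_cancel: "sym_diff (sym_diff a b) b = a"
  by blast

text \<open>Cosets agree iff the difference of representatives is a boundary, and modulo 2 the
  difference is again the symmetric difference.\<close>

lemma cls_eq_iff: "cls z = cls z' \<longleftrightarrow> sym_diff z z' \<in> B\<^sub>1"
proof
  assume "cls z = cls z'"
  moreover have "z \<in> cls z" unfolding cls_def using boundaries_empty by (intro image_eqI[of _ _ "{}"]) auto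
  ultimately obtain b where "b \<in> B\<^sub>1" "z = sym_diff b z'" by (auto simp: cls_def)
  then show "sym_diff z z' \<in> B\<^sub>1" using sym_diff_cancel[of b z'] by simp
next
  have sub: "cls z \<subseteq> cls z'" if "sym_diff z z' \<in> B\<^sub>1" for z z'
  proof
    fix x assume "x \<in> cls z"
    then obtain b where b: "b \<in> B\<^sub>1" "x = sym_diff b z" by (auto simp: cls_def)
    have "x = sym_diff (sym_diff b (sym_diff z z')) z'" using b by blast
    then show "x \<in> cls z'" unfolding cls_def using boundaries_sym_diff[OF b(1) that] by blast
  qed
  assume "sym_diff z z' \<in> B\<^sub>1"
  moreover from this have "sym_diff z' z \<in> B\<^sub>1" by (simp add: Un_commute)
  ultimately show "cls z = cls z'" using sub by blast
qed

lemma homology_carrier: "carrier (homology K 1) = cls ` Z\<^sub>1"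
  unfolding homology_def using homology_class_eq
  by (auto simp: A_RCOSETS_def' homology_class_def)

lemma homology_add: "cls z \<oplus>\<^bsub>homology K 1\<^esub> cls z' = cls (sym_diff z z')"
proof -
  have "cls z \<oplus>\<^bsub>homology K 1\<^esub> cls z' = {sym_diff x y | x y. x \<in> cls z \<and> y \<in> cls z'}"
    by (auto simp: homology_def set_add_def' chains_def)
  also have "\<dots> = cls (sym_diff z z')"
  proof (intro equalityI subsetI)
    fix x assume "x \<in> {sym_diff x y | x y. x \<in> cls z \<and> y \<in> cls z'}"
    then obtain x' y' where xy: "x' \<in> cls z" "y' \<in> cls z'" "x = sym_diff x' y'" by blast
    obtain b b' where "b \<in> B\<^sub>1" "x' = sym_diff b z" "b' \<in> B\<^sub>1" "y' = sym_diff b' z'"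
      using xy(1,2) unfolding cls_def by blast
    then have b: "b \<in> B\<^sub>1" "b' \<in> B\<^sub>1" "x = sym_diff (sym_diff b z) (sym_diff b' z')" using xy(3) by simp_all
    have "x = sym_diff (sym_diff b b') (sym_diff z z')" unfolding b(3) by blast
    then show "x \<in> cls (sym_diff z z')" unfolding cls_def using boundaries_sym_diff[OF b(1,2)] by blast
  next
    fix x assume "x \<in> cls (sym_diff z z')"
    then obtain b where b: "b \<in> B\<^sub>1" "x = sym_diff b (sym_diff z z')" by (auto simp: cls_def)
    have "x = sym_diff (sym_diff b z) (sym_diff {} z')" unfolding b(2) by blast
    moreover have "sym_diff b z \<in> cls z" "sym_diff {} z' \<in> cls z'"
      unfolding cls_def using b(1) boundaries_empty by blast+
    ultimately show "x \<in> {sym_diff x y | x y. x \<in> cls z \<and> y \<in> cls z'}" by blast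
  qed
  finally show ?thesis .
qed

lemma homology_zero: "\<zero>\<^bsub>homology K 1\<^esub> = cls {}"
  by (simp add: homology_def cls_def)

lemma homology_smult: "a \<odot>\<^bsub>homology K 1\<^esub> h = (if a = 1 then h else cls {})"
  by (simp add: homology_def cls_def)

lemma empty_cycle: "{} \<in> Z\<^sub>1"
  by (simp add: cycles_iff)

lemma homology_vectorspace: "vectorspace class_ring (homology K 1)"
proof (rule vs_criteria)
  have zz: "cls {} \<in> cls ` Z\<^sub>1" using empty_cycle by blast
  have d0: "cls (sym_diff z z) = cls {}" "cls (sym_diff z {}) = cls z" for z by simp_all
  show "field (class_ring :: bit ring)" by (rule class_field)
  show "\<zero>\<^bsub>homology K 1\<^esub> \<in> carrier (homology K 1)" using zz by (simp add: homology_zero homology_carrier)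
  show "\<forall>v w. v \<in> carrier (homology K 1) \<and> w \<in> carrier (homology K 1) --> v \<oplus>\<^bsub>homology K 1\<^esub> w \<in> carrier (homology K 1)"
    using cycles_sym_diff by (auto simp: homology_carrier homology_add)
  show "\<forall>v\<in>carrier (homology K 1). \<exists>neg_v\<in>carrier (homology K 1). v \<oplus>\<^bsub>homology K 1\<^esub> neg_v = \<zero>\<^bsub>homology K 1\<^esub>"
  proof
    \<comment> \<open>Modulo 2 every class is its own negative.\<close>
    fix v assume "v \<in> carrier (homology K 1)"
    moreover from this obtain z where "v = cls z" by (auto simp: homology_carrier)
    ultimately show "\<exists>neg_v\<in>carrier (homology K 1). v \<oplus>\<^bsub>homology K 1\<^esub> neg_v = \<zero>\<^bsub>homology K 1\<^esub>"
      by (intro bexI[of _ v]) (simp_all only: homology_add homology_zero d0)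
  qed
  show "\<forall>c v. c \<in> carrier class_ring \<and> v \<in> carrier (homology K 1) --> c \<odot>\<^bsub>homology K 1\<^esub> v \<in> carrier (homology K 1)"
    using zz by (simp add: homology_smult homology_carrier)
  have comm: "cls z \<oplus>\<^bsub>homology K 1\<^esub> cls z' = cls z' \<oplus>\<^bsub>homology K 1\<^esub> cls z" for z z'
    unfolding homology_add by (simp add: Un_commute)
  then show "\<forall>v w. v \<in> carrier (homology K 1) \<and> w \<in> carrier (homology K 1) --> v \<oplus>\<^bsub>homology K 1\<^esub> w = w \<oplus>\<^bsub>homology K 1\<^esub> v"
    unfolding homology_carrier by blast
  have assoc: "(cls x \<oplus>\<^bsub>homology K 1\<^esub> cls y) \<oplus>\<^bsub>homology K 1\<^esub> cls z = cls x \<oplus>\<^bsub>homology K 1\<^esub> (cls y \<oplus>\<^bsub>homology K 1\<^esub> cls z)" for x y z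
  proof -
    have "sym_diff (sym_diff x y) z = sym_diff x (sym_diff y z)" by blast
    then show ?thesis unfolding homology_add by simp
  qed
  then show "\<forall>v w x. v \<in> carrier (homology K 1) \<and> w \<in> carrier (homology K 1) \<and> x \<in> carrier (homology K 1) -->
      v \<oplus>\<^bsub>homology K 1\<^esub> w \<oplus>\<^bsub>homology K 1\<^esub> x = v \<oplus>\<^bsub>homology K 1\<^esub> (w \<oplus>\<^bsub>homology K 1\<^esub> x)"
    unfolding homology_carrier by blast
  show "\<forall>v\<in>carrier (homology K 1). v \<oplus>\<^bsub>homology K 1\<^esub> \<zero>\<^bsub>homology K 1\<^esub> = v"
    unfolding homology_carrier homology_zero by (auto simp: homology_add)
  show "\<forall>a b v. a \<in> carrier class_ring \<and> b \<in> carrier class_ring \<and> v \<in> carrier (homology K 1) -->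
      (a \<otimes>\<^bsub>class_ring\<^esub> b) \<odot>\<^bsub>homology K 1\<^esub> v = a \<odot>\<^bsub>homology K 1\<^esub> (b \<odot>\<^bsub>homology K 1\<^esub> v)"
    by (auto simp: homology_smult)
  show "\<forall>v\<in>carrier (homology K 1). \<one>\<^bsub>class_ring\<^esub> \<odot>\<^bsub>homology K 1\<^esub> v = v"
    by (simp add: homology_smult)
  show "\<forall>a b v. a \<in> carrier class_ring \<and> b \<in> carrier class_ring \<and> v \<in> carrier (homology K 1) -->
      (a \<oplus>\<^bsub>class_ring\<^esub> b) \<odot>\<^bsub>homology K 1\<^esub> v = a \<odot>\<^bsub>homology K 1\<^esub> v \<oplus>\<^bsub>homology K 1\<^esub> (b \<odot>\<^bsub>homology K 1\<^esub> v)"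
    unfolding homology_carrier by (auto simp: homology_smult homology_add)
  show "\<forall>a v w. a \<in> carrier class_ring \<and> v \<in> carrier (homology K 1) \<and> w \<in> carrier (homology K 1) -->
      a \<odot>\<^bsub>homology K 1\<^esub> (v \<oplus>\<^bsub>homology K 1\<^esub> w) = a \<odot>\<^bsub>homology K 1\<^esub> v \<oplus>\<^bsub>homology K 1\<^esub> (a \<odot>\<^bsub>homology K 1\<^esub> w)"
    unfolding homology_carrier by (auto simp: homology_smult homology_add)
qed

lemma finite_cycles: "finite Z\<^sub>1"
proof (rule finite_subset)
  show "Z\<^sub>1 \<subseteq> Pow K" using simplices_subset[of 1] cycles_iff by blast
qed (simp add: fin_K)

lemma card_homology: "card (carrier (homology K 1)) = 2 ^ homology_dim K 1"
  using vectorspace.card_carrier_eq[OF homology_vectorspace] finite_cycles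
  by (simp add: homology_carrier homology_dim_def card_UNIV_bit)

end

subsection \<open>Annotations\<close>

text \<open>All reduced columns vanish outside the used rows, so by \<open>gj_span\<close> the pivot
  columns span the whole column space.\<close>

lemma gj_sum_cols:
  assumes "pivoting piv M N q" "\<And>c i. c < q ==> i \<ge> N ==> M c i = 0" "J \<subseteq> {..<q}"
  obtains S where "S \<subseteq> pivot_cols piv q" "(\<lambda>i. \<Sum>c\<in>J. M c i) = (\<lambda>i. \<Sum>c\<in>S. M c i)"
proof -
  have fin: "finite J" using assms(3) finite_subset by blast
  have "gj piv M q (\<lambda>i. \<Sum>c\<in>J. M c i) i = 0" if "i \<notin> used_rows piv q" for i
    unfolding gj_sum[OF fin]
  proof (rule sum.neutral, rule ballI)
    fix c assume "c \<in> J"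
    then have "c < q" using assms(3) by auto
    show "gj piv M q (M c) i = 0"
      using assms(1) _ \<open>c < q\<close> that by (rule gj_col_used) (rule assms(2))
  qed
  from gj_span[OF assms(1) this] obtain S where
    "S \<subseteq> pivot_cols piv q" "(\<lambda>i. \<Sum>c\<in>J. M c i) = (\<lambda>i. \<Sum>c\<in>S. M c i)" by blast
  then show ?thesis by (rule that)
qed

lemma sum_bit_indicator: "finite A ==> (\<Sum>x\<in>A. if P x then 1 else (0::bit)) = (if odd (card {x\<in>A. P x}) then 1 else 0)"
proof (induction A rule: finite_induct)
  case (insert x A)
  have "{y \<in> insert x A. P y} = (if P x then insert x {y \<in> A. P y} else {y \<in> A. P y})" by auto
  then show ?case using insert by (auto split: if_splits)
qed simp

locale indexed_complex = finite_complex K for K :: "'v set set" +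
  fixes \<sigma> :: "nat => 'v set" and n :: nat
  assumes bij: "bij_betw \<sigma> {..<n} K"
begin

lemma \<sigma>_in: "i < n ==> \<sigma> i \<in> K"
  using bij by (auto simp: bij_betw_def)

lemma \<sigma>_inj: "i < n ==> j < n ==> \<sigma> i = \<sigma> j \<longleftrightarrow> i = j"
  using bij by (auto simp: bij_betw_def inj_on_def)

lemma \<sigma>_obtain: "s \<in> K ==> \<exists>i<n. s = \<sigma> i"
  using bij by (auto simp: bij_betw_def)

definition chain_vec :: "'v set set => nat => bit" where
  "chain_vec c i = (if i < n \<and> \<sigma> i \<in> c then 1 else 0)"

definition boundary_col :: "nat => nat => nat => bit" where
  "boundary_col p j i = (if i < n \<and> j < n \<and> card (\<sigma> i) = p \<and> card (\<sigma> j) = p + 1 \<and> \<sigma> i \<subseteq> \<sigma> j then 1 else 0)"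

lemma chain_vec_inj: "c \<subseteq> K ==> d \<subseteq> K ==> chain_vec c = chain_vec d ==> c = d"
proof -
  have sub: "c \<subseteq> d" if ck: "c \<subseteq> K" and eq: "chain_vec c = chain_vec d" for c d
  proof
    fix s assume s: "s \<in> c"
    then have "s \<in> K" using ck by blast
    then obtain i where "i < n" "s = \<sigma> i" using \<sigma>_obtain by blast
    moreover have "chain_vec c i = chain_vec d i" using eq by simp
    moreover note s
    ultimately show "s \<in> d" by (simp add: chain_vec_def split: if_splits)
  qed
  assume "c \<subseteq> K" "d \<subseteq> K" "chain_vec c = chain_vec d"
  then show "c = d" using sub[of c d] sub[of d c] by auto
qed

lemma chain_vec_sym_diff: "chain_vec (sym_diff c d) = (\<lambda>i. chain_vec c i + chain_vec d i)"
  by (auto simp: chain_vec_def fun_eq_iff)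

text \<open>The coefficient of a face is the parity of the number of its cofaces in the chain, which
  is the sum modulo 2 of the incidence entries. For \<open>p \<ge> 1\<close> this matrix column is
  indexed by the same numbers as the chains.\<close>

lemma chain_vec_boundary:
  assumes "c \<subseteq> simplices K p" "p \<ge> 1"
  shows "chain_vec (boundary p c) i = (\<Sum>j\<in>{j. j < n \<and> \<sigma> j \<in> c}. boundary_col p j i)"
proof (cases "i < n \<and> card (\<sigma> i) = p")
  case True
  then have i: "i < n" "card (\<sigma> i) = p" by auto
  have ne: "\<sigma> i \<noteq> {}" using complex \<sigma>_in[OF i(1)] unfolding simplicial_complex_def by blast
  have c: "card (\<sigma> j) = p + 1" if "\<sigma> j \<in> c" for j using that assms by (auto simp: simplices_def)
  have "(\<Sum>j\<in>{j. j < n \<and> \<sigma> j \<in> c}. boundary_col p j i) = (\<Sum>j\<in>{j. j < n \<and> \<sigma> j \<in> c}. if \<sigma> i \<subseteq> \<sigma> j then 1 else 0)"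
    using i c by (intro sum.cong) (auto simp: boundary_col_def)
  also have "\<dots> = (if odd (card {j \<in> {j. j < n \<and> \<sigma> j \<in> c}. \<sigma> i \<subseteq> \<sigma> j}) then 1 else 0)"
    by (rule sum_bit_indicator) simp
  also have "card {j \<in> {j. j < n \<and> \<sigma> j \<in> c}. \<sigma> i \<subseteq> \<sigma> j} = card {s \<in> c. \<sigma> i \<subseteq> s}"
  proof (rule bij_betw_same_card[of \<sigma>])
    have ob: "\<exists>j<n. s = \<sigma> j" if "s \<in> c" for s using \<sigma>_obtain that assms(1) simplices_subset by blast
    show "bij_betw \<sigma> {j \<in> {j. j < n \<and> \<sigma> j \<in> c}. \<sigma> i \<subseteq> \<sigma> j} {s \<in> c. \<sigma> i \<subseteq> s}"
      unfolding bij_betw_def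
    proof
      show "inj_on \<sigma> {j \<in> {j. j < n \<and> \<sigma> j \<in> c}. \<sigma> i \<subseteq> \<sigma> j}" using \<sigma>_inj by (auto simp: inj_on_def)
      show "\<sigma> ` {j \<in> {j. j < n \<and> \<sigma> j \<in> c}. \<sigma> i \<subseteq> \<sigma> j} = {s \<in> c. \<sigma> i \<subseteq> s}" using ob by fast
    qed
  qed
  finally show ?thesis using i ne by (simp add: chain_vec_def boundary_def)
next
  case False
  then have "boundary_col p j i = 0" for j by (auto simp: boundary_col_def)
  moreover have "chain_vec (boundary p c) i = 0" using False by (auto simp: chain_vec_def boundary_def)
  ultimately show ?thesis by simp
qed

end

text \<open>\<open>piv1\<close> stands for an elimination of the boundary matrix of the edges; its pivot columns are the
  edges of a spanning forest.  In the second matrix the columns of the triangles are joined by the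
  unit columns of the forest edges, so that its column space meets the cycles in the boundaries.\<close>

locale annotated_complex = indexed_complex K \<sigma> n for K :: "'v set set" and \<sigma> n +
  fixes N :: nat and piv1 piv2 :: "nat => nat"
  assumes nN: "n \<le> N" and piv1: "pivoting piv1 (boundary_col 1) N N"
begin

definition forest :: "'v set set" where
  "forest = \<sigma> ` pivot_cols piv1 N"

text \<open>Forest columns and triangle columns share one numbering without conflict: pivots of the
  first elimination are edges, whereas \<open>boundary_col 2 j\<close> is nonzero only if
  \<open>\<sigma> j\<close> is a triangle.\<close>

definition second_col :: "nat => nat => bit" where
  "second_col j = (if piv1 j \<noteq> 0 then unit_col j else boundary_col 2 j)"

lemma pivot_col_edge: assumes "j \<in> pivot_cols piv1 N" shows "j < n" "\<sigma> j \<in> edges K"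
proof -
  have "boundary_col 1 j \<noteq> (\<lambda>i. 0)"
    using pivot_cols_independent[OF piv1, of "{j}"] assms by auto
  then have "j < n \<and> card (\<sigma> j) = 1 + 1" by (auto simp: boundary_col_def fun_eq_iff split: if_splits)
  then show "j < n" "\<sigma> j \<in> edges K" using \<sigma>_in by (auto simp: simplices_def)
qed

lemma forest_edges: "forest \<subseteq> edges K"
  using pivot_col_edge by (auto simp: forest_def)

lemma forest_iff: "j < n ==> \<sigma> j \<in> forest \<longleftrightarrow> piv1 j \<noteq> 0"
proof -
  assume j: "j < n"
  have "\<sigma> j \<in> forest \<longleftrightarrow> j \<in> pivot_cols piv1 N"
    using pivot_col_edge(1) \<sigma>_inj j unfolding forest_def by blast
  then show ?thesis using j nN by (auto simp: pivot_cols_def)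
qed

text \<open>A cycle in the forest would be a vanishing sum of pivot columns, which are
  independent.\<close>

lemma forest_acyclic:
  assumes "z \<subseteq> forest" "boundary 1 z = {}"
  shows "z = {}"
proof -
  let ?J = "{j. j < n \<and> \<sigma> j \<in> z}"
  have J: "?J \<subseteq> pivot_cols piv1 N" using assms(1) forest_iff nN by (auto simp: pivot_cols_def)
  have "(\<Sum>j\<in>?J. boundary_col 1 j i) = 0" for i
    using chain_vec_boundary[of z 1 i] assms forest_edges by (simp add: chain_vec_def)
  then have "?J = {}" using pivot_cols_independent[OF piv1 J] by blast
  moreover have "z \<subseteq> K" using assms(1) forest_edges simplices_subset[of 1] by blast
  ultimately show ?thesis using \<sigma>_obtain by blast
qed

text \<open>Pivot columns span the column space of the boundary matrix, so every edge chain has the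
  boundary of some forest chain. It is used to close up arbitrary edge chains to cycles.\<close>

lemma forest_spans:
  assumes "c \<subseteq> edges K"
  obtains d where "d \<subseteq> forest" "boundary 1 d = boundary 1 c"
proof -
  let ?J = "{j. j < n \<and> \<sigma> j \<in> c}"
  have J: "?J \<subseteq> {..<N}" using nN by auto
  have z: "\<And>c i. c < N ==> N \<le> i ==> boundary_col 1 c i = 0" using nN by (simp add: boundary_col_def)
  obtain S where S: "S \<subseteq> pivot_cols piv1 N" "(\<lambda>i. \<Sum>c\<in>?J. boundary_col 1 c i) = (\<lambda>i. \<Sum>c\<in>S. boundary_col 1 c i)"
    by (rule gj_sum_cols[OF piv1 z J])
  let ?d = "\<sigma> ` S"
  have d: "?d \<subseteq> forest" using S(1) by (auto simp: forest_def)
  have "{j. j < n \<and> \<sigma> j \<in> ?d} = S" using S(1) pivot_col_edge(1) \<sigma>_inj by blast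
  then have "chain_vec (boundary 1 ?d) i = (\<Sum>c\<in>S. boundary_col 1 c i)" for i
    using chain_vec_boundary[of ?d 1 i] d forest_edges by simp
  moreover have "chain_vec (boundary 1 c) i = (\<Sum>c\<in>?J. boundary_col 1 c i)" for i
    using chain_vec_boundary[of c 1 i] assms by simp
  ultimately have "chain_vec (boundary 1 ?d) = chain_vec (boundary 1 c)"
    using S(2) by (simp add: fun_eq_iff)
  moreover have "?d \<subseteq> K" "c \<subseteq> K" using d forest_edges assms simplices_subset[of 1] by blast+
  then have bd: "boundary (0 + 1) ?d \<subseteq> simplices K 0" "boundary (0 + 1) c \<subseteq> simplices K 0" using boundary_subset by blast+
  then have "boundary 1 ?d \<subseteq> K" "boundary 1 c \<subseteq> K" using simplices_subset[of 0] bd by auto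
  ultimately have "boundary 1 ?d = boundary 1 c" using chain_vec_inj by blast
  then show ?thesis using that d by blast
qed

lemma second_col_support: "i \<notin> {i. i < n \<and> card (\<sigma> i) = 2} ==> j < N ==> second_col j i = 0"
proof (cases "piv1 j = 0")
  case False
  assume "i \<notin> {i. i < n \<and> card (\<sigma> i) = 2}" "j < N"
  moreover from this have "j \<in> pivot_cols piv1 N" using False by (simp add: pivot_cols_def)
  ultimately have "i \<noteq> j" using pivot_col_edge[of j] by (auto simp: simplices_def)
  then show ?thesis using False by (simp add: second_col_def)
qed (auto simp: second_col_def boundary_col_def)

definition free_rows :: "nat set" where
  "free_rows = {i. i < n \<and> card (\<sigma> i) = 2 \<and> i \<notin> used_rows piv2 N}"

text \<open>After elimination the column space occupies the used rows, so the entries in the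
  remaining rows are linear coordinates of the chain modulo that space.\<close>

definition annotation :: "'v set set => nat set" where
  "annotation c = {i \<in> free_rows. gj piv2 second_col N (chain_vec c) i = 1}"

lemma annotation_sym_diff: "annotation (sym_diff c d) = sym_diff (annotation c) (annotation d)"
proof -
  have "gj piv2 second_col N (chain_vec (sym_diff c d)) i =
      gj piv2 second_col N (chain_vec c) i + gj piv2 second_col N (chain_vec d) i" for i
    unfolding chain_vec_sym_diff gj_linear by simp
  moreover have "x + y = 1 \<longleftrightarrow> (x = 1) \<noteq> (y = (1::bit))" for x y
    by (cases x; cases y) auto
  ultimately show ?thesis unfolding annotation_def by auto
qed

lemma annotation_empty: "annotation {} = {}"
proof -
  have "chain_vec {} = (\<lambda>i. 0)" by (simp add: chain_vec_def fun_eq_iff)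
  then show ?thesis by (simp add: annotation_def gj_zero)
qed

context
  assumes piv2: "pivoting piv2 second_col N N"
begin

lemma second_col_used: "j < N ==> i \<notin> used_rows piv2 N ==> gj piv2 second_col N (second_col j) i = 0"
  by (rule gj_col_used[OF piv2]) (use second_col_support nN in auto)

lemma annotation_forest: "c \<subseteq> forest ==> annotation c = {}"
proof -
  assume c: "c \<subseteq> forest"
  let ?J = "{j. j < n \<and> \<sigma> j \<in> c}"
  have "chain_vec c i = (\<Sum>j\<in>?J. second_col j i)" for i
  proof -
    have "(\<Sum>j\<in>?J. second_col j i) = (\<Sum>j\<in>?J. if j = i then 1 else 0)"
      using c forest_iff by (intro sum.cong) (auto simp: second_col_def unit_col_def)
    then show ?thesis by (simp add: chain_vec_def)
  qed
  then have "chain_vec c = (\<lambda>i. \<Sum>j\<in>?J. second_col j i)" by (rule ext)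
  then have "gj piv2 second_col N (chain_vec c) = (\<lambda>i. \<Sum>j\<in>?J. gj piv2 second_col N (second_col j) i)"
    by (simp add: gj_sum)
  then show ?thesis using second_col_used nN by (auto simp: annotation_def free_rows_def intro!: sum.neutral)
qed

text \<open>No pivot of the first elimination is a triangle, so the triangle columns occur
  unreplaced in the second matrix. A boundary is a sum of them, and reduced columns vanish outside
  the used rows.\<close>

lemma annotation_boundary: "z \<in> B\<^sub>1 ==> annotation z = {}"
proof -
  assume "z \<in> B\<^sub>1"
  then obtain c where c: "c \<subseteq> simplices K 2" "z = boundary 2 c" by (auto simp: boundaries_iff)
  let ?J = "{j. j < n \<and> \<sigma> j \<in> c}"
  have ne: "piv1 j = 0" if "j \<in> ?J" for j
  proof (rule ccontr)
    assume "piv1 j \<noteq> 0"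
    then have "\<sigma> j \<in> edges K" using pivot_col_edge[of j] that nN by (auto simp: pivot_cols_def)
    then show False using that c by (auto simp: simplices_def)
  qed
  have "chain_vec z i = (\<Sum>j\<in>?J. boundary_col 2 j i)" for i using chain_vec_boundary[of c 2] c by simp
  also have "\<dots> i = (\<Sum>j\<in>?J. second_col j i)" for i
    using ne by (intro sum.cong) (auto simp: second_col_def)
  finally have "chain_vec z = (\<lambda>i. \<Sum>j\<in>?J. second_col j i)" by (rule ext)
  then have "gj piv2 second_col N (chain_vec z) = (\<lambda>i. \<Sum>j\<in>?J. gj piv2 second_col N (second_col j) i)"
    by (simp add: gj_sum)
  then show ?thesis using second_col_used nN by (auto simp: annotation_def free_rows_def intro!: sum.neutral)
qed

lemma chain_gj_support:
  assumes "c \<subseteq> edges K" "i \<notin> {i. i < n \<and> card (\<sigma> i) = 2}"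
  shows "gj piv2 second_col N (chain_vec c) i = 0"
proof (rule gj_support[OF piv2])
  show "\<And>c i. c < N ==> i \<notin> {i. i < n \<and> card (\<sigma> i) = 2} ==> second_col c i = 0" by (rule second_col_support)
  show "\<And>i. i \<notin> {i. i < n \<and> card (\<sigma> i) = 2} ==> chain_vec c i = 0"
    using assms by (auto simp: chain_vec_def simplices_def)
qed fact

text \<open>Such a cycle is a sum of columns of the second matrix, that is, of forest edges and of
  boundaries of triangles. The forest part is then a cycle as well, hence empty.\<close>

lemma annotation_zero:
  assumes "z \<in> Z\<^sub>1" "annotation z = {}"
  shows "z \<in> B\<^sub>1"
proof -
  have ze: "z \<subseteq> edges K" "boundary 1 z = {}" using assms(1) by (auto simp: cycles_iff)
  have "gj piv2 second_col N (chain_vec z) i = 0" if "i \<notin> used_rows piv2 N" for i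
  proof (cases "i < n \<and> card (\<sigma> i) = 2")
    case True
    then have "i \<in> free_rows" using that by (simp add: free_rows_def)
    then show ?thesis using assms(2) by (auto simp: annotation_def)
  qed (use chain_gj_support[OF ze(1), of i] in auto)
  from gj_span[OF piv2 this] obtain S where S: "S \<subseteq> pivot_cols piv2 N"
    "chain_vec z = (\<lambda>i. \<Sum>j\<in>S. second_col j i)" by blast
  define F where "F = {j \<in> S. piv1 j \<noteq> 0}"
  define T where "T = {j \<in> S. piv1 j = 0 \<and> j < n \<and> card (\<sigma> j) = 3}"
  have FS: "F \<subseteq> S" by (auto simp: F_def)
  have finS: "finite S" using S(1) finite_subset finite_pivot_cols by blast
  have SN: "j < N" if "j \<in> S" for j using S(1) that by (auto simp: pivot_cols_def)
  have F: "\<sigma> ` F \<subseteq> forest" "\<And>j. j \<in> F ==> j < n" using SN pivot_col_edge(1)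
    by (auto simp: F_def forest_def pivot_cols_def)
  have T: "\<sigma> ` T \<subseteq> simplices K 2" using \<sigma>_in by (auto simp: T_def simplices_def)
  have JT: "{j. j < n \<and> \<sigma> j \<in> \<sigma> ` T} = T" using \<sigma>_inj by (auto simp: T_def)
  have "chain_vec z i = chain_vec (\<sigma> ` F) i + chain_vec (boundary 2 (\<sigma> ` T)) i" for i
  proof -
    have "chain_vec z i = (\<Sum>j\<in>S. second_col j i)" using S(2) by simp
    also have "\<dots> = (\<Sum>j\<in>F. second_col j i) + (\<Sum>j\<in>S - F. second_col j i)"
      using sum.subset_diff[OF FS finS, of "\<lambda>j. second_col j i"] by (simp add: add.commute)
    also have "(\<Sum>j\<in>F. second_col j i) = (\<Sum>j\<in>F. if j = i then 1 else 0)"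
      by (intro sum.cong) (auto simp: F_def second_col_def unit_col_def)
    also have "\<dots> = chain_vec (\<sigma> ` F) i"
      using finS F(2) \<sigma>_inj by (auto simp: F_def chain_vec_def)
    also have "(\<Sum>j\<in>S - F. second_col j i) = (\<Sum>j\<in>T. second_col j i)"
      using finS by (intro sum.mono_neutral_right) (auto simp: F_def T_def second_col_def boundary_col_def)
    also have "\<dots> = (\<Sum>j\<in>T. boundary_col 2 j i)"
      by (intro sum.cong) (auto simp: T_def second_col_def)
    also have "\<dots> = chain_vec (boundary 2 (\<sigma> ` T)) i"
      using chain_vec_boundary[OF T, of i] JT by simp
    finally show ?thesis .
  qed
  then have "chain_vec z = chain_vec (sym_diff (\<sigma> ` F) (boundary 2 (\<sigma> ` T)))"
    unfolding chain_vec_sym_diff by (rule ext)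
  moreover have bT: "boundary 2 (\<sigma> ` T) \<in> B\<^sub>1" using T by (auto simp: boundaries_iff)
  moreover have bK: "boundary 2 (\<sigma> ` T) \<subseteq> edges K" using bT boundaries_cycles cycles_iff by blast
  ultimately have z: "z = sym_diff (\<sigma> ` F) (boundary 2 (\<sigma> ` T))"
    using F(1) forest_edges ze(1) simplices_subset[of 1] by (intro chain_vec_inj) blast+
  then have f: "\<sigma> ` F = sym_diff z (boundary 2 (\<sigma> ` T))" by blast
  have "sym_diff z (boundary 2 (\<sigma> ` T)) \<in> Z\<^sub>1"
    using cycles_sym_diff[OF assms(1)] bT boundaries_cycles by blast
  then have "boundary 1 (\<sigma> ` F) = {}" unfolding f cycles_iff by simp
  then have "\<sigma> ` F = {}" using forest_acyclic F(1) by blast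
  then show ?thesis using z bT by simp
qed

lemma annotation_eq_iff:
  assumes "z \<in> Z\<^sub>1" "z' \<in> Z\<^sub>1"
  shows "annotation z = annotation z' \<longleftrightarrow> cls z = cls z'"
proof -
  have "annotation z = annotation z' \<longleftrightarrow> annotation (sym_diff z z') = {}"
    unfolding annotation_sym_diff by blast
  also have "\<dots> \<longleftrightarrow> sym_diff z z' \<in> B\<^sub>1"
    using annotation_zero[OF cycles_sym_diff[OF assms]] annotation_boundary by blast
  finally show ?thesis by (simp add: cls_eq_iff)
qed

text \<open>The edges numbered by \<open>S\<close> have annotation \<open>S\<close>, since
  elimination fixes vectors that vanish in the used rows. A forest chain closes them up to a cycle
  and contributes no annotation.\<close>

lemma annotation_surj:
  assumes "S \<subseteq> free_rows"
  obtains z where "z \<in> Z\<^sub>1" "annotation z = S"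
proof -
  let ?c = "\<sigma> ` S"
  have c: "?c \<subseteq> edges K" using assms \<sigma>_in by (auto simp: free_rows_def simplices_def)
  have cv: "chain_vec ?c i = (if i \<in> S then 1 else 0)" for i
    using assms \<sigma>_inj by (auto simp: chain_vec_def free_rows_def image_iff)
  have "gj piv2 second_col N (chain_vec ?c) = chain_vec ?c"
    by (rule gj_unused) (use assms cv in \<open>auto simp: free_rows_def\<close>)
  then have ac: "annotation ?c = S" using assms cv by (auto simp: annotation_def)
  obtain d where d: "d \<subseteq> forest" "boundary 1 d = boundary 1 ?c" using forest_spans[OF c] by blast
  have "d \<subseteq> K" "?c \<subseteq> K" using d(1) c forest_edges simplices_subset[of 1] by blast+
  then have "finite d" "finite ?c" by (auto intro: finite_chain)
  then have "boundary 1 (sym_diff d ?c) = {}" using boundary_sym_diff[of d ?c 1] d(2) by simp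
  then have "sym_diff d ?c \<in> Z\<^sub>1" using c d(1) forest_edges unfolding cycles_iff by blast
  moreover have "annotation (sym_diff d ?c) = S"
    unfolding annotation_sym_diff using ac annotation_forest[OF d(1)] by simp
  ultimately show ?thesis by (rule that)
qed

text \<open>Annotation induces a bijection from homology classes to subsets of
  \<open>free_rows\<close>, so both \<open>2 ^ card free_rows\<close> and
  \<open>2 ^ homology_dim K 1\<close> count the classes.\<close>

lemma card_free_rows: "card free_rows = homology_dim K 1"
proof -
  have fin: "finite free_rows" by (rule finite_subset[of _ "{..<n}"]) (auto simp: free_rows_def)
  define f where "f h = annotation (SOME z. z \<in> Z\<^sub>1 \<and> cls z = h)" for h
  have f: "f (cls z) = annotation z" if "z \<in> Z\<^sub>1" for z
  proof -
    have "(SOME z'. z' \<in> Z\<^sub>1 \<and> cls z' = cls z) \<in> Z\<^sub>1 \<and> cls (SOME z'. z' \<in> Z\<^sub>1 \<and> cls z' = cls z) = cls z"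
      by (rule someI[of _ z]) (use that in simp)
    then show ?thesis unfolding f_def using annotation_eq_iff that by blast
  qed
  have "bij_betw f (carrier (homology K 1)) (Pow free_rows)"
    unfolding bij_betw_def homology_carrier
  proof
    show "inj_on f (cls ` Z\<^sub>1)" using f annotation_eq_iff by (auto simp: inj_on_def)
    have "annotation z \<in> Pow free_rows" for z by (auto simp: annotation_def)
    moreover have "S \<in> f ` cls ` Z\<^sub>1" if S: "S \<subseteq> free_rows" for S
    proof -
      obtain z where "z \<in> Z\<^sub>1" "annotation z = S" using annotation_surj[OF S] by blast
      then show ?thesis using f by blast
    qed
    ultimately show "f ` cls ` Z\<^sub>1 = Pow free_rows" using f by (metis (no_types, lifting) Pow_iff image_cong image_image image_subsetI subsetI subset_antisym)
  qed
  then have "card (carrier (homology K 1)) = 2 ^ card free_rows"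
    using fin by (simp add: bij_betw_same_card card_Pow)
  then show ?thesis using card_homology by simp
qed

text \<open>In the expansion of a unit vector only the block column with pivot row \<open>e\<close>
  survives. The unit vector itself adds nothing then, because \<open>i\<close> is not a used row.
  Annotations can thus be read off the result of the elimination.\<close>

lemma annotation_edge:
  assumes "e < n" "i \<in> free_rows"
  shows "i \<in> annotation {\<sigma> e} \<longleftrightarrow>
    (if e \<in> used_rows piv2 N then \<exists>y<N. piv2 y = Suc e \<and> block_col piv2 second_col 0 N y i = 1 else e = i)"
proof -
  have cv: "chain_vec {\<sigma> e} = unit_col e"
    using assms(1) \<sigma>_inj by (auto simp: chain_vec_def unit_col_def fun_eq_iff)
  have i: "i \<notin> used_rows piv2 N" using assms(2) by (simp add: free_rows_def)
  have ex: "gj piv2 second_col N (unit_col e) i = unit_col e i +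
     (\<Sum>y<N. if piv2 y = 0 then 0 else block_col piv2 second_col 0 N y i * unit_col e (piv2 y - 1))"
    by (rule gj_expand[OF piv2])
  show ?thesis
  proof (cases "e \<in> used_rows piv2 N")
    case True
    then obtain y where y: "y < N" "piv2 y = Suc e" by (auto simp: used_rows_def)
    have un: "y' = y" if "y' < N" "piv2 y' = Suc e" for y'
      using pivoting_distinct[OF piv2, of y' y] y that by auto
    have "(\<Sum>y'<N. if piv2 y' = 0 then 0 else block_col piv2 second_col 0 N y' i * unit_col e (piv2 y' - 1)) =
       (\<Sum>y'<N. if y' = y then block_col piv2 second_col 0 N y i else 0)"
    proof (rule sum.cong)
      fix y' assume "y' \<in> {..<N}"
      then have "y' \<noteq> y ==> piv2 y' \<noteq> 0 ==> piv2 y' - 1 \<noteq> e" using un[of y'] by auto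
      then show "(if piv2 y' = 0 then 0 else block_col piv2 second_col 0 N y' i * unit_col e (piv2 y' - 1)) =
        (if y' = y then block_col piv2 second_col 0 N y i else 0)"
        using y by (auto simp: unit_col_def)
    qed simp
    also have "\<dots> = block_col piv2 second_col 0 N y i" using y by simp
    finally have "gj piv2 second_col N (unit_col e) i = block_col piv2 second_col 0 N y i"
      using ex True i by (auto simp: unit_col_def)
    moreover have "(\<exists>y<N. piv2 y = Suc e \<and> block_col piv2 second_col 0 N y i = 1) \<longleftrightarrow>
        block_col piv2 second_col 0 N y i = 1" using y un by blast
    ultimately show ?thesis using True assms(2) by (simp add: annotation_def cv)
  next
    case False
    then have "gj piv2 second_col N (unit_col e) = unit_col e"
      by (intro gj_unused) (auto simp: unit_col_def)
    then show ?thesis using False assms(2) by (auto simp: annotation_def cv unit_col_def)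
  qed
qed

end

end

section \<open>A tournament tree as priority queue\<close>

definition lex_le :: "real \<times> nat => real \<times> nat => bool" where
  "lex_le p q \<longleftrightarrow> fst p < fst q \<or> fst p = fst q \<and> snd p \<le> snd q"

lemma lex_le_refl [simp]: "lex_le p p"
  by (simp add: lex_le_def)

lemma lex_le_trans: "lex_le p q ==> lex_le q r ==> lex_le p r"
  by (auto simp: lex_le_def)

lemma lex_le_total: "lex_le p q \<or> lex_le q p"
  by (auto simp: lex_le_def)

lemma lex_le_add: "0 \<le> w ==> lex_le p (fst p + w, snd p + c)"
  by (auto simp: lex_le_def)

text \<open>Heap numbering: the leaf of \<open>x\<close> is \<open>Q + x\<close>, and halving leads
  to the parent, so the nodes above \<open>x\<close> are the iterated halves.\<close>

definition under :: "nat => nat => nat => bool" where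
  "under Q i x \<longleftrightarrow> (\<exists>d. (Q + x) div 2 ^ d = i)"

lemma under_leaf: "x < Q ==> under Q (Q + x) y ==> y < Q ==> y = x"
proof -
  assume a: "x < Q" "under Q (Q + x) y" "y < Q"
  then obtain d where d: "(Q + y) div 2 ^ d = Q + x" by (auto simp: under_def)
  have "d = 0"
  proof (rule ccontr)
    assume "d \<noteq> 0"
    then have "(2::nat) ^ 1 \<le> 2 ^ d" by (intro power_increasing) auto
    then have "(Q + y) div 2 ^ d \<le> (Q + y) div 2" by (intro div_le_mono2) auto
    also have "\<dots> < Q" using a by auto
    finally show False using d by simp
  qed
  then show ?thesis using d by simp
qed

lemma under_leaf_self: "under Q (Q + x) x"
  unfolding under_def by (rule exI[of _ 0]) simp

lemma under_half: "under Q i x ==> under Q (i div 2) x"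
proof -
  assume "under Q i x"
  then obtain d where "(Q + x) div 2 ^ d = i" by (auto simp: under_def)
  then have "(Q + x) div 2 ^ Suc d = i div 2" by (metis div_mult2_eq power_Suc2)
  then show ?thesis unfolding under_def by blast
qed

lemma under_children:
  assumes "1 \<le> i" "i < Q"
  shows "under Q i x \<longleftrightarrow> under Q (2 * i) x \<or> under Q (2 * i + 1) x"
proof
  assume "under Q i x"
  then obtain d where d: "(Q + x) div 2 ^ d = i" by (auto simp: under_def)
  then have "d \<noteq> 0" using assms by (intro notI) auto
  then obtain e where e: "d = Suc e" by (cases d) auto
  have "((Q + x) div 2 ^ e) div 2 = i" using d e by (metis div_mult2_eq power_Suc2)
  moreover have "m = 2 * i \<or> m = 2 * i + 1" if "m div 2 = i" for m using that by presburger
  ultimately have "(Q + x) div 2 ^ e = 2 * i \<or> (Q + x) div 2 ^ e = 2 * i + 1" by blast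
  then show "under Q (2 * i) x \<or> under Q (2 * i + 1) x" unfolding under_def by blast
next
  assume "under Q (2 * i) x \<or> under Q (2 * i + 1) x"
  then show "under Q i x" using under_half[of Q "2 * i" x] under_half[of Q "2 * i + 1" x] by auto
qed

text \<open>The ancestors of a leaf are linearly ordered by halving, so nothing above the leaf lies
  strictly between a node of the chain and its parent.\<close>

lemma under_chain:
  assumes "under Q i x" "under Q j x" "j < i"
  shows "j \<le> i div 2"
proof -
  obtain d e where d: "(Q + x) div 2 ^ d = i" "(Q + x) div 2 ^ e = j" using assms by (auto simp: under_def)
  have "d < e"
  proof (rule ccontr)
    assume "\<not> d < e"
    then have "(2::nat) ^ e \<le> 2 ^ d" by (intro power_increasing) auto
    then have "i \<le> j" using d div_le_mono2[of "2 ^ e" "2 ^ d" "Q + x"] by auto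
    then show False using assms by simp
  qed
  then have "(2::nat) ^ Suc d \<le> 2 ^ e" by (intro power_increasing) auto
  then have "j \<le> (Q + x) div 2 ^ Suc d" using d div_le_mono2[of "2 ^ Suc d" "2 ^ e" "Q + x"] by auto
  also have "\<dots> = i div 2" using d by (metis div_mult2_eq power_Suc2)
  finally show ?thesis .
qed

lemma under_root: "x < Q ==> Q = 2 ^ L ==> under Q 1 x"
  unfolding under_def by (intro exI[of _ L] div_nat_eqI) auto

text \<open>Winners are stored plus one, so that zero can mean that no leaf below takes
  part.\<close>

definition node_ok :: "nat => (nat => bool) => (nat => real \<times> nat) => (nat => nat) => nat => bool" where
  "node_ok Q act key tr i \<longleftrightarrow> (if tr i = 0 then \<forall>x<Q. under Q i x --> \<not> act x
     else tr i - 1 < Q \<and> act (tr i - 1) \<and> under Q i (tr i - 1) \<and>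
       (\<forall>x<Q. under Q i x \<and> act x --> lex_le (key (tr i - 1)) (key x)))"

definition tree_ok :: "nat => (nat => bool) => (nat => real \<times> nat) => (nat => nat) => bool" where
  "tree_ok Q act key tr \<longleftrightarrow> (\<forall>i. 1 \<le> i \<and> i < 2 * Q --> node_ok Q act key tr i)"

lemma node_ok_leaf:
  assumes "x < Q" "tr (Q + x) = (if act x then Suc x else 0)"
  shows "node_ok Q act key tr (Q + x)"
  using under_leaf_self[of Q x] assms unfolding node_ok_def by (auto dest: under_leaf[OF assms(1)])

lemma node_ok_cong:
  assumes "node_ok Q act key tr i" "\<not> under Q i y" "tr' i = tr i"
    "\<And>x. x \<noteq> y ==> act' x = act x" "\<And>x. x \<noteq> y ==> key' x = key x"
  shows "node_ok Q act' key' tr' i"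
proof -
  have "act' x = act x \<and> key' x = key x" if "under Q i x" for x using assms(2,4,5) that by metis
  then show ?thesis using assms(1,3) unfolding node_ok_def by (auto split: if_splits)
qed

lemma node_ok_parent:
  assumes l: "node_ok Q act key tr (2 * i)" and r: "node_ok Q act key tr (2 * i + 1)" and i: "1 \<le> i" "i < Q"
    and tr: "tr' i = (if tr (2 * i) = 0 then tr (2 * i + 1) else if tr (2 * i + 1) = 0 then tr (2 * i)
      else if lex_le (key (tr (2 * i) - 1)) (key (tr (2 * i + 1) - 1)) then tr (2 * i) else tr (2 * i + 1))"
  shows "node_ok Q act key tr' i"
proof -
  note u = under_children[OF i]
  let ?l = "tr (2 * i)" and ?r = "tr (2 * i + 1)"
  consider "?l = 0" "?r = 0" | "?l = 0" "?r \<noteq> 0" | "?l \<noteq> 0" "?r = 0"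
    | "?l \<noteq> 0" "?r \<noteq> 0" "lex_le (key (?l - 1)) (key (?r - 1))"
    | "?l \<noteq> 0" "?r \<noteq> 0" "\<not> lex_le (key (?l - 1)) (key (?r - 1))" by blast
  then show ?thesis
  proof cases
    case 5
    then have "lex_le (key (?r - 1)) (key (?l - 1))" using lex_le_total by blast
    then have "lex_le (key (?r - 1)) (key x)" if "x < Q" "under Q (2 * i) x" "act x" for x
      using l 5 that lex_le_trans unfolding node_ok_def by auto
    then show ?thesis using r 5 tr unfolding node_ok_def by (auto simp: u)
  next
    case 4
    then have "lex_le (key (?l - 1)) (key x)" if "x < Q" "under Q (2 * i + 1) x" "act x" for x
      using r that lex_le_trans unfolding node_ok_def by auto
    then show ?thesis using l 4 tr unfolding node_ok_def by (auto simp: u)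
  qed (use l r tr in \<open>auto simp: node_ok_def u\<close>)
qed

lemma node_ok_tr_cong: "tr' i = tr i ==> node_ok Q act key tr' i = node_ok Q act key tr i"
  by (simp add: node_ok_def)

lemma tree_ok_root:
  assumes "tree_ok Q act key tr" "Q = 2 ^ L"
  shows "tr 1 = 0 ==> x < Q ==> \<not> act x"
    "tr 1 \<noteq> 0 ==> tr 1 - 1 < Q \<and> act (tr 1 - 1) \<and> (\<forall>x<Q. act x --> lex_le (key (tr 1 - 1)) (key x))"
proof -
  have "1 \<le> Q" using assms(2) by simp
  then have "1 < 2 * Q" by linarith
  then have "node_ok Q act key tr 1" using assms(1) by (simp add: tree_ok_def)
  then show "tr 1 = 0 ==> x < Q ==> \<not> act x"
    "tr 1 \<noteq> 0 ==> tr 1 - 1 < Q \<and> act (tr 1 - 1) \<and> (\<forall>x<Q. act x --> lex_le (key (tr 1 - 1)) (key x))"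
    using under_root[OF _ assms(2)] unfolding node_ok_def by auto
qed

text \<open>The depth of a node in heap numbering, used as the measure for climbing to the
  root.\<close>

fun halvings :: "nat => nat" where
  "halvings m = (if m < 2 then 0 else Suc (halvings (m div 2)))"

declare halvings.simps [simp del]

lemma halvings_le: "m < 2 * 2 ^ L ==> halvings m \<le> L"
proof (induction L arbitrary: m)
  case 0
  then show ?case by (simp add: halvings.simps)
next
  case (Suc L)
  have "halvings (m div 2) \<le> L" by (rule Suc.IH) (use Suc.prems in auto)
  then show ?case by (simp add: halvings.simps[of m])
qed

section \<open>The tournament on the machine\<close>

abbreviation (input) "vQ \<equiv> 21 :: nat"
abbreviation (input) "vy \<equiv> 24 :: nat"
abbreviation (input) "vk \<equiv> 25 :: nat"
abbreviation (input) "vlft \<equiv> 28 :: nat"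
abbreviation (input) "vrgt \<equiv> 29 :: nat"
abbreviation (input) "aStat \<equiv> 25 :: nat"
abbreviation (input) "aCnt \<equiv> 26 :: nat"
abbreviation (input) "aTree \<equiv> 28 :: nat"
abbreviation (input) "rDist \<equiv> 2 :: nat"

definition node_key :: "machine_state => nat => real \<times> nat" where
  "node_key s x = (rarr s rDist x, warr s aCnt x)"

text \<open>Weights admit only the test \<open>\<le>\<close>, so equality of the first components is
  expressed by both inequalities.\<close>

definition lex_test :: "real_exp => word_exp => real_exp => word_exp => test" where
  "lex_test d c d' c' = Conj (RLeq d d') (Neg (Conj (RLeq d' d) (Neg (Leq c c'))))"

lemma lex_test_val [simp]:
  "test_val (lex_test d c d' c') s \<longleftrightarrow> lex_le (real_val d s, word_val c s) (real_val d' s, word_val c' s)"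
  by (auto simp: lex_test_def lex_le_def)

lemma lex_test_words [simp]:
  "test_words (lex_test d c d' c') s = real_words d s \<union> real_words d' s \<union> word_words c s \<union> word_words c' s"
  by (auto simp: lex_test_def)

lemma lex_test_cost [simp]:
  "test_cost (lex_test d c d' c') = 7 + 2 * real_cost d + 2 * real_cost d' + word_cost c + word_cost c'"
  by (simp add: lex_test_def)

definition play :: com where
  "play = (vlft ::= Load aTree (Const 2 *. Var vk)) ;;
     (vrgt ::= Load aTree (Const 2 *. Var vk +. Const 1)) ;;
     Cond (Leq (Var vlft) (Const 0)) (Store aTree (Var vk) (Var vrgt))
       (Cond (Leq (Var vrgt) (Const 0)) (Store aTree (Var vk) (Var vlft))
         (Cond (lex_test (RLoad rDist (Var vlft -. Const 1)) (Load aCnt (Var vlft -. Const 1))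
                         (RLoad rDist (Var vrgt -. Const 1)) (Load aCnt (Var vrgt -. Const 1)))
           (Store aTree (Var vk) (Var vlft)) (Store aTree (Var vk) (Var vrgt))))"

definition fix_up :: com where
  "fix_up = (vk ::= Var vQ +. Var vy) ;;
     While (Leq (Const 2) (Var vk)) ((vk ::= Var vk div. Const 2) ;; play)"

lemma fix_up_names [simp]:
  "wvars_of fix_up = {vk, vlft, vrgt}" "warrs_of fix_up = {aTree}" "rvars_of fix_up = {}" "rarrs_of fix_up = {}"
  "wvars_of play = {vlft, vrgt}" "warrs_of play = {aTree}" "rvars_of play = {}" "rarrs_of play = {}"
  by (auto simp: fix_up_def play_def)

lemma run_play:
  assumes ws: "word_state W s" and k: "wvar s vk = i" "1 \<le> i" "2 * i + 1 \<le> W"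
  shows "run W play s (\<lambda>t s'. t \<le> 60 \<and> warr s' aTree = (warr s aTree)(i :=
     (let l = warr s aTree (2 * i); r = warr s aTree (2 * i + 1) in
      if l = 0 then r else if r = 0 then l else if lex_le (node_key s (l - 1)) (node_key s (r - 1)) then l else r)))"
proof -
  have w: "warr s a j \<le> W" for a j using word_stateD(2)[OF ws] .
  have "i \<le> W" "2 * i \<le> W" "2 \<le> W" "1 \<le> W" using k by linarith+
  then show ?thesis using k w[of aTree] w[of aCnt]
    by (simp add: play_def run_simps node_key_def Let_def diff_le_self[THEN order_trans])
qed

text \<open>A change at one leaf invalidates at most its proper ancestors. Replaying their matches
  from below repairs them one by one, and there are \<open>L\<close> of them.\<close>

lemma run_fix_up:
  assumes ws: "word_state W s" and v: "wvar s vQ = Q" "wvar s vy = y" "y < Q" "Q = 2 ^ L" and W: "2 * Q + 10 \<le> W"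
    and ok: "\<And>i. 1 \<le> i ==> i < 2 * Q ==> \<not> (under Q i y \<and> i < Q + y) ==> node_ok Q act (node_key s) (warr s aTree) i"
  shows "run W fix_up s (\<lambda>t s'. t \<le> 80 * L + 20 \<and> tree_ok Q act (node_key s) (warr s' aTree))"
proof -
  let ?s1 = "set_wvar vk (Q + y) s"
  let ?B = "(vk ::= Var vk div. Const 2) ;; play"
  let ?I = "\<lambda>s'. 1 \<le> wvar s' vk \<and> wvar s' vk < 2 * Q \<and> under Q (wvar s' vk) y \<and>
    (\<forall>i. 1 \<le> i \<and> i < 2 * Q \<and> \<not> (under Q i y \<and> i < wvar s' vk) --> node_ok Q act (node_key s) (warr s' aTree) i)"
  have Q0: "1 \<le> Q" using v by simp
  have main: "run W (While (Leq (Const 2) (Var vk)) ?B) ?s1 (\<lambda>t s'. t \<le> 80 * L + 10 \<and> tree_ok Q act (node_key s) (warr s' aTree))"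
  proof (rule run_While[where I = ?I and \<Phi> = "\<lambda>s'. 80 * halvings (wvar s' vk)"])
    show "word_state W ?s1" using ws v W by (auto simp: word_state_def)
    show "?I ?s1" using v Q0 ok under_leaf_self by auto
  next
    fix s' assume "word_state W s'" "?I s'"
    then show "test_words (Leq (Const 2) (Var vk)) s' \<subseteq> {..W}" using W by simp
  next
    fix s' assume ws': "word_state W s'" and fr: "frame ?B ?s1 s'" and I: "?I s'" and b: "test_val (Leq (Const 2) (Var vk)) s'"
    note fr' = frameD[OF fr]
    define k where "k = wvar s' vk"
    define j where "j = k div 2"
    have k2: "2 \<le> k" using b by (simp add: k_def)
    have kQ: "k < 2 * Q" using I by (simp add: k_def)
    have j: "1 \<le> j" "j < Q" using k2 kQ unfolding j_def by auto
    let ?s2 = "set_wvar vk j s'"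
    have ws2: "word_state W ?s2" using ws' W j by (auto simp: word_state_def)
    have uj: "under Q j y" using under_half I unfolding j_def k_def by blast
    have keyeq: "node_key s' = node_key s" by (simp add: node_key_def fun_eq_iff fr')
    have good: "node_ok Q act (node_key s) (warr s' aTree) i" if "1 \<le> i" "i < 2 * Q" "\<not> (under Q i y \<and> i < k)" for i
      using I that by (simp add: k_def)
    \<comment> \<open>An ancestor of \<open>y\<close> below \<open>k\<close> is at most
      \<open>k div 2 = j\<close> by \<open>under_chain\<close>, and so it is not a child of
      \<open>j\<close>. Hence both children are already correct.\<close>
    have child: "node_ok Q act (node_key s) (warr s' aTree) c" if c: "c = 2 * j \<or> c = 2 * j + 1" for c
    proof (rule good)
      show "1 \<le> c" "c < 2 * Q" using c j by auto
      show "\<not> (under Q c y \<and> c < k)"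
      proof
        assume "under Q c y \<and> c < k"
        then have "c \<le> j" using under_chain[of Q k y c] I unfolding j_def k_def by blast
        then show False using c j by auto
      qed
    qed
    have "2 * j + 1 \<le> W" using j W by linarith
    have "run W play ?s2 (\<lambda>t s''. t \<le> 60 \<and> ?I s'' \<and> wvar s'' vk = j)"
    proof (rule run_strengthenE[OF run_play[OF ws2 _ j(1) \<open>2 * j + 1 \<le> W\<close>] ws2])
      fix t and s3 :: machine_state
      let ?l = "warr s' aTree (2 * j)" and ?r = "warr s' aTree (2 * j + 1)"
      let ?v = "if ?l = 0 then ?r else if ?r = 0 then ?l else if lex_le (node_key s (?l - 1)) (node_key s (?r - 1)) then ?l else ?r"
      assume "t \<le> 60 \<and> warr s3 aTree = (warr ?s2 aTree)(j :=
         (let l = warr ?s2 aTree (2 * j); r = warr ?s2 aTree (2 * j + 1) in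
          if l = 0 then r else if r = 0 then l else if lex_le (node_key ?s2 (l - 1)) (node_key ?s2 (r - 1)) then l else r))"
      moreover have "node_key ?s2 = node_key s" using keyeq by (simp add: node_key_def fun_eq_iff)
      ultimately have a: "t \<le> 60" "warr s3 aTree = (warr s' aTree)(j := ?v)" by (simp_all add: Let_def)
      assume fr3: "frame play ?s2 s3"
      have k3: "wvar s3 vk = j" using frameD(1)[OF fr3, of vk] by simp
      have jok: "node_ok Q act (node_key s) (warr s3 aTree) j"
        by (rule node_ok_parent[OF child child j]) (simp_all add: a(2))
      have "node_ok Q act (node_key s) (warr s3 aTree) i" if i: "1 \<le> i" "i < 2 * Q" "\<not> (under Q i y \<and> i < j)" for i
      proof (cases "i = j")
        case False
        have "\<not> (under Q i y \<and> i < k)"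
        proof
          assume u: "under Q i y \<and> i < k"
          then have "i \<le> j" using under_chain[of Q k y i] I unfolding j_def k_def by blast
          then show False using i u False by simp
        qed
        then have "node_ok Q act (node_key s) (warr s' aTree) i" using good i by blast
        then show ?thesis using node_ok_tr_cong[of "warr s3 aTree" i "warr s' aTree"] a(2) False by simp
      qed (use jok in simp)
      then show "t \<le> 60 \<and> ?I s3 \<and> wvar s3 vk = j" using a(1) k3 j uj by auto
    qed simp_all
    then have "run W play ?s2 (\<lambda>t s''. ?I s'' \<and> 80 * halvings (wvar s'' vk) + (4 + t) + 1 + 3 \<le> 80 * halvings k)"
      by (rule run_mono) (use k2 in \<open>auto simp: halvings.simps[of k] j_def\<close>)
    then show "run W ?B s' (\<lambda>t s''. ?I s'' \<and> 80 * halvings (wvar s'' vk) + t + 1 + test_cost (Leq (Const 2) (Var vk)) \<le> 80 * halvings (wvar s' vk))"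
    proof (intro run_Assign_Seq[where v = j])
      show "word_words (Var vk div. Const 2) s' \<subseteq> {..W}" using kQ W j by (simp add: k_def[symmetric] j_def[symmetric])
    qed (auto simp: k_def j_def elim!: run_mono)
  next
    fix t s' assume I: "?I s'" and nb: "\<not> test_val (Leq (Const 2) (Var vk)) s'"
      and t: "t + 80 * halvings (wvar s' vk) \<le> 80 * halvings (wvar ?s1 vk) + 1 + test_cost (Leq (Const 2) (Var vk))"
    have k1: "wvar s' vk = 1" using I nb by simp
    have "halvings (Q + y) \<le> L" by (rule halvings_le) (use v in simp)
    then have "t \<le> 80 * L + 10" using t by simp
    moreover have "tree_ok Q act (node_key s) (warr s' aTree)"
      using I unfolding k1 tree_ok_def by auto
    ultimately show "t \<le> 80 * L + 10 \<and> tree_ok Q act (node_key s) (warr s' aTree)" by blast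
  qed
  show ?thesis unfolding fix_up_def
  proof (rule run_Assign_Seq[where v = "Q + y"])
    show "run W (While (Leq (Const 2) (Var vk)) ?B) ?s1 (\<lambda>t s'. 1 + word_cost (Var vQ +. Var vy) + t \<le> 80 * L + 20 \<and> tree_ok Q act (node_key s) (warr s' aTree))"
      by (rule run_mono[OF main]) auto
  qed (use v W in auto)
qed

section \<open>Dijkstra's algorithm\<close>

text \<open>Arcs are numbered, and the arcs leaving a node form a linked list in which numbers decrease;
  \<open>last_arc src m x\<close> is one more than the largest arc below \<open>m\<close> leaving \<open>x\<close>, or zero.\<close>

primrec last_arc :: "(nat => nat) => nat => nat => nat" where
  "last_arc src 0 x = 0"
| "last_arc src (Suc m) x = (if src m = x then Suc m else last_arc src m x)"

lemma last_arc_0: "last_arc src m x = 0 ==> a < m ==> src a \<noteq> x"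
  by (induction m) (auto split: if_splits simp: less_Suc_eq)

lemma last_arc_Suc: "last_arc src m x = p ==> p \<noteq> 0 ==> p - 1 < m \<and> src (p - 1) = x \<and> (\<forall>a. p \<le> a \<and> a < m --> src a \<noteq> x)"
  by (induction m) (auto split: if_splits simp: less_Suc_eq)

lemma last_arc_le: "last_arc src m x \<le> m"
  by (induction m) auto

lemma last_arc_cong: "(\<And>a. a < m ==> src a = src' a) ==> last_arc src m x = last_arc src' m x"
  by (induction m) auto

lemma last_arc_above: "last_arc src m x \<le> a ==> a < m ==> src a \<noteq> x"
  using last_arc_0[of src m x a] last_arc_Suc[of src m x "last_arc src m x"] by (cases "last_arc src m x = 0") auto

definition settled :: "nat => (nat => nat) => nat set" where
  "settled V st = {x. x < V \<and> st x = 2}"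

lemma finite_settled [simp]: "finite (settled V st)"
  by (simp add: settled_def)

text \<open>The status of a node is \<open>0\<close> if it is unseen, \<open>1\<close> if it is queued and \<open>2\<close> if it is settled.\<close>

definition dijkstra_inv :: "nat => nat => nat => (nat => nat) => (nat => nat) => (nat => real) => (nat => bool) =>
    (nat => nat) => (nat => real) => (nat => nat) => (nat => nat) => bool" where
  "dijkstra_inv V A z src tgt wt relaxed st D C par \<longleftrightarrow>
     z < V \<and> D z = 0 \<and> C z = 0 \<and>
     (\<forall>x<V. st x \<le> 2) \<and>
     (st z = 2 \<or> (\<forall>x<V. st x = (if x = z then 1 else 0))) \<and>
     (\<forall>y<V. y \<noteq> z \<and> st y \<noteq> 0 --> par y < A \<and> tgt (par y) = y \<and> st (src (par y)) = 2 \<and>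
        D y = D (src (par y)) + wt (par y) \<and> C y = C (src (par y)) + 1) \<and>
     (\<forall>a<A. relaxed a \<and> st (src a) = 2 --> st (tgt a) \<noteq> 0 \<and>
        lex_le (D (tgt a), C (tgt a)) (D (src a) + wt a, C (src a) + 1)) \<and>
     (\<forall>x<V. \<forall>y<V. st x = 2 \<and> st y = 1 --> lex_le (D x, C x) (D y, C y)) \<and>
     (\<forall>y<V. (st y = 1 --> C y \<le> card (settled V st)) \<and> (st y = 2 --> C y + 1 \<le> card (settled V st)))"

lemma dijkstra_inv_root:
  "dijkstra_inv V A z src tgt wt R st D C par ==> st z = 2 \<or> (\<forall>x<V. st x = (if x = z then 1 else 0))"
  unfolding dijkstra_inv_def by blast

text \<open>The minimal key among the queued nodes bounds those that remain, which preserves the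
  order between settled and queued nodes. Only the arcs leaving \<open>x\<close> lose their status
  as relaxed. Arc counters stay below the number of settled nodes, which grows by one here.\<close>

lemma dijkstra_inv_settle:
  assumes inv: "dijkstra_inv V A z src tgt wt (\<lambda>_. True) st D C par"
    and x: "x < V" "st x = 1" "\<And>y. y < V ==> st y = 1 ==> lex_le (D x, C x) (D y, C y)"
  shows "dijkstra_inv V A z src tgt wt (\<lambda>a. src a \<noteq> x) (st(x := 2)) D C par"
proof -
  have "settled V (st(x := 2)) = insert x (settled V st)" "x \<notin> settled V st" using x by (auto simp: settled_def)
  then have card: "card (settled V (st(x := 2))) = card (settled V st) + 1" by simp
  have z: "(st(x := 2)) z = 2" using dijkstra_inv_root[OF inv] x(1,2) by (auto split: if_splits)
  note i = inv[unfolded dijkstra_inv_def]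
  have p: "\<forall>y<V. y \<noteq> z \<and> st y \<noteq> 0 --> par y < A \<and> tgt (par y) = y \<and> st (src (par y)) = 2 \<and>
        D y = D (src (par y)) + wt (par y) \<and> C y = C (src (par y)) + 1" using i by blast
  have r: "\<forall>a<A. st (src a) = 2 --> st (tgt a) \<noteq> 0 \<and>
        lex_le (D (tgt a), C (tgt a)) (D (src a) + wt a, C (src a) + 1)" using i by blast
  have m: "\<forall>x<V. \<forall>y<V. st x = 2 \<and> st y = 1 --> lex_le (D x, C x) (D y, C y)" using i by blast
  have c: "\<forall>y<V. (st y = 1 --> C y \<le> card (settled V st)) \<and> (st y = 2 --> C y + 1 \<le> card (settled V st))" using i by blast
  show ?thesis
    unfolding dijkstra_inv_def card
  proof (intro conjI)
    show "\<forall>y<V. y \<noteq> z \<and> (st(x := 2)) y \<noteq> 0 --> par y < A \<and> tgt (par y) = y \<and> (st(x := 2)) (src (par y)) = 2 \<and>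
        D y = D (src (par y)) + wt (par y) \<and> C y = C (src (par y)) + 1" using p x by auto
    show "\<forall>a<A. src a \<noteq> x \<and> (st(x := 2)) (src a) = 2 --> (st(x := 2)) (tgt a) \<noteq> 0 \<and>
        lex_le (D (tgt a), C (tgt a)) (D (src a) + wt a, C (src a) + 1)" using r by auto
    show "\<forall>xa<V. \<forall>y<V. (st(x := 2)) xa = 2 \<and> (st(x := 2)) y = 1 --> lex_le (D xa, C xa) (D y, C y)"
      using m x(3) by auto
    show "\<forall>y<V. ((st(x := 2)) y = 1 --> C y \<le> card (settled V st) + 1) \<and>
        ((st(x := 2)) y = 2 --> C y + 1 \<le> card (settled V st) + 1)"
      using c x by (auto simp: le_Suc_eq intro: le_SucI)
  qed (use i z in auto)
qed

lemma dijkstra_inv_relaxed: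
  assumes "dijkstra_inv V A z src tgt wt R st D C par"
    and "\<And>a. a < A ==> R' a ==> \<not> R a ==> st (src a) = 2 ==> st (tgt a) \<noteq> 0 \<and>
        lex_le (D (tgt a), C (tgt a)) (D (src a) + wt a, C (src a) + 1)"
  shows "dijkstra_inv V A z src tgt wt R' st D C par"
  using assms unfolding dijkstra_inv_def by blast

text \<open>As \<open>x\<close> has the largest key among the settled nodes and the weight is
  non-negative, the new key of \<open>y\<close> still dominates all settled keys. Keys of settled
  nodes are left alone, so other parents remain correct.\<close>

lemma dijkstra_inv_relax:
  assumes inv: "dijkstra_inv V A z src tgt wt R st D C par"
    and a: "a < A" "src a = x" "tgt a = y" "x < V" "y < V" "0 \<le> wt a" and sources: "\<And>a. a < A ==> src a < V"
    and st: "st x = 2" "st z = 2" "st y \<noteq> 2" and max: "\<And>x'. x' < V ==> st x' = 2 ==> lex_le (D x', C x') (D x, C x)"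
    and upd: "st y = 0 \<or> \<not> lex_le (D y, C y) (D x + wt a, C x + 1)"
  shows "dijkstra_inv V A z src tgt wt (\<lambda>a'. R a' \<or> a' = a) (st(y := 1)) (D(y := D x + wt a)) (C(y := C x + 1)) (par(y := a))"
proof -
  note i = inv[unfolded dijkstra_inv_def]
  have p: "\<forall>y<V. y \<noteq> z \<and> st y \<noteq> 0 --> par y < A \<and> tgt (par y) = y \<and> st (src (par y)) = 2 \<and>
        D y = D (src (par y)) + wt (par y) \<and> C y = C (src (par y)) + 1" using i by blast
  have r: "\<forall>a<A. R a \<and> st (src a) = 2 --> st (tgt a) \<noteq> 0 \<and>
        lex_le (D (tgt a), C (tgt a)) (D (src a) + wt a, C (src a) + 1)" using i by blast
  have m: "\<forall>x<V. \<forall>y<V. st x = 2 \<and> st y = 1 --> lex_le (D x, C x) (D y, C y)" using i by blast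
  have c: "\<forall>y<V. (st y = 1 --> C y \<le> card (settled V st)) \<and> (st y = 2 --> C y + 1 \<le> card (settled V st))" using i by blast
  have ne: "x \<noteq> y" "z \<noteq> y" using st by auto
  have set: "settled V (st(y := 1)) = settled V st" using st by (auto simp: settled_def)
  have src2: "src a' \<noteq> y" if "st (src a') = 2" for a' using that st by auto
  have better: "lex_le (D x + wt a, C x + 1) q" if "st y \<noteq> 0" "lex_le (D y, C y) q" for q
    using upd that lex_le_total lex_le_trans by blast
  have up: "lex_le (D x, C x) (D x + wt a, C x + 1)" using lex_le_add[OF a(6), of "(D x, C x)" 1] by simp
  show ?thesis
    unfolding dijkstra_inv_def set
  proof (intro conjI)
    show "\<forall>y'<V. y' \<noteq> z \<and> (st(y := 1)) y' \<noteq> 0 --> (par(y := a)) y' < A \<and> tgt ((par(y := a)) y') = y' \<and>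
        (st(y := 1)) (src ((par(y := a)) y')) = 2 \<and>
        (D(y := D x + wt a)) y' = (D(y := D x + wt a)) (src ((par(y := a)) y')) + wt ((par(y := a)) y') \<and>
        (C(y := C x + 1)) y' = (C(y := C x + 1)) (src ((par(y := a)) y')) + 1"
    proof (intro allI impI)
      fix y' assume y': "y' < V" "y' \<noteq> z \<and> (st(y := 1)) y' \<noteq> 0"
      show "(par(y := a)) y' < A \<and> tgt ((par(y := a)) y') = y' \<and>
        (st(y := 1)) (src ((par(y := a)) y')) = 2 \<and>
        (D(y := D x + wt a)) y' = (D(y := D x + wt a)) (src ((par(y := a)) y')) + wt ((par(y := a)) y') \<and>
        (C(y := C x + 1)) y' = (C(y := C x + 1)) (src ((par(y := a)) y')) + 1"
      proof (cases "y' = y")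
        case True
        then show ?thesis using a ne st by simp
      next
        case False
        then have "st y' \<noteq> 0" "y' \<noteq> z" using y' by auto
        then have "par y' < A \<and> tgt (par y') = y' \<and> st (src (par y')) = 2 \<and>
          D y' = D (src (par y')) + wt (par y') \<and> C y' = C (src (par y')) + 1" using p y'(1) by blast
        moreover from this have "src (par y') \<noteq> y" using src2 by blast
        ultimately show ?thesis using False by simp
      qed
    qed
    show "\<forall>a'<A. (R a' \<or> a' = a) \<and> (st(y := 1)) (src a') = 2 --> (st(y := 1)) (tgt a') \<noteq> 0 \<and>
        lex_le ((D(y := D x + wt a)) (tgt a'), (C(y := C x + 1)) (tgt a'))
          ((D(y := D x + wt a)) (src a') + wt a', (C(y := C x + 1)) (src a') + 1)"
    proof (intro allI impI)
      fix a' assume a': "a' < A" "(R a' \<or> a' = a) \<and> (st(y := 1)) (src a') = 2"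
      then have s': "src a' \<noteq> y" "st (src a') = 2" by (auto split: if_splits)
      show "(st(y := 1)) (tgt a') \<noteq> 0 \<and>
        lex_le ((D(y := D x + wt a)) (tgt a'), (C(y := C x + 1)) (tgt a'))
          ((D(y := D x + wt a)) (src a') + wt a', (C(y := C x + 1)) (src a') + 1)"
      proof (cases "a' = a")
        case True
        then show ?thesis using a ne by simp
      next
        case False
        then have old: "st (tgt a') \<noteq> 0 \<and> lex_le (D (tgt a'), C (tgt a')) (D (src a') + wt a', C (src a') + 1)"
          using r a' s' by blast
        show ?thesis
        proof (cases "tgt a' = y")
          case True
          then show ?thesis using old s' better by simp
        next
          case False
          then show ?thesis using old s' by simp
        qed
      qed
    qed
    show "\<forall>x'<V. \<forall>y'<V. (st(y := 1)) x' = 2 \<and> (st(y := 1)) y' = 1 -->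
        lex_le ((D(y := D x + wt a)) x', (C(y := C x + 1)) x') ((D(y := D x + wt a)) y', (C(y := C x + 1)) y')"
    proof (intro allI impI)
      fix x' y' assume xy: "x' < V" "y' < V" "(st(y := 1)) x' = 2 \<and> (st(y := 1)) y' = 1"
      then have x': "x' \<noteq> y" "st x' = 2" by (auto split: if_splits)
      show "lex_le ((D(y := D x + wt a)) x', (C(y := C x + 1)) x') ((D(y := D x + wt a)) y', (C(y := C x + 1)) y')"
      proof (cases "y' = y")
        case True
        then show ?thesis using lex_le_trans[OF max[OF xy(1) x'(2)] up] x' by simp
      next
        case False
        then show ?thesis using m xy x' by auto
      qed
    qed
    have "C x + 1 \<le> card (settled V st)" using c a st by blast
    then show "\<forall>y'<V. ((st(y := 1)) y' = 1 --> (C(y := C x + 1)) y' \<le> card (settled V st)) \<and>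
        ((st(y := 1)) y' = 2 --> (C(y := C x + 1)) y' + 1 \<le> card (settled V st))"
      using c by auto
  qed (use i ne st in auto)
qed

section \<open>Dijkstra's algorithm on the machine\<close>

abbreviation (input) "vV \<equiv> 20 :: nat"
abbreviation (input) "vx \<equiv> 22 :: nat"
abbreviation (input) "va \<equiv> 23 :: nat"
abbreviation (input) "vcnt \<equiv> 26 :: nat"
abbreviation (input) "vroot \<equiv> 27 :: nat"
abbreviation (input) "vQQ \<equiv> 31 :: nat"
abbreviation (input) "rnd \<equiv> 3 :: nat"
abbreviation (input) "aSrc \<equiv> 20 :: nat"
abbreviation (input) "aTgt \<equiv> 21 :: nat"
abbreviation (input) "aHead \<equiv> 23 :: nat"
abbreviation (input) "aNxt \<equiv> 24 :: nat"
abbreviation (input) "aPar \<equiv> 27 :: nat"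
abbreviation (input) "rWt \<equiv> 1 :: nat"

definition set_key :: com where
  "set_key = RStore rDist (Var vy) (RVar rnd) ;; Store aCnt (Var vy) (Var vcnt) ;; Store aPar (Var vy) (Var va -. Const 1) ;;
     Store aStat (Var vy) (Const 1) ;; Store aTree (Var vQ +. Var vy) (Var vy +. Const 1)"

definition relax :: com where
  "relax = (vy ::= Load aTgt (Var va -. Const 1)) ;;
     RAssign rnd (RAdd (RLoad rDist (Var vx)) (RLoad rWt (Var va -. Const 1))) ;;
     (vcnt ::= Load aCnt (Var vx) +. Const 1) ;;
     Cond (Conj (Leq (Load aStat (Var vy)) (Const 1))
         (Neg (Conj (Leq (Const 1) (Load aStat (Var vy))) (lex_test (RLoad rDist (Var vy)) (Load aCnt (Var vy)) (RVar rnd) (Var vcnt)))))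
       (set_key ;; fix_up) Skip"

definition scan :: com where
  "scan = (va ::= Load aHead (Var vx)) ;;
     While (Leq (Const 1) (Var va)) (relax ;; (va ::= Load aNxt (Var va -. Const 1)))"

definition settle :: com where
  "settle = (vx ::= Load aTree (Const 1) -. Const 1) ;; (vy ::= Var vx) ;;
     Store aStat (Var vx) (Const 2) ;; Store aTree (Var vQ +. Var vx) (Const 0) ;; fix_up"

text \<open>Memory is uninitialised. Clearing status and tree suffices, since keys and parents of
  unseen nodes have no influence.\<close>

definition dijkstra_init :: com where
  "dijkstra_init = (vQQ ::= Var vQ +. Var vQ) ;; For vi vQ (Store aStat (Var vi) (Const 0)) ;; For vi vQQ (Store aTree (Var vi) (Const 0)) ;;
     RStore rDist (Var vroot) RZero ;; Store aCnt (Var vroot) (Const 0) ;; Store aStat (Var vroot) (Const 1) ;;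
     Store aTree (Var vQ +. Var vroot) (Var vroot +. Const 1) ;; (vy ::= Var vroot) ;; fix_up"

definition dijkstra :: com where
  "dijkstra = dijkstra_init ;; While (Leq (Const 1) (Load aTree (Const 1))) (settle ;; scan)"

lemma dijkstra_names [simp]:
  "wvars_of set_key = {}" "warrs_of set_key = {aCnt, aPar, aStat, aTree}" "rvars_of set_key = {}" "rarrs_of set_key = {rDist}"
  "wvars_of relax = {vy, vcnt, vk, vlft, vrgt}" "warrs_of relax = {aCnt, aPar, aStat, aTree}" "rvars_of relax = {rnd}" "rarrs_of relax = {rDist}"
  "wvars_of scan = {va, vy, vcnt, vk, vlft, vrgt}" "warrs_of scan = {aCnt, aPar, aStat, aTree}" "rvars_of scan = {rnd}" "rarrs_of scan = {rDist}"
  "wvars_of settle = {vx, vy, vk, vlft, vrgt}" "warrs_of settle = {aStat, aTree}" "rvars_of settle = {}" "rarrs_of settle = {}"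
  "wvars_of dijkstra_init = {vQQ, vi, vy, vk, vlft, vrgt}" "warrs_of dijkstra_init = {aStat, aTree, aCnt}" "rvars_of dijkstra_init = {}" "rarrs_of dijkstra_init = {rDist}"
  "wvars_of dijkstra = {vQQ, vi, vx, va, vy, vcnt, vk, vlft, vrgt}" "warrs_of dijkstra = {aCnt, aPar, aStat, aTree}" "rvars_of dijkstra = {rnd}" "rarrs_of dijkstra = {rDist}"
  by (auto simp: set_key_def relax_def scan_def settle_def dijkstra_init_def dijkstra_def)

definition graph_ok :: "nat => nat => machine_state => bool" where
  "graph_ok V A s \<longleftrightarrow> (\<forall>a<A. warr s aSrc a < V \<and> warr s aTgt a < V \<and> 0 \<le> rarr s rWt a \<and>
      warr s aNxt a = last_arc (warr s aSrc) a (warr s aSrc a)) \<and>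
    (\<forall>x<V. warr s aHead x = last_arc (warr s aSrc) A x)"

abbreviation queued :: "machine_state => nat => bool" where
  "queued s x \<equiv> warr s aStat x = 1"

abbreviation (input) state_inv :: "nat => nat => nat => (nat => bool) => machine_state => bool" where
  "state_inv V A z R s \<equiv> dijkstra_inv V A z (warr s aSrc) (warr s aTgt) (rarr s rWt) R (warr s aStat) (rarr s rDist) (warr s aCnt) (warr s aPar)"

abbreviation (input) same_settled :: "machine_state => machine_state => bool" where
  "same_settled s s' \<equiv> \<forall>x. warr s' aStat x = 2 \<longleftrightarrow> warr s aStat x = 2"

definition search_inv :: "nat => nat => nat => nat => (nat => bool) => machine_state => bool" where
  "search_inv V A Q z R s \<longleftrightarrow> graph_ok V A s \<and> tree_ok Q (queued s) (node_key s) (warr s aTree) \<and>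
     (\<forall>x. V \<le> x \<and> x < Q --> warr s aStat x = 0) \<and>
     state_inv V A z R s"

text \<open>A change of status or key at \<open>y\<close> matters only to the nodes above its leaf,
  and the leaf itself is written directly. This establishes the precondition of
  \<open>fix_up\<close>.\<close>

lemma node_ok_except:
  assumes "tree_ok Q act key tr" "1 \<le> i" "i < 2 * Q" "\<not> (under Q i y \<and> i < Q + y)" "y < Q"
    "\<And>x. x \<noteq> y ==> act' x = act x" "\<And>x. x \<noteq> y ==> key' x = key x"
  shows "node_ok Q act' key' (tr(Q + y := if act' y then Suc y else 0)) i"
proof (cases "i = Q + y")
  case True
  then show ?thesis using node_ok_leaf[of y Q "tr(Q + y := if act' y then Suc y else 0)" act' key'] assms(5) by simp
next
  case False
  have "i \<le> Q + y" if "under Q i y"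
    using that unfolding under_def by (metis div_le_dividend)
  then have nu: "\<not> under Q i y" using assms(4) False by (metis le_neq_implies_less)
  have "node_ok Q act key tr i" using assms(1-3) by (simp add: tree_ok_def)
  then show ?thesis by (rule node_ok_cong[OF _ nu]) (use False assms(6,7) in auto)
qed

lemma graph_ok_cong:
  assumes "graph_ok V A s" "warr s' aSrc = warr s aSrc" "warr s' aTgt = warr s aTgt" "warr s' aNxt = warr s aNxt"
    "warr s' aHead = warr s aHead" "rarr s' rWt = rarr s rWt"
  shows "graph_ok V A s'"
  using assms by (simp add: graph_ok_def)

lemma run_relax:
  assumes ws: "word_state W s" and W: "2 * Q + 10 \<le> W" "A \<le> W" and VQ: "V \<le> Q" "Q = 2 ^ L"
    and v: "wvar s vQ = Q" "wvar s vx = x" "wvar s va = p" and p: "1 \<le> p" "p \<le> A" "warr s aSrc (p - 1) = x" and x: "x < V"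
    and inv: "search_inv V A Q z R s"
    and st: "warr s aStat x = 2" "warr s aStat z = 2"
    and max: "\<And>x'. x' < V ==> warr s aStat x' = 2 ==> lex_le (node_key s x') (node_key s x)"
  shows "run W relax s (\<lambda>t s'. t \<le> 80 * L + 150 \<and> search_inv V A Q z (\<lambda>a. R a \<or> a = p - 1) s' \<and>
    same_settled s s' \<and> (\<forall>x. warr s aStat x = 2 --> node_key s' x = node_key s x))"
proof -
  define a where "a = p - 1"
  define y where "y = warr s aTgt a"
  define nd where "nd = rarr s rDist x + rarr s rWt a"
  define nc where "nc = warr s aCnt x + 1"
  define s1 where "s1 = set_wvar vcnt nc (set_rvar rnd nd (set_wvar vy y s))"
  have aA: "a < A" using p by (simp add: a_def)
  have g: "graph_ok V A s" and tree: "tree_ok Q (queued s) (node_key s) (warr s aTree)"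
    and hi: "\<And>x. V \<le> x ==> x < Q ==> warr s aStat x = 0"
    and d: "state_inv V A z R s"
    using inv by (auto simp: search_inv_def)
  have yV: "y < V" and w0: "0 \<le> rarr s rWt a" and srcs: "\<And>a. a < A ==> warr s aSrc a < V"
    using g aA by (auto simp: graph_ok_def y_def)
  \<comment> \<open>Arc counters are bounded by the number of settled nodes, so the incremented
    counter still fits into a word.\<close>
  have "card (settled V (warr s aStat)) \<le> card {..<V}" by (rule card_mono) (auto simp: settled_def)
  moreover have "warr s aCnt x + 1 \<le> card (settled V (warr s aStat))"
    using d x st(1) unfolding dijkstra_inv_def by blast
  ultimately have ncW: "nc \<le> W" using VQ W by (simp add: nc_def)
  have bw: "y \<le> W" "x \<le> W" "p \<le> W" "a \<le> W" "Q + y \<le> W" "y + 1 \<le> W" "Q \<le> W" "1 \<le> W" "2 \<le> W"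
    using yV VQ W x p a_def by linarith+
  have ws1: "word_state W s1" using ws bw ncW by (auto simp: s1_def word_state_def)
  let ?P = "\<lambda>s'. search_inv V A Q z (\<lambda>a'. R a' \<or> a' = a) s' \<and>
    same_settled s s' \<and> (\<forall>x. warr s aStat x = 2 --> node_key s' x = node_key s x)"
  let ?b = "Conj (Leq (Load aStat (Var vy)) (Const 1))
         (Neg (Conj (Leq (Const 1) (Load aStat (Var vy))) (lex_test (RLoad rDist (Var vy)) (Load aCnt (Var vy)) (RVar rnd) (Var vcnt))))"
  have bval: "test_val ?b s1 \<longleftrightarrow> warr s aStat y \<le> 1 \<and> \<not> (1 \<le> warr s aStat y \<and> lex_le (node_key s y) (nd, nc))"
    by (simp add: s1_def node_key_def)
  have bwords: "test_words ?b s1 \<subseteq> {..W}"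
    using bw ncW word_stateD(2)[OF ws] by (simp add: s1_def)
  have C: "run W (Cond ?b (set_key ;; fix_up) Skip) s1 (\<lambda>t s'. t \<le> 80 * L + 120 \<and> ?P s')"
  proof (cases "test_val ?b s1")
    case False
    have "state_inv V A z (\<lambda>a'. R a' \<or> a' = a) s"
    proof (rule dijkstra_inv_relaxed[OF d])
      fix a' assume "R a' \<or> a' = a" "\<not> R a'"
      then have a': "a' = a" by blast
      have xa: "warr s aSrc a = x" using p(3) by (simp add: a_def)
      have "warr s aStat y \<noteq> 0 \<and> lex_le (rarr s rDist y, warr s aCnt y) (nd, nc)"
      proof (cases "warr s aStat y \<le> 1")
        case True
        then show ?thesis using False bval by (auto simp: node_key_def)
      next
        case F: False
        \<comment> \<open>A settled target has a key at most that of \<open>x\<close>, hence at most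
          the key offered along the arc.\<close>
        then have "warr s aStat y = 2" using d yV unfolding dijkstra_inv_def by (metis le_antisym not_less_eq_eq One_nat_def Suc_1)
        then show ?thesis using lex_le_trans[OF max[OF yV] lex_le_add[OF w0, of _ 1]] by (simp add: node_key_def nd_def nc_def)
      qed
      then show "warr s aStat (warr s aTgt a') \<noteq> 0 \<and>
         lex_le (rarr s rDist (warr s aTgt a'), warr s aCnt (warr s aTgt a')) (rarr s rDist (warr s aSrc a') + rarr s rWt a', warr s aCnt (warr s aSrc a') + 1)"
        unfolding a' xa by (simp add: y_def nd_def nc_def)
    qed
    then have "search_inv V A Q z (\<lambda>a'. R a' \<or> a' = a) s1"
      using g tree hi by (simp add: search_inv_def s1_def graph_ok_def node_key_def[abs_def])
    then have "?P s1" by (simp add: s1_def node_key_def)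
    then show ?thesis unfolding run_Cond if_not_P[OF False] using bwords by (simp add: run_Skip)
  next
    case True
    define s2 where "s2 = s1\<lparr>rarr := (rarr s1)(rDist := (rarr s1 rDist)(y := nd)),
      warr := (warr s1)(aCnt := (warr s1 aCnt)(y := nc), aPar := (warr s1 aPar)(y := a), aStat := (warr s1 aStat)(y := 1),
        aTree := (warr s1 aTree)(Q + y := y + 1))\<rparr>"
    have sk: "run W set_key s1 (\<lambda>t s'. t \<le> 40 \<and> s' = s2)"
      using bw ncW v by (simp add: set_key_def run_simps s2_def s1_def a_def[symmetric])
    have s2: "warr s2 aStat = (warr s aStat)(y := 1)" "warr s2 aCnt = (warr s aCnt)(y := nc)" "warr s2 aPar = (warr s aPar)(y := a)"
      "warr s2 aTree = (warr s aTree)(Q + y := Suc y)" "rarr s2 rDist = (rarr s rDist)(y := nd)"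
      "warr s2 aSrc = warr s aSrc" "warr s2 aTgt = warr s aTgt" "warr s2 aNxt = warr s aNxt" "warr s2 aHead = warr s aHead" "rarr s2 rWt = rarr s rWt"
      "wvar s2 vQ = Q" "wvar s2 vy = y"
      by (simp_all add: s2_def s1_def v Suc_eq_plus1)
    have yQ: "y < Q" using yV VQ by simp
    have st2: "warr s aStat y \<noteq> 2" using True bval by auto
    have ok: "node_ok Q (queued s2) (node_key s2) (warr s2 aTree) i" if "1 \<le> i" "i < 2 * Q" "\<not> (under Q i y \<and> i < Q + y)" for i
      using node_ok_except[OF tree that yQ, of "queued s2" "node_key s2"] by (simp add: s2 node_key_def)
    have "run W (set_key ;; fix_up) s1 (\<lambda>t s'. t \<le> 80 * L + 60 \<and> ?P s')"
    proof (rule run_SeqI[OF sk ws1])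
      fix t :: nat and s2' assume a0: "t \<le> 40 \<and> s2' = s2" and ws2: "word_state W s2'"
      have fx: "run W fix_up s2 (\<lambda>t s'. t \<le> 80 * L + 20 \<and> tree_ok Q (queued s2) (node_key s2) (warr s' aTree))"
        by (rule run_fix_up[OF _ s2(11,12) yQ VQ(2) W(1) ok]) (use ws2 a0 in auto)
      have "run W fix_up s2 (\<lambda>u s'. t + u \<le> 80 * L + 60 \<and> ?P s')"
      proof (rule run_strengthenE[OF fx])
        show "word_state W s2" using ws2 a0 by simp
        fix u :: nat and s3 assume b: "u \<le> 80 * L + 20 \<and> tree_ok Q (queued s2) (node_key s2) (warr s3 aTree)" and fr: "frame fix_up s2 s3"
        note fr' = frameD[OF fr]
        have k3: "node_key s3 = node_key s2" by (simp add: node_key_def fun_eq_iff fr')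
        have "dijkstra_inv V A z (warr s aSrc) (warr s aTgt) (rarr s rWt) (\<lambda>a'. R a' \<or> a' = a)
           ((warr s aStat)(y := 1)) ((rarr s rDist)(y := nd)) ((warr s aCnt)(y := nc)) ((warr s aPar)(y := a))"
          unfolding nd_def nc_def
        proof (rule dijkstra_inv_relax[OF d aA])
          show "warr s aSrc a = x" using p by (simp add: a_def)
          show "warr s aTgt a = y" by (simp add: y_def)
          show "warr s aStat y = 0 \<or> \<not> lex_le (rarr s rDist y, warr s aCnt y) (rarr s rDist x + rarr s rWt a, warr s aCnt x + 1)"
            using True bval by (auto simp: node_key_def nd_def nc_def)
          show "\<And>x'. x' < V ==> warr s aStat x' = 2 ==> lex_le (rarr s rDist x', warr s aCnt x') (rarr s rDist x, warr s aCnt x)"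
            using max by (simp add: node_key_def)
        qed (use x yV w0 srcs st st2 in auto)
        moreover have "graph_ok V A s3" by (rule graph_ok_cong[OF g]) (simp_all add: fr' s2)
        moreover have "\<forall>x. V \<le> x \<and> x < Q --> warr s3 aStat x = 0" using hi yV by (auto simp: fr' s2)
        ultimately have "search_inv V A Q z (\<lambda>a'. R a' \<or> a' = a) s3"
          unfolding search_inv_def k3 using b by (simp add: fr' s2)
        moreover have "\<forall>x. warr s3 aStat x = 2 \<longleftrightarrow> warr s aStat x = 2" using st2 by (auto simp: fr' s2)
        moreover have "\<forall>x. warr s aStat x = 2 --> node_key s3 x = node_key s x"
          unfolding k3 using st2 by (auto simp: node_key_def s2)
        ultimately show "t + u \<le> 80 * L + 60 \<and> ?P s3" using a0 b by simp
      qed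
      then show "run W fix_up s2' (\<lambda>u s'. t + u \<le> 80 * L + 60 \<and> ?P s')" using a0 by simp
    qed
    then show ?thesis unfolding run_Cond if_P[OF True] using bwords by (auto elim!: run_mono)
  qed
  show ?thesis unfolding relax_def a_def[symmetric]
  proof (rule run_Assign_Seq[where v = y], goal_cases)
    case 3
    show ?case
    proof (rule run_RAssign_Seq[where v = nd], goal_cases)
      case 3
      show ?case
      proof (rule run_Assign_Seq[where v = nc], goal_cases)
        case 3
        show ?case unfolding s1_def[symmetric] by (rule run_mono[OF C]) auto
      qed (use bw ncW v word_stateD(2)[OF ws] in \<open>simp_all add: nc_def\<close>)
    qed (use bw v in \<open>simp_all add: nd_def a_def[symmetric]\<close>)
  qed (use bw v in \<open>simp_all add: y_def a_def[symmetric]\<close>)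
qed

definition out_arcs :: "machine_state => nat => nat => nat set" where
  "out_arcs s m x = {a. a < m \<and> warr s aSrc a = x}"

text \<open>Arc numbers decrease along the list, so when the list pointer is \<open>p\<close> the
  relaxed arcs are those that do not leave \<open>x\<close> or have a number from \<open>p\<close>
  on. Every iteration uses up one arc leaving \<open>x\<close>.\<close>

lemma run_scan:
  assumes ws: "word_state W s" and W: "2 * Q + 10 \<le> W" "A \<le> W" and VQ: "V \<le> Q" "Q = 2 ^ L"
    and v: "wvar s vQ = Q" "wvar s vx = x" and x: "x < V"
    and inv: "search_inv V A Q z (\<lambda>a. warr s aSrc a \<noteq> x) s"
    and st: "warr s aStat x = 2" "warr s aStat z = 2"
    and max: "\<And>x'. x' < V ==> warr s aStat x' = 2 ==> lex_le (node_key s x') (node_key s x)"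
  shows "run W scan s (\<lambda>t s'. t \<le> card (out_arcs s A x) * (80 * L + 180) + 20 \<and> search_inv V A Q z (\<lambda>_. True) s' \<and>
    same_settled s s')"
proof -
  let ?src = "warr s aSrc"
  define p0 where "p0 = last_arc ?src A x"
  have g: "graph_ok V A s" using inv by (simp add: search_inv_def)
  have head: "warr s aHead x = p0" using g x by (simp add: graph_ok_def p0_def)
  have p0A: "p0 \<le> A" unfolding p0_def by (rule last_arc_le)
  let ?s1 = "set_wvar va p0 s"
  let ?B = "relax ;; (va ::= Load aNxt (Var va -. Const 1))"
  let ?b = "Leq (Const 1) (Var va)"
  let ?I = "\<lambda>s'. wvar s' va \<le> A \<and> (wvar s' va \<noteq> 0 --> ?src (wvar s' va - 1) = x) \<and>
     search_inv V A Q z (\<lambda>a. ?src a \<noteq> x \<or> wvar s' va \<le> a) s' \<and>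
     same_settled s s' \<and> (\<forall>x. warr s aStat x = 2 --> node_key s' x = node_key s x)"
  have fin: "finite (out_arcs s m x)" for m by (rule finite_subset[of _ "{..<m}"]) (auto simp: out_arcs_def)
  have ws1: "word_state W ?s1" using ws p0A W by (auto simp: word_state_def)
  have main: "run W (While ?b ?B) ?s1 (\<lambda>t s'. t \<le> card (out_arcs s A x) * (80 * L + 180) + 10 \<and> search_inv V A Q z (\<lambda>_. True) s' \<and>
    same_settled s s')"
  proof (rule run_While[where I = ?I and \<Phi> = "\<lambda>s'. card (out_arcs s (wvar s' va) x) * (80 * L + 180)"])
    show "word_state W ?s1" by fact
    have "dijkstra_inv V A z ?src (warr s aTgt) (rarr s rWt) (\<lambda>a. ?src a \<noteq> x \<or> p0 \<le> a) (warr s aStat) (rarr s rDist) (warr s aCnt) (warr s aPar)"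
    proof (rule dijkstra_inv_relaxed)
      show "dijkstra_inv V A z ?src (warr s aTgt) (rarr s rWt) (\<lambda>a. ?src a \<noteq> x) (warr s aStat) (rarr s rDist) (warr s aCnt) (warr s aPar)"
        using inv by (simp add: search_inv_def)
    qed (use last_arc_above in \<open>auto simp: p0_def\<close>)
    then have "search_inv V A Q z (\<lambda>a. ?src a \<noteq> x \<or> p0 \<le> a) ?s1"
      using inv by (simp add: search_inv_def graph_ok_def node_key_def[abs_def])
    then show "?I ?s1" using p0A last_arc_Suc[of ?src A x p0] by (auto simp: p0_def node_key_def)
  next
    fix s' assume "word_state W s'"
    then show "test_words ?b s' \<subseteq> {..W}" using W word_stateD(1)[of W s' va] by simp
  next
    fix s' assume ws': "word_state W s'" and fr: "frame ?B ?s1 s'" and I: "?I s'" and b: "test_val ?b s'"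
    note fr' = frameD[OF fr]
    define p where "p = wvar s' va"
    have p: "1 \<le> p" "p \<le> A" "?src (p - 1) = x" using I b by (auto simp: p_def)
    have v': "wvar s' vQ = Q" "wvar s' vx = x" "wvar s' va = p" by (simp_all add: fr' v p_def)
    have src': "warr s' aSrc = ?src" by (simp add: fr')
    have inv': "search_inv V A Q z (\<lambda>a. ?src a \<noteq> x \<or> p \<le> a) s'" using I by (simp add: p_def)
    have pp: "warr s' aSrc (p - 1) = x" using p by (simp add: src')
    have st': "warr s' aStat x = 2" "warr s' aStat z = 2" using I st by blast+
    have max': "lex_le (node_key s' x') (node_key s' x)" if "x' < V" "warr s' aStat x' = 2" for x'
      using max I that st by simp
    have step: "run W ?B s' (\<lambda>t s''. t \<le> 80 * L + 170 \<and> ?I s'' \<and> wvar s'' va < p \<and> out_arcs s (wvar s'' va) x \<subseteq> out_arcs s p x - {p - 1})"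
    proof (rule run_SeqI[OF run_relax[OF ws' W VQ v' p(1,2) pp x inv' st' max'] ws'])
      fix t :: nat and s2 :: machine_state
      assume a: "t \<le> 80 * L + 150 \<and> search_inv V A Q z (\<lambda>a. (?src a \<noteq> x \<or> p \<le> a) \<or> a = p - 1) s2 \<and>
          same_settled s' s2 \<and> (\<forall>x. warr s' aStat x = 2 --> node_key s2 x = node_key s' x)"
        and ws2: "word_state W s2" and fr2: "frame relax s' s2"
      note fr2' = frameD[OF fr2]
      define q where "q = last_arc ?src (p - 1) x"
      have nx: "warr s2 aNxt (p - 1) = q"
        using g p unfolding graph_ok_def q_def by (simp add: fr2' fr')
      have vp: "wvar s2 va = p" by (simp add: fr2' v')
      have q: "q \<le> p - 1" unfolding q_def by (rule last_arc_le)
      have qs: "q \<noteq> 0 --> ?src (q - 1) = x" using last_arc_Suc[of ?src "p - 1" x q] by (auto simp: q_def)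
      have above: "?src a \<noteq> x" if "q \<le> a" "a < p - 1" for a
        using last_arc_above[of ?src "p - 1" x a] that by (simp add: q_def)
      have "state_inv V A z (\<lambda>a. ?src a \<noteq> x \<or> q \<le> a) s2"
      proof (rule dijkstra_inv_relaxed)
        show "state_inv V A z (\<lambda>a. (?src a \<noteq> x \<or> p \<le> a) \<or> a = p - 1) s2"
          using a unfolding search_inv_def by blast
        fix a' assume R: "?src a' \<noteq> x \<or> q \<le> a'" "\<not> ((?src a' \<noteq> x \<or> p \<le> a') \<or> a' = p - 1)"
        then have "q \<le> a'" "a' < p - 1" "?src a' = x" by auto
        then have False using above by blast
        then show "warr s2 aStat (warr s2 aTgt a') \<noteq> 0 \<and> lex_le (rarr s2 rDist (warr s2 aTgt a'), warr s2 aCnt (warr s2 aTgt a'))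
          (rarr s2 rDist (warr s2 aSrc a') + rarr s2 rWt a', warr s2 aCnt (warr s2 aSrc a') + 1)" ..
      qed
      then have "search_inv V A Q z (\<lambda>a. ?src a \<noteq> x \<or> q \<le> a) (set_wvar va q s2)"
        using a by (simp add: search_inv_def graph_ok_def node_key_def[abs_def])
      moreover have "node_key (set_wvar va q s2) = node_key s2" by (simp add: node_key_def fun_eq_iff)
      ultimately have "?I (set_wvar va q s2)"
        using q p qs a I by simp
      moreover have "out_arcs s q x \<subseteq> out_arcs s p x - {p - 1}"
        using q p by (auto simp: out_arcs_def)
      moreover have "q < p" using q p by simp
      ultimately show "run W (va ::= Load aNxt (Var va -. Const 1)) s2
        (\<lambda>u s''. t + u \<le> 80 * L + 170 \<and> ?I s'' \<and> wvar s'' va < p \<and> out_arcs s (wvar s'' va) x \<subseteq> out_arcs s p x - {p - 1})"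
        using a p W q unfolding run_Assign by (simp add: vp nx)
    qed
    show "run W ?B s' (\<lambda>t s''. ?I s'' \<and> card (out_arcs s (wvar s'' va) x) * (80 * L + 180) + t + 1 + test_cost ?b
      \<le> card (out_arcs s (wvar s' va) x) * (80 * L + 180))"
    proof (rule run_mono[OF step])
      fix t :: nat and s'' :: machine_state assume c: "t \<le> 80 * L + 170 \<and> ?I s'' \<and> wvar s'' va < p \<and> out_arcs s (wvar s'' va) x \<subseteq> out_arcs s p x - {p - 1}"
      have "p - 1 \<in> out_arcs s p x" using p by (simp add: out_arcs_def)
      then have "Suc (card (out_arcs s p x - {p - 1})) = card (out_arcs s p x)" using card_Suc_Diff1[OF fin] by blast
      moreover have "card (out_arcs s (wvar s'' va) x) \<le> card (out_arcs s p x - {p - 1})"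
        using c fin by (intro card_mono) auto
      ultimately have "Suc (card (out_arcs s (wvar s'' va) x)) \<le> card (out_arcs s p x)" by simp
      then have "Suc (card (out_arcs s (wvar s'' va) x)) * (80 * L + 180) \<le> card (out_arcs s p x) * (80 * L + 180)" by (rule mult_le_mono1)
      then show "?I s'' \<and> card (out_arcs s (wvar s'' va) x) * (80 * L + 180) + t + 1 + test_cost ?b
        \<le> card (out_arcs s (wvar s' va) x) * (80 * L + 180)" using c by (simp add: p_def)
    qed
  next
    fix t :: nat and s' :: machine_state assume I: "?I s'" and nb: "\<not> test_val ?b s'" and fr: "frame ?B ?s1 s'"
      and t: "t + card (out_arcs s (wvar s' va) x) * (80 * L + 180) \<le> card (out_arcs s (wvar ?s1 va) x) * (80 * L + 180) + 1 + test_cost ?b"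
    have va0: "wvar s' va = 0" using nb by simp
    have "out_arcs s p0 x \<subseteq> out_arcs s A x" using p0A by (auto simp: out_arcs_def)
    then have "card (out_arcs s p0 x) * (80 * L + 180) \<le> card (out_arcs s A x) * (80 * L + 180)"
      using fin by (intro mult_le_mono1 card_mono)
    moreover have "t \<le> 4 + card (out_arcs s p0 x) * (80 * L + 180)" using t by simp
    ultimately have "t \<le> card (out_arcs s A x) * (80 * L + 180) + 10" by linarith
    moreover have "search_inv V A Q z (\<lambda>_. True) s'" using I va0 by simp
    ultimately show "t \<le> card (out_arcs s A x) * (80 * L + 180) + 10 \<and> search_inv V A Q z (\<lambda>_. True) s' \<and>
      same_settled s s'" using I by blast
  qed
  show ?thesis unfolding scan_def
    by (rule run_Assign_Seq[where v = p0]; (rule run_mono[OF main])?)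
      (use v head p0A W x VQ word_stateD(1)[OF ws, of vx] in auto)
qed

lemma run_settle:
  assumes ws: "word_state W s" and W: "2 * Q + 10 \<le> W" and VQ: "V \<le> Q" "Q = 2 ^ L"
    and v: "wvar s vQ = Q" and inv: "search_inv V A Q z (\<lambda>_. True) s" and ne: "warr s aTree 1 \<noteq> 0"
  defines "x \<equiv> warr s aTree 1 - 1"
  shows "x < V" "warr s aStat x = 1"
    "run W settle s (\<lambda>t s'. t \<le> 80 * L + 60 \<and> wvar s' vx = x \<and> search_inv V A Q z (\<lambda>a. warr s aSrc a \<noteq> x) s' \<and>
      warr s' aStat = (warr s aStat)(x := 2) \<and> warr s' aStat z = 2 \<and>
      (\<forall>x'<V. warr s' aStat x' = 2 --> lex_le (node_key s' x') (node_key s' x)))"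
proof -
  have g: "graph_ok V A s" and tree: "tree_ok Q (queued s) (node_key s) (warr s aTree)"
    and hi: "\<And>x. V \<le> x ==> x < Q ==> warr s aStat x = 0"
    and d: "state_inv V A z (\<lambda>_. True) s"
    using inv by (auto simp: search_inv_def)
  note root = tree_ok_root(2)[OF tree VQ(2) ne, folded x_def]
  then have xQ: "x < Q" and st: "warr s aStat x = 1" by auto
  show "warr s aStat x = 1" by fact
  show xV: "x < V" using hi[of x] xQ st by (metis leI zero_neq_one)
  have max: "lex_le (node_key s x') (node_key s x)" if "x' < V" "warr s aStat x' = 2" for x'
    using d that xV st unfolding dijkstra_inv_def node_key_def by blast
  have min: "lex_le (node_key s x) (node_key s y)" if "y < V" "warr s aStat y = 1" for y
    using root that VQ by auto
  have d': "dijkstra_inv V A z (warr s aSrc) (warr s aTgt) (rarr s rWt) (\<lambda>a. warr s aSrc a \<noteq> x) ((warr s aStat)(x := 2)) (rarr s rDist) (warr s aCnt) (warr s aPar)"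
    by (rule dijkstra_inv_settle[OF d xV st]) (use min in \<open>auto simp: node_key_def\<close>)
  have z2: "((warr s aStat)(x := 2)) z = 2"
    using dijkstra_inv_root[OF d] st xV by (auto split: if_splits)
  have bw: "x \<le> W" "Q \<le> W" "Q + x \<le> W" "x + 1 \<le> W" "1 \<le> W" "2 \<le> W" using xQ W by linarith+
  have tW: "warr s aTree 1 \<le> W" by (rule word_stateD(2)[OF ws])
  define s2 where "s2 = s\<lparr>wvar := (wvar s)(vx := x, vy := x),
    warr := (warr s)(aStat := (warr s aStat)(x := 2), aTree := (warr s aTree)(Q + x := 0))\<rparr>"
  have s2: "warr s2 aStat = (warr s aStat)(x := 2)" "warr s2 aCnt = warr s aCnt" "warr s2 aPar = warr s aPar"
      "warr s2 aTree = (warr s aTree)(Q + x := 0)" "rarr s2 rDist = rarr s rDist"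
      "warr s2 aSrc = warr s aSrc" "warr s2 aTgt = warr s aTgt" "warr s2 aNxt = warr s aNxt" "warr s2 aHead = warr s aHead" "rarr s2 rWt = rarr s rWt"
      "wvar s2 vQ = Q" "wvar s2 vy = x" "wvar s2 vx = x"
    by (simp_all add: s2_def v)
  have ws2: "word_state W s2" using ws bw by (auto simp: s2_def word_state_def)
  have k2: "node_key s2 = node_key s" by (simp add: node_key_def fun_eq_iff s2)
  have ok: "node_ok Q (queued s2) (node_key s2) (warr s2 aTree) i" if "1 \<le> i" "i < 2 * Q" "\<not> (under Q i x \<and> i < Q + x)" for i
    using node_ok_except[OF tree that xQ, of "queued s2" "node_key s2"] k2 by (simp add: s2)
  have fx: "run W fix_up s2 (\<lambda>t s'. t \<le> 80 * L + 20 \<and> tree_ok Q (queued s2) (node_key s2) (warr s' aTree))"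
    by (rule run_fix_up[OF ws2 s2(11,12) xQ VQ(2) W ok])
  have "run W fix_up s2 (\<lambda>t s'. t \<le> 80 * L + 20 \<and> wvar s' vx = x \<and> search_inv V A Q z (\<lambda>a. warr s aSrc a \<noteq> x) s' \<and>
      warr s' aStat = (warr s aStat)(x := 2) \<and> warr s' aStat z = 2 \<and>
      (\<forall>x'<V. warr s' aStat x' = 2 --> lex_le (node_key s' x') (node_key s' x)))"
  proof (rule run_strengthenE[OF fx ws2])
    fix t :: nat and s3 assume b: "t \<le> 80 * L + 20 \<and> tree_ok Q (queued s2) (node_key s2) (warr s3 aTree)" and fr: "frame fix_up s2 s3"
    note fr' = frameD[OF fr]
    have k3: "node_key s3 = node_key s" using k2 by (simp add: node_key_def fun_eq_iff fr')
    have "graph_ok V A s3" by (rule graph_ok_cong[OF g]) (simp_all add: fr' s2)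
    moreover have "\<forall>x. V \<le> x \<and> x < Q --> warr s3 aStat x = 0" using hi xV by (auto simp: fr' s2)
    ultimately have "search_inv V A Q z (\<lambda>a. warr s aSrc a \<noteq> x) s3"
      unfolding search_inv_def k3 using b d' by (simp add: fr' s2 k2)
    moreover have "\<forall>x'<V. warr s3 aStat x' = 2 --> lex_le (node_key s3 x') (node_key s3 x)"
      unfolding k3 using max by (auto simp: fr' s2)
    ultimately show "t \<le> 80 * L + 20 \<and> wvar s3 vx = x \<and> search_inv V A Q z (\<lambda>a. warr s aSrc a \<noteq> x) s3 \<and>
      warr s3 aStat = (warr s aStat)(x := 2) \<and> warr s3 aStat z = 2 \<and>
      (\<forall>x'<V. warr s3 aStat x' = 2 --> lex_le (node_key s3 x') (node_key s3 x))"
      using b z2 by (simp add: fr' s2)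
  qed
  note fixed = run_mono[OF this]
  show "run W settle s (\<lambda>t s'. t \<le> 80 * L + 60 \<and> wvar s' vx = x \<and> search_inv V A Q z (\<lambda>a. warr s aSrc a \<noteq> x) s' \<and>
      warr s' aStat = (warr s aStat)(x := 2) \<and> warr s' aStat z = 2 \<and>
      (\<forall>x'<V. warr s' aStat x' = 2 --> lex_le (node_key s' x') (node_key s' x)))"
    unfolding settle_def
  proof (rule run_Assign_Seq[where v = x], goal_cases)
    case 3
    show ?case
    proof (rule run_Assign_Seq[where v = x], goal_cases)
      case 3
      show ?case
        unfolding run_Seq[of W "Store _ _ _"] run_Store
        using bw v by (auto simp: s2_def[symmetric] intro!: fixed)
    qed (use bw in simp_all)
  qed (use bw tW x_def in simp_all)
qed

lemma run_dijkstra_init: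
  assumes ws: "word_state W s" and W: "2 * Q + 10 \<le> W" and VQ: "V \<le> Q" "Q = 2 ^ L"
    and v: "wvar s vQ = Q" "wvar s vroot = z" "z < V" and g: "graph_ok V A s"
  shows "run W dijkstra_init s (\<lambda>t s'. t \<le> 100 * Q + 80 * L + 100 \<and> search_inv V A Q z (\<lambda>_. True) s' \<and>
    (\<forall>x<V. warr s' aStat x \<noteq> 2))"
proof -
  have zQ: "z < Q" using v VQ by simp
  have bw: "z \<le> W" "Q \<le> W" "Q + z \<le> W" "z + 1 \<le> W" "1 \<le> W" "Q + Q \<le> W" using zQ W by linarith+
  let ?s0 = "set_wvar vQQ (Q + Q) s"
  let ?F1 = "For vi vQ (Store aStat (Var vi) (Const 0))" and ?F2 = "For vi vQQ (Store aTree (Var vi) (Const 0))"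
  let ?rest = "RStore rDist (Var vroot) RZero ;; Store aCnt (Var vroot) (Const 0) ;; Store aStat (Var vroot) (Const 1) ;;
     Store aTree (Var vQ +. Var vroot) (Var vroot +. Const 1) ;; (vy ::= Var vroot) ;; fix_up"
  have ws0: "word_state W ?s0" using ws bw by (auto simp: word_state_def)
  have F1: "run W ?F1 ?s0 (\<lambda>t s'. (\<forall>i<wvar ?s0 vQ. warr s' aStat i = 0) \<and>
    (\<forall>k. k \<notin> (\<lambda>i. i) ` {..<wvar ?s0 vQ} --> warr s' aStat k = warr ?s0 aStat k) \<and>
    t \<le> 7 + wvar ?s0 vQ * (word_cost (Var vi) + word_cost (Const 0) + 10))"
    by (rule run_fill1[OF ws0 bw(5)]) (use bw v in auto)
  have main: "run W (?F1 ;; ?F2 ;; ?rest) ?s0 (\<lambda>t s'. t \<le> 100 * Q + 80 * L + 90 \<and> search_inv V A Q z (\<lambda>_. True) s' \<and>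
    (\<forall>x<V. warr s' aStat x \<noteq> 2))"
  proof (rule run_SeqI[OF F1 ws0])
    fix t1 s1 assume a1: "(\<forall>i<wvar ?s0 vQ. warr s1 aStat i = 0) \<and>
      (\<forall>k. k \<notin> (\<lambda>i. i) ` {..<wvar ?s0 vQ} --> warr s1 aStat k = warr ?s0 aStat k) \<and>
      t1 \<le> 7 + wvar ?s0 vQ * (word_cost (Var vi) + word_cost (Const 0) + 10)"
      and ws1: "word_state W s1" and fr1: "frame ?F1 ?s0 s1"
    note fr1' = frameD[OF fr1]
    have F2: "run W ?F2 s1 (\<lambda>t s'. (\<forall>i<wvar s1 vQQ. warr s' aTree i = 0) \<and>
      (\<forall>k. k \<notin> (\<lambda>i. i) ` {..<wvar s1 vQQ} --> warr s' aTree k = warr s1 aTree k) \<and>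
      t \<le> 7 + wvar s1 vQQ * (word_cost (Var vi) + word_cost (Const 0) + 10))"
      by (rule run_fill1[OF ws1 bw(5)]) (use bw v in \<open>auto simp: fr1'\<close>)
    show "run W (?F2 ;; ?rest) s1 (\<lambda>t s'. t1 + t \<le> 100 * Q + 80 * L + 90 \<and> search_inv V A Q z (\<lambda>_. True) s' \<and>
      (\<forall>x<V. warr s' aStat x \<noteq> 2))"
    proof (rule run_SeqI[OF F2 ws1])
      fix t2 s2 assume a2: "(\<forall>i<wvar s1 vQQ. warr s2 aTree i = 0) \<and>
        (\<forall>k. k \<notin> (\<lambda>i. i) ` {..<wvar s1 vQQ} --> warr s2 aTree k = warr s1 aTree k) \<and>
        t2 \<le> 7 + wvar s1 vQQ * (word_cost (Var vi) + word_cost (Const 0) + 10)"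
        and ws2: "word_state W s2" and fr2: "frame ?F2 s1 s2"
      note fr2' = frameD[OF fr2]
      have t12: "t1 \<le> 7 + Q * 12" "t2 \<le> 7 + (Q + Q) * 12" using a1 a2 by (simp_all add: v fr1')
      have st2: "warr s2 aStat i = 0" if "i < Q" for i using a1 that by (simp add: fr2' v)
      have tr2: "warr s2 aTree i = 0" if "i < 2 * Q" for i using a2 that by (simp add: fr1' mult_2)
      have v2: "wvar s2 vQ = Q" "wvar s2 vroot = z" by (simp_all add: fr2' fr1' v)
      define s3 where "s3 = (set_rarr rDist z 0 s2)\<lparr>
        warr := (warr s2)(aCnt := (warr s2 aCnt)(z := 0), aStat := (warr s2 aStat)(z := 1), aTree := (warr s2 aTree)(Q + z := z + 1)),
        wvar := (wvar s2)(vy := z)\<rparr>"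
      have s3: "warr s3 aStat = (warr s2 aStat)(z := 1)" "warr s3 aCnt = (warr s2 aCnt)(z := 0)"
        "warr s3 aTree = (warr s2 aTree)(Q + z := Suc z)" "rarr s3 rDist = (rarr s2 rDist)(z := 0)"
        "warr s3 aSrc = warr s aSrc" "warr s3 aTgt = warr s aTgt" "warr s3 aNxt = warr s aNxt" "warr s3 aHead = warr s aHead" "rarr s3 rWt = rarr s rWt"
        "wvar s3 vQ = Q" "wvar s3 vy = z"
        by (simp_all add: s3_def v2 fr1' fr2' Suc_eq_plus1)
      have ws3: "word_state W s3" using ws2 bw by (auto simp: s3_def word_state_def)
      have empty: "tree_ok Q (queued s2) (node_key s2) (warr s2 aTree)"
        using st2 tr2 by (simp add: tree_ok_def node_ok_def)
      have ok: "node_ok Q (queued s3) (node_key s3) (warr s3 aTree) i" if "1 \<le> i" "i < 2 * Q" "\<not> (under Q i z \<and> i < Q + z)" for i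
        using node_ok_except[OF empty that zQ, of "queued s3" "node_key s3"] by (simp add: s3 node_key_def)
      have fx: "run W fix_up s3 (\<lambda>t s'. t \<le> 80 * L + 20 \<and> tree_ok Q (queued s3) (node_key s3) (warr s' aTree))"
        by (rule run_fix_up[OF ws3 s3(10,11) zQ VQ(2) W ok])
      have "run W fix_up s3 (\<lambda>t s'. t \<le> 80 * L + 20 \<and> search_inv V A Q z (\<lambda>_. True) s' \<and> (\<forall>x<V. warr s' aStat x \<noteq> 2))"
      proof (rule run_strengthenE[OF fx ws3])
        fix t :: nat and s4 assume b: "t \<le> 80 * L + 20 \<and> tree_ok Q (queued s3) (node_key s3) (warr s4 aTree)" and fr: "frame fix_up s3 s4"
        note fr' = frameD[OF fr]
        have k4: "node_key s4 = node_key s3" by (simp add: node_key_def fun_eq_iff fr')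
        have g4: "graph_ok V A s4" by (rule graph_ok_cong[OF g]) (simp_all add: fr' s3)
        have st4: "warr s4 aStat x = (if x = z then 1 else 0)" if "x < Q" for x
          using st2 that by (simp add: fr' s3)
        have stV: "warr s4 aStat x = (if x = z then 1 else 0)" if "x < V" for x using st4 that VQ by simp
        have src: "warr s4 aSrc a < V" if "a < A" for a using g4 that by (simp add: graph_ok_def)
        have "state_inv V A z (\<lambda>_. True) s4"
          unfolding dijkstra_inv_def using stV src v(3) by (simp add: fr' s3(2,4))
        then have "search_inv V A Q z (\<lambda>_. True) s4"
          unfolding search_inv_def k4 using b g4 st4 v(3) by (simp add: fr')
        then show "t \<le> 80 * L + 20 \<and> search_inv V A Q z (\<lambda>_. True) s4 \<and> (\<forall>x<V. warr s4 aStat x \<noteq> 2)"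
          using b stV by simp
      qed
      note fixed = run_mono[OF this]
      show "run W ?rest s2 (\<lambda>t s'. t1 + (t2 + t) \<le> 100 * Q + 80 * L + 90 \<and> search_inv V A Q z (\<lambda>_. True) s' \<and>
        (\<forall>x<V. warr s' aStat x \<noteq> 2))"
        unfolding run_Seq[of W "Store _ _ _"] run_Seq[of W "RStore _ _ _"] run_Store run_RStore run_Seq[of W "_ ::= _"] run_Assign
        using bw t12 by (auto simp: v2 s3_def[symmetric] intro!: fixed)
    qed
  qed
  show ?thesis unfolding dijkstra_init_def
    by (rule run_Assign_Seq[where v = "Q + Q"]; (rule run_mono[OF main])?) (use v bw in auto)
qed

text \<open>The potential reserves for each unsettled node the cost of settling it and of scanning
  its arcs. Every arc has one source, so the scans amount to \<open>A\<close> relaxations in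
  all.\<close>

lemma run_dijkstra:
  assumes ws: "word_state W s" and W: "2 * Q + 10 \<le> W" "A \<le> W" and VQ: "V \<le> Q" "Q = 2 ^ L"
    and v: "wvar s vQ = Q" "wvar s vroot = z" "z < V" and g: "graph_ok V A s"
  shows "run W dijkstra s (\<lambda>t s'. t \<le> (Q + V + A) * (80 * L + 300) + 300 \<and>
    dijkstra_inv V A z (warr s aSrc) (warr s aTgt) (rarr s rWt) (\<lambda>_. True) (warr s' aStat) (rarr s' rDist) (warr s' aCnt) (warr s' aPar) \<and>
    (\<forall>x<V. warr s' aStat x \<noteq> 1))"
  unfolding dijkstra_def
proof (rule run_SeqI[OF run_dijkstra_init[OF ws W(1) VQ v g] ws])
  fix t1 :: nat and s1 assume a1: "t1 \<le> 100 * Q + 80 * L + 100 \<and> search_inv V A Q z (\<lambda>_. True) s1 \<and> (\<forall>x<V. warr s1 aStat x \<noteq> 2)"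
    and ws1: "word_state W s1" and fr1: "frame dijkstra_init s s1"
  note fr1' = frameD[OF fr1]
  let ?b = "Leq (Const 1) (Load aTree (Const 1))"
  let ?B = "settle ;; scan"
  define c where "c x = 80 * L + 100 + card (out_arcs s A x) * (80 * L + 180)" for x
  define \<Phi> where "\<Phi> s' = (\<Sum>x\<in>{x. x < V \<and> warr s' aStat x \<noteq> 2}. c x)" for s' :: machine_state
  show "run W (While ?b ?B) s1 (\<lambda>t s'. t1 + t \<le> (Q + V + A) * (80 * L + 300) + 300 \<and>
    dijkstra_inv V A z (warr s aSrc) (warr s aTgt) (rarr s rWt) (\<lambda>_. True) (warr s' aStat) (rarr s' rDist) (warr s' aCnt) (warr s' aPar) \<and>
    (\<forall>x<V. warr s' aStat x \<noteq> 1))"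
  proof (rule run_While[where I = "search_inv V A Q z (\<lambda>_. True)" and \<Phi> = \<Phi>])
    show "word_state W s1" by fact
    show "search_inv V A Q z (\<lambda>_. True) s1" using a1 by blast
  next
    fix s' assume "word_state W s'"
    then show "test_words ?b s' \<subseteq> {..W}" using W word_stateD(2)[of W s' aTree 1] by simp
  next
    fix s' assume ws': "word_state W s'" and fr: "frame ?B s1 s'" and I: "search_inv V A Q z (\<lambda>_. True) s'" and b: "test_val ?b s'"
    note fr' = frameD[OF fr]
    have v': "wvar s' vQ = Q" by (simp add: fr' fr1' v)
    have ne: "warr s' aTree 1 \<noteq> 0" using b by simp
    define x where "x = warr s' aTree 1 - 1"
    note rs = run_settle[OF ws' W(1) VQ v' I ne, folded x_def]
    have step: "run W ?B s' (\<lambda>t s''. search_inv V A Q z (\<lambda>_. True) s'' \<and> t \<le> 80 * L + 80 + card (out_arcs s A x) * (80 * L + 180) \<and>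
      (\<forall>y. warr s'' aStat y = 2 \<longleftrightarrow> y = x \<or> warr s' aStat y = 2))"
    proof (rule run_SeqI[OF rs(3) ws'])
      fix t2 :: nat and s2 assume a: "t2 \<le> 80 * L + 60 \<and> wvar s2 vx = x \<and> search_inv V A Q z (\<lambda>a. warr s' aSrc a \<noteq> x) s2 \<and>
        warr s2 aStat = (warr s' aStat)(x := 2) \<and> warr s2 aStat z = 2 \<and>
        (\<forall>x'<V. warr s2 aStat x' = 2 --> lex_le (node_key s2 x') (node_key s2 x))"
        and ws2: "word_state W s2" and fr2: "frame settle s' s2"
      note fr2' = frameD[OF fr2]
      have v2: "wvar s2 vQ = Q" "wvar s2 vx = x" using a by (simp_all add: fr2' v')
      have src2: "warr s2 aSrc = warr s aSrc" "warr s' aSrc = warr s aSrc" by (simp_all add: fr2' fr' fr1')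
      have sc: "run W scan s2 (\<lambda>t s''. t \<le> card (out_arcs s2 A x) * (80 * L + 180) + 20 \<and> search_inv V A Q z (\<lambda>_. True) s'' \<and>
        same_settled s2 s'')"
        by (rule run_scan[OF ws2 W VQ v2 rs(1)]) (use a src2 in auto)
      show "run W scan s2 (\<lambda>u s''. search_inv V A Q z (\<lambda>_. True) s'' \<and> t2 + u \<le> 80 * L + 80 + card (out_arcs s A x) * (80 * L + 180) \<and>
        (\<forall>y. warr s'' aStat y = 2 \<longleftrightarrow> y = x \<or> warr s' aStat y = 2))"
        by (rule run_mono[OF sc]) (use a src2 in \<open>auto simp: out_arcs_def\<close>)
    qed
    show "run W ?B s' (\<lambda>t s''. search_inv V A Q z (\<lambda>_. True) s'' \<and> \<Phi> s'' + t + 1 + test_cost ?b \<le> \<Phi> s')"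
    proof (rule run_mono[OF step])
      fix t :: nat and s'' :: machine_state
      assume a: "search_inv V A Q z (\<lambda>_. True) s'' \<and> t \<le> 80 * L + 80 + card (out_arcs s A x) * (80 * L + 180) \<and>
        (\<forall>y. warr s'' aStat y = 2 \<longleftrightarrow> y = x \<or> warr s' aStat y = 2)"
      let ?S = "{y. y < V \<and> warr s' aStat y \<noteq> 2}"
      have "{y. y < V \<and> warr s'' aStat y \<noteq> 2} = ?S - {x}" using a by auto
      moreover have "x \<in> ?S" using rs(1,2) by simp
      moreover have "finite ?S" by simp
      ultimately have "\<Phi> s' = c x + \<Phi> s''" unfolding \<Phi>_def by (simp only: sum.remove)
      then show "search_inv V A Q z (\<lambda>_. True) s'' \<and> \<Phi> s'' + t + 1 + test_cost ?b \<le> \<Phi> s'"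
        using a by (simp add: c_def)
    qed
  next
    fix t :: nat and s' assume I: "search_inv V A Q z (\<lambda>_. True) s'" and nb: "\<not> test_val ?b s'" and fr: "frame ?B s1 s'"
      and t: "t + \<Phi> s' \<le> \<Phi> s1 + 1 + test_cost ?b"
    note fr' = frameD[OF fr]
    have t0: "warr s' aTree 1 = 0" using nb by simp
    have tree: "tree_ok Q (queued s') (node_key s') (warr s' aTree)" using I by (simp add: search_inv_def)
    have none: "\<forall>x<V. warr s' aStat x \<noteq> 1" using tree_ok_root(1)[OF tree VQ(2) t0] VQ by simp
    have inv: "dijkstra_inv V A z (warr s aSrc) (warr s aTgt) (rarr s rWt) (\<lambda>_. True) (warr s' aStat) (rarr s' rDist) (warr s' aCnt) (warr s' aPar)"
      using I unfolding search_inv_def by (simp add: fr' fr1')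
    have "(\<Sum>x<V. card (out_arcs s A x)) = card (\<Union>x<V. out_arcs s A x)"
      by (rule card_UN_disjoint[symmetric]) (auto simp: out_arcs_def)
    also have "\<dots> \<le> card {..<A}" by (rule card_mono) (auto simp: out_arcs_def)
    finally have arcs: "(\<Sum>x<V. card (out_arcs s A x)) \<le> A" by simp
    have "\<Phi> s1 \<le> (\<Sum>x<V. c x)" unfolding \<Phi>_def by (rule sum_mono2) auto
    also have "\<dots> = V * (80 * L + 100) + (\<Sum>x<V. card (out_arcs s A x)) * (80 * L + 180)"
      unfolding c_def sum.distrib sum_distrib_right by (simp add: algebra_simps)
    also have "\<dots> \<le> V * (80 * L + 100) + A * (80 * L + 180)" using arcs by (intro add_left_mono mult_le_mono1)
    finally have "t \<le> V * (80 * L + 100) + A * (80 * L + 180) + 10" using t by simp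
    moreover have "V * (80 * L + 100) \<le> V * (80 * L + 300)" "A * (80 * L + 180) \<le> A * (80 * L + 300)"
      by (intro mult_le_mono2; simp)+
    moreover have "100 * Q + 80 * L + 100 \<le> Q * (80 * L + 300) + 200"
    proof -
      have "1 * (80 * L) \<le> Q * (80 * L)" using VQ by (intro mult_le_mono1) simp
      then show ?thesis unfolding add_mult_distrib2 by linarith
    qed
    moreover have "(Q + V + A) * (80 * L + 300) = Q * (80 * L + 300) + V * (80 * L + 300) + A * (80 * L + 300)"
      by (simp only: add_mult_distrib)
    moreover have "t1 \<le> 100 * Q + 80 * L + 100" using a1 by blast
    ultimately have "t1 + t \<le> (Q + V + A) * (80 * L + 300) + 300" by linarith
    then show "t1 + t \<le> (Q + V + A) * (80 * L + 300) + 300 \<and>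
      dijkstra_inv V A z (warr s aSrc) (warr s aTgt) (rarr s rWt) (\<lambda>_. True) (warr s' aStat) (rarr s' rDist) (warr s' aCnt) (warr s' aPar) \<and>
      (\<forall>x<V. warr s' aStat x \<noteq> 1)" using inv none by blast
  qed
qed

section \<open>Shortest cycles as shortest paths\<close>

notation xor (infixl \<open>XOR\<close> 59)

lemma boundary_edge: "x \<noteq> y ==> boundary 1 {{x, y}} = {{x}, {y}}"
  by (auto simp: boundary_single card_1_singleton_iff One_nat_def)

text \<open>If the edge cancels, the weight drops instead of growing, which is at most as much
  because \<open>w e\<close> is non-negative.\<close>

lemma weight_sym_diff_single:
  assumes "finite c" "0 \<le> w e"
  shows "weight w (sym_diff c {e}) \<le> weight w c + w e"
proof (cases "e \<in> c")
  case True
  then have "sym_diff c {e} = c - {e}" by auto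
  moreover have "weight w c = w e + weight w (c - {e})" unfolding weight_def using assms True by (simp add: sum.remove)
  ultimately show ?thesis using assms by simp
next
  case False
  then have "sym_diff c {e} = insert e c" by auto
  then show ?thesis unfolding weight_def using assms False by simp
qed

lemma weight_nonneg: "(\<And>e. e \<in> c ==> 0 \<le> w e) ==> 0 \<le> weight w c"
  unfolding weight_def by (rule sum_nonneg)

text \<open>The node \<open>walk_node n h v u\<close> stands for a walk that started in \<open>v\<close> and is now in \<open>u\<close>, where
  \<open>h\<close> is the class of the chain collected so far; in \<open>hub n h\<close> this chain is a cycle and a new
  component may be started at any vertex.\<close>

definition walk_node :: "nat => nat => nat => nat => nat" where
  "walk_node n h v u = h * (n * n + 1) + (v * n + u)"

definition hub :: "nat => nat => nat" where
  "hub n h = h * (n * n + 1) + n * n"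

lemma walk_node_less: "v < n ==> u < n ==> h < G ==> walk_node n h v u < G * (n * n + 1)"
  unfolding walk_node_def by (rule mat_idx_less) (use mat_idx_less[of v n u n] in simp_all)

lemma hub_less: "h < G ==> hub n h < G * (n * n + 1)"
  unfolding hub_def by (rule mat_idx_less) simp_all

lemma hub_inj: "hub n h = hub n h' \<longleftrightarrow> h = h'"
  unfolding hub_def using mat_idx_inj[of "n * n" "n * n + 1" "n * n" h h'] by simp

lemma walk_node_inj: "v < n ==> u < n ==> v' < n ==> u' < n ==>
    walk_node n h v u = walk_node n h' v' u' \<longleftrightarrow> h = h' \<and> v = v' \<and> u = u'"
  unfolding walk_node_def
  using mat_idx_inj[of "v * n + u" "n * n + 1" "v' * n + u'" h h'] mat_idx_less[of v n u n] mat_idx_less[of v' n u' n]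
    mat_idx_inj[of u n u' v v'] by auto

lemma walk_node_not_hub: "v < n ==> u < n ==> walk_node n h v u \<noteq> hub n h'"
  unfolding walk_node_def hub_def
  using mat_idx_inj[of "v * n + u" "n * n + 1" "n * n" h h'] mat_idx_less[of v n u n] by auto

text \<open>The third component is the number of the edge traversed. The value \<open>n\<close> is
  no simplex number and marks the arcs of weight zero between hubs and walks. Each edge yields an
  arc in either direction.\<close>

definition arc_set :: "nat => nat => (nat => bool) => (nat => nat) => (nat => nat) => (nat => nat) => (nat => real) => (nat \<times> nat \<times> nat \<times> real) set" where
  "arc_set n G E e1 e2 ann we = {(hub n h, walk_node n h v v, n, 0) | h v. h < G \<and> v < n} \<union>
     {(walk_node n h v v, hub n h, n, 0) | h v. h < G \<and> v < n} \<union>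
     {(walk_node n h v (e1 e), walk_node n (h XOR ann e) v (e2 e), e, we e) | h v e. h < G \<and> v < n \<and> e < n \<and> E e} \<union>
     {(walk_node n h v (e2 e), walk_node n (h XOR ann e) v (e1 e), e, we e) | h v e. h < G \<and> v < n \<and> e < n \<and> E e}"

section \<open>Annotations as numbers, and the chains collected along paths\<close>

locale cycle_graph = annotated_complex K \<sigma> n N piv1 piv2
  for K :: "'v set set" and \<sigma> n N piv1 piv2 +
  fixes w :: "'v set => real" and r e1 e2 :: "nat => nat" and g :: nat
  assumes piv2: "pivoting piv2 second_col N N"
    and w_nonneg: "\<And>e. e \<in> edges K ==> 0 \<le> w e"
    and n_pos: "0 < n"
    and r: "bij_betw r {..<g} free_rows"
    and ends: "\<And>e. e < n ==> card (\<sigma> e) = 2 ==>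
      e1 e < n \<and> e2 e < n \<and> (\<exists>x y. x \<noteq> y \<and> \<sigma> (e1 e) = {x} \<and> \<sigma> (e2 e) = {y} \<and> \<sigma> e = {x, y})"
begin

text \<open>Annotations become numbers below \<open>2 ^ g\<close> that index the layers of the
  graph; addition of chains becomes XOR.\<close>

definition code :: "'v set set => nat" where
  "code c = horner_sum of_bool 2 (map (\<lambda>i. r i \<in> annotation c) [0..<g])"

lemma bit_code: "bit (code c) i \<longleftrightarrow> i < g \<and> r i \<in> annotation c"
  unfolding code_def by (auto simp: bit_horner_sum_bit_iff)

lemma code_sym_diff: "code (sym_diff c d) = code c XOR code d"
  by (rule bit_eqI) (auto simp: bit_code bit_xor_iff annotation_sym_diff)

lemma less_iff_bits: "m < 2 ^ g \<longleftrightarrow> (\<forall>i\<ge>g. \<not> bit (m :: nat) i)"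
proof -
  have "m < 2 ^ g \<longleftrightarrow> take_bit g m = m" by (simp add: take_bit_nat_eq_self_iff)
  also have "\<dots> \<longleftrightarrow> (\<forall>i\<ge>g. \<not> bit m i)"
  proof -
    have "(\<forall>i. (i < g \<and> bit m i) \<longleftrightarrow> bit m i) \<longleftrightarrow> (\<forall>i\<ge>g. \<not> bit m i)"
      using not_le by blast
    then show ?thesis by (simp add: bit_eq_iff bit_take_bit_iff)
  qed
  finally show ?thesis .
qed

lemma code_less: "code c < 2 ^ g"
  by (simp add: less_iff_bits bit_code)

lemma code_empty [simp]: "code {} = 0"
  by (rule bit_eqI) (simp add: bit_code annotation_empty)

lemma xor_less: "a < 2 ^ g ==> b < 2 ^ g ==> a XOR b < (2 ^ g :: nat)"
  by (simp add: less_iff_bits bit_xor_iff)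

lemma code_eq_iff: "code c = code d \<longleftrightarrow> annotation c = annotation d"
proof
  assume a: "code c = code d"
  have "r i \<in> annotation c \<longleftrightarrow> r i \<in> annotation d" if "i < g" for i
    using bit_code[of c i] bit_code[of d i] a that by simp
  moreover have "annotation c' \<subseteq> r ` {..<g}" for c' using r by (auto simp: annotation_def bij_betw_def)
  ultimately show "annotation c = annotation d" by blast
qed (simp add: code_def)

lemma code_cls: "z \<in> Z\<^sub>1 ==> z' \<in> Z\<^sub>1 ==> code z = code z' \<longleftrightarrow> cls z = cls z'"
  using annotation_eq_iff[OF piv2] code_eq_iff by blast

text \<open>All \<open>2 ^ g\<close> hubs stand for homology classes, so each of them will be
  reached by the search.\<close>

lemma code_surj:
  assumes "h < 2 ^ g"
  obtains z where "z \<in> Z\<^sub>1" "code z = h"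
proof -
  let ?S = "{r i | i. i < g \<and> bit h i}"
  have "?S \<subseteq> free_rows" using r by (auto simp: bij_betw_def)
  then obtain z where z: "z \<in> Z\<^sub>1" "annotation z = ?S" using annotation_surj[OF piv2] by blast
  have inj: "r i = r j \<longleftrightarrow> i = j" if "i < g" "j < g" for i j using r that by (auto simp: bij_betw_def inj_on_def)
  have "bit (code z) i \<longleftrightarrow> bit h i" for i
  proof (cases "i < g")
    case True
    then show ?thesis unfolding bit_code z(2) using inj by auto
  next
    case False
    then show ?thesis using assms by (simp add: bit_code less_iff_bits)
  qed
  then have "code z = h" by (simp add: bit_eq_iff)
  then show ?thesis using that z by blast
qed

lemma g_eq: "g = homology_dim K 1"
  using bij_betw_same_card[OF r] card_free_rows[OF piv2] by simp

lemma edge_ends: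
  assumes "e < n" "card (\<sigma> e) = 2"
  shows "e1 e < n" "e2 e < n" "\<sigma> e \<in> edges K" "boundary 1 {\<sigma> e} = sym_diff {\<sigma> (e1 e)} {\<sigma> (e2 e)}"
    "card (\<sigma> u) = 1 ==> \<sigma> u \<subseteq> \<sigma> e ==> u < n ==> u = e1 e \<or> u = e2 e"
proof -
  obtain x y where xy: "x \<noteq> y" "\<sigma> (e1 e) = {x}" "\<sigma> (e2 e) = {y}" "\<sigma> e = {x, y}" using ends[OF assms] by blast
  show l: "e1 e < n" "e2 e < n" using ends[OF assms] by auto
  show "\<sigma> e \<in> edges K" using assms \<sigma>_in by (simp add: simplices_def)
  show "boundary 1 {\<sigma> e} = sym_diff {\<sigma> (e1 e)} {\<sigma> (e2 e)}" unfolding xy(2-4) boundary_edge[OF xy(1)] using xy(1) by auto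
  assume u: "card (\<sigma> u) = 1" "\<sigma> u \<subseteq> \<sigma> e" "u < n"
  then obtain z where "\<sigma> u = {z}" by (metis card_1_singletonE)
  then have "\<sigma> u = \<sigma> (e1 e) \<or> \<sigma> u = \<sigma> (e2 e)" using u xy by auto
  then show "u = e1 e \<or> u = e2 e" using \<sigma>_inj u l by blast
qed

abbreviation "V \<equiv> 2 ^ g * (n * n + 1)"
abbreviation "arcs \<equiv> arc_set n (2 ^ g) (\<lambda>e. card (\<sigma> e) = 2) e1 e2 (\<lambda>e. code {\<sigma> e}) (\<lambda>e. w (\<sigma> e))"

text \<open>The weight is only bounded by the distance, since edges traversed twice cancel in the
  chain but not in the length of the path.\<close>

definition collected :: "(nat => real) => nat => 'v set set => bool" where
  "collected D x c \<longleftrightarrow> c \<subseteq> edges K \<and> weight w c \<le> D x \<and>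
     ((\<exists>h<2 ^ g. x = hub n h \<and> boundary 1 c = {} \<and> code c = h) \<or>
      (\<exists>h<2 ^ g. \<exists>v<n. \<exists>u<n. x = walk_node n h v u \<and> boundary 1 c = sym_diff {\<sigma> v} {\<sigma> u} \<and> code c = h))"

lemma collected_hub: "collected D (hub n h) c \<longleftrightarrow> c \<in> Z\<^sub>1 \<and> weight w c \<le> D (hub n h) \<and> code c = h \<and> h < 2 ^ g"
  unfolding collected_def cycles_iff using hub_inj walk_node_not_hub by metis

lemma collected_walk: "v < n ==> u < n ==> collected D (walk_node n h v u) c \<longleftrightarrow>
    c \<subseteq> edges K \<and> weight w c \<le> D (walk_node n h v u) \<and> h < 2 ^ g \<and> boundary 1 c = sym_diff {\<sigma> v} {\<sigma> u} \<and> code c = h"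
  unfolding collected_def using walk_node_inj walk_node_not_hub by metis

lemma collected_edge:
  assumes c: "collected D (walk_node n h v u) c" and v: "v < n" "u < n" "u' < n" and e: "e < n" "card (\<sigma> e) = 2"
    and uu': "(u, u') = (e1 e, e2 e) \<or> (u, u') = (e2 e, e1 e)"
    and D: "D (walk_node n (h XOR code {\<sigma> e}) v u') = D (walk_node n h v u) + w (\<sigma> e)"
  shows "collected D (walk_node n (h XOR code {\<sigma> e}) v u') (sym_diff c {\<sigma> e})"
proof -
  note c' = c[unfolded collected_walk[OF v(1,2)]]
  note ee = edge_ends[OF e]
  have "c \<subseteq> edges K" using c' by (rule conjunct1)
  then have fin: "finite c" by (rule finite_chain[OF subset_trans[OF _ simplices_subset]])
  have "boundary 1 {\<sigma> e} = sym_diff {\<sigma> u} {\<sigma> u'}" using ee(4) uu' by auto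
  then have "boundary 1 (sym_diff c {\<sigma> e}) = sym_diff (sym_diff {\<sigma> v} {\<sigma> u}) (sym_diff {\<sigma> u} {\<sigma> u'})"
    using boundary_sym_diff[OF fin, of "{\<sigma> e}" 1] c' by simp
  also have "\<dots> = sym_diff {\<sigma> v} {\<sigma> u'}" by blast
  finally have "boundary 1 (sym_diff c {\<sigma> e}) = sym_diff {\<sigma> v} {\<sigma> u'}" .
  moreover have "weight w (sym_diff c {\<sigma> e}) \<le> D (walk_node n (h XOR code {\<sigma> e}) v u')"
    using weight_sym_diff_single[where w = w and e = "\<sigma> e", OF fin w_nonneg[OF ee(3)]] c' D by linarith
  moreover have "code (sym_diff c {\<sigma> e}) = h XOR code {\<sigma> e}" using code_sym_diff c' by simp
  moreover have "sym_diff c {\<sigma> e} \<subseteq> edges K" using c' ee(3) by auto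
  moreover have "h < 2 ^ g" using c' by (elim conjE)
  then have "h XOR code {\<sigma> e} < 2 ^ g" by (rule xor_less[OF _ code_less])
  ultimately show ?thesis unfolding collected_walk[OF v(1,3)] by (intro conjI)
qed

text \<open>Arcs from and to hubs change neither chain nor class: at a node
  \<open>walk_node n h v v\<close> the boundary of the chain is empty, as it is at a hub.\<close>

lemma collected_arc:
  assumes arc: "(x, y, l, d) \<in> arcs" and D: "D y = D x + d" and c: "collected D x c"
  shows "collected D y (if l < n then sym_diff c {\<sigma> l} else c)"
proof -
  from arc consider
    (start) h v where "x = hub n h" "y = walk_node n h v v" "l = n" "d = 0" "h < 2 ^ g" "v < n"
  | (stop) h v where "x = walk_node n h v v" "y = hub n h" "l = n" "d = 0" "h < 2 ^ g" "v < n"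
  | (step1) h v e where "x = walk_node n h v (e1 e)" "y = walk_node n (h XOR code {\<sigma> e}) v (e2 e)" "l = e" "d = w (\<sigma> e)" "h < 2 ^ g" "v < n" "e < n" "card (\<sigma> e) = 2"
  | (step2) h v e where "x = walk_node n h v (e2 e)" "y = walk_node n (h XOR code {\<sigma> e}) v (e1 e)" "l = e" "d = w (\<sigma> e)" "h < 2 ^ g" "v < n" "e < n" "card (\<sigma> e) = 2"
    unfolding arc_set_def by auto
  then show ?thesis
  proof cases
    case start
    then show ?thesis using c D by (simp add: collected_hub collected_walk cycles_iff)
  next
    case stop
    then show ?thesis using c D by (simp add: collected_hub collected_walk cycles_iff)
  next
    case step1
    then show ?thesis using collected_edge[of D h v "e1 e" c "e2 e" e] edge_ends(1,2)[of e] c D by simp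
  next
    case step2
    then show ?thesis using collected_edge[of D h v "e2 e" c "e1 e" e] edge_ends(1,2)[of e] c D by simp
  qed
qed

end

section \<open>The paths found by the search against the cycles of the complex\<close>

locale cycle_search = cycle_graph K \<sigma> n N piv1 piv2 w r e1 e2 g
  for K :: "'v set set" and \<sigma> n N piv1 piv2 w r e1 e2 g +
  fixes A :: nat and src tgt lab :: "nat => nat" and wt :: "nat => real" and st C par :: "nat => nat" and D :: "nat => real"
  assumes arcs: "(\<lambda>a. (src a, tgt a, lab a, wt a)) ` {..<A} = arcs"
    and inv: "dijkstra_inv V A (hub n 0) src tgt wt (\<lambda>_. True) st D C par"
    and no_queue: "\<And>x. x < V ==> st x \<noteq> 1"
begin

lemma settled_iff: "x < V ==> st x = 2 \<longleftrightarrow> st x \<noteq> 0"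
proof -
  assume x: "x < V"
  then have "st x \<le> 2" using inv unfolding dijkstra_inv_def by blast
  then show ?thesis using no_queue[OF x] by linarith
qed

lemma root: "st (hub n 0) = 2" "D (hub n 0) = 0" "C (hub n 0) = 0"
proof -
  have z: "hub n 0 < V" by (rule hub_less) simp
  show "D (hub n 0) = 0" "C (hub n 0) = 0" using inv unfolding dijkstra_inv_def by blast+
  show "st (hub n 0) = 2" using inv no_queue[OF z] z unfolding dijkstra_inv_def by metis
qed

lemma parent:
  assumes "y < V" "st y = 2" "y \<noteq> hub n 0"
  shows "par y < A" "(src (par y), y, lab (par y), wt (par y)) \<in> arcs" "src (par y) < V" "st (src (par y)) = 2"
    "D y = D (src (par y)) + wt (par y)" "C y = C (src (par y)) + 1"
proof -
  have p: "par y < A \<and> tgt (par y) = y \<and> st (src (par y)) = 2 \<and> D y = D (src (par y)) + wt (par y) \<and> C y = C (src (par y)) + 1"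
    using inv assms unfolding dijkstra_inv_def by simp
  then show "par y < A" "st (src (par y)) = 2" "D y = D (src (par y)) + wt (par y)" "C y = C (src (par y)) + 1" by auto
  show a: "(src (par y), y, lab (par y), wt (par y)) \<in> arcs" using arcs p by (metis (no_types, lifting) image_eqI lessThan_iff)
  then show "src (par y) < V"
    unfolding arc_set_def using hub_less walk_node_less edge_ends(1,2) by auto
qed

lemma step:
  assumes "(x, y, l, d) \<in> arcs" "st x = 2" "lex_le (D x, C x) (a, b)"
  shows "st y = 2" "lex_le (D y, C y) (a + d, b + 1)"
proof -
  obtain i where i: "i < A" "src i = x" "tgt i = y" "wt i = d" using arcs assms(1) by (force simp: image_iff)
  have y: "y < V" using assms(1) unfolding arc_set_def using hub_less walk_node_less edge_ends(1,2) xor_less code_less by auto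
  have "st y \<noteq> 0 \<and> lex_le (D y, C y) (D x + d, C x + 1)" using inv i assms(2) unfolding dijkstra_inv_def by blast
  moreover have "lex_le (D x + d, C x + 1) (a + d, b + 1)" using assms(3) by (auto simp: lex_le_def)
  ultimately show "st y = 2" "lex_le (D y, C y) (a + d, b + 1)" using settled_iff[OF y] lex_le_trans by blast+
qed

lemma start_arc: "h < 2 ^ g ==> v < n ==> (hub n h, walk_node n h v v, n, 0) \<in> arcs"
  unfolding arc_set_def by blast

lemma stop_arc: "h < 2 ^ g ==> v < n ==> (walk_node n h v v, hub n h, n, 0) \<in> arcs"
  unfolding arc_set_def by blast

lemma edge_arc: "h < 2 ^ g ==> v < n ==> e < n ==> card (\<sigma> e) = 2 ==> (u, u') = (e1 e, e2 e) \<or> (u, u') = (e2 e, e1 e) ==>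
    (walk_node n h v u, walk_node n (h XOR code {\<sigma> e}) v u', e, w (\<sigma> e)) \<in> arcs"
  unfolding arc_set_def by blast

text \<open>Up to three arcs are spent on an edge, since a new component needs an arc from a hub and one
  back to a hub.\<close>

lemma traverse:
  assumes "c \<subseteq> edges K" "h < 2 ^ g" "v < n" "u < n" "boundary 1 c = sym_diff {\<sigma> v} {\<sigma> u}"
    "st (walk_node n h v u) = 2" "lex_le (D (walk_node n h v u), C (walk_node n h v u)) (a, b)"
  shows "st (hub n (h XOR code c)) = 2 \<and>
    lex_le (D (hub n (h XOR code c)), C (hub n (h XOR code c))) (a + weight w c, b + 3 * card c + 1)"
  using assms
proof (induction "card c" arbitrary: c h v u a b rule: less_induct)
  case less
  have fin: "finite c" by (rule finite_chain[OF subset_trans[OF less.prems(1) simplices_subset]])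
  have remove: "sym_diff c {e} = c - {e}" "card (c - {e}) < card c" "card c = Suc (card (c - {e}))" "weight w c = w e + weight w (c - {e})"
    "c - {e} \<subseteq> edges K" "boundary 1 (c - {e}) = sym_diff (boundary 1 c) (boundary 1 {e})" "code {e} XOR code (c - {e}) = code c" if "e \<in> c" for e
  proof -
    show s: "sym_diff c {e} = c - {e}" using that by auto
    show "card (c - {e}) < card c" "card c = Suc (card (c - {e}))" using card.remove[OF fin that] by simp_all
    show "weight w c = w e + weight w (c - {e})" unfolding weight_def using fin that by (simp add: sum.remove)
    show "c - {e} \<subseteq> edges K" using less.prems(1) by auto
    show "boundary 1 (c - {e}) = sym_diff (boundary 1 c) (boundary 1 {e})" using boundary_sym_diff[OF fin, of "{e}" 1] s by simp
    have "sym_diff {e} (c - {e}) = c" using that by auto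
    then show "code {e} XOR code (c - {e}) = code c" using code_sym_diff[of "{e}" "c - {e}"] by simp
  qed
  let ?hub = "\<lambda>s e. hub n ((h XOR code {\<sigma> e}) XOR code (c - {s}))"
  show ?case
  proof (cases "u = v")
    case True
    note hb = step[OF stop_arc[OF less.prems(2,3)]]
    have h: "st (hub n h) = 2" "lex_le (D (hub n h), C (hub n h)) (a, b + 1)"
      using hb[of a b] less.prems(6,7) True by auto
    show ?thesis
    proof (cases "c = {}")
      case True
      then show ?thesis using h by (simp add: weight_def)
    next
      case False
      \<comment> \<open>The remaining edges form a cycle, so a new walk may start at an end of any
        of them. The arc to the hub, the arc from the hub and the edge itself make up the three
        arcs.\<close>
      then obtain s where s: "s \<in> c" by blast
      then have "s \<in> K" "card s = 2" using less.prems(1) by (auto simp: simplices_def)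
      then obtain e where e: "e < n" "s = \<sigma> e" "card (\<sigma> e) = 2" using \<sigma>_obtain by blast
      note ee = edge_ends[OF e(1,3)]
      note s1 = step[OF start_arc[OF less.prems(2) ee(1)] h]
      note s2 = step[OF edge_arc[OF less.prems(2) ee(1) e(1,3), of "e1 e" "e2 e"] s1, simplified]
      have bd: "boundary 1 (c - {s}) = sym_diff {\<sigma> (e1 e)} {\<sigma> (e2 e)}"
        using remove(6)[OF s] less.prems(5) True ee(4) e(2) by simp
      have "st (?hub s e) = 2 \<and>
        lex_le (D (?hub s e), C (?hub s e))
          (a + w (\<sigma> e) + weight w (c - {s}), b + 1 + 1 + 1 + 3 * card (c - {s}) + 1)"
        by (rule less.hyps[OF remove(2)[OF s] remove(5)[OF s] xor_less[OF less.prems(2) code_less] ee(1,2) bd s2(1)])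
          (use s2(2) in simp)
      moreover have "(h XOR code {\<sigma> e}) XOR code (c - {s}) = h XOR code c"
        using remove(7)[OF s] e(2) by (simp add: xor.assoc)
      moreover have "b + 1 + 1 + 1 + 3 * card (c - {s}) + 1 = b + 3 * card c + 1" using remove(3)[OF s] by simp
      moreover have "a + w (\<sigma> e) + weight w (c - {s}) = a + weight w c" using remove(4)[OF s] e(2) by simp
      ultimately show ?thesis by (simp only:)
    qed
  next
    case False
    \<comment> \<open>An open walk can be continued: \<open>\<sigma> u\<close> lies in the boundary
      of the remaining edges, so an odd number of them contain it.\<close>
    then have "\<sigma> u \<in> boundary 1 c" using less.prems(3-5) \<sigma>_inj by auto
    then have u: "card (\<sigma> u) = 1" "odd (card {s \<in> c. \<sigma> u \<subseteq> s})" by (auto simp: boundary_def)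
    then have "{s \<in> c. \<sigma> u \<subseteq> s} \<noteq> {}" by (metis card.empty even_zero)
    then obtain s where s: "s \<in> c" "\<sigma> u \<subseteq> s" by blast
    then have "s \<in> K" "card s = 2" using less.prems(1) by (auto simp: simplices_def)
    then obtain e where e: "e < n" "s = \<sigma> e" "card (\<sigma> e) = 2" using \<sigma>_obtain by blast
    note ee = edge_ends[OF e(1,3)]
    obtain u' where u': "(u, u') = (e1 e, e2 e) \<or> (u, u') = (e2 e, e1 e)"
      using ee(5)[OF u(1) _ less.prems(4)] s(2) e(2) by blast
    have u'n: "u' < n" using u' ee by auto
    note s2 = step[OF edge_arc[OF less.prems(2,3) e(1,3) u'] less.prems(6,7)]
    have "boundary 1 {s} = sym_diff {\<sigma> u} {\<sigma> u'}" using ee(4) u' e(2) by auto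
    then have "boundary 1 (c - {s}) = sym_diff (sym_diff {\<sigma> v} {\<sigma> u}) (sym_diff {\<sigma> u} {\<sigma> u'})"
      using remove(6)[OF s(1)] less.prems(5) by simp
    also have "\<dots> = sym_diff {\<sigma> v} {\<sigma> u'}" by blast
    finally have bd: "boundary 1 (c - {s}) = sym_diff {\<sigma> v} {\<sigma> u'}" .
    have "st (?hub s e) = 2 \<and>
        lex_le (D (?hub s e), C (?hub s e))
          (a + w (\<sigma> e) + weight w (c - {s}), b + 1 + 3 * card (c - {s}) + 1)"
      by (rule less.hyps[OF remove(2)[OF s(1)] remove(5)[OF s(1)] xor_less[OF less.prems(2) code_less] less.prems(3) u'n bd s2])
    moreover have "(h XOR code {\<sigma> e}) XOR code (c - {s}) = h XOR code c"
      using remove(7)[OF s(1)] e(2) by (simp add: xor.assoc)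
    moreover have "lex_le (x, b + 1 + 3 * card (c - {s}) + 1) (x, b + 3 * card c + 1)" for x :: real
      using remove(3)[OF s(1)] by (simp add: lex_le_def)
    ultimately show ?thesis using remove(4)[OF s(1)] e(2) lex_le_trans by (simp add: add.assoc) blast
  qed
qed

lemma cycle_bound:
  assumes "z \<in> Z\<^sub>1"
  shows "st (hub n (code z)) = 2" "lex_le (D (hub n (code z)), C (hub n (code z))) (weight w z, 3 * card z + 2)"
proof -
  have z: "z \<subseteq> edges K" "boundary 1 z = {}" using assms by (auto simp: cycles_iff)
  have le0: "lex_le (D (hub n 0), C (hub n 0)) (0, 0)" using root by simp
  \<comment> \<open>Any simplex number can serve for the first start, because the empty walk there
    is closed. This start and the last return to a hub account for the summand 2.\<close>
  note s1 = step[OF start_arc[of 0 0, OF _ n_pos] root(1) le0, simplified]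
  have "st (hub n (0 XOR code z)) = 2 \<and>
    lex_le (D (hub n (0 XOR code z)), C (hub n (0 XOR code z))) (0 + weight w z, 1 + 3 * card z + 1)"
    by (rule traverse[OF z(1) _ n_pos n_pos _ s1]) (use z in simp_all)
  then show "st (hub n (code z)) = 2" "lex_le (D (hub n (code z)), C (hub n (code z))) (weight w z, 3 * card z + 2)" by simp_all
qed

lemma hub_settled: "h < 2 ^ g ==> st (hub n h) = 2"
  using code_surj cycle_bound(1) by metis

lemma collected_root: "collected D (hub n 0) {}"
  by (simp add: collected_hub empty_cycle weight_def root)

text \<open>The arc counter drops by one from a node to its parent, so the induction follows the
  parents to the root even across arcs of weight zero.\<close>

lemma collected_exists: "x < V ==> st x = 2 ==> \<exists>c. collected D x c"
proof (induction "C x" arbitrary: x rule: less_induct)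
  case less
  show ?case
  proof (cases "x = hub n 0")
    case False
    note p = parent[OF less.prems False]
    obtain c where "collected D (src (par x)) c" using less.hyps[of "src (par x)"] p by auto
    then show ?thesis using collected_arc[where D = D, OF p(2,5)] by blast
  qed (use collected_root in blast)
qed

text \<open>The collected chain \<open>c\<close> weighs at most the distance, whereas
  \<open>cycle_bound\<close> puts the key of the hub below the pair of the weight of
  \<open>c\<close> and \<open>3 * card c + 2\<close>. Hence the first components agree and the
  second ones can be compared.\<close>

lemma hub_count: assumes "h < 2 ^ g" shows "C (hub n h) \<le> 3 * n + 2"
proof -
  obtain c where "collected D (hub n h) c" using collected_exists[OF hub_less hub_settled] assms by blast
  then have c: "c \<in> Z\<^sub>1" "weight w c \<le> D (hub n h)" "code c = h" by (auto simp: collected_hub)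
  then have "C (hub n h) \<le> 3 * card c + 2" using cycle_bound(2)[OF c(1)] by (auto simp: lex_le_def)
  moreover have "card c \<le> card K" using c(1) fin_K simplices_subset[of 1] by (intro card_mono) (auto simp: cycles_iff)
  moreover have "card K = n" using bij_betw_same_card[OF bij] by simp
  ultimately show ?thesis by simp
qed

text \<open>The chain weighs at most the distance of its hub, and by \<open>cycle_bound\<close> that
  distance is at most the weight of any cycle in the class.\<close>

lemma collected_shortest:
  assumes c: "collected D (hub n h) c" and h: "h' \<in> carrier (homology K 1)" "\<And>z. z \<in> Z\<^sub>1 ==> cls z = h' ==> code z = h"
  shows "shortest_cycle_in K w h' c"
proof -
  have c': "c \<in> Z\<^sub>1" "weight w c \<le> D (hub n h)" "code c = h" using c by (auto simp: collected_hub)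
  obtain z where z: "z \<in> Z\<^sub>1" "h' = cls z" using h(1) by (auto simp: homology_carrier)
  have "cls c = h'" using code_cls[OF c'(1) z(1)] h(2)[OF z(1)] z c' by simp
  moreover have "weight w c \<le> weight w z'" if "z' \<in> Z\<^sub>1" "cls z' = h'" for z'
    using cycle_bound(2)[OF that(1)] h(2)[OF that] c' by (auto simp: lex_le_def)
  ultimately show ?thesis using c'(1) unfolding shortest_cycle_in_def homology_class_eq by blast
qed

lemma classes: "card (carrier (homology K 1)) = 2 ^ g"
  using card_homology g_eq by simp

end

section \<open>Reading the input\<close>

locale encoded_complex = indexed_complex K \<sigma> n for K :: "'v set set" and \<sigma> n +
  fixes w :: "'v set => real" and s\<^sub>0 :: machine_state
  assumes enc: "encodes_complex K w \<sigma> s\<^sub>0" and n_card: "n = card K" and n_pos: "0 < n"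
begin

abbreviation "off i \<equiv> warr s\<^sub>0 0 i"

definition vert :: "nat => nat => nat" where
  "vert k i = warr s\<^sub>0 1 (off i + k)"

lemma off_0: "off 0 = 0"
  using enc by (simp add: encodes_complex_def)

lemma enc_at: "i < n ==> off (i + 1) = off i + card (\<sigma> i) \<and>
    (\<lambda>j. \<sigma> (warr s\<^sub>0 1 j)) ` {off i..<off (i + 1)} = (\<lambda>v. {v}) ` \<sigma> i \<and>
    warr s\<^sub>0 1 ` {off i..<off (i + 1)} \<subseteq> {..<n}"
  using enc unfolding encodes_complex_def n_card by blast

lemma off_Suc: "i < n ==> off (i + 1) = off i + card (\<sigma> i)"
  using enc_at by blast

lemma vert_image: "i < n ==> (\<lambda>k. \<sigma> (vert k i)) ` {..<card (\<sigma> i)} = (\<lambda>v. {v}) ` \<sigma> i"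
proof -
  assume i: "i < n"
  have "(\<lambda>j. \<sigma> (warr s\<^sub>0 1 j)) ` {off i..<off (i + 1)} = (\<lambda>v. {v}) ` \<sigma> i"
    using enc_at[OF i] by blast
  moreover have "{off i..<off (i + 1)} = (+) (off i) ` {..<card (\<sigma> i)}"
    using off_Suc[OF i] by (simp add: lessThan_atLeast0 image_add_atLeastLessThan add.commute)
  ultimately show ?thesis by (simp add: image_image vert_def)
qed

lemma vert_less: "i < n ==> k < card (\<sigma> i) ==> vert k i < n"
proof -
  assume i: "i < n" "k < card (\<sigma> i)"
  have "warr s\<^sub>0 1 ` {off i..<off (i + 1)} \<subseteq> {..<n}"
    using enc_at[OF i(1)] by blast
  moreover have "off i + k \<in> {off i..<off (i + 1)}" using off_Suc[OF i(1)] i(2) by simp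
  ultimately show ?thesis unfolding vert_def by blast
qed

lemma vert_card: "i < n ==> k < card (\<sigma> i) ==> card (\<sigma> (vert k i)) = 1"
proof -
  assume i: "i < n" "k < card (\<sigma> i)"
  then have "\<sigma> (vert k i) \<in> (\<lambda>v. {v}) ` \<sigma> i" using vert_image[OF i(1)] by blast
  then show ?thesis by auto
qed

lemma subset_iff_vert:
  assumes "i < n" "j < n" "card (\<sigma> j) = 1"
  shows "\<sigma> j \<subseteq> \<sigma> i \<longleftrightarrow> (\<exists>k<card (\<sigma> i). j = vert k i)"
proof -
  obtain v where v: "\<sigma> j = {v}" using assms(3) by (rule card_1_singletonE)
  have "\<sigma> j \<subseteq> \<sigma> i \<longleftrightarrow> {v} \<in> (\<lambda>v. {v}) ` \<sigma> i" using v by auto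
  also have "\<dots> \<longleftrightarrow> (\<exists>k<card (\<sigma> i). {v} = \<sigma> (vert k i))" unfolding vert_image[OF assms(1), symmetric] by auto
  also have "\<dots> \<longleftrightarrow> (\<exists>k<card (\<sigma> i). j = vert k i)"
    using \<sigma>_inj[OF assms(2) vert_less[OF assms(1)]] v by metis
  finally show ?thesis .
qed

lemma edge_verts:
  assumes "i < n" "card (\<sigma> i) = 2"
  shows "vert 0 i < n" "vert 1 i < n" "\<exists>x y. x \<noteq> y \<and> \<sigma> (vert 0 i) = {x} \<and> \<sigma> (vert 1 i) = {y} \<and> \<sigma> i = {x, y}"
proof -
  show "vert 0 i < n" "vert 1 i < n" using vert_less[OF assms(1)] assms(2) by auto
  obtain x y where xy: "\<sigma> i = {x, y}" "x \<noteq> y" using assms(2) by (auto simp: card_2_iff)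
  have "{..<card (\<sigma> i)} = {0, 1}" using assms(2) by auto
  then have "{\<sigma> (vert 0 i), \<sigma> (vert 1 i)} = {{x}, {y}}"
    using vert_image[OF assms(1)] xy by simp
  then have "\<sigma> (vert 0 i) = {x} \<and> \<sigma> (vert 1 i) = {y} \<or> \<sigma> (vert 0 i) = {y} \<and> \<sigma> (vert 1 i) = {x}"
    by (auto simp: doubleton_eq_iff)
  then show "\<exists>x y. x \<noteq> y \<and> \<sigma> (vert 0 i) = {x} \<and> \<sigma> (vert 1 i) = {y} \<and> \<sigma> i = {x, y}"
  proof
    assume "\<sigma> (vert 0 i) = {x} \<and> \<sigma> (vert 1 i) = {y}"
    then show ?thesis using xy by blast
  next
    assume a: "\<sigma> (vert 0 i) = {y} \<and> \<sigma> (vert 1 i) = {x}"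
    have "\<sigma> i = {y, x}" using xy by auto
    then show ?thesis using a xy(2) by (intro exI[of _ y] exI[of _ x]) auto
  qed
qed

lemma card_simplex_le: "i < n ==> card (\<sigma> i) \<le> n"
proof -
  assume i: "i < n"
  have fin: "finite (\<sigma> i)" using complex \<sigma>_in[OF i] by (simp add: simplicial_complex_def)
  have "(\<lambda>v. {v}) ` \<sigma> i \<subseteq> K" using complex \<sigma>_in[OF i] unfolding simplicial_complex_def by blast
  then have "card ((\<lambda>v. {v}) ` \<sigma> i) \<le> card K" using fin_K by (intro card_mono)
  moreover have "card ((\<lambda>v. {v}) ` \<sigma> i) = card (\<sigma> i)" by (intro card_image) (auto simp: inj_on_def)
  ultimately show ?thesis using n_card by simp
qed

text \<open>The vertex lists together have at most \<open>n * n\<close> entries, so offsets into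
  them are words.\<close>

lemma off_le: "i \<le> n ==> off i \<le> i * n"
proof (induction i)
  case (Suc i)
  then have "off (Suc i) = off i + card (\<sigma> i)" using off_Suc[of i] by (simp add: Suc_eq_plus1)
  then show ?case using Suc card_simplex_le[of i] by simp
qed (simp add: off_0)

text \<open>With the vertices of every simplex listed, incidence needs only a fixed number of
  comparisons, so the whole matrix is read in quadratic time.\<close>

lemma boundary_col_1:
  assumes "i < n" "j < n"
  shows "boundary_col 1 j i = (if card (\<sigma> j) = 2 \<and> (i = vert 0 j \<or> i = vert 1 j) then 1 else 0)"
proof -
  have "card (\<sigma> i) = 1 \<and> \<sigma> i \<subseteq> \<sigma> j \<longleftrightarrow> i = vert 0 j \<or> i = vert 1 j" if c: "card (\<sigma> j) = 2"
  proof -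
    have "(\<exists>k<card (\<sigma> j). i = vert k j) \<longleftrightarrow> i = vert 0 j \<or> i = vert 1 j"
    proof -
      have "k < 2 \<longleftrightarrow> k = 0 \<or> k = 1" for k :: nat by auto
      then show ?thesis unfolding c by auto
    qed
    then show ?thesis using subset_iff_vert[OF assms(2,1)] vert_card[OF assms(2)] c by (metis one_less_numeral_iff semiring_norm(76) zero_less_numeral)
  qed
  then show ?thesis using assms by (auto simp: boundary_col_def)
qed

text \<open>An edge is a face of a triangle iff both its listed vertices occur among the three
  listed vertices of the triangle.\<close>

lemma boundary_col_2:
  assumes "i < n" "j < n"
  shows "boundary_col 2 j i = (if card (\<sigma> i) = 2 \<and> card (\<sigma> j) = 3 \<and>
    (vert 0 i = vert 0 j \<or> vert 0 i = vert 1 j \<or> vert 0 i = vert 2 j) \<and>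
    (vert 1 i = vert 0 j \<or> vert 1 i = vert 1 j \<or> vert 1 i = vert 2 j) then 1 else 0)"
proof -
  have "\<sigma> i \<subseteq> \<sigma> j \<longleftrightarrow> (vert 0 i = vert 0 j \<or> vert 0 i = vert 1 j \<or> vert 0 i = vert 2 j) \<and>
    (vert 1 i = vert 0 j \<or> vert 1 i = vert 1 j \<or> vert 1 i = vert 2 j)" if c: "card (\<sigma> i) = 2" "card (\<sigma> j) = 3"
  proof -
    obtain x y where xy: "x \<noteq> y" "\<sigma> (vert 0 i) = {x}" "\<sigma> (vert 1 i) = {y}" "\<sigma> i = {x, y}"
      using edge_verts(3)[OF assms(1) c(1)] by blast
    have ex: "(\<exists>k<card (\<sigma> j). u = vert k j) \<longleftrightarrow> u = vert 0 j \<or> u = vert 1 j \<or> u = vert 2 j" for u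
    proof -
      have "k < 3 \<longleftrightarrow> k = 0 \<or> k = 1 \<or> k = 2" for k :: nat by auto
      then show ?thesis unfolding c by auto
    qed
    have "\<sigma> i \<subseteq> \<sigma> j \<longleftrightarrow> \<sigma> (vert 0 i) \<subseteq> \<sigma> j \<and> \<sigma> (vert 1 i) \<subseteq> \<sigma> j" using xy by auto
    also have "\<dots> \<longleftrightarrow> (\<exists>k<card (\<sigma> j). vert 0 i = vert k j) \<and> (\<exists>k<card (\<sigma> j). vert 1 i = vert k j)"
      using subset_iff_vert[OF assms(2) edge_verts(1)[OF assms(1) c(1)]] subset_iff_vert[OF assms(2) edge_verts(2)[OF assms(1) c(1)]] xy(2,3)
      by simp
    finally show ?thesis unfolding ex .
  qed
  then show ?thesis using assms by (auto simp: boundary_col_def)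
qed

end

subsection \<open>Boolean expressions\<close>

text \<open>With truncated subtraction, \<open>(a -. b) +. (b -. a)\<close> is the absolute
  difference; one summand is zero, so it does not exceed the larger operand. Truth values as words
  avoid branching inside the loops that fill arrays.\<close>

definition eq_exp :: "word_exp => word_exp => word_exp" where
  "eq_exp a b = Const 1 -. ((a -. b) +. (b -. a))"

definition or_exp :: "word_exp => word_exp => word_exp" where
  "or_exp a b = Const 1 -. (Const 1 -. a) *. (Const 1 -. b)"

definition pos_exp :: "word_exp => word_exp" where
  "pos_exp a = Const 1 -. (Const 1 -. a)"

definition evals :: "nat => machine_state => word_exp => nat => bool" where
  "evals W s e v \<longleftrightarrow> word_val e s = v \<and> word_words e s \<subseteq> {..W}"

lemma evals_le: "evals W s e v ==> v \<le> W"
  using word_val_in_words[of e s] by (auto simp: evals_def)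

lemma evals_Const: "c \<le> W ==> evals W s (Const c) c"
  by (simp add: evals_def)

lemma evals_Var: "word_state W s ==> wvar s x = v ==> evals W s (Var x) v"
  by (auto simp: evals_def word_state_def)

lemma evals_Load: "word_state W s ==> evals W s e i ==> warr s a i = v ==> evals W s (Load a e) v"
  by (auto simp: evals_def word_state_def)

lemma evals_add: "evals W s a x ==> evals W s b y ==> x + y \<le> W ==> evals W s (a +. b) (x + y)"
  by (auto simp: evals_def)

lemma evals_mult: "evals W s a x ==> evals W s b y ==> x * y \<le> W ==> evals W s (a *. b) (x * y)"
  by (auto simp: evals_def)

lemma evals_sub: "evals W s a x ==> evals W s b y ==> evals W s (a -. b) (x - y)"
  using evals_le[of W s a x] by (auto simp: evals_def)

lemma evals_eq: "evals W s a x ==> evals W s b y ==> 1 \<le> W ==> evals W s (eq_exp a b) (of_bool (x = y))"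
  using evals_le[of W s a x] evals_le[of W s b y] by (auto simp: evals_def eq_exp_def)

lemma evals_or: "evals W s a (of_bool p) ==> evals W s b (of_bool q) ==> 1 \<le> W ==> evals W s (or_exp a b) (of_bool (p \<or> q))"
  by (auto simp: evals_def or_exp_def)

lemma evals_and: "evals W s a (of_bool p) ==> evals W s b (of_bool q) ==> 1 \<le> W ==> evals W s (a *. b) (of_bool (p \<and> q))"
  by (auto simp: evals_def)

lemma evals_pos: "evals W s a x ==> 1 \<le> W ==> evals W s (pos_exp a) (of_bool (x \<noteq> 0))"
  by (auto simp: evals_def pos_exp_def)

lemma evals_not: "evals W s a x ==> 1 \<le> W ==> evals W s (Const 1 -. a) (of_bool (x = 0))"
  by (auto simp: evals_def)

lemma evals_fill:
  assumes "evals W s ie i" "evals W s e v"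
  shows "word_val ie s = i \<and> word_val e s = v \<and> word_words ie s \<union> word_words e s \<subseteq> {..W}"
  using assms by (simp add: evals_def)

subsection \<open>Powers of two\<close>

text \<open>The result is less than twice the given number or equal to 1, so padding to a power of
  two costs only constant factors.\<close>

definition power_above :: "nat => nat => com" where
  "power_above x y = (x ::= Const 1) ;; While (Neg (Leq (Var y) (Var x))) (x ::= Var x +. Var x)"

lemma power_above_names [simp]:
  "wvars_of (power_above x y) = {x}" "warrs_of (power_above x y) = {}" "rvars_of (power_above x y) = {}" "rarrs_of (power_above x y) = {}"
  by (auto simp: power_above_def)

lemma run_power_above:
  assumes ws: "word_state W s" and xy: "x \<noteq> y" and m: "wvar s y = m" "0 < m" "2 * m \<le> W"
  shows "run W (power_above x y) s (\<lambda>t s'. (\<exists>L. wvar s' x = 2 ^ L) \<and> m \<le> wvar s' x \<and> wvar s' x \<le> 2 * m \<and> t \<le> 20 * m + 10)"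
  unfolding power_above_def
proof (rule run_Assign_Seq[where v = 1], goal_cases)
  case 3
  have ws': "word_state W (set_wvar x 1 s)" using ws m by (auto simp: word_state_def)
  show ?case
  proof (rule run_While[where I = "\<lambda>s'. (\<exists>L. wvar s' x = 2 ^ L) \<and> wvar s' x \<le> 2 * m" and \<Phi> = "\<lambda>s'. 10 * (2 * m - wvar s' x)"], goal_cases)
    case 1 show ?case by (rule ws')
  next
    case 2 show ?case using m by (auto intro: exI[of _ 0])
  next
    case (3 s') then show ?case by (auto simp: word_state_def)
  next
    case (4 s')
    have y: "wvar s' y = m" using 4(2) xy m(1) by (simp add: frame_def)
    obtain L where L: "wvar s' x = 2 ^ L" using 4(3) by blast
    have lt: "2 ^ L < m" using 4(4) y L by simp
    have pos: "0 < (2::nat) ^ L" by simp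
    have w: "(2::nat) ^ L \<le> W" "2 ^ L + 2 ^ L \<le> W" using lt m by linarith+
    have "\<exists>L'. (2::nat) ^ L + 2 ^ L = 2 ^ L'" by (rule exI[of _ "Suc L"]) simp
    moreover have "10 * (2 * m - (2 ^ L + 2 ^ L)) + 10 \<le> 10 * (2 * m - 2 ^ L)" using lt pos by linarith
    ultimately show ?case using w L lt by (simp add: run_Assign)
  next
    case (5 t s')
    have y: "wvar s' y = m" using 5(2) xy m(1) by (simp add: frame_def)
    show ?case using 5 y m by auto
  qed
qed (use m in auto)

subsection \<open>Reading the boundary matrices\<close>

text \<open>The padding up to size \<open>N\<close> must be zero but memory is uninitialised, so the
  whole square is cleared before the entries are written.\<close>

definition load_matrix :: "word_exp => com" where
  "load_matrix e = For 35 vN (For 36 vN (Store aX (cell_exp 35 vN 36) (Const 0))) ;;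
     For 35 0 (For 36 0 (Store aX (cell_exp 35 vN 36) e))"

lemma load_matrix_names [simp]:
  "wvars_of (load_matrix e) = {35, 36}" "warrs_of (load_matrix e) = {aX}" "rvars_of (load_matrix e) = {}" "rarrs_of (load_matrix e) = {}"
  by (auto simp: load_matrix_def)

lemma run_load_matrix:
  assumes ws: "word_state W s" and v: "wvar s 0 = n" "wvar s vN = N" "n \<le> N" "N * N + 10 \<le> W"
    and e: "\<And>i j s'. i < n ==> j < n ==> word_state W s' ==> frame (load_matrix e) s s' ==> wvar s' 35 = i ==> wvar s' 36 = j ==>
      evals W s' e (nat_of_bit (M j i))"
    and M: "\<And>i j. i < N ==> j < N ==> \<not> (i < n \<and> j < n) ==> M j i = 0"
  shows "run W (load_matrix e) s (\<lambda>t s'. stores_cols N aX M s' \<and> t \<le> (N * N + N + 1) * (word_cost e + 60))"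
proof -
  have idx: "evals W s' (cell_exp 35 vN 36) (i * N + j)"
    if "word_state W s'" "wvar s' 35 = i" "wvar s' 36 = j" "wvar s' vN = N" "i < N" "j < N" for s' i j
  proof -
    have "i * N + j \<le> W" using mat_idx_less[of i N j N] that v(4) by linarith
    then show ?thesis using that by (intro evals_add evals_mult evals_Var) auto
  qed
  let ?F1 = "For 35 vN (For 36 vN (Store aX (cell_exp 35 vN 36) (Const 0)))"
  let ?F2 = "For 35 0 (For 36 0 (Store aX (cell_exp 35 vN 36) e))"
  have "run W ?F1 s (\<lambda>t s'. (\<forall>i<N. \<forall>l<N. warr s' aX (i * N + l) = 0) \<and>
      (\<forall>k. k \<notin> (\<lambda>(i, j). i * N + j) ` ({..<N} \<times> {..<N}) --> warr s' aX k = warr s aX k) \<and>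
      t \<le> 7 + N * (16 + N * (word_cost (cell_exp 35 vN 36) + word_cost (Const 0) + 10)))"
  proof (rule run_fill2)
    fix i l s' assume a: "i < N" "l < N" "word_state W s'" "frame ?F1 s s'" "wvar s' 35 = i" "wvar s' 36 = l"
    show "word_val (cell_exp 35 vN 36) s' = i * N + l \<and> word_val (Const 0) s' = 0 \<and>
        word_words (cell_exp 35 vN 36) s' \<union> word_words (Const 0) s' \<subseteq> {..W}"
      by (rule evals_fill[OF idx evals_Const]) (use a v in \<open>auto simp: frame_def\<close>)
  qed (use ws v in \<open>auto simp: mat_idx_inj\<close>)
  then have F1: "run W ?F1 s (\<lambda>t s'. (\<forall>i<N. \<forall>l<N. warr s' aX (i * N + l) = 0) \<and> t \<le> 7 + N * (16 + N * 16))"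
    by (rule run_mono) simp
  show ?thesis
    unfolding load_matrix_def
  proof (rule run_SeqI[OF F1 ws], goal_cases)
    case (1 t1 s1)
    have s1: "wvar s1 0 = n" "wvar s1 vN = N" using 1(3) v by (auto simp: frame_def)
    have "run W ?F2 s1 (\<lambda>t s'. (\<forall>i<n. \<forall>l<n. warr s' aX (i * N + l) = nat_of_bit (M l i)) \<and>
      (\<forall>k. k \<notin> (\<lambda>(i, j). i * N + j) ` ({..<n} \<times> {..<n}) --> warr s' aX k = warr s1 aX k) \<and>
      t \<le> 7 + n * (16 + n * (word_cost (cell_exp 35 vN 36) + word_cost e + 10)))"
    proof (rule run_fill2)
      fix i l s' assume a: "i < n" "l < n" "word_state W s'" "frame ?F2 s1 s'" "wvar s' 35 = i" "wvar s' 36 = l"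
      have "frame (load_matrix e) s s'" using 1(3) a(4) by (auto simp: frame_def load_matrix_def)
      then show "word_val (cell_exp 35 vN 36) s' = i * N + l \<and> word_val e s' = nat_of_bit (M l i) \<and>
          word_words (cell_exp 35 vN 36) s' \<union> word_words e s' \<subseteq> {..W}"
        by (intro evals_fill[OF idx e]) (use a v s1 in \<open>auto simp: frame_def\<close>)
    qed (use 1 s1 v in \<open>auto simp: mat_idx_inj\<close>)
    then show ?case
    proof (rule run_mono, goal_cases)
      case (1 t2 s2)
      have "warr s2 aX (i * N + y) = nat_of_bit (M y i)" if "i < N" "y < N" for i y
      proof (cases "i < n \<and> y < n")
        case False
        have "i * N + y \<notin> (\<lambda>(i, j). i * N + j) ` ({..<n} \<times> {..<n})"
          using False that v(3) by (auto simp: mat_idx_inj)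
        then show ?thesis using 1 \<open>(\<forall>i<N. \<forall>l<N. warr s1 aX (i * N + l) = 0) \<and> _\<close> that M[OF _ _ False] by simp
      qed (use 1 in simp)
      moreover have "t1 + t2 \<le> (N * N + N + 1) * (word_cost e + 60)"
      proof -
        have "t2 \<le> 7 + N * (16 + N * (word_cost e + 15))"
        proof -
          have "n * (16 + n * (word_cost e + 15)) \<le> N * (16 + N * (word_cost e + 15))"
            using v(3) by (intro mult_le_mono add_le_mono) auto
          moreover have "t2 \<le> 7 + n * (16 + n * (word_cost e + 15))" using 1 by (simp add: add.commute)
          ultimately show ?thesis by linarith
        qed
        moreover have "t1 \<le> 7 + N * (16 + N * 16)" using \<open>_ \<and> t1 \<le> _\<close> by simp
        ultimately have "t1 + t2 \<le> (7 + N * (16 + N * 16)) + (7 + N * (16 + N * (word_cost e + 15)))" by linarith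
        also have "\<dots> \<le> (N * N + N + 1) * (word_cost e + 60)" by (simp add: algebra_simps)
        finally show ?thesis .
      qed
      ultimately show ?case by (auto simp: stores_cols_def)
    qed
  qed
qed

section \<open>The annotation of the edges\<close>

abbreviation (input) "aTr \<equiv> 6 :: nat"
abbreviation (input) "aR \<equiv> 7 :: nat"
abbreviation (input) "aXor \<equiv> 8 :: nat"
abbreviation (input) "vg \<equiv> 16 :: nat"
abbreviation (input) "vG \<equiv> 17 :: nat"
abbreviation (input) "vpw \<equiv> 18 :: nat"

definition size_exp :: "nat => word_exp" where
  "size_exp x = Load 0 (Var x +. Const 1) -. Load 0 (Var x)"

definition vert_exp :: "nat => nat => word_exp" where
  "vert_exp k x = Load 1 (Load 0 (Var x) +. Const k)"

definition col1_exp :: "nat => nat => word_exp" where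
  "col1_exp i j = eq_exp (size_exp j) (Const 2) *. or_exp (eq_exp (Var i) (vert_exp 0 j)) (eq_exp (Var i) (vert_exp 1 j))"

definition vert_in_exp :: "nat => nat => nat => word_exp" where
  "vert_in_exp k i j = or_exp (eq_exp (vert_exp k i) (vert_exp 0 j))
     (or_exp (eq_exp (vert_exp k i) (vert_exp 1 j)) (eq_exp (vert_exp k i) (vert_exp 2 j)))"

definition col2_exp :: "nat => nat => word_exp" where
  "col2_exp i j = (eq_exp (size_exp i) (Const 2) *. eq_exp (size_exp j) (Const 3)) *. (vert_in_exp 0 i j *. vert_in_exp 1 i j)"

definition second_exp :: "nat => nat => word_exp" where
  "second_exp i j = or_exp (pos_exp (Load aTr (Var j)) *. eq_exp (Var i) (Var j))
     ((Const 1 -. Load aTr (Var j)) *. col2_exp i j)"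

text \<open>Doubling \<open>vG\<close> with every free row computes 2^g along the way.\<close>

definition collect_free :: com where
  "collect_free = (vg ::= Const 0) ;; (vG ::= Const 1) ;;
     For 35 0 (Cond (Conj (Leq (Const 1) (eq_exp (size_exp 35) (Const 2))) (Leq (Load aUsed (Var 35)) (Const 0)))
       (Store aR (Var vg) (Var 35) ;; (vg ::= Var vg +. Const 1) ;; (vG ::= Var vG +. Var vG)) Skip)"

context mult_machine
begin

definition prepare :: com where
  "prepare = power_above vN 0 ;; load_matrix (col1_exp 35 36) ;; eliminate MM ;;
     For 35 vN (Store aTr (Var 35) (Load aPiv (Var 35))) ;;
     load_matrix (second_exp 35 36) ;; eliminate MM ;; collect_free"

end

lemma collect_free_names [simp]:
  "wvars_of collect_free = {vg, vG, 35}" "warrs_of collect_free = {aR}" "rvars_of collect_free = {}" "rarrs_of collect_free = {}"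
  by (auto simp: collect_free_def)

text \<open>The bound on \<open>W\<close> covers the largest addresses and numbers: padding gives
  \<open>N \<le> 2 * n\<close> and matrices of at most \<open>4 * (n * n)\<close> entries; with
  \<open>q = n * n * 2 ^ g\<close> there are at most \<open>2 * q\<close> nodes,
  \<open>4 * q\<close> arcs and \<open>8 * q\<close> tree entries.\<close>

locale cycle_program = encoded_complex K \<sigma> n w s\<^sub>0 + mult_machine MM TM k\<^sub>M
  for K :: "'v set set" and \<sigma> n w s\<^sub>0 MM TM k\<^sub>M +
  fixes W :: nat
  assumes ws\<^sub>0: "word_state W s\<^sub>0" and W: "30 * (n * n * 2 ^ homology_dim K 1) \<le> W" and W_mult: "k\<^sub>M * (2 * n) ^ k\<^sub>M \<le> W"
    and weight_nonneg: "\<And>e. e \<in> edges K ==> 0 \<le> w e"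
begin

lemma W_n: "30 * (n * n) \<le> W"
proof -
  have "30 * (n * n) * 1 \<le> 30 * (n * n) * 2 ^ homology_dim K 1" by (intro mult_le_mono2) simp
  also have "\<dots> = 30 * (n * n * 2 ^ homology_dim K 1)" by (simp only: mult.assoc)
  finally show ?thesis using W by linarith
qed

lemma n_le: "n \<le> n * n" using n_pos by simp

lemma W_ge: "30 \<le> W" "30 * n \<le> W"
  using W_n n_le n_pos by linarith+

definition input :: "machine_state => bool" where
  "input s \<longleftrightarrow> wvar s 0 = n \<and> warr s 0 = warr s\<^sub>0 0 \<and> warr s 1 = warr s\<^sub>0 1 \<and> rarr s 0 = rarr s\<^sub>0 0"

lemma input_0: "input s\<^sub>0"
  using enc unfolding input_def encodes_complex_def n_card[symmetric] by blast

lemma input_frame: "input s ==> frame P s s' ==> 0 \<notin> wvars_of P ==> 0 \<notin> warrs_of P ==> 1 \<notin> warrs_of P ==> 0 \<notin> rarrs_of P ==> input s'"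
  by (simp add: input_def frame_def)

lemma evals_size: "input s ==> word_state W s ==> wvar s x = i ==> i < n ==> evals W s (size_exp x) (card (\<sigma> i))"
proof -
  assume a: "input s" "word_state W s" "wvar s x = i" "i < n"
  have "card (\<sigma> i) = off (i + 1) - off i" using off_Suc[OF a(4)] by simp
  moreover have "evals W s (size_exp x) (off (i + 1) - off i)"
    unfolding size_exp_def
    by (intro evals_sub evals_Load[OF a(2), where i = "i + 1"] evals_Load[OF a(2), where i = i] evals_add evals_Const evals_Var[OF a(2)])
      (use a W_ge in \<open>auto simp: input_def\<close>)
  ultimately show ?thesis by simp
qed

lemma evals_vert: "input s ==> word_state W s ==> wvar s x = i ==> i < n ==> k \<le> 2 ==> evals W s (vert_exp k x) (vert k i)"
proof -
  assume a: "input s" "word_state W s" "wvar s x = i" "i < n" "k \<le> 2"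
  have "off i \<le> i * n" using off_le[of i] a by simp
  also have "\<dots> \<le> n * n" using a by simp
  finally have "off i + k \<le> W" using a W_n W_ge n_le by linarith
  then show ?thesis unfolding vert_exp_def vert_def
    by (intro evals_Load[OF a(2), where i = "off i + k"] evals_Load[OF a(2), where i = i] evals_add evals_Const evals_Var[OF a(2)])
      (use a W_ge in \<open>auto simp: input_def\<close>)
qed

lemma evals_size_eq: "input s ==> word_state W s ==> wvar s x = i ==> i < n ==> k \<le> 3 ==>
    evals W s (eq_exp (size_exp x) (Const k)) (of_bool (card (\<sigma> i) = k))"
  by (intro evals_eq evals_size evals_Const) (use W_ge in auto)

lemma evals_col1:
  assumes "input s" "word_state W s" "wvar s x = i" "wvar s y = j" "i < n" "j < n"
  shows "evals W s (col1_exp x y) (nat_of_bit (boundary_col 1 j i))"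
proof -
  have "nat_of_bit (boundary_col 1 j i) = of_bool (card (\<sigma> j) = 2 \<and> (i = vert 0 j \<or> i = vert 1 j))"
    unfolding boundary_col_1[OF assms(5,6)] by simp
  then show ?thesis unfolding col1_exp_def
    by (simp only:) (intro evals_and evals_or evals_size_eq[OF assms(1,2)] evals_eq evals_vert[OF assms(1,2)] evals_Var[OF assms(2)];
      use assms W_ge in simp)
qed

lemma evals_col2:
  assumes "input s" "word_state W s" "wvar s x = i" "wvar s y = j" "i < n" "j < n"
  shows "evals W s (col2_exp x y) (nat_of_bit (boundary_col 2 j i))"
proof -
  have "nat_of_bit (boundary_col 2 j i) = of_bool ((card (\<sigma> i) = 2 \<and> card (\<sigma> j) = 3) \<and>
    (vert 0 i = vert 0 j \<or> vert 0 i = vert 1 j \<or> vert 0 i = vert 2 j) \<and>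
    (vert 1 i = vert 0 j \<or> vert 1 i = vert 1 j \<or> vert 1 i = vert 2 j))"
    unfolding boundary_col_2[OF assms(5,6)] by simp
  then show ?thesis unfolding col2_exp_def vert_in_exp_def
    by (simp only:) (intro evals_and evals_or evals_size_eq[OF assms(1,2)] evals_eq evals_vert[OF assms(1,2)];
      use assms W_ge in simp)
qed

lemma N_words: "N \<le> 2 * n ==> N * N + 10 \<le> W" "N \<le> 2 * n ==> k\<^sub>M * N ^ k\<^sub>M \<le> W"
proof -
  assume N: "N \<le> 2 * n"
  have "N * N \<le> (2 * n) * (2 * n)" by (rule mult_le_mono[OF N N])
  also have "\<dots> = 4 * (n * n)" by simp
  finally show "N * N + 10 \<le> W" using W_n W_ge n_le n_pos by linarith
  have "k\<^sub>M * N ^ k\<^sub>M \<le> k\<^sub>M * (2 * n) ^ k\<^sub>M" using N by (intro mult_le_mono2 power_mono) auto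
  then show "k\<^sub>M * N ^ k\<^sub>M \<le> W" using W_mult by linarith
qed

lemma run_collect_free:
  assumes ws: "word_state W s" and inp: "input s" and F: "annotated_complex K \<sigma> n N piv1" and piv2: "pivoting piv2 (annotated_complex.second_col \<sigma> n piv1) N N"
    and used: "used_ok piv2 N N (warr s aUsed)"
  shows "run W collect_free s (\<lambda>t s'. bij_betw (warr s' aR) {..<wvar s' vg} (annotated_complex.free_rows \<sigma> n N piv2) \<and>
    wvar s' vG = 2 ^ wvar s' vg \<and> t \<le> 100 * n + 20)"
proof -
  interpret annotated_complex K \<sigma> n N piv1 piv2 by (rule F)
  let ?s = "set_wvar vG 1 (set_wvar vg 0 s)"
  let ?test = "Conj (Leq (Const 1) (eq_exp (size_exp 35) (Const 2))) (Leq (Load aUsed (Var 35)) (Const 0))"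
  let ?B = "Cond ?test (Store aR (Var vg) (Var 35) ;; (vg ::= Var vg +. Const 1) ;; (vG ::= Var vG +. Var vG)) Skip"
  define R where "R i = {e \<in> free_rows. e < i}" for i
  have finR: "finite (R i)" for i by (simp add: R_def)
  have R_Suc: "R (Suc i) = (if i \<in> free_rows then insert i (R i) else R i)" for i by (auto simp: R_def less_Suc_eq)
  have i_R: "i \<notin> R i" for i by (simp add: R_def)
  \<comment> \<open>The dimension is not known to the program, but the free rows found so far are
    part of all free rows, so the power computed so far is bounded by the number of classes.\<close>
  have card_R: "2 * 2 ^ card (R i) \<le> W \<and> card (R i) + 1 \<le> W" if "i < n" "i \<in> free_rows" for i
  proof -
    have "finite free_rows" by (rule finite_subset[of _ "{..<n}"]) (auto simp: free_rows_def)
    moreover have "R (Suc i) \<subseteq> free_rows" by (auto simp: R_def)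
    ultimately have "card (R (Suc i)) \<le> homology_dim K 1" using card_mono card_free_rows[OF piv2] by metis
    then have c: "Suc (card (R i)) \<le> homology_dim K 1" using R_Suc[of i] that finR[of i] i_R[of i] by simp
    then have "2 ^ Suc (card (R i)) \<le> (2 :: nat) ^ homology_dim K 1" by (intro power_increasing) auto
    moreover have "1 * 2 ^ homology_dim K 1 \<le> n * n * 2 ^ homology_dim K 1" using n_pos n_le by (intro mult_le_mono1) linarith
    moreover have "Suc (card (R i)) < (2 :: nat) ^ Suc (card (R i))" by (rule less_exp)
    moreover have "(2 :: nat) ^ Suc (card (R i)) = 2 * 2 ^ card (R i)" by simp
    ultimately have "2 * 2 ^ card (R i) \<le> W" "card (R i) + 1 \<le> W" using W by linarith+
    then show ?thesis by blast
  qed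
  have main: "run W (For 35 0 ?B) ?s (\<lambda>t s'. bij_betw (warr s' aR) {..<wvar s' vg} free_rows \<and> wvar s' vG = 2 ^ wvar s' vg \<and> t \<le> 100 * n + 7)"
  proof (rule run_For[where I = "\<lambda>i s'. bij_betw (warr s' aR) {..<wvar s' vg} (R i) \<and> wvar s' vG = 2 ^ wvar s' vg" and T = "\<lambda>_. 80"], goal_cases)
    case 1 show ?case using ws W_ge by (auto simp: word_state_def)
  next
    case 6 show ?case by (simp add: R_def bij_betw_def)
  next
    case (7 i s')
    have i: "i < n" using 7(1) inp by (simp add: input_def)
    have inp': "input s'" using inp 7(3) by (simp add: input_def frame_def)
    have us: "warr s' aUsed = warr s aUsed" using 7(3) by (simp add: frame_def)
    have e1: "evals W s' (eq_exp (size_exp 35) (Const 2)) (of_bool (card (\<sigma> i) = 2))"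
      by (rule evals_size_eq[OF inp' 7(2,4) i]) simp
    have e2: "evals W s' (Load aUsed (Var 35)) (warr s aUsed i)"
      by (rule evals_Load[OF 7(2) evals_Var[OF 7(2,4)]]) (simp add: us)
    have words: "test_words ?test s' \<subseteq> {..W}" using e1 e2 W_ge by (auto simp: evals_def)
    have "used_rows piv2 N = {p. p \<in> used_rows piv2 N}" by simp
    have iff: "test_val ?test s' \<longleftrightarrow> i \<in> free_rows"
      using e1 e2 used i nN by (auto simp: evals_def free_rows_def used_ok_def)
    have cardg: "wvar s' vg = card (R i)" using bij_betw_same_card 7(5) by fastforce
    have cost: "word_cost (eq_exp (size_exp 35) (Const 2)) \<le> 30" by (simp add: eq_exp_def size_exp_def)
    have bR: "bij_betw (warr s' aR) {..<card (R i)} (R i)" and G: "wvar s' vG = 2 ^ card (R i)" using 7(5) cardg by auto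
    show ?case
    proof (cases "i \<in> free_rows")
      case True
      have c: "2 ^ card (R i) + 2 ^ card (R i) \<le> W" "card (R i) + 1 \<le> W" "2 ^ card (R i) \<le> W" "card (R i) \<le> W" "i \<le> W"
        using card_R[OF i True] word_stateD(1)[OF 7(2), of 35] 7(4) by auto
      have d: "(2 :: nat) ^ card (R i) + 2 ^ card (R i) = 2 ^ (card (R i) + 1)" by (simp add: power_add)
      have bij': "bij_betw ((warr s' aR)(card (R i) := i)) {..<card (R i) + 1} (R (Suc i))"
      proof -
        have "bij_betw ((warr s' aR)(card (R i) := i)) {..<card (R i)} (R i) = bij_betw (warr s' aR) {..<card (R i)} (R i)"
          by (rule bij_betw_cong) auto
        then have "bij_betw ((warr s' aR)(card (R i) := i)) ({..<card (R i)} \<union> {card (R i)}) (R i \<union> {i})"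
          using bR i_R by (intro bij_betw_combine) (auto simp: bij_betw_def)
        moreover have "{..<card (R i)} \<union> {card (R i)} = {..<card (R i) + 1}" by auto
        ultimately show ?thesis using True by (simp add: R_Suc)
      qed
      show ?thesis
        using words iff True 7(4) c bij' W_ge cost d by (simp add: run_simps cardg G)
    next
      case False
      then have nt: "\<not> test_val ?test s'" using iff by blast
      show ?thesis unfolding run_Cond if_not_P[OF nt] using words cost bR G cardg False by (simp add: run_Skip R_Suc)
    qed
  next
    case (8 t s')
    have "R n = free_rows" by (auto simp: R_def free_rows_def)
    then show ?case using 8 inp by (auto simp: input_def)
  qed (use W_ge in auto)
  show ?thesis
    unfolding collect_free_def
  proof (rule run_Assign_Seq[where v = 0], goal_cases)
    case 3
    show ?case
    proof (rule run_Assign_Seq[where v = 1], goal_cases)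
      case 3
      show ?case by (rule run_mono[OF main]) auto
    qed (use W_ge in auto)
  qed auto
qed

end

lemma col_cost:
  "word_cost (col1_exp x y) \<le> 200" "word_cost (second_exp x y) \<le> 400"
  by (simp_all add: col1_exp_def second_exp_def col2_exp_def vert_in_exp_def eq_exp_def or_exp_def pos_exp_def size_exp_def vert_exp_def)

context cycle_program
begin

definition prepared :: "nat => (nat => nat) => (nat => nat) => machine_state => bool" where
  "prepared N piv1 piv2 s \<longleftrightarrow> annotated_complex K \<sigma> n N piv1 \<and> N \<le> 2 * n \<and>
     pivoting piv2 (annotated_complex.second_col \<sigma> n piv1) N N \<and> used_ok piv2 N N (warr s aUsed) \<and>
     (\<forall>y<N. piv2 y \<noteq> 0 --> (\<forall>i<N. warr s aX (i * N + y) =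
        nat_of_bit (block_col piv2 (annotated_complex.second_col \<sigma> n piv1) 0 N y i))) \<and>
     bij_betw (warr s aR) {..<wvar s vg} (annotated_complex.free_rows \<sigma> n N piv2) \<and>
     wvar s vG = 2 ^ wvar s vg \<and> wvar s vN = N \<and> input s"

lemma evals_second:
  assumes "input s" "word_state W s" "wvar s x = i" "wvar s y = j" "i < n" "j < n"
    and F: "annotated_complex K \<sigma> n N piv1" and tr: "warr s aTr j = piv1 j"
  shows "evals W s (second_exp x y) (nat_of_bit (annotated_complex.second_col \<sigma> n piv1 j i))"
proof -
  interpret annotated_complex K \<sigma> n N piv1 piv1 by (rule F)
  have "evals W s (col2_exp x y) (of_bool (boundary_col 2 j i = 1))"
    using evals_col2[OF assms(1-6)] by (simp add: nat_of_bit_def of_bool_def)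
  note c2 = this
  have t: "evals W s (Load aTr (Var y)) (piv1 j)" by (rule evals_Load[OF assms(2) evals_Var[OF assms(2,4)] tr])
  have "nat_of_bit (second_col j i) = of_bool ((piv1 j \<noteq> 0 \<and> i = j) \<or> (piv1 j = 0 \<and> boundary_col 2 j i = 1))"
    by (auto simp: second_col_def unit_col_def nat_of_bit_def)
  then show ?thesis unfolding second_exp_def
    by (simp only:) (intro evals_and evals_or evals_pos[OF t] evals_not[OF t] evals_eq evals_Var[OF assms(2)] c2; use assms W_ge in simp)
qed

lemma run_prepare:
  "run W prepare s\<^sub>0 (\<lambda>t s. \<exists>L piv1 piv2. prepared (2 ^ L) piv1 piv2 s \<and> t \<le> 2 * eliminate_time (2 ^ L) L + 10000 * (n * n))"
proof -
  have P: "run W (power_above vN 0) s\<^sub>0 (\<lambda>t s'. (\<exists>L. wvar s' vN = 2 ^ L) \<and> n \<le> wvar s' vN \<and> wvar s' vN \<le> 2 * n \<and> t \<le> 20 * n + 10)"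
    by (rule run_power_above[OF ws\<^sub>0]) (use input_0 n_pos W_ge in \<open>auto simp: input_def\<close>)
  show ?thesis
    unfolding prepare_def
  proof (rule run_SeqI[OF P ws\<^sub>0], goal_cases)
    case (1 t1 s1)
    then obtain L where L: "wvar s1 vN = 2 ^ L" by blast
    define N where "N = (2::nat) ^ L"
    have N: "n \<le> N" "N \<le> 2 * n" "wvar s1 vN = N" using 1 L by (auto simp: N_def)
    note NW = N_words[OF N(2)]
    have i1: "input s1" by (rule input_frame[OF input_0 1(3)]) auto
    have A1: "run W (load_matrix (col1_exp 35 36)) s1 (\<lambda>t s'. stores_cols N aX (boundary_col 1) s' \<and>
       t \<le> (N * N + N + 1) * (word_cost (col1_exp 35 36) + 60))"
    proof (rule run_load_matrix[OF 1(2) _ N(3,1) NW(1)])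
      show "wvar s1 0 = n" using i1 by (simp add: input_def)
      fix i j s' assume a: "i < n" "j < n" "word_state W s'" "frame (load_matrix (col1_exp 35 36)) s1 s'" "wvar s' 35 = i" "wvar s' 36 = j"
      show "evals W s' (col1_exp 35 36) (nat_of_bit (boundary_col 1 j i))"
        by (rule evals_col1) (use a input_frame[OF i1 a(4)] in auto)
    qed (auto simp: boundary_col_def)
    show ?case
    proof (rule run_SeqI[OF A1 1(2)], goal_cases)
      case (1 t2 s2)
      have i2: "input s2" "wvar s2 vN = N" by (rule input_frame[OF i1 1(3)]; simp) (use 1 N in \<open>simp add: frame_def\<close>)
      have "stores_cols N aX (boundary_col 1) s2" using 1 by blast
      note E = run_eliminate[OF 1(2) NW i2(2) N_def this]
      show ?case
      proof (rule run_SeqI[OF E 1(2)], goal_cases)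
        case (1 t3 s3)
        have "input s3" by (rule input_frame[OF i2(1) 1(3)]) (use MM_names in auto)
        moreover have "wvar s3 vN = N" using frameD(1)[OF 1(3), of vN] i2 MM_names by auto
        ultimately have i3: "input s3" "wvar s3 vN = N" by blast+
        define piv1 where "piv1 = warr s3 aPiv"
        have F1: "annotated_complex K \<sigma> n N piv1" by unfold_locales (use 1 N in \<open>auto simp: piv1_def\<close>)
        interpret annotated_complex K \<sigma> n N piv1 by (rule F1)
        let ?F = "For 35 vN (Store aTr (Var 35) (Load aPiv (Var 35)))"
        have "run W ?F s3 (\<lambda>t s'. (\<forall>i<wvar s3 vN. warr s' aTr i = piv1 i) \<and>
           (\<forall>k. k \<notin> (\<lambda>i. i) ` {..<wvar s3 vN} --> warr s' aTr k = warr s3 aTr k) \<and>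
           t \<le> 7 + wvar s3 vN * (word_cost (Var 35) + word_cost (Load aPiv (Var 35)) + 10))"
        proof (rule run_fill1)
          fix i s' assume a: "i < wvar s3 vN" "word_state W s'" "frame ?F s3 s'" "wvar s' 35 = i"
          show "word_val (Var 35) s' = i \<and> word_val (Load aPiv (Var 35)) s' = piv1 i \<and>
            word_words (Var 35) s' \<union> word_words (Load aPiv (Var 35)) s' \<subseteq> {..W}"
            by (rule evals_fill[OF evals_Var evals_Load[OF _ evals_Var]]) (use a in \<open>auto simp: frame_def piv1_def\<close>)
        qed (use 1 W_ge in auto)
        then have F: "run W ?F s3 (\<lambda>t s'. (\<forall>i<N. warr s' aTr i = piv1 i) \<and> t \<le> 7 + N * 13)"
          by (rule run_mono) (simp add: i3)
        show ?case
        proof (rule run_SeqI[OF F 1(2)], goal_cases)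
          case (1 t4 s4)
          have i4: "input s4" "wvar s4 vN = N" by (rule input_frame[OF i3(1) 1(3)]; simp) (use 1 i3 in \<open>simp add: frame_def\<close>)
          have A2: "run W (load_matrix (second_exp 35 36)) s4 (\<lambda>t s'. stores_cols N aX second_col s' \<and>
             t \<le> (N * N + N + 1) * (word_cost (second_exp 35 36) + 60))"
          proof (rule run_load_matrix[OF 1(2) _ i4(2) N(1) NW(1)])
            show "wvar s4 0 = n" using i4 by (simp add: input_def)
            fix i j s' assume a: "i < n" "j < n" "word_state W s'" "frame (load_matrix (second_exp 35 36)) s4 s'" "wvar s' 35 = i" "wvar s' 36 = j"
            show "evals W s' (second_exp 35 36) (nat_of_bit (second_col j i))"
              by (rule evals_second[OF _ _ _ _ _ _ F1])
                (use a input_frame[OF i4(1) a(4)] N 1 in \<open>auto simp: frame_def\<close>)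
          next
            fix i j assume "i < N" "j < N" "\<not> (i < n \<and> j < n)"
            moreover have "piv1 j \<noteq> 0 ==> j < N ==> j < n" using pivot_col_edge(1)[of j] by (simp add: pivot_cols_def)
            ultimately show "second_col j i = 0" by (auto simp: second_col_def unit_col_def boundary_col_def)
          qed
          show ?case
          proof (rule run_SeqI[OF A2 1(2)], goal_cases)
            case (1 t5 s5)
            have i5: "input s5" "wvar s5 vN = N" by (rule input_frame[OF i4(1) 1(3)]; simp) (use 1 i4 in \<open>simp add: frame_def\<close>)
            have "stores_cols N aX second_col s5" using 1 by blast
      note E = run_eliminate[OF 1(2) NW i5(2) N_def this]
      show ?case
      proof (rule run_SeqI[OF E 1(2)], goal_cases)
        case (1 t6 s6)
              have "input s6" by (rule input_frame[OF i5(1) 1(3)]) (use MM_names in auto)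
        moreover have "wvar s6 vN = N" using frameD(1)[OF 1(3), of vN] i5 MM_names by auto
        ultimately have i6: "input s6" "wvar s6 vN = N" by blast+
              define piv2 where "piv2 = warr s6 aPiv"
              note C = run_collect_free[OF 1(2) i6(1) F1 conjunct1[OF conjunct2[OF 1(1)[folded piv2_def]]]
                conjunct1[OF conjunct2[OF conjunct2[OF 1(1)[folded piv2_def]]]]]
              note e2 = 1(1)[folded piv2_def]
              show ?case
              proof (rule run_strengthenE[OF C 1(2)], goal_cases)
                case (1 t7 s7)
                have "input s7" by (rule input_frame[OF i6(1) 1(3)]) auto
                then have i7: "input s7" "wvar s7 vN = N" "warr s7 aUsed = warr s6 aUsed" "warr s7 aX = warr s6 aX"
                  using 1(3) i6 by (auto simp: frame_def)
                have "prepared N piv1 piv2 s7"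
                  unfolding prepared_def i7(2-4)
                  by (intro conjI F1 i7(1) N(2) refl) (use e2 1(1) in blast)+
                moreover have "t1 + (t2 + (t3 + (t4 + (t5 + (t6 + t7))))) \<le> 2 * eliminate_time (2 ^ L) L + 10000 * (n * n)"
                proof -
                  have NN: "N * N \<le> 4 * (n * n)"
                    using mult_le_mono[OF N(2) N(2)] by simp
                  have c: "word_cost (col1_exp 35 36) + 60 \<le> 260" "word_cost (second_exp 35 36) + 60 \<le> 460" using col_cost by simp_all
                  \<comment> \<open>As \<open>N \<le> 2 * n\<close>, the three summands are at most
                    4, 2 and 1 times \<open>n * n\<close>.\<close>
                  have b: "N * N + N + 1 \<le> 7 * (n * n)" using NN N(2) n_le n_pos by linarith
                  have "t2 \<le> 7 * (n * n) * 260"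
                    using \<open>_ \<and> t2 \<le> _\<close> mult_le_mono[OF b c(1)] by linarith
                  moreover have "t5 \<le> 7 * (n * n) * 460"
                    using \<open>_ \<and> t5 \<le> _\<close> mult_le_mono[OF b c(2)] by linarith
                  moreover have "t3 \<le> eliminate_time N L" "t6 \<le> eliminate_time N L"
                    using \<open>t3 \<le> eliminate_time N L \<and> _\<close> e2 by blast+
                  moreover have "t1 \<le> 20 * n + 10" "t4 \<le> 7 + N * 13" "t7 \<le> 100 * n + 20"
                    using \<open>_ \<and> _ \<and> _ \<and> t1 \<le> _\<close> \<open>_ \<and> t4 \<le> _\<close> 1(1) by blast+
                  ultimately show ?thesis unfolding N_def[symmetric] using N(2) n_le n_pos by linarith
                qed
                ultimately show ?case unfolding N_def by blast
              qed
            qed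
          qed
        qed
      qed
    qed
  qed
qed

end

subsection \<open>Adding annotations\<close>

text \<open>Flipping a bit is expressed by arithmetic, since the machine has no bit
  operations.\<close>

lemma flip_bit_nat: "flip_bit b (x :: nat) = (if bit x b then x - 2 ^ b else x + 2 ^ b)"
proof (cases "bit x b")
  case True
  have "x = set_bit b (unset_bit b x)"
    by (rule bit_eqI) (use True in \<open>auto simp: bit_set_bit_iff bit_unset_bit_iff\<close>)
  also have "\<dots> = unset_bit b x + 2 ^ b" by (subst set_bit_eq) (simp add: bit_unset_bit_iff)
  finally have "unset_bit b x = x - 2 ^ b" by simp
  then show ?thesis using True by (simp add: flip_bit_eq_if)
qed (simp add: flip_bit_eq_if set_bit_eq)

text \<open>One more bit of \<open>c\<close> flips at most one bit of the entry, so the table can be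
  improved in place, one bit position per pass.\<close>

lemma xor_take_bit_Suc: "(h :: nat) XOR take_bit (Suc b) c = (if bit c b then flip_bit b (h XOR take_bit b c) else h XOR take_bit b c)"
  by (rule bit_eqI) (auto simp: bit_xor_iff bit_take_bit_iff bit_flip_bit_iff less_Suc_eq)

abbreviation (input) entry_exp :: word_exp where
  "entry_exp \<equiv> Load aX (Load aR (Var 37) *. Var vN +. (Load aUsed (Var 35) -. Const 1))"

text \<open>\<open>annotation_edge\<close> in constant time: \<open>aUsed\<close> holds the pivot
  column of row \<open>e\<close> plus one, so the column need not be searched for.\<close>

definition edge_bit_exp :: word_exp where
  "edge_bit_exp = or_exp ((Const 1 -. Load aUsed (Var 35)) *. eq_exp (Var 35) (Load aR (Var 37)))
     (pos_exp (Load aUsed (Var 35)) *. entry_exp)"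

definition flip_exp :: "word_exp => word_exp => word_exp" where
  "flip_exp x b = x +. b *. (Var vpw *. (Const 1 -. x div. Var vpw mod. Const 2)) -. b *. (Var vpw *. (x div. Var vpw mod. Const 2))"

text \<open>Adding two classes bit by bit inside the loops over the graph would cost a factor g on
  every arc. The sums of each class with each simplex annotation are tabulated instead, in time
  proportional to \<open>n * 2 ^ g * (g + 1)\<close>.\<close>

definition xor_table :: com where
  "xor_table = For 35 0 (For 36 vG (Store aXor (cell_exp 35 vG 36) (Var 36))) ;; (vpw ::= Const 1) ;;
     For 37 vg (For 35 0 (For 36 vG (Store aXor (cell_exp 35 vG 36)
         (flip_exp (Load aXor (cell_exp 35 vG 36)) edge_bit_exp))) ;; (vpw ::= Var vpw +. Var vpw))"

lemma xor_table_names [simp]: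
  "wvars_of xor_table = {35, 36, 37, vpw}" "warrs_of xor_table = {aXor}" "rvars_of xor_table = {}" "rarrs_of xor_table = {}"
  by (auto simp: xor_table_def)

lemma evals_flip:
  assumes "evals W s x v" "evals W s b (of_bool p)" "word_state W s" "wvar s vpw = 2 ^ k" "2 \<le> W" "v + 2 ^ k \<le> W"
  shows "evals W s (flip_exp x b) (if p then flip_bit k v else v)"
proof -
  have m: "evals W s (x div. Var vpw mod. Const 2) (of_bool (bit v k))"
  proof -
    have "v div 2 ^ k \<le> v" by simp
    then have "v div 2 ^ k \<le> W" using evals_le[OF assms(1)] by linarith
    moreover have "v div 2 ^ k mod 2 = of_bool (bit v k)" by (simp add: bit_iff_odd mod_2_eq_odd)
    moreover have "of_bool (bit v k) \<le> W" using assms(5) by simp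
    moreover have "2 ^ k \<le> W" using assms(6) by linarith
    ultimately show ?thesis using assms(1,4,5) by (auto simp: evals_def)
  qed
  have 1: "1 \<le> W" using assms(5) by simp
  have nm: "evals W s (Const 1 -. x div. Var vpw mod. Const 2) (of_bool (\<not> bit v k))"
    using evals_not[OF m 1] by simp
  have pw: "evals W s (Var vpw) (2 ^ k)" by (rule evals_Var[OF assms(3,4)])
  have le: "of_bool q * (2 ^ k * of_bool r) \<le> (2 :: nat) ^ k" "2 ^ k * of_bool r \<le> (2 :: nat) ^ k" for q r by (cases q; cases r; simp)+
  have e: "evals W s (flip_exp x b) (v + of_bool p * (2 ^ k * of_bool (\<not> bit v k)) - of_bool p * (2 ^ k * of_bool (bit v k)))"
    unfolding flip_exp_def
  proof (intro evals_sub evals_add evals_mult assms(1,2) pw m nm)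
    show "v + of_bool p * (2 ^ k * of_bool (\<not> bit v k)) \<le> W" using le(1)[of p "\<not> bit v k"] assms(6) by linarith
    show "of_bool p * (2 ^ k * of_bool (\<not> bit v k)) \<le> W" using le(1)[of p "\<not> bit v k"] assms(6) by linarith
    show "of_bool p * (2 ^ k * of_bool (bit v k)) \<le> W" using le(1)[of p "bit v k"] assms(6) by linarith
    show "2 ^ k * of_bool (\<not> bit v k) \<le> W" using le(2)[of "\<not> bit v k"] assms(6) by linarith
    show "2 ^ k * of_bool (bit v k) \<le> W" using le(2)[of "bit v k"] assms(6) by linarith
  qed
  have "v + of_bool p * (2 ^ k * of_bool (\<not> bit v k)) - of_bool p * (2 ^ k * of_bool (bit v k)) = (if p then flip_bit k v else v)"
    by (auto simp: flip_bit_nat)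
  then show ?thesis using e by simp
qed

lemma flip_cost: "word_cost (flip_exp (Load aXor (cell_exp 35 vG 36)) edge_bit_exp) \<le> 300"
  by (simp add: flip_exp_def edge_bit_exp_def eq_exp_def or_exp_def pos_exp_def)

context cycle_program
begin

lemma cycle_graph_prepared:
  assumes "prepared N piv1 piv2 s"
  shows "cycle_graph K \<sigma> n N piv1 piv2 w (warr s aR) (vert 0) (vert 1) (wvar s vg)"
proof -
  interpret annotated_complex K \<sigma> n N piv1 piv2 using assms by (simp add: prepared_def)
  show ?thesis
  proof
    show "pivoting piv2 second_col N N" "bij_betw (warr s aR) {..<wvar s vg} free_rows" using assms by (auto simp: prepared_def)
    show "0 \<le> w e" if "e \<in> edges K" for e using weight_nonneg that .
    show "0 < n" by (rule n_pos)
    show "vert 0 e < n \<and> vert 1 e < n \<and> (\<exists>x y. x \<noteq> y \<and> \<sigma> (vert 0 e) = {x} \<and> \<sigma> (vert 1 e) = {y} \<and> \<sigma> e = {x, y})"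
      if "e < n" "card (\<sigma> e) = 2" for e using edge_verts[OF that] by blast
  qed
qed

lemma run_xor_table:
  assumes ws: "word_state W s" and P: "prepared N piv1 piv2 s"
  shows "run W xor_table s (\<lambda>t s'. (\<forall>e<n. \<forall>h<2 ^ wvar s vg. warr s' aXor (e * 2 ^ wvar s vg + h) =
      h XOR cycle_graph.code \<sigma> n N piv1 piv2 (warr s aR) (wvar s vg) {\<sigma> e}) \<and>
    t \<le> 400 * (n * n * 2 ^ wvar s vg * (wvar s vg + 1)))"
proof -
  interpret cycle_graph K \<sigma> n N piv1 piv2 w "warr s aR" "vert 0" "vert 1" "wvar s vg" by (rule cycle_graph_prepared[OF P])
  define g where "g = wvar s vg"
  define G where "G = (2::nat) ^ g"
  define r where "r = warr s aR"
  have WG: "30 * (n * n * G) \<le> W" using W g_eq by (simp add: g_def G_def)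
  have G: "0 < G" "wvar s vG = G" using P unfolding G_def g_def prepared_def by simp_all
  have n2: "1 \<le> n * n" "n \<le> n * n" using n_pos n_le by linarith+
  have nG: "n * G \<le> n * n * G" "G \<le> n * n * G" using n_pos G by auto
  have v: "wvar s 0 = n" "wvar s vN = N" using P unfolding prepared_def input_def by blast+
  have inj: "i = i' \<and> l = l'" if "l < G" "l' < G" "i * G + l = i' * G + l'" for i l i' l' using that by (simp add: mat_idx_inj)
  have idx: "evals W s' (cell_exp 35 vG 36) (e * G + h)"
    if "word_state W s'" "wvar s' 35 = e" "wvar s' 36 = h" "wvar s' vG = G" "e < n" "h < G" for s' e h
  proof -
    have "e * G + h < n * G" by (rule mat_idx_less) (use that in auto)
    then have "e * G + h \<le> W" using WG nG by linarith
    then show ?thesis using that by (intro evals_add evals_mult evals_Var) auto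
  qed
  let ?F1 = "For 35 0 (For 36 vG (Store aXor (cell_exp 35 vG 36) (Var 36)))"
  let ?val = "\<lambda>b e h. h XOR take_bit b (code {\<sigma> e})"
  have "run W ?F1 s (\<lambda>t s'. (\<forall>e<n. \<forall>h<G. warr s' aXor (e * G + h) = h) \<and>
     (\<forall>k. k \<notin> (\<lambda>(i, j). i * G + j) ` ({..<n} \<times> {..<G}) --> warr s' aXor k = warr s aXor k) \<and>
     t \<le> 7 + n * (16 + G * (word_cost (cell_exp 35 vG 36) + word_cost (Var 36) + 10)))"
  proof (rule run_fill2)
    show "i = i' \<and> l = l'" if "i < n" "i' < n" "l < G" "l' < G" "i * G + l = i' * G + l'" for i l i' l'
      by (rule inj[OF that(3-5)])
    fix e h s' assume a: "e < n" "h < G" "word_state W s'" "frame ?F1 s s'" "wvar s' 35 = e" "wvar s' 36 = h"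
    show "word_val (cell_exp 35 vG 36) s' = e * G + h \<and> word_val (Var 36) s' = h \<and>
        word_words (cell_exp 35 vG 36) s' \<union> word_words (Var 36) s' \<subseteq> {..W}"
      by (rule evals_fill[OF idx evals_Var]) (use a G in \<open>auto simp: frame_def\<close>)
  qed (use ws v G W_ge in auto)
  then have F1: "run W ?F1 s (\<lambda>t s'. (\<forall>e<n. \<forall>h<G. warr s' aXor (e * G + h) = ?val 0 e h) \<and> t \<le> 7 + n * (16 + G * 16))"
    by (rule run_mono) simp
  let ?flip = "flip_exp (Load aXor (cell_exp 35 vG 36)) edge_bit_exp"
  let ?F2 = "For 35 0 (For 36 vG (Store aXor (cell_exp 35 vG 36) ?flip))"
  let ?F3 = "For 37 vg (?F2 ;; (vpw ::= Var vpw +. Var vpw))"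
  have F2: "run W ?F2 s' (\<lambda>t s''. (\<forall>e<n. \<forall>h<G. warr s'' aXor (e * G + h) = ?val (Suc b) e h) \<and> t \<le> 7 + n * (16 + G * 320))"
    if s': "word_state W s'" "frame xor_table s s'" "wvar s' 37 = b" "b < g" "wvar s' vpw = 2 ^ b" "\<forall>e<n. \<forall>h<G. warr s' aXor (e * G + h) = ?val b e h" for s' b
  proof -
    have rb: "r b \<in> free_rows" using r that(4) by (auto simp: bij_betw_def r_def g_def)
    then have rbn: "r b < n" by (simp add: free_rows_def)
    have bit: "evals W s'' edge_bit_exp (of_bool (bit (code {\<sigma> e}) b))"
      if a: "word_state W s''" "e < n" "wvar s'' 35 = e" "frame ?F2 s' s''" for s'' e
    proof -
      have fr: "wvar s'' 37 = b" "warr s'' aUsed = warr s aUsed" "warr s'' aR = r" "warr s'' aX = warr s aX" "wvar s'' vN = N"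
        using a(4) s'(2,3) v by (auto simp: frame_def r_def)
      have us: "evals W s'' (Load aUsed (Var 35)) (warr s aUsed e)"
        by (rule evals_Load[OF a(1) evals_Var[OF a(1,3)]]) (simp add: fr)
      have R: "evals W s'' (Load aR (Var 37)) (r b)"
        by (rule evals_Load[OF a(1) evals_Var[OF a(1) fr(1)]]) (simp add: fr)
      let ?u = "warr s aUsed e - 1"
      have uok: "used_ok piv2 N N (warr s aUsed)" using P by (simp add: prepared_def)
      have eN: "e < N" using a(2) nN by simp
      \<comment> \<open>The expression is evaluated without branching, so the address must be legal
        even if \<open>aUsed\<close> is zero and the entry is multiplied by zero.\<close>
      have ubound: "?u < N"
      proof (cases "warr s aUsed e = 0")
        case False
        then have "e \<in> used_rows piv2 N" using uok eN by (auto simp: used_ok_def)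
        then obtain y where "y < N" "piv2 y = Suc e" by (auto simp: used_rows_def)
        then show ?thesis using uok eN by (auto simp: used_ok_def)
      qed (use eN in simp)
      have "r b * N + ?u < n * N" by (rule mat_idx_less[OF rbn ubound])
      moreover have "n * N \<le> n * (2 * n)" using P by (intro mult_le_mono2) (simp add: prepared_def)
      moreover have "n * (2 * n) = 2 * (n * n)" by simp
      ultimately have ad: "r b * N + ?u \<le> W" using W_n by linarith
      have X: "evals W s'' (entry_exp) (warr s aX (r b * N + ?u))"
      proof (rule evals_Load[OF a(1)])
        show "evals W s'' (Load aR (Var 37) *. Var vN +. (Load aUsed (Var 35) -. Const 1)) (r b * N + ?u)"
          by (intro evals_add evals_mult R evals_Var[OF a(1)] evals_sub us evals_Const) (use ad W_ge fr in auto)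
      qed (simp add: fr)
      have iff: "bit (code {\<sigma> e}) b \<longleftrightarrow> (warr s aUsed e = 0 \<and> e = r b) \<or> (warr s aUsed e \<noteq> 0 \<and> warr s aX (r b * N + ?u) = 1)"
      proof -
        have "bit (code {\<sigma> e}) b \<longleftrightarrow> r b \<in> annotation {\<sigma> e}" using that s'(4) by (simp add: bit_code r_def g_def)
        also have "\<dots> \<longleftrightarrow> (if e \<in> used_rows piv2 N then \<exists>y<N. piv2 y = Suc e \<and> block_col piv2 second_col 0 N y (r b) = 1 else e = r b)"
          by (rule annotation_edge[OF piv2 a(2) rb])
        also have "\<dots> \<longleftrightarrow> (warr s aUsed e = 0 \<and> e = r b) \<or> (warr s aUsed e \<noteq> 0 \<and> warr s aX (r b * N + ?u) = 1)"
        proof (cases "e \<in> used_rows piv2 N")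
          case True
          then obtain y where y: "y < N" "piv2 y = Suc e" by (auto simp: used_rows_def)
          have u: "warr s aUsed e = Suc y" using uok eN y by (auto simp: used_ok_def)
          have uniq: "y' = y" if "y' < N" "piv2 y' = Suc e" for y'
            using uok eN that u by (auto simp: used_ok_def)
          have "warr s aX (r b * N + y) = nat_of_bit (block_col piv2 second_col 0 N y (r b))"
            using P y rbn nN by (auto simp: prepared_def)
          moreover have "(\<exists>y<N. piv2 y = Suc e \<and> block_col piv2 second_col 0 N y (r b) = 1) \<longleftrightarrow> block_col piv2 second_col 0 N y (r b) = 1"
            using uniq y by blast
          ultimately show ?thesis using True u by simp
        next
          case False
          then show ?thesis using uok eN by (auto simp: used_ok_def)
        qed
        finally show ?thesis .
      qed
      have Xle: "warr s aX (r b * N + ?u) = 0 \<or> warr s aX (r b * N + ?u) = 1" if "warr s aUsed e \<noteq> 0"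
      proof -
        have "e \<in> used_rows piv2 N" using that uok eN by (auto simp: used_ok_def)
        then obtain y where y: "y < N" "piv2 y = Suc e" by (auto simp: used_rows_def)
        then have "warr s aUsed e = Suc y" using uok eN by (auto simp: used_ok_def)
        then have "warr s aX (r b * N + ?u) = nat_of_bit (block_col piv2 second_col 0 N y (r b))"
          using P y rbn nN by (auto simp: prepared_def)
        then show ?thesis by (auto simp: nat_of_bit_def)
      qed
      have W1: "1 \<le> W" using W_ge by simp
      have and2: "evals W s'' (pos_exp (Load aUsed (Var 35)) *. entry_exp)
          (of_bool (warr s aUsed e \<noteq> 0 \<and> warr s aX (r b * N + ?u) = 1))"
      proof -
        have "evals W s'' (pos_exp (Load aUsed (Var 35)) *. entry_exp)
          (of_bool (warr s aUsed e \<noteq> 0) * warr s aX (r b * N + ?u))"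
          by (intro evals_mult evals_pos[OF us W1] X) (use evals_le[OF X] in auto)
        moreover have "of_bool (warr s aUsed e \<noteq> 0) * warr s aX (r b * N + ?u) = of_bool (warr s aUsed e \<noteq> 0 \<and> warr s aX (r b * N + ?u) = 1)"
          using Xle by (cases "warr s aUsed e = 0") auto
        ultimately show ?thesis by (simp only:)
      qed
      show ?thesis unfolding edge_bit_exp_def iff
        by (rule evals_or[OF evals_and[OF evals_not[OF us W1] evals_eq[OF evals_Var[OF a(1,3)] R W1] W1] and2 W1])
    qed
    have "run W ?F2 s' (\<lambda>t s''. (\<forall>e<n. \<forall>h<G. warr s'' aXor (e * G + h) = ?val (Suc b) e h) \<and>
     (\<forall>k. k \<notin> (\<lambda>(i, j). i * G + j) ` ({..<n} \<times> {..<G}) --> warr s'' aXor k = warr s' aXor k) \<and>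
     t \<le> 7 + n * (16 + G * (word_cost (cell_exp 35 vG 36) + word_cost ?flip + 10)))"
    proof (rule run_fill2)
      show "i = i' \<and> l = l'" if "i < n" "i' < n" "l < G" "l' < G" "i * G + l = i' * G + l'" for i l i' l'
        by (rule inj[OF that(3-5)])
      show "wvar s' 0 = n" "wvar s' vG = G" using s'(2) v G by (auto simp: frame_def)
      fix e h s'' assume a: "e < n" "h < G" "word_state W s''" "frame ?F2 s' s''" "wvar s'' 35 = e" "wvar s'' 36 = h"
        "warr s'' aXor (e * G + h) = warr s' aXor (e * G + h)"
      have vs: "wvar s'' vG = G" "wvar s'' vpw = 2 ^ b" using a(4) s'(2,5) G by (auto simp: frame_def)
      have i: "evals W s'' (cell_exp 35 vG 36) (e * G + h)" by (rule idx[OF a(3,5,6) vs(1) a(1,2)])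
      have x: "evals W s'' (Load aXor (cell_exp 35 vG 36)) (?val b e h)"
        by (rule evals_Load[OF a(3) i]) (use a s'(6) in auto)
      have "take_bit b (code {\<sigma> e}) < 2 ^ b" by simp
      then have "take_bit b (code {\<sigma> e}) < 2 ^ wvar s vg"
        using s'(4) power_increasing[of b "wvar s vg" "2::nat"] unfolding g_def by linarith
      then have "?val b e h < G" using a(2) xor_less unfolding G_def g_def by blast
      moreover have "2 ^ b \<le> G" unfolding G_def using s'(4) by (intro power_increasing) auto
      ultimately have le: "?val b e h + 2 ^ b \<le> W" using nG(2) WG by linarith
      have f: "evals W s'' ?flip (?val (Suc b) e h)"
        unfolding xor_take_bit_Suc by (rule evals_flip[OF x bit[OF a(3,1,5,4)] a(3) vs(2) _ le]) (use W_ge in simp)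
      show "word_val (cell_exp 35 vG 36) s'' = e * G + h \<and> word_val ?flip s'' = ?val (Suc b) e h \<and>
        word_words (cell_exp 35 vG 36) s'' \<union> word_words ?flip s'' \<subseteq> {..W}"
        by (rule evals_fill[OF i f])
    qed (use s'(1) W_ge in auto)
    then show ?thesis
    proof (rule run_mono, goal_cases)
      case (1 t s'')
      have "word_cost (cell_exp 35 vG 36) + word_cost ?flip + 10 \<le> 320" using flip_cost by simp
      then have "7 + n * (16 + G * (word_cost (cell_exp 35 vG 36) + word_cost ?flip + 10)) \<le> 7 + n * (16 + G * 320)"
        by (intro add_le_mono mult_le_mono) auto
      then show ?case using 1 by (meson le_trans)
    qed
  qed
  show ?thesis
    unfolding xor_table_def
  proof (rule run_SeqI[OF F1 ws], goal_cases)
    case (1 t1 s1)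
    have sv: "wvar s1 vg = g" using 1(3) by (simp add: frame_def g_def)
    let ?s = "set_wvar vpw 1 s1"
    have fr1: "frame xor_table s ?s" using 1(3) by (simp add: frame_def)
    have F3: "run W ?F3 ?s (\<lambda>t s'. (\<forall>e<n. \<forall>h<G. warr s' aXor (e * G + h) = ?val g e h) \<and> t \<le> 7 + g * (30 + n * (16 + G * 320)))"
    proof (rule run_For[where I = "\<lambda>b s'. wvar s' vpw = 2 ^ b \<and> (\<forall>e<n. \<forall>h<G. warr s' aXor (e * G + h) = ?val b e h)"
          and T = "\<lambda>_. 21 + n * (16 + G * 320)"], goal_cases)
      case 1 show ?case using \<open>word_state W s1\<close> W_ge by (auto simp: word_state_def)
    next
      case 6 show ?case using \<open>(\<forall>e<n. \<forall>h<G. warr s1 aXor (e * G + h) = ?val 0 e h) \<and> _\<close> by simp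
    next
      case (7 b s')
      have b: "b < g" using 7(1) sv by simp
      have fr: "frame xor_table s s'" using fr1 7(3) by (simp add: frame_def)
      show ?case
      proof (rule run_SeqI[OF F2[OF 7(2) fr 7(4) b] 7(2)], goal_cases)
        case 1 show ?case using 7(5) by blast
      next
        case 2 show ?case using 7(5) by blast
      next
        case (3 t s'')
        have "2 ^ Suc b \<le> G" unfolding G_def using b by (intro power_increasing) auto
        then have "2 * 2 ^ b \<le> G" by simp
        then have "2 ^ b + 2 ^ b \<le> W" "(2::nat) ^ b \<le> W" using nG(2) WG by linarith+
        moreover have "wvar s'' vpw = 2 ^ b" using 3(3) 7(5) by (simp add: frame_def)
        ultimately show ?case using 3(1) by (simp add: run_Assign)
      qed
    next
      case (8 t s') then show ?case by (simp add: sv)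
    qed (use W_ge in auto)
    show ?case
    proof (rule run_Assign_Seq[where v = 1], goal_cases)
      case 3
      show ?case
      proof (rule run_mono[OF F3], goal_cases)
        case (1 t s')
        have "take_bit g (code {\<sigma> e}) = code {\<sigma> e}" for e using code_less[of "{\<sigma> e}"] by (simp add: take_bit_nat_eq_self_iff g_def)
        moreover have "t1 + (1 + word_cost (Const 1) + t) \<le> 400 * (n * n * G * (g + 1))"
        proof -
          have t1: "t1 \<le> 7 + n * (16 + G * 16)" using \<open>_ \<and> t1 \<le> _\<close> by blast
          define q where "q = n * n * G"
          have "n * 1 \<le> n * G" using G by (intro mult_le_mono2) simp
          moreover have nq: "n * G \<le> q" using nG(1) by (simp only: q_def)
          ultimately have q: "n \<le> q" "n * G \<le> q" "1 \<le> q" using n_pos by linarith+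
          have e1: "n * (16 + G * 16) \<le> 32 * q" using q by (simp add: algebra_simps)
          have "30 + n * (16 + G * 320) = 30 + 16 * n + 320 * (n * G)" by (simp add: algebra_simps)
          then have "30 + n * (16 + G * 320) \<le> 366 * q" using q by linarith
          then have "g * (30 + n * (16 + G * 320)) \<le> g * (366 * q)" by (rule mult_le_mono2)
          moreover have "400 * (q * (g + 1)) = 400 * (g * q) + 400 * q" by (simp add: algebra_simps)
          moreover have "g * (366 * q) = 366 * (g * q)" by simp
          ultimately have "t1 + (2 + t) \<le> 400 * (q * (g + 1))" using t1 e1 1 q by linarith
          then show ?thesis by (simp add: q_def)
        qed
        ultimately show ?case using 1 by (simp add: G_def g_def)
      qed
    qed (use W_ge in auto)
  qed
qed

end

section \<open>Building the graph\<close>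

abbreviation (input) "aLab \<equiv> 22 :: nat"
abbreviation (input) "vM \<equiv> 19 :: nat"
abbreviation (input) "vA \<equiv> 30 :: nat"

lemma run_Assign_evals:
  assumes "evals W s e v" "run W B (set_wvar x v s) (\<lambda>t. Q (1 + word_cost e + t))"
  shows "run W (x ::= e ;; B) s Q"
  using assms by (intro run_Assign_Seq[where v = v]) (auto simp: evals_def)

lemma word_state_set_wvar: "word_state W s ==> v \<le> W ==> word_state W (set_wvar x v s)"
  by (simp add: word_state_def)

definition add_arc :: com where
  "add_arc = Store aSrc (Var vA) (Var 32) ;; Store aTgt (Var vA) (Var 33) ;; Store aLab (Var vA) (Var 34) ;;
     RStore rWt (Var vA) (RVar 4) ;; Store aNxt (Var vA) (Load aHead (Var 32)) ;; Store aHead (Var 32) (Var vA +. Const 1) ;;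
     (vA ::= Var vA +. Const 1)"

lemma add_arc_names [simp]:
  "wvars_of add_arc = {vA}" "warrs_of add_arc = {aSrc, aTgt, aLab, aNxt, aHead}" "rvars_of add_arc = {}" "rarrs_of add_arc = {rWt}"
  by (auto simp: add_arc_def)

type_synonym arc = "nat \<times> nat \<times> nat \<times> real"

text \<open>Shortest paths depend only on the set of arcs, so their order and numbering need not be
  specified.\<close>

definition stored_arcs :: "machine_state => arc set" where
  "stored_arcs s = (\<lambda>a. (warr s aSrc a, warr s aTgt a, warr s aLab a, rarr s rWt a)) ` {..<wvar s vA}"

definition arcs_state :: "nat => arc set => nat => machine_state => bool" where
  "arcs_state V S m s \<longleftrightarrow> graph_ok V (wvar s vA) s \<and> stored_arcs s = S \<and> wvar s vA \<le> m"

lemma arcs_state_wvar [simp]: "f vA = wvar s vA ==> arcs_state V S m (s\<lparr>wvar := f\<rparr>) = arcs_state V S m s"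
  by (simp add: arcs_state_def stored_arcs_def graph_ok_def)

lemma arcs_state_rvar [simp]: "arcs_state V S m (s\<lparr>rvar := f\<rparr>) = arcs_state V S m s"
  by (simp add: arcs_state_def stored_arcs_def graph_ok_def)

lemma run_add_arc:
  assumes ws: "word_state W s" and S: "arcs_state V S m s" "m + 1 \<le> W"
    and v: "wvar s 32 = x" "wvar s 33 = y" "wvar s 34 = l" "rvar s 4 = d" "x < V" "y < V" "0 \<le> d"
  shows "run W add_arc s (\<lambda>t s'. arcs_state V (insert (x, y, l, d) S) (m + 1) s' \<and> t \<le> 40)"
proof -
  define A where "A = wvar s vA"
  have A: "A \<le> m" "graph_ok V A s" "stored_arcs s = S" "wvar s vA = A" using S by (auto simp: arcs_state_def A_def)
  have le: "x \<le> W" "y \<le> W" "l \<le> W" "A \<le> W" "A + 1 \<le> W" "warr s aHead x \<le> W"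
    using word_stateD[OF ws] v A S(2) by (auto simp: word_stateD[OF ws])
  let ?src = "(warr s aSrc)(A := x)"
  have cong: "last_arc ?src a u = last_arc (warr s aSrc) a u" if "a \<le> A" for a u
    by (rule last_arc_cong) (use that in auto)
  have hd: "warr s aHead u = last_arc (warr s aSrc) A u" if "u < V" for u using A(2) that by (simp add: graph_ok_def)
  let ?s = "s\<lparr>rarr := (rarr s)(rWt := (rarr s rWt)(A := d)),
     warr := (warr s)(aSrc := ?src, aTgt := (warr s aTgt)(A := y), aLab := (warr s aLab)(A := l),
       aNxt := (warr s aNxt)(A := warr s aHead x), aHead := (warr s aHead)(x := A + 1)),
     wvar := (wvar s)(vA := A + 1)\<rparr>"
  have "graph_ok V (A + 1) ?s"
    unfolding graph_ok_def
  proof (intro conjI allI impI)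
    fix a assume a: "a < A + 1"
    show "warr ?s aNxt a = last_arc (warr ?s aSrc) a (warr ?s aSrc a)"
    proof (cases "a = A")
      case True
      then show ?thesis using cong[of A x] hd[OF v(5)] by simp
    next
      case False
      then have "a < A" using a by simp
      then show ?thesis using cong[of a "warr s aSrc a"] A(2) by (simp add: graph_ok_def)
    qed
    show "warr ?s aSrc a < V" "warr ?s aTgt a < V" "0 \<le> rarr ?s rWt a"
      using a A(2) v by (auto simp: graph_ok_def less_Suc_eq)
  next
    fix u assume u: "u < V"
    show "warr ?s aHead u = last_arc (warr ?s aSrc) (A + 1) u"
      using cong[of A u] hd[OF u] by (simp add: Suc_eq_plus1[symmetric])
  qed
  moreover have "stored_arcs ?s = insert (x, y, l, d) S"
  proof -
    have "stored_arcs ?s = (\<lambda>a. (?src a, ((warr s aTgt)(A := y)) a, ((warr s aLab)(A := l)) a, ((rarr s rWt)(A := d)) a)) ` {..<A + 1}"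
      by (simp add: stored_arcs_def)
    also have "{..<A + 1} = insert A {..<A}" by auto
    also have "(\<lambda>a. (?src a, ((warr s aTgt)(A := y)) a, ((warr s aLab)(A := l)) a, ((rarr s rWt)(A := d)) a)) ` insert A {..<A} =
        insert (x, y, l, d) (stored_arcs s)"
      unfolding stored_arcs_def A(4) image_insert by (intro arg_cong2[of _ _ _ _ insert] image_cong) auto
    finally show ?thesis unfolding A(3) .
  qed
  ultimately have "arcs_state V (insert (x, y, l, d) S) (m + 1) ?s" using A(1) by (simp add: arcs_state_def)
  then show ?thesis
    unfolding add_arc_def using le v A(4) by (simp add: run_simps)
qed

text \<open>\<open>T i\<close> is the set of arcs contributed by iteration \<open>i\<close>, and
  \<open>c\<close> bounds their number. Since the count is only bounded from above, iterations that
  add no arc need no special treatment.\<close>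

lemma run_For_arcs:
  assumes ws: "word_state W s" and x: "x \<notin> wvars_of P" and y: "y \<notin> wvars_of P" "y \<noteq> x" and xA: "x \<noteq> vA"
    and S: "arcs_state V S m s" and W: "1 \<le> W" "m + wvar s y * c \<le> W"
    and step: "\<And>i s' S' m'. i < wvar s y ==> word_state W s' ==> frame (For x y P) s s' ==> wvar s' x = i ==>
      arcs_state V S' m' s' ==> m' + c \<le> W ==> run W P s' (\<lambda>t s''. arcs_state V (S' \<union> T i) (m' + c) s'' \<and> t \<le> \<tau>)"
  shows "run W (For x y P) s (\<lambda>t s'. arcs_state V (S \<union> (\<Union>i<wvar s y. T i)) (m + wvar s y * c) s' \<and> t \<le> 7 + wvar s y * (\<tau> + 9))"
proof (rule run_For[OF ws x y W(1), where I = "\<lambda>i. arcs_state V (S \<union> (\<Union>i'<i. T i')) (m + i * c)" and T = "\<lambda>_. \<tau>"], goal_cases)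
  case 1
  show ?case using S xA by simp
next
  case (2 i s')
  have "(i + 1) * c \<le> wvar s y * c" using 2(1) by (intro mult_le_mono1) simp
  then have "m + i * c + c \<le> W" using W(2) by (simp add: algebra_simps)
  from step[OF 2(1-5) this] show ?case
    by (rule run_mono) (use xA in \<open>simp add: lessThan_Suc Un_ac ac_simps\<close>)
next
  case (3 t s')
  then show ?case by simp
qed

definition node_exp :: "word_exp => word_exp => word_exp" where
  "node_exp h u = h *. Var vM +. (Var 36 *. Var 0 +. u)"

definition hub_exp :: word_exp where
  "hub_exp = Var 35 *. Var vM +. Var 0 *. Var 0"

definition edge_arc_com :: "nat => nat => com" where
  "edge_arc_com k k' = (32 ::= node_exp (Var 35) (vert_exp k 37)) ;;
     (33 ::= node_exp (Load aXor (cell_exp 37 vG 35)) (vert_exp k' 37)) ;; add_arc"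

definition edge_arcs_com :: com where
  "edge_arcs_com = Cond (Leq (Const 1) (eq_exp (size_exp 37) (Const 2)))
     ((34 ::= Var 37) ;; RAssign 4 (RLoad 0 (Var 37)) ;; edge_arc_com 0 1 ;; edge_arc_com 1 0) Skip"

definition hub_arcs_com :: com where
  "hub_arcs_com = (34 ::= Var 0) ;; RAssign 4 RZero ;; (32 ::= hub_exp) ;; (33 ::= node_exp (Var 35) (Var 36)) ;; add_arc ;;
     (32 ::= node_exp (Var 35) (Var 36)) ;; (33 ::= hub_exp) ;; add_arc"

definition build_arcs :: com where
  "build_arcs = (vM ::= Var 0 *. Var 0 +. Const 1) ;; (vV ::= Var vG *. Var vM) ;; (vA ::= Const 0) ;;
     For 35 vV (Store aHead (Var 35) (Const 0)) ;;
     For 35 vG (For 36 0 (hub_arcs_com ;; For 37 0 edge_arcs_com))"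

lemma build_arcs_names [simp]:
  "wvars_of (edge_arc_com k k') = {vA, 32, 33}" "warrs_of (edge_arc_com k k') = {aSrc, aTgt, aLab, aNxt, aHead}"
  "rvars_of (edge_arc_com k k') = {}" "rarrs_of (edge_arc_com k k') = {rWt}"
  "wvars_of edge_arcs_com = {vA, 32, 33, 34}" "warrs_of edge_arcs_com = {aSrc, aTgt, aLab, aNxt, aHead}"
  "rvars_of edge_arcs_com = {4}" "rarrs_of edge_arcs_com = {rWt}"
  "wvars_of hub_arcs_com = {vA, 32, 33, 34}" "warrs_of hub_arcs_com = {aSrc, aTgt, aLab, aNxt, aHead}"
  "rvars_of hub_arcs_com = {4}" "rarrs_of hub_arcs_com = {rWt}"
  "wvars_of build_arcs = {vM, vV, vA, 32, 33, 34, 35, 36, 37}" "warrs_of build_arcs = {aSrc, aTgt, aLab, aNxt, aHead}"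
  "rvars_of build_arcs = {4}" "rarrs_of build_arcs = {rWt}"
  by (auto simp: edge_arc_com_def edge_arcs_com_def hub_arcs_com_def build_arcs_def)

text \<open>The arcs grouped as the three nested loops produce them.\<close>

lemma arc_set_Union:
  "arc_set n G E e1 e2 ann we = (\<Union>h<G. \<Union>v<n. {(hub n h, walk_node n h v v, n, 0), (walk_node n h v v, hub n h, n, 0)} \<union>
     (\<Union>e<n. if E e then {(walk_node n h v (e1 e), walk_node n (h XOR ann e) v (e2 e), e, we e),
        (walk_node n h v (e2 e), walk_node n (h XOR ann e) v (e1 e), e, we e)} else {}))"
  unfolding arc_set_def by (simp add: set_eq_iff) blast

context cycle_program
begin

lemma W_graph:
  assumes "n * n * G \<le> n * n * 2 ^ homology_dim K 1" "0 < G"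
  shows "30 * (n * n * G) \<le> W" "G * (n * n + 1) \<le> 2 * (n * n * G)" "G * (n * (2 + n * 2)) \<le> 4 * (n * n * G)"
proof -
  show "30 * (n * n * G) \<le> W" using assms W by linarith
  have "1 * G \<le> n * n * G" using n_pos n_le by (intro mult_le_mono1) linarith
  then show "G * (n * n + 1) \<le> 2 * (n * n * G)" by (simp add: algebra_simps)
  have "n * G \<le> n * n * G" using n_le by (intro mult_le_mono1)
  then show "G * (n * (2 + n * 2)) \<le> 4 * (n * n * G)" by (simp add: algebra_simps)
qed

lemma edge_weight: "i < n ==> \<sigma> i \<in> edges K ==> rarr s\<^sub>0 0 i = w (\<sigma> i)"
proof -
  have "\<forall>i<card K. \<sigma> i \<in> edges K --> rarr s\<^sub>0 0 i = w (\<sigma> i)"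
    using enc unfolding encodes_complex_def by (elim conjE)
  then show "i < n ==> \<sigma> i \<in> edges K ==> rarr s\<^sub>0 0 i = w (\<sigma> i)" unfolding n_card by simp
qed

text \<open>Each pair of a class and a start vertex has two arcs to or from a hub and at most two
  arcs per simplex, in total at most \<open>G * (n * (2 + n * 2))\<close>, which is at most
  \<open>4 * (n * n * G)\<close>.\<close>

lemma run_build_arcs:
  assumes ws: "word_state W s" and inp: "input s" and G: "wvar s vG = G" "0 < G" "n * n * G \<le> n * n * 2 ^ homology_dim K 1"
    and X: "\<And>e h. e < n ==> h < G ==> warr s aXor (e * G + h) = h XOR ann e \<and> h XOR ann e < G"
  shows "run W build_arcs s (\<lambda>t s'. arcs_state (G * (n * n + 1))
      (arc_set n G (\<lambda>e. card (\<sigma> e) = 2) (vert 0) (vert 1) ann (\<lambda>e. w (\<sigma> e))) (4 * (n * n * G)) s' \<and>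
    wvar s' vM = n * n + 1 \<and> wvar s' vV = G * (n * n + 1) \<and> t \<le> 1000 * (n * n * G))"
proof -
  let ?V = "G * (n * n + 1)"
  note WG = W_graph[OF G(3,2)]
  have mm: "m + 1 + 1 = m + 2" for m :: nat by simp
  have VW: "?V \<le> W" using WG by linarith
  have q: "1 \<le> n * n * G" "n * n + 1 \<le> W" "n * n \<le> W" "n \<le> W"
  proof -
    have "n * n * 1 \<le> n * n * G" using G(2) by (intro mult_le_mono2) simp
    then show "1 \<le> n * n * G" "n * n + 1 \<le> W" "n * n \<le> W" "n \<le> W" using n_pos n_le WG(1) W_ge by linarith+
  qed
  define frm where "frm s' \<longleftrightarrow> input s' \<and> wvar s' vG = G \<and> wvar s' vM = n * n + 1 \<and> warr s' aXor = warr s aXor" for s'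
  have node_less: "h * (n * n + 1) + (v * n + u) < ?V" "v * n + u < n * n" "h * (n * n + 1) \<le> ?V" if "h < G" "v < n" "u < n" for h v u
    using walk_node_less[OF that(2,3,1)] mat_idx_less[OF that(2,3)] mult_le_mono1[of h G "n * n + 1"] that by (auto simp: walk_node_def)
  have node: "evals W s' (node_exp he ue) (walk_node n h v u)"
    if "frm s'" "word_state W s'" "evals W s' he h" "wvar s' 36 = v" "evals W s' ue u" "h < G" "v < n" "u < n" for s' he ue h v u
    unfolding node_exp_def walk_node_def
  proof -
    have v: "wvar s' vM = n * n + 1" "wvar s' 0 = n" using that(1) by (auto simp: frm_def input_def)
    note nl = node_less[OF that(6-8)]
    show "evals W s' (he *. Var vM +. (Var 36 *. Var 0 +. ue)) (h * (n * n + 1) + (v * n + u))"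
      by (intro evals_add evals_mult evals_Var[OF that(2)] that(3,4,5) v) (use nl VW q in linarith)+
  qed
  have hubs: "evals W s' hub_exp (hub n h)" if "frm s'" "word_state W s'" "wvar s' 35 = h" "h < G" for s' h
  proof -
    have "hub n h < ?V" by (rule hub_less[OF that(4)])
    then have "h * (n * n + 1) + n * n \<le> W" using WG unfolding hub_def by linarith
    then show ?thesis unfolding hub_exp_def hub_def
      by (intro evals_add evals_mult evals_Var[OF that(2)]) (use that in \<open>auto simp: frm_def input_def\<close>)
  qed
  have costs: "word_cost (node_exp (Var 35) (vert_exp k 37)) \<le> 20" "word_cost (node_exp (Load aXor (cell_exp 37 vG 35)) (vert_exp k 37)) \<le> 20"
    "word_cost (node_exp (Var 35) (Var 36)) \<le> 20" "word_cost hub_exp \<le> 20" "word_cost (eq_exp (size_exp 37) (Const 2)) \<le> 30" for k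
    by (simp_all add: node_exp_def hub_exp_def vert_exp_def eq_exp_def size_exp_def)
  have frm_frame: "frm s''" if "frm s'" "frame P s' s''" "wvars_of P \<inter> {0, vG, vM} = {}" "warrs_of P \<inter> {0, 1, aXor} = {}" "0 \<notin> rarrs_of P" for s' s'' P
  proof -
    have "0 \<notin> wvars_of P" "vG \<notin> wvars_of P" "vM \<notin> wvars_of P" "0 \<notin> warrs_of P" "1 \<notin> warrs_of P" "aXor \<notin> warrs_of P"
      using that(3,4) by blast+
    then have "wvar s'' 0 = wvar s' 0" "wvar s'' vG = wvar s' vG" "wvar s'' vM = wvar s' vM"
      "warr s'' 0 = warr s' 0" "warr s'' 1 = warr s' 1" "warr s'' aXor = warr s' aXor" "rarr s'' 0 = rarr s' 0"
      using frameD[OF that(2)] that(5) by blast+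
    then show ?thesis using that(1) unfolding frm_def input_def by simp
  qed
  let ?arc = "\<lambda>h v e k k'. (walk_node n h v (vert k e), walk_node n (h XOR ann e) v (vert k' e), e, w (\<sigma> e))"
  have edge: "run W (edge_arc_com k k') s' (\<lambda>t s''. arcs_state ?V (insert (?arc h v e k k') S) (m + 1) s'' \<and> t \<le> 100)"
    if a: "frm s'" "word_state W s'" "arcs_state ?V S m s'" "m + 1 \<le> W" "wvar s' 35 = h" "wvar s' 36 = v" "wvar s' 37 = e" "wvar s' 34 = e"
      "rvar s' 4 = w (\<sigma> e)" "h < G" "v < n" "e < n" "card (\<sigma> e) = 2" "{k, k'} = {0, 1}" for s' k k' h v e S m
  proof -
    have k: "k \<le> 2" "k' \<le> 2" "vert k e < n" "vert k' e < n"
      using a(14) edge_verts(1,2)[OF a(12,13)] by (auto simp: doubleton_eq_iff)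
    have i: "input s'" using a(1) by (simp add: frm_def)
    have n1: "evals W s' (node_exp (Var 35) (vert_exp k 37)) (walk_node n h v (vert k e))"
      by (rule node[OF a(1,2) evals_Var[OF a(2,5)] a(6) evals_vert[OF i a(2,7,12) k(1)] a(10,11) k(3)])
    have wl: "walk_node n h v (vert k e) < ?V" by (rule walk_node_less[OF a(11) k(3) a(10)])
    have xl: "h XOR ann e < G" using X[OF a(12,10)] by blast
    have wl': "walk_node n (h XOR ann e) v (vert k' e) < ?V" by (rule walk_node_less[OF a(11) k(4) xl])
    let ?s1 = "set_wvar 32 (walk_node n h v (vert k e)) s'"
    have ws1: "word_state W ?s1" by (rule word_state_set_wvar[OF a(2)]) (use wl VW in linarith)
    have f1: "frm ?s1" "input ?s1" using a(1) i by (auto simp: frm_def input_def)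
    have "e * G + h < n * G" by (rule mat_idx_less[OF a(12,10)])
    moreover have "n * G \<le> n * n * G" using n_le by (intro mult_le_mono1)
    ultimately have eG: "e * G + h \<le> W" using WG by linarith
    have x: "evals W ?s1 (Load aXor (cell_exp 37 vG 35)) (h XOR ann e)"
    proof (rule evals_Load[OF ws1])
      show "evals W ?s1 (cell_exp 37 vG 35) (e * G + h)"
        by (intro evals_add evals_mult evals_Var[OF ws1]) (use a eG in \<open>auto simp: frm_def\<close>)
      show "warr ?s1 aXor (e * G + h) = h XOR ann e" using a(1) X[OF a(12,10)] by (simp add: frm_def)
    qed
    have n2: "evals W ?s1 (node_exp (Load aXor (cell_exp 37 vG 35)) (vert_exp k' 37)) (walk_node n (h XOR ann e) v (vert k' e))"
      by (rule node[OF f1(1) ws1 x _ evals_vert[OF f1(2) ws1 _ a(12) k(2)] xl a(11) k(4)]) (use a in simp_all)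
    let ?s2 = "set_wvar 33 (walk_node n (h XOR ann e) v (vert k' e)) ?s1"
    have ws2: "word_state W ?s2" by (rule word_state_set_wvar[OF ws1]) (use wl' VW in linarith)
    have "0 \<le> w (\<sigma> e)" using weight_nonneg \<sigma>_in a(12,13) by (simp add: simplices_def)
    then have "run W add_arc ?s2 (\<lambda>t s''. arcs_state ?V (insert (?arc h v e k k') S) (m + 1) s'' \<and> t \<le> 40)"
      by (intro run_add_arc[OF ws2 _ a(4)]) (use a wl wl' in simp_all)
    then show ?thesis
      unfolding edge_arc_com_def
      by (intro run_Assign_evals[OF n1] run_Assign_evals[OF n2]) (erule run_mono, use costs(1)[of k] costs(2)[of k'] in auto)
  qed
  define Te where "Te h v e = (if card (\<sigma> e) = 2 then {(?arc h v e 0 1),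
        (?arc h v e 1 0)} else {})" for h v e
  have edges: "run W edge_arcs_com s' (\<lambda>t s''. arcs_state ?V (S \<union> Te h v e) (m + 2) s'' \<and> t \<le> 300)"
    if a: "frm s'" "word_state W s'" "arcs_state ?V S m s'" "m + 2 \<le> W" "wvar s' 35 = h" "wvar s' 36 = v" "wvar s' 37 = e"
      "h < G" "v < n" "e < n" for s' h v e S m
  proof -
    have i: "input s'" using a(1) by (simp add: frm_def)
    have sz: "evals W s' (eq_exp (size_exp 37) (Const 2)) (of_bool (card (\<sigma> e) = 2))" by (rule evals_size_eq[OF i a(2,7,10)]) simp
    have words: "test_words (Leq (Const 1) (eq_exp (size_exp 37) (Const 2))) s' \<subseteq> {..W}" using sz W_ge by (auto simp: evals_def)
    have val: "test_val (Leq (Const 1) (eq_exp (size_exp 37) (Const 2))) s' \<longleftrightarrow> card (\<sigma> e) = 2" using sz by (auto simp: evals_def)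
    show ?thesis
    proof (cases "card (\<sigma> e) = 2")
      case False
      then have "\<not> test_val (Leq (Const 1) (eq_exp (size_exp 37) (Const 2))) s'" using val by blast
      then show ?thesis unfolding edge_arcs_com_def run_Cond using words costs(5) a(3) False
        by (simp add: run_Skip Te_def arcs_state_def)
    next
      case True
      let ?s1 = "set_rvar 4 (w (\<sigma> e)) (set_wvar 34 e s')"
      have "\<sigma> e \<in> edges K" using \<sigma>_in a(10) True by (simp add: simplices_def)
      then have we: "rarr s' 0 e = w (\<sigma> e)" using edge_weight[OF a(10)] i by (simp add: input_def)
      have eW: "e \<le> W" using word_stateD(1)[OF a(2), of 37] a(7) by simp
      have ws1: "word_state W ?s1" using a(2) eW by (simp add: word_state_def)
      have f1: "frm ?s1" using a(1) by (simp add: frm_def input_def)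
      have E1: "run W (edge_arc_com 0 1) ?s1 (\<lambda>t s''. arcs_state ?V (insert (?arc h v e 0 1) S) (m + 1) s'' \<and> t \<le> 100)"
        by (rule edge[OF f1 ws1]) (use a True in simp_all)
      have "run W (edge_arc_com 0 1 ;; edge_arc_com 1 0) ?s1 (\<lambda>t s''. arcs_state ?V (S \<union> Te h v e) (m + 2) s'' \<and> t \<le> 200)"
      proof (rule run_SeqI[OF E1 ws1], goal_cases)
        case (1 t1 s1)
        have f2: "frm s1" by (rule frm_frame[OF f1 1(3)]) auto
        have "run W (edge_arc_com 1 0) s1 (\<lambda>t s''. arcs_state ?V (insert (?arc h v e 1 0)
            (insert (?arc h v e 0 1) S)) (m + 2) s'' \<and> t \<le> 100)"
          unfolding mm[of m, symmetric] by (rule edge[OF f2 1(2) conjunct1[OF 1(1)]]) (use a True 1(3) in \<open>auto simp: frame_def\<close>)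
        then show ?case by (rule run_mono) (use 1 True in \<open>auto simp: Te_def insert_commute\<close>)
      qed
      then have "run W ((34 ::= Var 37) ;; RAssign 4 (RLoad 0 (Var 37)) ;; edge_arc_com 0 1 ;; edge_arc_com 1 0) s'
          (\<lambda>t s''. arcs_state ?V (S \<union> Te h v e) (m + 2) s'' \<and> t \<le> 210)"
      proof (intro run_Assign_Seq[where v = e and x = 34] run_RAssign_Seq[where v = "w (\<sigma> e)"], goal_cases)
        case 5 then show ?case by (rule run_mono) simp
      qed (use a eW we in simp_all)
      then show ?thesis unfolding edge_arcs_com_def run_Cond using words val True costs(5) by (auto elim!: run_mono)
    qed
  qed
  define Th where "Th h v = {(hub n h, walk_node n h v v, n, 0 :: real), (walk_node n h v v, hub n h, n, 0)}" for h v
  have hubr: "run W hub_arcs_com s' (\<lambda>t s''. arcs_state ?V (S \<union> Th h v) (m + 2) s'' \<and> t \<le> 200)"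
    if a: "frm s'" "word_state W s'" "arcs_state ?V S m s'" "m + 2 \<le> W" "wvar s' 35 = h" "wvar s' 36 = v" "h < G" "v < n" for s' h v S m
  proof -
    have nd: "evals W s'' (node_exp (Var 35) (Var 36)) (walk_node n h v v)" if "frm s''" "word_state W s''" "wvar s'' 35 = h" "wvar s'' 36 = v" for s''
      by (rule node[OF that(1,2) evals_Var[OF that(2,3)] that(4) evals_Var[OF that(2,4)] a(7,8,8)])
    have l: "walk_node n h v v < ?V" "hub n h < ?V" by (rule walk_node_less[OF a(8,8,7)], rule hub_less[OF a(7)])
    let ?s0 = "set_rvar 4 0 (set_wvar 34 n s')"
    have ws0: "word_state W ?s0" using a(2) q by (simp add: word_state_def)
    have f0: "frm ?s0" using a(1) by (simp add: frm_def input_def)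
    let ?s1 = "set_wvar 32 (hub n h) ?s0"
    have ws1: "word_state W ?s1" by (rule word_state_set_wvar[OF ws0]) (use l VW in linarith)
    have f1: "frm ?s1" using a(1) by (simp add: frm_def input_def)
    let ?s2 = "set_wvar 33 (walk_node n h v v) ?s1"
    have ws2: "word_state W ?s2" by (rule word_state_set_wvar[OF ws1]) (use l VW in linarith)
    have f2: "frm ?s2" using a(1) by (simp add: frm_def input_def)
    have A1: "run W add_arc ?s2 (\<lambda>t s''. arcs_state ?V (insert (hub n h, walk_node n h v v, n, 0) S) (m + 1) s'' \<and> t \<le> 40)"
      by (rule run_add_arc[OF ws2]) (use a l in simp_all)
    have main: "run W (add_arc ;; (32 ::= node_exp (Var 35) (Var 36)) ;; (33 ::= hub_exp) ;; add_arc) ?s2 (\<lambda>t s''. arcs_state ?V (S \<union> Th h v) (m + 2) s'' \<and> t \<le> 130)"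
    proof (rule run_SeqI[OF A1 ws2], goal_cases)
      case (1 t1 s3)
      have f3: "frm s3" by (rule frm_frame[OF f2 1(3)]) auto
      have v3: "wvar s3 35 = h" "wvar s3 36 = v" "wvar s3 34 = n" "rvar s3 4 = 0" using 1(3) a by (auto simp: frame_def)
      let ?s4 = "set_wvar 32 (walk_node n h v v) s3"
      have ws4: "word_state W ?s4" by (rule word_state_set_wvar[OF 1(2)]) (use l VW in linarith)
      have f4: "frm ?s4" using f3 by (simp add: frm_def input_def)
      have h4: "evals W ?s4 hub_exp (hub n h)" by (rule hubs[OF f4 ws4]) (use v3 a in simp_all)
      have ws5: "word_state W (set_wvar 33 (hub n h) ?s4)" by (rule word_state_set_wvar[OF ws4]) (use l VW in linarith)
      have "run W add_arc (set_wvar 33 (hub n h) ?s4) (\<lambda>t s''. arcs_state ?V (insert (walk_node n h v v, hub n h, n, 0) (insert (hub n h, walk_node n h v v, n, 0) S)) (m + 2) s'' \<and> t \<le> 40)"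
        unfolding mm[of m, symmetric] by (rule run_add_arc[OF ws5]) (use a l v3 1(1) in simp_all)
      then show ?case
        by (intro run_Assign_evals[OF nd[OF f3 1(2) v3(1,2)]] run_Assign_evals[OF h4])
          (erule run_mono, use 1(1) costs(3,4) in \<open>auto simp: Th_def insert_commute\<close>)
    qed
    have h1: "evals W ?s0 hub_exp (hub n h)" by (rule hubs[OF f0 ws0]) (use a in simp_all)
    have nd1: "evals W ?s1 (node_exp (Var 35) (Var 36)) (walk_node n h v v)" by (rule nd[OF f1 ws1]) (use a in simp_all)
    have i0: "wvar s' 0 = n" using a(1) by (simp add: frm_def input_def)
    have "run W ((32 ::= hub_exp) ;; (33 ::= node_exp (Var 35) (Var 36)) ;; add_arc ;;
     (32 ::= node_exp (Var 35) (Var 36)) ;; (33 ::= hub_exp) ;; add_arc) ?s0 (\<lambda>t s''. arcs_state ?V (S \<union> Th h v) (m + 2) s'' \<and> t \<le> 180)"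
      by (intro run_Assign_evals[OF h1] run_Assign_evals[OF nd1]) (rule run_mono[OF main], use costs(3,4) in auto)
    then show ?thesis unfolding hub_arcs_com_def
    proof (intro run_Assign_Seq[where v = n and x = 34] run_RAssign_Seq[where v = 0], goal_cases)
      case 5 then show ?case by (rule run_mono) simp
    qed (use a q i0 in simp_all)
  qed
  let ?L3 = "For 37 0 edge_arcs_com"
  let ?L2 = "For 36 0 (hub_arcs_com ;; ?L3)"
  let ?L1 = "For 35 vG ?L2"
  define Tv where "Tv h v = Th h v \<union> (\<Union>e<n. Te h v e)" for h v
  have L3: "run W (hub_arcs_com ;; ?L3) s' (\<lambda>t s''. arcs_state ?V (S \<union> Tv h v) (m + (2 + n * 2)) s'' \<and> t \<le> 207 + n * 309)"
    if a: "frm s'" "word_state W s'" "arcs_state ?V S m s'" "m + (2 + n * 2) \<le> W" "wvar s' 35 = h" "wvar s' 36 = v" "h < G" "v < n" for s' h v S m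
  proof (rule run_SeqI[OF hubr[OF a(1-3) _ a(5-8)] a(2)], goal_cases)
    case 1 show ?case using a(4) by linarith
  next
    case (2 t1 s1)
    have f1: "frm s1" by (rule frm_frame[OF a(1) 2(3)]) auto
    have n1: "wvar s1 0 = n" using f1 by (simp add: frm_def input_def)
    have "run W ?L3 s1 (\<lambda>t s''. arcs_state ?V (S \<union> Th h v \<union> (\<Union>e<wvar s1 0. Te h v e)) (m + 2 + wvar s1 0 * 2) s'' \<and> t \<le> 7 + wvar s1 0 * (300 + 9))"
    proof (rule run_For_arcs[OF 2(2) _ _ _ _ conjunct1[OF 2(1)]], goal_cases)
      case 6 show ?case using a(4) n1 by simp
    next
      case (7 e s' S' m')
      have f: "frm s'" by (rule frm_frame[OF f1 7(3)]) auto
      show ?case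
        by (rule edges[OF f 7(2,5,6)]) (use 7 2(3) a n1 in \<open>auto simp: frame_def\<close>)
    qed (use W_ge in auto)
    then show ?case
      by (rule run_mono) (use 2(1) n1 in \<open>auto simp: Tv_def Un_assoc add.assoc\<close>)
  qed
  have L2: "run W ?L2 s' (\<lambda>t s''. arcs_state ?V (S \<union> (\<Union>v<n. Tv h v)) (m + n * (2 + n * 2)) s'' \<and> t \<le> 7 + n * (207 + n * 309 + 9))"
    if a: "frm s'" "word_state W s'" "arcs_state ?V S m s'" "m + n * (2 + n * 2) \<le> W" "wvar s' 35 = h" "h < G" for s' h S m
  proof -
    have n1: "wvar s' 0 = n" using a(1) by (simp add: frm_def input_def)
    have "run W ?L2 s' (\<lambda>t s''. arcs_state ?V (S \<union> (\<Union>v<wvar s' 0. Tv h v)) (m + wvar s' 0 * (2 + n * 2)) s'' \<and> t \<le> 7 + wvar s' 0 * (207 + n * 309 + 9))"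
    proof (rule run_For_arcs[OF a(2) _ _ _ _ a(3)], goal_cases)
      case 6 show ?case using a(4) n1 by simp
    next
      case (7 v s'' S' m')
      have f: "frm s''" by (rule frm_frame[OF a(1) 7(3)]) auto
      show ?case
        by (rule L3[OF f 7(2,5,6)]) (use 7 a n1 in \<open>auto simp: frame_def\<close>)
    qed (use W_ge in auto)
    then show ?thesis by (simp only: n1)
  qed
  let ?s0 = "set_wvar vA 0 (set_wvar vV ?V (set_wvar vM (n * n + 1) s))"
  have ws0: "word_state W ?s0" using ws VW q by (simp add: word_state_def)
  have f0: "frm ?s0" using inp G by (simp add: frm_def input_def)
  have n0: "wvar s 0 = n" using inp by (simp add: input_def)
  let ?H = "For 35 vV (Store aHead (Var 35) (Const 0))"
  have H: "run W ?H ?s0 (\<lambda>t s'. (\<forall>i<wvar ?s0 vV. warr s' aHead i = 0) \<and>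
     (\<forall>k. k \<notin> (\<lambda>i. i) ` {..<wvar ?s0 vV} --> warr s' aHead k = warr ?s0 aHead k) \<and>
     t \<le> 7 + wvar ?s0 vV * (word_cost (Var 35) + word_cost (Const 0) + 10))"
  proof (rule run_fill1)
    fix i s' assume a: "i < wvar ?s0 vV" "word_state W s'" "frame ?H ?s0 s'" "wvar s' 35 = i"
    show "word_val (Var 35) s' = i \<and> word_val (Const 0) s' = 0 \<and> word_words (Var 35) s' \<union> word_words (Const 0) s' \<subseteq> {..W}"
      by (rule evals_fill[OF evals_Var evals_Const]) (use a in auto)
  qed (use ws0 W_ge in auto)
  have "run W (?H ;; ?L1) ?s0 (\<lambda>t s'. arcs_state ?V (arc_set n G (\<lambda>e. card (\<sigma> e) = 2) (vert 0) (vert 1) ann (\<lambda>e. w (\<sigma> e))) (4 * (n * n * G)) s' \<and>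
      wvar s' vM = n * n + 1 \<and> wvar s' vV = ?V \<and> t \<le> 980 * (n * n * G))"
  proof (rule run_SeqI[OF H ws0], goal_cases)
    case (1 t1 s1)
    have f1: "frm s1" by (rule frm_frame[OF f0 1(3)]) auto
    have v1: "wvar s1 vA = 0" "wvar s1 vG = G" "wvar s1 vM = n * n + 1" "wvar s1 vV = ?V" using 1(3) G by (auto simp: frame_def)
    have S0: "arcs_state ?V {} 0 s1" using 1(1) v1 by (simp add: arcs_state_def graph_ok_def stored_arcs_def)
    have "run W ?L1 s1 (\<lambda>t s''. arcs_state ?V ({} \<union> (\<Union>h<wvar s1 vG. \<Union>v<n. Tv h v)) (0 + wvar s1 vG * (n * (2 + n * 2))) s'' \<and>
        t \<le> 7 + wvar s1 vG * (7 + n * (207 + n * 309 + 9) + 9))"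
    proof (rule run_For_arcs[OF 1(2) _ _ _ _ S0], goal_cases)
      case 6 show ?case unfolding v1(2) using WG by linarith
    next
      case (7 h s' S' m')
      have f: "frm s'" by (rule frm_frame[OF f1 7(3)]) auto
      show ?case by (rule L2[OF f 7(2,5,6,4)]) (use 7(1) v1 in simp)
    qed (use W_ge in auto)
    then show ?case
    proof (rule run_strengthenE[OF _ 1(2)], goal_cases)
      case (1 t2 s2)
      have "arc_set n G (\<lambda>e. card (\<sigma> e) = 2) (vert 0) (vert 1) ann (\<lambda>e. w (\<sigma> e)) = (\<Union>h<G. \<Union>v<n. Tv h v)"
        unfolding arc_set_Union Tv_def Th_def Te_def ..
      moreover have "wvar s2 vA \<le> 4 * (n * n * G)" using 1(1) WG(3) unfolding v1(2) arcs_state_def by linarith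
      moreover have "wvar s2 vM = n * n + 1" "wvar s2 vV = ?V" using 1(3) v1 by (auto simp: frame_def)
      moreover have "t1 + t2 \<le> 980 * (n * n * G)"
      proof -
        have "t1 \<le> 7 + ?V * 12" using \<open>_ \<and> _ \<and> t1 \<le> _\<close> by simp
        moreover have "t2 \<le> 7 + G * (16 + n * (216 + n * 309))" using 1(1) v1(2) by (simp add: add.commute)
        moreover have "G * (16 + n * (216 + n * 309)) = 16 * G + 216 * (n * G) + 309 * (n * n * G)" by (simp add: algebra_simps)
        moreover have "n * G \<le> n * n * G" using n_le by (intro mult_le_mono1)
        moreover have "1 * G \<le> n * G" using n_pos by (intro mult_le_mono1) simp
        ultimately show ?thesis using WG(2) q(1) by linarith
      qed
      ultimately show ?case using 1(1) unfolding v1(2) arcs_state_def by simp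
    qed
  qed
  then show ?thesis
    unfolding build_arcs_def
  proof (intro run_Assign_Seq[where v = "n * n + 1" and x = vM] run_Assign_Seq[where v = ?V and x = vV] run_Assign_Seq[where v = 0 and x = vA], goal_cases)
    case 7
    then show ?case by (rule run_mono) (use q(1) in simp)
  qed (use n0 G(1) q VW word_stateD(1)[OF ws, of vG] in simp_all)
qed

end

section \<open>Writing the cycles\<close>

abbreviation (input) "aOut \<equiv> 2 :: nat"

text \<open>Entries are toggled rather than set, which takes the sum modulo 2 of the edges on the
  path. Labels equal to \<open>n\<close> belong to hub arcs and are skipped.\<close>

definition trace_step :: com where
  "trace_step = (va ::= Load aPar (Var vx)) ;; (34 ::= Load aLab (Var va)) ;;
     Cond (Leq (Var 34 +. Const 1) (Var 0))
       (Store aOut (cell_exp 35 0 34) (Const 1 -. Load aOut (cell_exp 35 0 34))) Skip ;;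
     (vx ::= Load aSrc (Var va))"

definition write_cycles :: com where
  "write_cycles = For 35 vG (For 36 0 (Store aOut (cell_exp 35 0 36) (Const 0))) ;;
     For 35 vG ((vx ::= hub_exp) ;; While (Leq (Const 1) (Load aCnt (Var vx))) trace_step)"

lemma write_cycles_names [simp]:
  "wvars_of trace_step = {vx, va, 34}" "warrs_of trace_step = {aOut}" "rvars_of trace_step = {}" "rarrs_of trace_step = {}"
  "wvars_of write_cycles = {vx, va, 34, 35, 36}" "warrs_of write_cycles = {aOut}" "rvars_of write_cycles = {}" "rarrs_of write_cycles = {}"
  by (auto simp: trace_step_def write_cycles_def)

context cycle_program
begin

definition row :: "machine_state => nat => 'v set set" where
  "row s h = {\<sigma> j | j. j < n \<and> warr s aOut (h * n + j) = 1}"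

lemma row_cong: "(\<And>j. j < n ==> warr s' aOut (h * n + j) = warr s aOut (h * n + j)) ==> row s' h = row s h"
  unfolding row_def by (intro Collect_cong ex_cong1) auto

lemma row_toggle:
  assumes "l < n" "warr s aOut (h * n + l) \<le> 1" "\<And>k. warr s' aOut k = (if k = h * n + l then 1 - warr s aOut k else warr s aOut k)"
  shows "row s' h = sym_diff (row s h) {\<sigma> l}" "h' \<noteq> h ==> row s' h' = row s h'"
proof -
  show "row s' h' = row s h'" if "h' \<noteq> h"
    by (rule row_cong) (use assms that in \<open>simp add: mat_idx_inj\<close>)
  have mem: "\<sigma> j \<in> row t h \<longleftrightarrow> warr t aOut (h * n + j) = 1" if "j < n" for j t
    using that \<sigma>_inj by (auto simp: row_def)
  have in_row: "\<exists>j<n. c = \<sigma> j" if "c \<in> row t h" for c t using that by (auto simp: row_def)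
  have tog: "\<sigma> j \<in> row s' h \<longleftrightarrow> \<sigma> j \<in> sym_diff (row s h) {\<sigma> l}" if "j < n" for j
    using mem[OF that] assms \<sigma>_inj[OF that assms(1)] that by auto
  have in2: "\<exists>j<n. c = \<sigma> j" if "c \<in> sym_diff (row s h) {\<sigma> l}" for c using that in_row assms(1) by blast
  show "row s' h = sym_diff (row s h) {\<sigma> l}"
  proof (rule Set.set_eqI)
    fix c show "c \<in> row s' h \<longleftrightarrow> c \<in> sym_diff (row s h) {\<sigma> l}"
      using tog in_row[of c s'] in2[of c] by metis
  qed
qed

text \<open>The path is read from its end, while \<open>collected\<close> grows from its start. The
  invariant therefore speaks about the missing beginning of the path; at the root this is empty and
  the row itself is the collected chain.\<close>

lemma run_write_cycles:
  assumes ws: "word_state W s" and inp: "input s" and v: "wvar s vG = 2 ^ g" "wvar s vM = n * n + 1"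
    and S: "cycle_search K \<sigma> n N piv1 piv2 w r e1 e2 g A (warr s aSrc) tgt (warr s aLab) wt st (warr s aCnt) (warr s aPar) D"
  shows "run W write_cycles s (\<lambda>t s'. (\<forall>h<2 ^ g. cycle_graph.collected K \<sigma> n N piv1 piv2 w r g D (hub n h) (row s' h)) \<and>
    (\<forall>k<2 ^ g * n. warr s' aOut k \<le> 1) \<and> t \<le> 2000 * (n * n * 2 ^ g))"
proof -
  interpret cycle_search K \<sigma> n N piv1 piv2 w r e1 e2 g A "warr s aSrc" tgt "warr s aLab" wt st "warr s aCnt" "warr s aPar" D by (rule S)
  define G where "G = (2::nat) ^ g"
  have G: "0 < G" "wvar s vG = G" using v by (auto simp: G_def)
  have "n * n * G \<le> n * n * 2 ^ homology_dim K 1" using g_eq by (simp add: G_def)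
  note WG = W_graph[OF this G(1)]
  have nG: "G * n \<le> n * n * G" "G \<le> G * n"
  proof -
    have "n * G \<le> n * n * G" using n_le by (intro mult_le_mono1)
    then show "G * n \<le> n * n * G" by (simp only: mult.commute)
    show "G \<le> G * n" using n_pos by simp
  qed
  have VW: "G * (n * n + 1) \<le> W" using WG by linarith
  have n0: "wvar s 0 = n" using inp by (simp add: input_def)
  have idx: "evals W s' (cell_exp 35 0 x) (h * n + j)"
    if "word_state W s'" "wvar s' 35 = h" "wvar s' x = j" "wvar s' 0 = n" "h < G" "j < n" for s' x h j
  proof -
    have "h * n + j < G * n" by (rule mat_idx_less[OF that(5,6)])
    then have "h * n + j \<le> W" using WG nG by linarith
    then show ?thesis by (intro evals_add evals_mult evals_Var[OF that(1)]) (use that in auto)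
  qed
  let ?F = "For 35 vG (For 36 0 (Store aOut (cell_exp 35 0 36) (Const 0)))"
  have F: "run W ?F s (\<lambda>t s'. (\<forall>h<G. \<forall>j<n. warr s' aOut (h * n + j) = 0) \<and>
     (\<forall>k. k \<notin> (\<lambda>(i, j). i * n + j) ` ({..<G} \<times> {..<n}) --> warr s' aOut k = warr s aOut k) \<and>
     t \<le> 7 + G * (16 + n * (word_cost (cell_exp 35 0 36) + word_cost (Const 0) + 10)))"
  proof (rule run_fill2)
    show "i = i' \<and> l = l'" if "i < G" "i' < G" "l < n" "l' < n" "i * n + l = i' * n + l'" for i l i' l'
      using that by (simp add: mat_idx_inj)
    fix h j s' assume a: "h < G" "j < n" "word_state W s'" "frame ?F s s'" "wvar s' 35 = h" "wvar s' 36 = j"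
    show "word_val (cell_exp 35 0 36) s' = h * n + j \<and> word_val (Const 0) s' = 0 \<and>
        word_words (cell_exp 35 0 36) s' \<union> word_words (Const 0) s' \<subseteq> {..W}"
      by (rule evals_fill[OF idx evals_Const]) (use a n0 in \<open>auto simp: frame_def\<close>)
  qed (use ws n0 G W_ge in auto)
  let ?b = "Leq (Const 1) (Load aCnt (Var vx))"
  define same where "same s' \<longleftrightarrow> input s' \<and> wvar s' vG = G \<and> wvar s' vM = n * n + 1 \<and> warr s' aSrc = warr s aSrc \<and>
    warr s' aLab = warr s aLab \<and> warr s' aCnt = warr s aCnt \<and> warr s' aPar = warr s aPar" for s'
  have same_frame: "same s''" if "same s'" "frame P s' s''" "wvars_of P \<subseteq> {vx, va, 34, 35, 36}" "warrs_of P \<subseteq> {aOut}" "rarrs_of P = {}" for s' s'' P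
  proof -
    have "0 \<notin> wvars_of P" "vG \<notin> wvars_of P" "vM \<notin> wvars_of P" "0 \<notin> warrs_of P" "1 \<notin> warrs_of P" "aSrc \<notin> warrs_of P" "aLab \<notin> warrs_of P"
      "aCnt \<notin> warrs_of P" "aPar \<notin> warrs_of P" "0 \<notin> rarrs_of P"
      using that(3-5) by auto
    then have "wvar s'' 0 = wvar s' 0" "wvar s'' vG = wvar s' vG" "wvar s'' vM = wvar s' vM"
      "warr s'' 0 = warr s' 0" "warr s'' 1 = warr s' 1" "warr s'' aSrc = warr s' aSrc" "warr s'' aLab = warr s' aLab"
      "warr s'' aCnt = warr s' aCnt" "warr s'' aPar = warr s' aPar" "rarr s'' 0 = rarr s' 0"
      using frameD[OF that(2)] by blast+
    then show ?thesis using that(1) unfolding same_def input_def by simp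
  qed
  \<comment> \<open>\<open>R\<close> holds the edges between \<open>x\<close> and the hub of
    \<open>h\<close>: added to whatever is collected at \<open>x\<close>, it gives something
    collected at that hub.\<close>
  define traced where "traced h x R \<longleftrightarrow> x < V \<and> st x = 2 \<and> (\<forall>c. collected D x c --> collected D (hub n h) (sym_diff c R))" for h x R
  define J where "J h s' \<longleftrightarrow> traced h (wvar s' vx) (row s' h) \<and> (\<forall>k<G * n. warr s' aOut k \<le> 1)" for h s'
  have step: "run W trace_step s' (\<lambda>t s''. J h s'' \<and> (\<forall>h'. h' \<noteq> h --> row s'' h' = row s' h') \<and>
        warr s aCnt (wvar s'' vx) + 1 = warr s aCnt (wvar s' vx) \<and> t \<le> 50)"
    if a: "word_state W s'" "same s'" "J h s'" "test_val ?b s'" "h < G" "wvar s' 35 = h" for s' h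
  proof -
    define x where "x = wvar s' vx"
    define p where "p = warr s aPar x"
    define l where "l = warr s aLab p"
    have x: "x < V" "st x = 2" "\<And>c. collected D x c ==> collected D (hub n h) (sym_diff c (row s' h))"
      using a(3) by (auto simp: J_def traced_def x_def)
    have cx: "1 \<le> warr s aCnt x" using a(4) a(2) by (simp add: x_def same_def)
    have "x \<noteq> hub n 0" using cx root(3) by auto
    note par = parent[OF x(1,2) this, folded p_def, folded l_def]
    have tr: "traced h (warr s aSrc p) (if l < n then sym_diff (row s' h) {\<sigma> l} else row s' h)"
      unfolding traced_def
    proof (intro conjI allI impI)
      fix c assume "collected D (warr s aSrc p) c"
      then have "collected D x (if l < n then sym_diff c {\<sigma> l} else c)" by (rule collected_arc[OF par(2,5)])
      then have "collected D (hub n h) (sym_diff (if l < n then sym_diff c {\<sigma> l} else c) (row s' h))" by (rule x(3))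
      moreover have "sym_diff (if l < n then sym_diff c {\<sigma> l} else c) (row s' h) = sym_diff c (if l < n then sym_diff (row s' h) {\<sigma> l} else row s' h)"
        by auto
      ultimately show "collected D (hub n h) (sym_diff c (if l < n then sym_diff (row s' h) {\<sigma> l} else row s' h))" by (simp only:)
    qed (use par in blast)+
    have eqs: "warr s' aPar x = p" "warr s' aLab p = l" "wvar s' 0 = n" "warr s' aSrc p = warr s aSrc p"
      using a(2) by (auto simp: same_def p_def l_def input_def)
    note wd = word_stateD[OF a(1)]
    have le: "x \<le> W" "p \<le> W" "l \<le> W" "warr s aSrc p \<le> W" "n \<le> W" "h \<le> W"
      using wd(1)[of vx] wd(1)[of 0] wd(1)[of 35] wd(2)[of aPar x] wd(2)[of aLab p] wd(2)[of aSrc p] eqs a(6) by (auto simp: x_def)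
    have lW: "l + 1 \<le> W"
    proof -
      have "l \<le> n" using par(2) unfolding arc_set_def by auto
      then show ?thesis using W_ge(2) n_pos by linarith
    qed
    show ?thesis
    proof (cases "l < n")
      case True
      let ?k = "h * n + l"
      let ?v = "1 - warr s' aOut ?k"
      let ?s = "set_wvar vx (warr s aSrc p) (set_warr aOut ?k ?v (set_wvar 34 l (set_wvar va p s')))"
      have k: "?k < G * n" by (rule mat_idx_less[OF a(5) True])
      have kW: "h * n \<le> W" "?k \<le> W" using k WG nG by linarith+
      have le1: "warr s' aOut ?k \<le> 1" using a(3) k by (simp add: J_def)
      have tog: "warr ?s aOut i = (if i = ?k then 1 - warr s' aOut i else warr s' aOut i)" for i by simp
      have "row ?s h = sym_diff (row s' h) {\<sigma> l}" by (rule row_toggle(1)[OF True le1 tog])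
      moreover have "\<forall>h'. h' \<noteq> h --> row ?s h' = row s' h'" using row_toggle(2)[OF True le1 tog] by blast
      moreover have "\<forall>i<G * n. warr ?s aOut i \<le> 1" using a(3) by (simp add: J_def)
      ultimately have post: "J h ?s" "\<forall>h'. h' \<noteq> h --> row ?s h' = row s' h'" using tr True by (simp_all add: J_def)
      have "run W trace_step s' (\<lambda>t s''. s'' = ?s \<and> t \<le> 50)"
        unfolding trace_step_def
        using True le lW kW eqs a(6) wd(2)[of aOut ?k] W_ge by (simp add: run_simps x_def[symmetric])
      then show ?thesis
      proof (rule run_mono, goal_cases)
        case (1 t s'')
        have "warr s aCnt (wvar ?s vx) + 1 = warr s aCnt (wvar s' vx)" using par(6) by (simp add: x_def)
        then show ?case using 1 post by blast
      qed
    next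
      case False
      let ?s = "set_wvar vx (warr s aSrc p) (set_wvar 34 l (set_wvar va p s'))"
      have rows: "row ?s h' = row s' h'" for h' by (rule row_cong) simp
      have post: "J h ?s" unfolding J_def rows using tr False a(3) by (simp add: J_def)
      have "run W trace_step s' (\<lambda>t s''. s'' = ?s \<and> t \<le> 50)"
        unfolding trace_step_def
        using False le lW eqs a(6) W_ge by (simp add: run_simps x_def[symmetric])
      then show ?thesis
      proof (rule run_mono, goal_cases)
        case (1 t s'')
        have "warr s aCnt (wvar ?s vx) + 1 = warr s aCnt (wvar s' vx)" using par(6) by (simp add: x_def)
        then show ?case using 1 post rows by blast
      qed
    qed
  qed
  define I where "I i s' \<longleftrightarrow> (\<forall>h<i. collected D (hub n h) (row s' h)) \<and> (\<forall>h. i \<le> h \<and> h < G --> row s' h = {}) \<and> (\<forall>k<G * n. warr s' aOut k \<le> 1)" for i s'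
  let ?B = "(vx ::= hub_exp) ;; While ?b trace_step"
  have body: "run W ?B s' (\<lambda>t s''. I (Suc h) (set_wvar 35 (Suc h) s'') \<and> t \<le> 200 * n + 200)"
    if a: "word_state W s'" "same s'" "I h s'" "h < G" "wvar s' 35 = h" for s' h
  proof -
    have hV: "hub n h < V" using hub_less a(4) by (simp add: G_def)
    have n0': "wvar s' 0 = n" "wvar s' vM = n * n + 1" using a(2) by (auto simp: same_def input_def)
    have hub: "evals W s' hub_exp (hub n h)"
    proof -
      have "h * (n * n + 1) + n * n \<le> W" using hV VW unfolding hub_def G_def by linarith
      then show ?thesis unfolding hub_exp_def hub_def by (intro evals_add evals_mult evals_Var[OF a(1)]) (use a n0' in auto)
    qed
    let ?s = "set_wvar vx (hub n h) s'"
    have ws1: "word_state W ?s" by (rule word_state_set_wvar[OF a(1)]) (use hV VW in \<open>unfold G_def, linarith\<close>)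
    have h2: "h < 2 ^ g" using a(4) by (simp add: G_def)
    have same1: "same ?s" using a(2) by (simp add: same_def input_def)
    have rows1: "row ?s h' = row s' h'" for h' by (rule row_cong) simp
    have "run W (While ?b trace_step) ?s (\<lambda>t s''. I (Suc h) (set_wvar 35 (Suc h) s'') \<and> t \<le> 60 * (3 * n + 2) + 6)"
    proof (rule run_While[where I = "\<lambda>s''. J h s'' \<and> (\<forall>h'. h' \<noteq> h --> row s'' h' = row s' h')" and \<Phi> = "\<lambda>s''. 60 * warr s aCnt (wvar s'' vx)"], goal_cases)
      case 1 show ?case by (rule ws1)
    next
      case 2
      have "row s' h = {}" using a(3,4) by (simp add: I_def)
      then show ?case using a(3) hV hub_settled[OF h2] by (simp add: J_def traced_def rows1 I_def)
    next
      case (3 s'')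
      show ?case using word_stateD[OF 3(1)] W_ge by simp
    next
      case (4 s'')
      have sm: "same s''" by (rule same_frame[OF same1 4(2)]) auto
      have h35: "wvar s'' 35 = h" using 4(2) a(5) by (simp add: frame_def)
      show ?case
        by (rule run_mono[OF step[OF 4(1) sm conjunct1[OF 4(3)] 4(4) a(4) h35]]) (use 4(3) in auto)
    next
      case (5 t s'')
      have sm: "same s''" by (rule same_frame[OF same1 5(2)]) auto
      define x where "x = wvar s'' vx"
      have x: "x < V" "st x = 2" "\<And>c. collected D x c ==> collected D (hub n h) (sym_diff c (row s'' h))" "\<forall>k<G * n. warr s'' aOut k \<le> 1"
        using 5(3) by (auto simp: J_def traced_def x_def)
      have "warr s aCnt x = 0" using 5(4) sm by (simp add: x_def same_def)
      \<comment> \<open>Any other settled node has an arc counter one larger than that of its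
        parent, so the counter zero identifies the root.\<close>
      then have "x = hub n 0" using parent(6)[OF x(1,2)] by fastforce
      then have "collected D (hub n h) (sym_diff {} (row s'' h))" using x(3) collected_root by blast
      then have c: "collected D (hub n h) (row s'' h)" by simp
      have rows2: "row (set_wvar 35 (Suc h) s'') h' = row s'' h'" for h' by (rule row_cong) simp
      have "I (Suc h) (set_wvar 35 (Suc h) s'')"
        unfolding I_def rows2
      proof (intro conjI allI impI)
        fix h' assume "h' < Suc h"
        then show "collected D (hub n h') (row s'' h')" using c 5(3) a(3) by (cases "h' = h") (auto simp: I_def)
      next
        fix h' assume "Suc h \<le> h' \<and> h' < G"
        then show "row s'' h' = {}" using 5(3) a(3) by (auto simp: I_def)
      qed (use x(4) in simp)
      moreover have "t \<le> 60 * (3 * n + 2) + 6" using 5(5) hub_count[OF h2] by simp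
      ultimately show ?case by blast
    qed
    then show ?thesis
      by (intro run_Assign_evals[OF hub]) (erule run_mono, simp add: hub_exp_def)
  qed
  show ?thesis
    unfolding write_cycles_def
  proof (rule run_SeqI[OF F ws], goal_cases)
    case (1 t1 s1)
    have same1: "same s1" using inp G v 1(3) by (simp add: same_def input_def frame_def)
    have z: "warr s1 aOut k = 0" if "k < G * n" for k
    proof -
      have "k div n < G" using that by (simp add: less_mult_imp_div_less)
      moreover have "k mod n < n" using n_pos by simp
      ultimately have "warr s1 aOut (k div n * n + k mod n) = 0" using 1(1) by blast
      then show ?thesis by simp
    qed
    have rows0: "row s1 h = {}" if "h < G" for h using 1(1) that by (auto simp: row_def)
    have "run W (For 35 vG ?B) s1 (\<lambda>t s'. I G s' \<and> t \<le> 7 + G * (200 * n + 209))"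
    proof (rule run_For[where I = I and T = "\<lambda>_. 200 * n + 200"], goal_cases)
      case 1 show ?case by fact
    next
      case 6
      have "row (set_wvar 35 0 s1) h = row s1 h" for h by (rule row_cong) simp
      then show ?case using rows0 z by (simp add: I_def)
    next
      case (7 h s')
      have "same s'" by (rule same_frame[OF same1 7(3)]) auto
      then show ?case by (rule body[OF 7(2) _ 7(5) _ 7(4)]) (use 7(1) same1 in \<open>simp add: same_def\<close>)
    next
      case (8 t s')
      have "wvar s1 vG = G" using same1 by (simp add: same_def)
      then show ?case using 8(4,5) by (simp add: add.commute)
    qed (use W_ge in auto)
    then show ?case
    proof (rule run_mono, goal_cases)
      case (1 t2 s2)
      have "t1 \<le> 7 + G * (16 + n * 16)" using \<open>_ \<and> _ \<and> t1 \<le> _\<close> by simp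
      moreover have "t2 \<le> 7 + G * (200 * n + 209)" using 1 by blast
      moreover have "G * (16 + n * 16) = 16 * G + 16 * (G * n)" "G * (200 * n + 209) = 200 * (G * n) + 209 * G" by (simp_all add: algebra_simps)
      ultimately have "t1 + t2 \<le> 2000 * (n * n * G)" using nG G(1) by linarith
      then show ?case using 1 unfolding I_def G_def by blast
    qed
  qed
qed

end

section \<open>The algorithm\<close>

context mult_machine
begin

definition shortest_cycles :: com where
  "shortest_cycles = prepare ;; xor_table ;; build_arcs ;; power_above vQ vV ;; (vroot ::= Var 0 *. Var 0) ;; dijkstra ;;
     write_cycles ;; (0 ::= Var vG)"

end

context cycle_program
begin

lemma run_search:
  assumes ws: "word_state W s" and P: "prepared N piv1 piv2 s" and g: "wvar s vg = g"
    and X: "\<forall>e<n. \<forall>h<2 ^ g. warr s aXor (e * 2 ^ g + h) = h XOR cycle_graph.code \<sigma> n N piv1 piv2 r g {\<sigma> e}"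
    and r: "r = warr s aR"
  shows "run W (build_arcs ;; power_above vQ vV ;; (vroot ::= Var 0 *. Var 0) ;; dijkstra ;; write_cycles ;; (0 ::= Var vG)) s
    (\<lambda>t s'. \<exists>L. outputs_shortest_cycles K w \<sigma> s' \<and> 2 ^ L \<le> 4 * (n * n * 2 ^ g) \<and> t \<le> 8000 * (n * n * 2 ^ g * (L + 1)))"
proof -
  interpret cycle_graph K \<sigma> n N piv1 piv2 w r "vert 0" "vert 1" g
    using cycle_graph_prepared[OF P] r g by simp
  have Gle: "n * n * 2 ^ g \<le> n * n * 2 ^ homology_dim K 1" using g_eq by simp
  define q where "q = n * n * 2 ^ g"
  have "n * n * 1 \<le> q" unfolding q_def by (intro mult_le_mono2) simp
  moreover have "30 * q \<le> W" "V \<le> 2 * q" using W_graph[OF Gle] by (simp_all add: q_def)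
  moreover have "1 * 1 \<le> V" by (intro mult_le_mono) simp_all
  ultimately have q: "1 \<le> q" "n * n \<le> q" "n \<le> q" "30 * q \<le> W" "V \<le> 2 * q" "1 \<le> V"
    using n_pos n_le by linarith+
  have inp: "input s" and G: "wvar s vG = 2 ^ g" using P g by (auto simp: prepared_def)
  have B: "run W build_arcs s (\<lambda>t s'. arcs_state V arcs (4 * q) s' \<and> wvar s' vM = n * n + 1 \<and> wvar s' vV = V \<and> t \<le> 1000 * q)"
    unfolding q_def by (rule run_build_arcs[OF ws inp G _ Gle]) (use X xor_less code_less in auto)
  show ?thesis
  proof (rule run_SeqI[OF B ws], goal_cases)
    case (1 t1 s1)
    define A where "A = wvar s1 vA"
    have i1: "input s1" by (rule input_frame[OF inp 1(3)]) auto
    have v1: "wvar s1 vM = n * n + 1" "wvar s1 vV = V" "wvar s1 vG = 2 ^ g" "A \<le> 4 * q" "graph_ok V A s1" "stored_arcs s1 = arcs" "t1 \<le> 1000 * q"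
      using 1(1,3) G by (auto simp: arcs_state_def A_def frame_def)
    have Pw: "run W (power_above vQ vV) s1 (\<lambda>t s'. (\<exists>L. wvar s' vQ = 2 ^ L) \<and> V \<le> wvar s' vQ \<and> wvar s' vQ \<le> 2 * V \<and> t \<le> 20 * V + 10)"
      by (rule run_power_above[OF 1(2) _ v1(2)]) (use q in auto)
    show ?case
    proof (rule run_SeqI[OF Pw 1(2)], goal_cases)
      case (1 t2 s2)
      then obtain L where L: "wvar s2 vQ = 2 ^ L" "V \<le> 2 ^ L" "2 ^ L \<le> 2 * V" "t2 \<le> 20 * V + 10" by auto
      have i2: "input s2" by (rule input_frame[OF i1 1(3)]) auto
      let ?s3 = "set_wvar vroot (hub n 0) s2"
      have hub0: "hub n 0 = n * n" by (simp add: hub_def)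
      have i3: "input ?s3" using i2 by (simp add: input_def)
      have ws3: "word_state W ?s3" by (rule word_state_set_wvar[OF 1(2)]) (use q hub0 in linarith)
      have same3: "warr ?s3 = warr s1" "rarr ?s3 = rarr s1" "wvar ?s3 vM = n * n + 1" "wvar ?s3 vG = 2 ^ g"
        using 1(3) v1 by (auto simp: frame_def)
      have D: "run W dijkstra ?s3 (\<lambda>t s'. t \<le> (2 ^ L + V + A) * (80 * L + 300) + 300 \<and>
          dijkstra_inv V A (hub n 0) (warr ?s3 aSrc) (warr ?s3 aTgt) (rarr ?s3 rWt) (\<lambda>_. True) (warr s' aStat) (rarr s' rDist) (warr s' aCnt) (warr s' aPar) \<and>
          (\<forall>x<V. warr s' aStat x \<noteq> 1))"
      proof (rule run_dijkstra[OF ws3])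
        show "2 * 2 ^ L + 10 \<le> W" "A \<le> W" using L q v1 by linarith+
        show "graph_ok V A ?s3" using v1(5) same3 by (simp add: graph_ok_def)
        show "hub n 0 < V" by (rule hub_less) simp
      qed (use L in simp_all)
      show ?case
      proof (rule run_Assign_Seq[where v = "hub n 0"], goal_cases)
        case 1 show ?case using i2 q word_stateD(1)[OF \<open>word_state W s2\<close>, of 0] by (simp add: input_def)
      next
        case 2 show ?case using i2 hub0 by (simp add: input_def)
      next
        case 3
        show ?case
        proof (rule run_SeqI[OF D ws3], goal_cases)
          case (1 t4 s4)
          have i4: "input s4" by (rule input_frame[OF i3 1(3)]) auto
          have v4: "wvar s4 vG = 2 ^ g" "wvar s4 vM = n * n + 1" "warr s4 aSrc = warr s1 aSrc" "warr s4 aLab = warr s1 aLab"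
            using 1(3) same3 by (auto simp: frame_def)
          have S: "cycle_search K \<sigma> n N piv1 piv2 w r (vert 0) (vert 1) g A (warr s4 aSrc) (warr s1 aTgt) (warr s4 aLab) (rarr s1 rWt)
              (warr s4 aStat) (warr s4 aCnt) (warr s4 aPar) (rarr s4 rDist)"
          proof (intro cycle_search.intro cycle_search_axioms.intro)
            show "cycle_graph K \<sigma> n N piv1 piv2 w r (vert 0) (vert 1) g" by (rule cycle_graph_axioms)
            show "(\<lambda>a. (warr s4 aSrc a, warr s1 aTgt a, warr s4 aLab a, rarr s1 rWt a)) ` {..<A} = arcs"
              using v1(6) unfolding stored_arcs_def v4 A_def .
            show "dijkstra_inv V A (hub n 0) (warr s4 aSrc) (warr s1 aTgt) (rarr s1 rWt) (\<lambda>_. True) (warr s4 aStat) (rarr s4 rDist) (warr s4 aCnt) (warr s4 aPar)"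
              using 1(1) unfolding same3 v4 by blast
            show "warr s4 aStat x \<noteq> 1" if "x < V" for x using 1(1) that by blast
          qed
          interpret cs: cycle_search K \<sigma> n N piv1 piv2 w r "vert 0" "vert 1" g A "warr s4 aSrc" "warr s1 aTgt" "warr s4 aLab" "rarr s1 rWt"
            "warr s4 aStat" "warr s4 aCnt" "warr s4 aPar" "rarr s4 rDist" by (rule S)
          show ?case
          proof (rule run_SeqI[OF run_write_cycles[OF 1(2) i4 v4(1,2) S] 1(2)], goal_cases)
            case (1 t5 s5)
            have G5: "wvar s5 vG = 2 ^ g" using 1(3) v4 by (simp add: frame_def)
            let ?s6 = "set_wvar 0 (2 ^ g) s5"
            have rows: "output_chain K \<sigma> ?s6 h = row s5 h" for h unfolding output_chain_def row_def n_card[symmetric] by simp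
            have out: "outputs_shortest_cycles K w \<sigma> ?s6"
              unfolding outputs_shortest_cycles_def rows
            proof (intro conjI ballI allI impI)
              show "wvar ?s6 0 = card (carrier (homology K 1))" using cs.classes by simp
              show "warr ?s6 2 i \<in> {0, 1}" if "i < wvar ?s6 0 * card K" for i
              proof -
                have "warr s5 2 i \<le> 1" using 1(1) that n_card by simp
                then have "warr s5 2 i = 0 \<or> warr s5 2 i = 1" by linarith
                then show ?thesis by simp
              qed
              fix h assume h: "h \<in> carrier (homology K 1)"
              then obtain z where z: "z \<in> Z\<^sub>1" "h = cls z" by (auto simp: homology_carrier)
              have "shortest_cycle_in K w h (row s5 (code z))"
                by (rule cs.collected_shortest[OF _ h]) (use 1(1) code_less code_cls z in blast)+
              then show "\<exists>i<wvar ?s6 0. shortest_cycle_in K w h (row s5 i)" using code_less[of z] by auto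
            qed
            have "2 ^ L \<le> 4 * (n * n * 2 ^ g)" using L(3) q(5) unfolding q_def by linarith
            moreover have "t1 + (t2 + (4 + (t4 + (t5 + 2)))) \<le> 8000 * (q * (L + 1))"
            proof -
              \<comment> \<open>The tree has at most \<open>4 * q\<close> leaves, the graph at most
                \<open>2 * q\<close> nodes and \<open>4 * q\<close> arcs.\<close>
              have a: "2 ^ L + V + A \<le> 10 * q" using L q v1 by linarith
              have "(2 ^ L + V + A) * (80 * L + 300) \<le> 10 * q * (80 * L + 300)" using a by (intro mult_le_mono1)
              moreover have "10 * q * (80 * L + 300) = 800 * (q * L) + 3000 * q" by (simp add: algebra_simps)
              moreover have "t5 \<le> 2000 * q" using 1(1) by (simp add: q_def)
              moreover have "t4 \<le> (2 ^ L + V + A) * (80 * L + 300) + 300" using \<open>t4 \<le> _ \<and> _\<close> by blast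
              moreover have "8000 * (q * (L + 1)) = 8000 * (q * L) + 8000 * q" by (simp add: algebra_simps)
              ultimately show ?thesis using v1(7) L(4) q by linarith
            qed
            ultimately show ?case
              using out word_stateD(1)[OF 1(2), of vG] G5 by (auto simp: run_Assign q_def intro!: exI[of _ L])
          qed
        qed
      qed
    qed
  qed
qed

text \<open>\<open>L\<close> is the depth of the recursion in the elimination, whose matrix is
  padded to \<open>2 ^ L\<close> columns, and \<open>L'\<close> is the depth of the priority queue,
  which bounds the cost of an update.\<close>

lemma run_shortest_cycles:
  "run W shortest_cycles s\<^sub>0 (\<lambda>t s'. \<exists>L L'. outputs_shortest_cycles K w \<sigma> s' \<and> 2 ^ L \<le> 2 * n \<and>
     2 ^ L' \<le> 4 * (n * n * 2 ^ homology_dim K 1) \<and>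
     t \<le> 2 * eliminate_time (2 ^ L) L + 20000 * (n * n * 2 ^ homology_dim K 1 * (homology_dim K 1 + L' + 1)))"
  unfolding shortest_cycles_def
proof (rule run_SeqI[OF run_prepare ws\<^sub>0], goal_cases)
  case (1 t1 s1)
  then obtain L piv1 piv2 where P: "prepared (2 ^ L) piv1 piv2 s1" "t1 \<le> 2 * eliminate_time (2 ^ L) L + 10000 * (n * n)" by blast
  define g where "g = wvar s1 vg"
  interpret cycle_graph K \<sigma> n "2 ^ L" piv1 piv2 w "warr s1 aR" "vert 0" "vert 1" g
    unfolding g_def by (rule cycle_graph_prepared[OF P(1)])
  have L: "2 ^ L \<le> 2 * n" using P(1) by (simp add: prepared_def)
  show ?case
  proof (rule run_SeqI[OF run_xor_table[OF 1(2) P(1)] 1(2)], goal_cases)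
    case (1 t2 s2)
    have s2: "wvar s2 vg = g" "warr s1 aR = warr s2 aR" using 1(3) by (auto simp: frame_def g_def)
    have P2: "prepared (2 ^ L) piv1 piv2 s2"
    proof -
      have i: "input s2" by (rule input_frame[OF _ 1(3)]) (use P(1) in \<open>auto simp: prepared_def\<close>)
      have "warr s2 aUsed = warr s1 aUsed" "warr s2 aX = warr s1 aX" "wvar s2 vG = wvar s1 vG" "wvar s2 vN = wvar s1 vN"
        using 1(3) by (auto simp: frame_def)
      then show ?thesis using P(1) i s2 unfolding prepared_def g_def by simp
    qed
    have X: "\<forall>e<n. \<forall>h<2 ^ g. warr s2 aXor (e * 2 ^ g + h) = h XOR code {\<sigma> e}" "t2 \<le> 400 * (n * n * 2 ^ g * (g + 1))"
      using 1(1) unfolding g_def by blast+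
    show ?case
    proof (rule run_mono[OF run_search[OF 1(2) P2 s2(1) X(1) s2(2)]], goal_cases)
      case (1 t3 s3)
      then obtain L' where L': "outputs_shortest_cycles K w \<sigma> s3" "2 ^ L' \<le> 4 * (n * n * 2 ^ g)" "t3 \<le> 8000 * (n * n * 2 ^ g * (L' + 1))"
        by blast
      define q where "q = n * n * 2 ^ g"
      have "n * n * 1 \<le> q" unfolding q_def by (intro mult_le_mono2) simp
      moreover have "400 * (q * (g + 1)) + 8000 * (q * (L' + 1)) + 10000 * q \<le> 20000 * (q * (g + L' + 1))" by (simp add: algebra_simps)
      ultimately have "t1 + (t2 + t3) \<le> 2 * eliminate_time (2 ^ L) L + 20000 * (q * (g + L' + 1))"
        using P(2) X(2) L'(3) unfolding q_def[symmetric] by linarith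
      then show ?case using L L'(1,2) unfolding g_eq[symmetric] q_def by blast
    qed
  qed
qed

end

subsection \<open>The running time\<close>

text \<open>The depth of the queue is logarithmic in the size of the graph: \<open>L\<close> is at
  most \<open>2 + g + 2 * log 2 n\<close>. The remaining multiples of the graph size are split
  between the two terms of the bound.\<close>

lemma search_time_le:
  fixes n g L :: nat
  assumes n: "0 < n" and \<omega>: "2 < \<omega>" and L: "2 ^ L \<le> 4 * (n * n * 2 ^ g)"
  shows "real (n * n * 2 ^ g * (g + L + 1)) \<le> 3 * real n powr \<omega> + 5 * (2 ^ g * (real n)\<^sup>2 * (real g + log 2 (real n)))"
proof -
  define q where "q = 2 ^ g * (real n)\<^sup>2"
  have q: "real (n * n * 2 ^ g) = q" by (simp add: q_def power2_eq_square)
  have q0: "0 \<le> q" by (simp add: q_def)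
  have lg: "0 \<le> log 2 (real n)" using n by simp
  have "real (2 ^ L) \<le> real (4 * (n * n * 2 ^ g))" using L by (simp only: of_nat_le_iff)
  then have "2 ^ L \<le> 4 * q" unfolding of_nat_mult q[symmetric] by simp
  then have "log 2 (2 ^ L) \<le> log 2 (4 * q)" using n by (subst log_le_cancel_iff) (auto simp: q_def)
  also have "log 2 (4 * q) = 2 + (real g + 2 * log 2 (real n))"
  proof -
    have l4: "log 2 4 = (2 :: real)" using log_pow_cancel[of 2 2] by simp
    have "log 2 (4 * q) = log 2 4 + (log 2 (2 ^ g) + log 2 (real n ^ 2))" using n by (simp add: q_def log_mult)
    also have "\<dots> = 2 + (real g + 2 * log 2 (real n))" using n by (simp add: log_nat_power l4)
    finally show ?thesis .
  qed
  finally have L': "real L \<le> 2 + real g + 2 * log 2 (real n)" by (simp add: log_nat_power)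
  \<comment> \<open>Either \<open>g + log 2 n\<close> is at least 1 and absorbs the factor, or
    \<open>g = 0\<close> and \<open>n = 1\<close>, where the logarithm vanishes and the first term
    takes over.\<close>
  have small: "q \<le> real n powr \<omega> + q * (real g + log 2 (real n))"
  proof (cases "g = 0 \<and> n = 1")
    case False
    have "1 \<le> real g + log 2 (real n)"
    proof (cases "g = 0")
      case True
      then have "2 \<le> n" using False n by simp
      then have "log 2 2 \<le> log 2 (real n)" by (subst log_le_cancel_iff) auto
      then show ?thesis by simp
    qed (use lg in simp)
    then have "q * 1 \<le> q * (real g + log 2 (real n))" using q0 by (rule mult_left_mono)
    moreover have "0 \<le> real n powr \<omega>" by simp
    ultimately show ?thesis by linarith
  qed (simp add: q_def)
  have "real (n * n * 2 ^ g * (g + L + 1)) = q * (real g + real L + 1)" unfolding of_nat_mult[of "n * n * 2 ^ g"] q by simp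
  also have "\<dots> \<le> q * (2 * (real g + log 2 (real n)) + 3)" using L' q0 by (intro mult_left_mono) auto
  also have "\<dots> = 2 * (q * (real g + log 2 (real n))) + 3 * q" by (simp add: algebra_simps)
  also have "\<dots> \<le> 3 * real n powr \<omega> + 5 * (q * (real g + log 2 (real n)))" using small by linarith
  finally show ?thesis by (simp add: q_def)
qed

text \<open>The summands of \<open>C'\<close> belong to three cases. For \<open>n = 1\<close> the
  logarithm is zero and everything, at most \<open>7 * C\<close>, goes into the first term. For
  \<open>g = 0\<close> the factor 2^O(g) is 1 and cannot absorb a constant, so the quadratic term is
  bounded by \<open>n powr \<omega>\<close>, using \<omega> > 2. For \<open>g \<ge> 1\<close> the
  constants move into the exponent.\<close>

lemma simplified_bound:
  fixes n g :: nat and C \<omega> :: real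
  assumes n: "0 < n" and \<omega>: "2 < \<omega>" and g: "g \<le> n" and C: "0 \<le> C"
    and C': "C' = 8 * C + 3 + 3 * C + C / ((\<omega> - 2) * ln 2)"
  shows "C * (real n powr \<omega> + 4 ^ g * real g + 2 ^ g * (real n)\<^sup>2 * (real g + log 2 (real n)))
        \<le> C' * real n powr \<omega> + 2 powr (C' * real g) * (real n)\<^sup>2 * log 2 (real n)"
proof -
  have c0: "0 \<le> C / ((\<omega> - 2) * ln 2)" using C \<omega> by simp
  have C'0: "0 \<le> C'" "8 * C \<le> C'" "3 + 3 * C \<le> C'" using C c0 C' by linarith+
  show ?thesis
  proof (cases "n = 1")
    case True
    have "C * (1 + 4 ^ g * real g + 2 ^ g * real g) \<le> C * 7" using g True C by (intro mult_left_mono) (cases g; simp)+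
    also have "\<dots> \<le> C'" using C'0 C by linarith
    finally show ?thesis using True by simp
  next
    case False
    define l where "l = log 2 (real n)"
    have n2: "2 \<le> n" using False n by simp
    then have "log 2 2 \<le> l" unfolding l_def by (subst log_le_cancel_iff) auto
    then have l: "1 \<le> l" by simp
    define m where "m = (real n)\<^sup>2 * l"
    have "1 \<le> (real n)\<^sup>2" using n by simp
    then have nm: "(real n)\<^sup>2 \<le> m" "1 \<le> m" unfolding m_def using l mult_left_mono[OF l, of "(real n)\<^sup>2"] by auto
    show ?thesis
    proof (cases "g = 0")
      case True
      have "l \<le> real n powr (\<omega> - 2) / ((\<omega> - 2) * ln 2)"
      proof -
        have "ln (real n) \<le> real n powr (\<omega> - 2) / (\<omega> - 2)" using ln_powr_bound[of "real n" "\<omega> - 2"] n \<omega> by simp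
        then have "ln (real n) / ln 2 \<le> real n powr (\<omega> - 2) / (\<omega> - 2) / ln 2" by (rule divide_right_mono) simp
        then show ?thesis by (simp add: l_def log_def)
      qed
      then have "C * m \<le> C * ((real n)\<^sup>2 * (real n powr (\<omega> - 2) / ((\<omega> - 2) * ln 2)))"
        unfolding m_def using C by (intro mult_left_mono) auto
      also have "\<dots> = C / ((\<omega> - 2) * ln 2) * ((real n)\<^sup>2 * real n powr (\<omega> - 2))" by simp
      also have "(real n)\<^sup>2 * real n powr (\<omega> - 2) = real n powr \<omega>"
        using n by (simp add: powr_diff)
      finally have cm: "C * m \<le> C / ((\<omega> - 2) * ln 2) * real n powr \<omega>" .
      have "C * real n powr \<omega> + C / ((\<omega> - 2) * ln 2) * real n powr \<omega> \<le> C' * real n powr \<omega>"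
        unfolding distrib_right[symmetric] by (rule mult_right_mono) (use C' C c0 in auto)
      then show ?thesis using True cm nm by (simp add: l_def[symmetric] m_def[symmetric] distrib_left)
    next
      case False
      have g8: "4 ^ g * real g \<le> 8 ^ g" "2 ^ g * real g \<le> (8::real) ^ g" "(2::real) ^ g \<le> 8 ^ g"
      proof -
        have gg: "real g \<le> 2 ^ g" using less_imp_le[OF less_exp[of g], folded of_nat_le_iff[where 'a = real]] by simp
        have "4 ^ g * real g \<le> 4 ^ g * 2 ^ g" using gg by (intro mult_left_mono) auto
        also have "(4::real) ^ g * 2 ^ g = 8 ^ g" by (simp add: power_mult_distrib[symmetric])
        finally show *: "4 ^ g * real g \<le> 8 ^ g" .
        have "2 ^ g * real g \<le> 4 ^ g * real g" by (intro mult_right_mono power_mono) auto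
        then show "2 ^ g * real g \<le> (8::real) ^ g" using * by linarith
        show "(2::real) ^ g \<le> 8 ^ g" by (intro power_mono) auto
      qed
      have "4 ^ g * real g + 2 ^ g * (real n)\<^sup>2 * (real g + l) = 4 ^ g * real g + (2 ^ g * real g) * (real n)\<^sup>2 + 2 ^ g * m"
        by (simp add: m_def algebra_simps)
      also have "\<dots> \<le> 8 ^ g * m + 8 ^ g * m + 8 ^ g * m"
      proof (intro add_mono)
        have "4 ^ g * real g * 1 \<le> 8 ^ g * m" using g8 nm by (intro mult_mono) auto
        then show "4 ^ g * real g \<le> 8 ^ g * m" by simp
        show "(2 ^ g * real g) * (real n)\<^sup>2 \<le> 8 ^ g * m" using g8 nm by (intro mult_mono) auto
        show "2 ^ g * m \<le> 8 ^ g * m" using g8 nm by (intro mult_right_mono) auto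
      qed
      finally have "C * (4 ^ g * real g + 2 ^ g * (real n)\<^sup>2 * (real g + l)) \<le> C * (8 ^ g * m + 8 ^ g * m + 8 ^ g * m)"
        using C by (rule mult_left_mono)
      also have "\<dots> = (3 * C) * 8 ^ g * m" by simp
      also have "\<dots> \<le> 2 powr (C' * real g) * m"
      proof (rule mult_right_mono)
        \<comment> \<open>With \<open>k\<close> the integer part of x = 3C, x is at most k + 1,
          which is at most 2^k and hence at most 2^x.\<close>
        have "3 * C \<le> 2 powr (3 * C)"
        proof -
          define k where "k = nat \<lfloor>3 * C\<rfloor>"
          have k: "real k \<le> 3 * C" "3 * C \<le> real (Suc k)" using C by (auto simp: k_def) linarith
          have "Suc k \<le> 2 ^ k" using less_exp[of k] by (simp add: Suc_le_eq)
          then have "real (Suc k) \<le> real (2 ^ k)" by (simp only: of_nat_le_iff)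
          also have "\<dots> = 2 ^ k" by simp
          also have "(2::real) ^ k \<le> 2 powr (3 * C)" using k(1) by (simp add: powr_realpow[symmetric])
          finally show ?thesis using k(2) by linarith
        qed
        also have "2 powr (3 * C) \<le> 2 powr (3 * C * real g)" using False C by (intro powr_mono) (auto simp: mult_le_cancel_left1)
        finally have c: "3 * C \<le> 2 powr (3 * C * real g)" .
        have e8: "(8::real) ^ g = 2 powr (3 * real g)"
        proof -
          have "(8::real) ^ g = (2 ^ 3) ^ g" by simp
          also have "\<dots> = 2 ^ (3 * g)" by (simp only: power_mult)
          also have "\<dots> = 2 powr real (3 * g)" by (subst powr_realpow) auto
          finally show ?thesis by simp
        qed
        have "3 * C * 8 ^ g \<le> 2 powr (3 * C * real g) * 8 ^ g" using c by (intro mult_right_mono) auto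
        also have "\<dots> = 2 powr ((3 + 3 * C) * real g)"
          unfolding e8 by (simp add: powr_add[symmetric] algebra_simps)
        also have "\<dots> \<le> 2 powr (C' * real g)" using C'0(3) by (intro powr_mono mult_right_mono) auto
        finally show "3 * C * 8 ^ g \<le> 2 powr (C' * real g)" .
      qed (use nm in simp)
      finally have "C * (4 ^ g * real g + 2 ^ g * (real n)\<^sup>2 * (real g + l)) \<le> 2 powr (C' * real g) * m" .
      moreover have "C * real n powr \<omega> \<le> C' * real n powr \<omega>" using C'0 C by (intro mult_right_mono) auto
      ultimately show ?thesis by (simp add: l_def m_def distrib_left)
    qed
  qed
qed

text \<open>There are at most as many classes as sets of simplices. This crude bound on g is used to
  bound the powers of 2 and 4 when \<open>n = 1\<close>.\<close>

lemma (in finite_complex) homology_dim_le: "homology_dim K 1 \<le> card K"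
proof -
  have "card (cls ` Z\<^sub>1) \<le> card Z\<^sub>1"
    by (rule card_image_le[OF finite_cycles])
  also have "\<dots> \<le> card (Pow K)"
  proof (intro card_mono subsetI)
    fix z assume "z \<in> Z\<^sub>1"
    then have "z \<subseteq> edges K" unfolding cycles_iff by (rule conjunct1)
    then show "z \<in> Pow K" using simplices_subset[of 1] by blast
  qed (use fin_K in simp)
  finally have "2 ^ homology_dim K 1 \<le> (2::nat) ^ card K"
    using card_homology fin_K by (simp add: homology_carrier[symmetric] card_Pow)
  then show ?thesis by simp
qed

theorem theorem5p5:
  fixes \<omega> :: real
  assumes "\<omega> > 2" and "matrix_mult_time \<omega>"
  shows "\<exists>P (k::nat) (C::real) (C'::real).
    \<forall>(K :: 'v set set) (w :: 'v set \<Rightarrow> real) n g.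
      finite K \<and> simplicial_complex K \<and> connected_complex K \<and> (\<forall>e\<in>edges K. 0 \<le> w e) \<and>
      n = card K \<and> g = homology_dim K 1 \<longrightarrow>
      (\<forall>W \<ge> k * (n * 2 ^ g) ^ k. \<forall>\<sigma> s. word_state W s \<and> encodes_complex K w \<sigma> s \<longrightarrow>
         (\<exists>t s'. exec W P s t s' \<and> outputs_shortest_cycles K w \<sigma> s' \<and>
            real t \<le> C * (real n powr \<omega> + 4 ^ g * real g
                          + 2 ^ g * (real n)\<^sup>2 * (real g + log 2 (real n))))) \<and>
      C * (real n powr \<omega> + 4 ^ g * real g + 2 ^ g * (real n)\<^sup>2 * (real g + log 2 (real n)))
        \<le> C' * real n powr \<omega> + 2 powr (C' * real g) * (real n)\<^sup>2 * log 2 (real n)"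
proof -
  obtain MM TM k\<^sub>M C\<^sub>M where MM: "mult_machine MM TM k\<^sub>M" and TM: "\<And>b. 1 \<le> b ==> real (TM b) \<le> C\<^sub>M * real b powr \<omega>" "C\<^sub>M \<ge> 0"
    using matrix_mult_time_machine[OF assms(2)] by blast
  interpret mult_machine MM TM k\<^sub>M by (rule MM)
  obtain D where D: "D \<ge> 0" "\<And>L. real (eliminate_time (2 ^ L) L) \<le> D * (2 ^ L) powr \<omega>"
    using eliminate_time_bound[OF assms(1) TM(2) TM(1)] by auto
  \<comment> \<open>The factor 30 and an exponent of at least 2 provide the words of the search. The
    summand \<open>k\<^sub>M * 2 ^ k\<^sub>M\<close> meets the demand of the multiplication at the
    padded size, at most \<open>2 * n\<close>, and makes the exponent at least
    \<open>k\<^sub>M\<close>.\<close>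
  define k where "k = 30 + k\<^sub>M * 2 ^ k\<^sub>M"
  \<comment> \<open>Two eliminations of size at most \<open>2 * n\<close> give the first summand;
    the second is 20000 times the larger coefficient, 5, of \<open>search_time_le\<close>.\<close>
  define C where "C = 2 * D * 2 powr \<omega> + 100000"
  define C' where "C' = 8 * C + 3 + 3 * C + C / ((\<omega> - 2) * ln 2)"
  have C0: "0 \<le> C" using D(1) by (simp add: C_def)
  show ?thesis
  proof (rule exI[of _ shortest_cycles], rule exI[of _ k], rule exI[of _ C], rule exI[of _ C'], intro allI impI conjI)
    fix K :: "'v set set" and w :: "'v set => real" and n g :: nat
    assume a: "finite K \<and> simplicial_complex K \<and> connected_complex K \<and> (\<forall>e\<in>edges K. 0 \<le> w e) \<and> n = card K \<and> g = homology_dim K 1"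
    interpret finite_complex K by unfold_locales (use a in auto)
    have n: "0 < n" using a by (auto simp: connected_complex_def card_gt_0_iff)
    show "C * (real n powr \<omega> + 4 ^ g * real g + 2 ^ g * (real n)\<^sup>2 * (real g + log 2 (real n)))
        \<le> C' * real n powr \<omega> + 2 powr (C' * real g) * (real n)\<^sup>2 * log 2 (real n)"
      by (rule simplified_bound[OF n assms(1) _ C0 C'_def]) (use a homology_dim_le in simp)
    fix W \<sigma> s
    assume W: "k * (n * 2 ^ g) ^ k \<le> W" and s: "word_state W s \<and> encodes_complex K w \<sigma> s"
    have "0 < n * 2 ^ g" using n by simp
    then have m1: "1 \<le> n * 2 ^ g" by linarith
    have W1: "30 * (n * n * 2 ^ g) \<le> W"
    proof -
      have "n * n * 2 ^ g \<le> (n * 2 ^ g) ^ 2" by (simp add: power2_eq_square)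
      also have "\<dots> \<le> (n * 2 ^ g) ^ k" using m1 by (intro power_increasing) (auto simp: k_def)
      finally have "30 * (n * n * 2 ^ g) \<le> k * (n * 2 ^ g) ^ k" by (intro mult_le_mono) (auto simp: k_def)
      then show ?thesis using W by linarith
    qed
    have W2: "k\<^sub>M * (2 * n) ^ k\<^sub>M \<le> W"
    proof -
      have "k\<^sub>M * 1 \<le> k\<^sub>M * 2 ^ k\<^sub>M" by (intro mult_le_mono2) simp
      then have kk: "k\<^sub>M \<le> k" unfolding k_def by linarith
      have "n ^ k\<^sub>M \<le> (n * 2 ^ g) ^ k\<^sub>M" by (intro power_mono) auto
      also have "\<dots> \<le> (n * 2 ^ g) ^ k" using m1 kk by (intro power_increasing)
      finally have "k\<^sub>M * 2 ^ k\<^sub>M * n ^ k\<^sub>M \<le> k * (n * 2 ^ g) ^ k" by (intro mult_le_mono) (auto simp: k_def)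
      then show ?thesis using W by (simp add: power_mult_distrib mult.assoc)
    qed
    have "cycle_program K \<sigma> n w s MM TM k\<^sub>M W"
    proof
      show "bij_betw \<sigma> {..<n} K" using s a by (simp add: encodes_complex_def)
      show "30 * (n * n * 2 ^ homology_dim K 1) \<le> W" using W1 a by simp
    qed (use s a n W2 in auto)
    then interpret cycle_program K \<sigma> n w s MM TM k\<^sub>M W .
    have gd: "homology_dim K 1 = g" using a by simp
    note R = run_shortest_cycles[unfolded run_def gd]
    obtain t s' L L' where ex: "exec W shortest_cycles s t s'" "outputs_shortest_cycles K w \<sigma> s'" "2 ^ L \<le> 2 * n"
      "2 ^ L' \<le> 4 * (n * n * 2 ^ g)" "t \<le> 2 * eliminate_time (2 ^ L) L + 20000 * (n * n * 2 ^ g * (g + L' + 1))"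
      using R by (elim exE conjE) (rule that)
    have "real t \<le> C * (real n powr \<omega> + 4 ^ g * real g + 2 ^ g * (real n)\<^sup>2 * (real g + log 2 (real n)))"
    proof -
      define X where "X = real n powr \<omega>"
      define Y where "Y = 2 ^ g * (real n)\<^sup>2 * (real g + log 2 (real n))"
      have XY: "0 \<le> X" "0 \<le> Y" using n by (auto simp: X_def Y_def)
      have "real (2 ^ L) \<le> real (2 * n)" using ex(3) by (simp only: of_nat_le_iff)
      then have "(2 ^ L) powr \<omega> \<le> (2 * real n) powr \<omega>" using assms(1) by (intro powr_mono2) auto
      also have "\<dots> = 2 powr \<omega> * X" unfolding X_def by (simp add: powr_mult)
      finally have "D * (2 ^ L) powr \<omega> \<le> D * (2 powr \<omega> * X)" using D(1) by (rule mult_left_mono)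
      then have e: "real (eliminate_time (2 ^ L) L) \<le> D * 2 powr \<omega> * X" using D(2)[of L] by simp
      define Z where "Z = real (n * n * 2 ^ g * (g + L' + 1))"
      have Z: "Z \<le> 3 * X + 5 * Y" using search_time_le[OF n assms(1) ex(4)] unfolding X_def Y_def Z_def .
      have "real t \<le> real (2 * eliminate_time (2 ^ L) L + 20000 * (n * n * 2 ^ g * (g + L' + 1)))"
        using ex(5) by (simp only: of_nat_le_iff)
      also have "\<dots> = 2 * real (eliminate_time (2 ^ L) L) + 20000 * Z"
        unfolding Z_def of_nat_add of_nat_mult by simp
      also have "\<dots> \<le> 2 * (D * 2 powr \<omega> * X) + 20000 * (3 * X + 5 * Y)"
        by (intro add_mono mult_left_mono e Z) simp_all
      also have "\<dots> \<le> C * (X + Y)"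
      proof -
        have "0 \<le> D * 2 powr \<omega> * Y" using D(1) XY by simp
        then show ?thesis unfolding C_def using XY by (simp add: algebra_simps)
      qed
      also have "\<dots> \<le> C * (X + 4 ^ g * real g + Y)" using C0 by (intro mult_left_mono) auto
      finally show ?thesis by (simp add: X_def Y_def)
    qed
    then show "\<exists>t s'. exec W shortest_cycles s t s' \<and> outputs_shortest_cycles K w \<sigma> s' \<and>
            real t \<le> C * (real n powr \<omega> + 4 ^ g * real g + 2 ^ g * (real n)\<^sup>2 * (real g + log 2 (real n)))"
      using ex by blast
  qed
qed

end
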